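(* Assume the Ultrapower Axiom. Suppose $U$ and $W$ are countably complete ultrafilters such that $j_U\restriction\alpha\in M_W$ for every ordinal $\alpha$. Then $U\mathrel{I}W$.
   Context: For a countably complete ultrafilter $U$, $j_U:V\to M_U$ is its ultrapower embedding. The internal relation: $U\mathrel{I}W$ iff $j_U\restriction x\in M_W$ for every set $x\in M_W$. An internal ultrapower embedding of an inner model $M$ is $j^M_Z:M\to M^M_Z$ for some $Z\in M$ countably complete in $M$. The Ultrapower Axiom (UA): for all countably complete $U,W$ there are internal ultrapower embeddings $i_0:M_U\to N$, $i_1:M_W\to N$ with $i_0\circ j_U=i_1\circ j_W$. *)

theory Defs
  imports Main
begin

text \<open>
  The ambient theory is first-order ZFC. The universe of sets is a type \<open>'v\<close> with a binary
  relation satisfying the ZFC axioms; in particular it need not be a standard or well-founded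
  model, and Separation and Replacement are schemas over first-order formulas. All notions are
  introduced for a structure \<open>(M, E)\<close> with carrier \<open>M\<close>, every quantifier ranging over \<open>M\<close>, so that
  the same definition serves for the universe (\<open>M = UNIV\<close>) and for the inner models \<open>M\<^sub>U\<close>.
\<close>

datatype fm = Mem nat nat | Equ nat nat | Neg fm | Conj fm fm | Forall nat fm

context
  fixes M :: "'v set" and E :: "'v \<Rightarrow> 'v \<Rightarrow> bool" (infix "\<epsilon>" 50)
begin

primrec sat :: "(nat \<Rightarrow> 'v) \<Rightarrow> fm \<Rightarrow> bool" where
  "sat s (Mem m n) = (s m \<epsilon> s n)"
| "sat s (Equ m n) = (s m = s n)"
| "sat s (Neg p) = (\<not> sat s p)"
| "sat s (Conj p q) = (sat s p \<and> sat s q)"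
| "sat s (Forall n p) = (\<forall>x\<in>M. sat (s(n := x)) p)"


subsection \<open>Basic set-theoretic vocabulary\<close>

definition is_empty :: "'v \<Rightarrow> bool" where
  "is_empty e \<longleftrightarrow> (\<forall>z\<in>M. \<not> z \<epsilon> e)"

definition is_subset :: "'v \<Rightarrow> 'v \<Rightarrow> bool" where
  "is_subset a b \<longleftrightarrow> (\<forall>z\<in>M. z \<epsilon> a \<longrightarrow> z \<epsilon> b)"

definition is_union :: "'v \<Rightarrow> 'v \<Rightarrow> bool" where
  "is_union a u \<longleftrightarrow> (\<forall>x\<in>M. x \<epsilon> u \<longleftrightarrow> (\<exists>y\<in>M. y \<epsilon> a \<and> x \<epsilon> y))"

definition is_succ :: "'v \<Rightarrow> 'v \<Rightarrow> bool" where
  "is_succ x y \<longleftrightarrow> (\<forall>z\<in>M. z \<epsilon> y \<longleftrightarrow> z \<epsilon> x \<or> z = x)"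

definition is_inductive :: "'v \<Rightarrow> bool" where
  "is_inductive w \<longleftrightarrow> (\<exists>e\<in>M. is_empty e \<and> e \<epsilon> w) \<and>
     (\<forall>x\<in>M. x \<epsilon> w \<longrightarrow> (\<exists>y\<in>M. is_succ x y \<and> y \<epsilon> w))"

definition is_omega :: "'v \<Rightarrow> bool" where
  "is_omega w \<longleftrightarrow> is_inductive w \<and> (\<forall>v\<in>M. is_inductive v \<longrightarrow> is_subset w v)"

definition is_upair :: "'v \<Rightarrow> 'v \<Rightarrow> 'v \<Rightarrow> bool" where
  "is_upair a b p \<longleftrightarrow> (\<forall>z\<in>M. z \<epsilon> p \<longleftrightarrow> z = a \<or> z = b)"

definition is_opair :: "'v \<Rightarrow> 'v \<Rightarrow> 'v \<Rightarrow> bool" where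
  "is_opair a b p \<longleftrightarrow>
     (\<exists>u\<in>M. \<exists>v\<in>M. is_upair a a u \<and> is_upair a b v \<and> is_upair u v p)"

definition maps_to :: "'v \<Rightarrow> 'v \<Rightarrow> 'v \<Rightarrow> bool" where
  "maps_to f a b \<longleftrightarrow> (\<exists>p\<in>M. is_opair a b p \<and> p \<epsilon> f)"

definition is_fun_on :: "'v \<Rightarrow> 'v \<Rightarrow> bool" where
  "is_fun_on f X \<longleftrightarrow>
     (\<forall>p\<in>M. p \<epsilon> f \<longrightarrow> (\<exists>a\<in>M. \<exists>b\<in>M. a \<epsilon> X \<and> is_opair a b p)) \<and>
     (\<forall>a\<in>M. a \<epsilon> X \<longrightarrow> (\<exists>!b. b \<in> M \<and> maps_to f a b))"

text \<open>Well-foundedness of membership is supplied by Foundation.\<close>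

definition is_ordinal :: "'v \<Rightarrow> bool" where
  "is_ordinal a \<longleftrightarrow>
     (\<forall>x\<in>M. x \<epsilon> a \<longrightarrow> is_subset x a) \<and>
     (\<forall>x\<in>M. \<forall>y\<in>M. x \<epsilon> a \<and> y \<epsilon> a \<longrightarrow> x \<epsilon> y \<or> x = y \<or> y \<epsilon> x)"


subsection \<open>The axioms of ZFC\<close>

definition ZFC :: bool where
  "ZFC \<longleftrightarrow>
     \<comment> \<open>Extensionality\<close>
     (\<forall>x\<in>M. \<forall>y\<in>M. (\<forall>z\<in>M. z \<epsilon> x \<longleftrightarrow> z \<epsilon> y) \<longrightarrow> x = y) \<and>
     \<comment> \<open>Foundation\<close>
     (\<forall>a\<in>M. (\<exists>x\<in>M. x \<epsilon> a) \<longrightarrow> (\<exists>x\<in>M. x \<epsilon> a \<and> (\<forall>y\<in>M. y \<epsilon> x \<longrightarrow> \<not> y \<epsilon> a))) \<and>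
     \<comment> \<open>Pairing\<close>
     (\<forall>a\<in>M. \<forall>b\<in>M. \<exists>p\<in>M. is_upair a b p) \<and>
     \<comment> \<open>Union\<close>
     (\<forall>a\<in>M. \<exists>u\<in>M. is_union a u) \<and>
     \<comment> \<open>Power set\<close>
     (\<forall>a\<in>M. \<exists>p\<in>M. \<forall>x\<in>M. x \<epsilon> p \<longleftrightarrow> is_subset x a) \<and>
     \<comment> \<open>Infinity\<close>
     (\<exists>w\<in>M. is_inductive w) \<and>
     \<comment> \<open>Separation schema\<close>
     (\<forall>p s. \<forall>a\<in>M. range s \<subseteq> M \<longrightarrow>
        (\<exists>b\<in>M. \<forall>x\<in>M. x \<epsilon> b \<longleftrightarrow> x \<epsilon> a \<and> sat (s(0 := x)) p)) \<and>
     \<comment> \<open>Replacement schema\<close>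
     (\<forall>p s. \<forall>a\<in>M. range s \<subseteq> M \<longrightarrow>
        (\<forall>x\<in>M. x \<epsilon> a \<longrightarrow> (\<exists>!y. y \<in> M \<and> sat (s(0 := x, 1 := y)) p)) \<longrightarrow>
        (\<exists>b\<in>M. \<forall>y\<in>M. y \<epsilon> b \<longleftrightarrow> (\<exists>x\<in>M. x \<epsilon> a \<and> sat (s(0 := x, 1 := y)) p))) \<and>
     \<comment> \<open>Choice\<close>
     (\<forall>a\<in>M. (\<forall>x\<in>M. x \<epsilon> a \<longrightarrow> (\<exists>z\<in>M. z \<epsilon> x)) \<longrightarrow>
        (\<forall>x\<in>M. \<forall>y\<in>M. x \<epsilon> a \<and> y \<epsilon> a \<and> x \<noteq> y \<longrightarrow> (\<forall>z\<in>M. \<not> (z \<epsilon> x \<and> z \<epsilon> y))) \<longrightarrow>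
        (\<exists>c\<in>M. \<forall>x\<in>M. x \<epsilon> a \<longrightarrow> (\<exists>!z. z \<in> M \<and> z \<epsilon> x \<and> z \<epsilon> c)))"


subsection \<open>Countably complete ultrafilters\<close>

definition is_ultrafilter_on :: "'v \<Rightarrow> 'v \<Rightarrow> bool" where
  "is_ultrafilter_on U X \<longleftrightarrow>
     (\<forall>A\<in>M. A \<epsilon> U \<longrightarrow> is_subset A X) \<and>
     X \<epsilon> U \<and>
     (\<forall>A\<in>M. is_empty A \<longrightarrow> \<not> A \<epsilon> U) \<and>
     (\<forall>A\<in>M. \<forall>B\<in>M. A \<epsilon> U \<and> is_subset A B \<and> is_subset B X \<longrightarrow> B \<epsilon> U) \<and>
     (\<forall>A\<in>M. \<forall>B\<in>M. \<forall>C\<in>M. A \<epsilon> U \<and> B \<epsilon> U \<and> (\<forall>i\<in>M. i \<epsilon> C \<longleftrightarrow> i \<epsilon> A \<and> i \<epsilon> B) \<longrightarrow> C \<epsilon> U) \<and>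
     (\<forall>A\<in>M. \<forall>B\<in>M. is_subset A X \<and> (\<forall>i\<in>M. i \<epsilon> B \<longleftrightarrow> i \<epsilon> X \<and> \<not> i \<epsilon> A) \<longrightarrow> A \<epsilon> U \<or> B \<epsilon> U)"

definition is_countably_complete :: "'v \<Rightarrow> bool" where
  "is_countably_complete U \<longleftrightarrow>
     (\<forall>w\<in>M. \<forall>F\<in>M. \<forall>S\<in>M.
        is_omega w \<and> is_fun_on F w \<and> (\<forall>n\<in>M. \<forall>A\<in>M. n \<epsilon> w \<and> maps_to F n A \<longrightarrow> A \<epsilon> U) \<and>
        (\<forall>i\<in>M. i \<epsilon> S \<longleftrightarrow> (\<forall>n\<in>M. \<forall>A\<in>M. n \<epsilon> w \<and> maps_to F n A \<longrightarrow> i \<epsilon> A))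
        \<longrightarrow> S \<epsilon> U)"

definition cc_ultrafilter :: "'v \<Rightarrow> bool" where
  "cc_ultrafilter U \<longleftrightarrow>
     U \<in> M \<and> (\<exists>X\<in>M. is_ultrafilter_on U X) \<and> is_countably_complete U"


subsection \<open>Ultrapowers\<close>

text \<open>The underlying set of an ultrafilter is its union.\<close>

definition ult_funs :: "'v \<Rightarrow> 'v set" where
  "ult_funs U = {f \<in> M. \<exists>X\<in>M. is_union U X \<and> is_fun_on f X}"

definition ult_eq :: "'v \<Rightarrow> 'v \<Rightarrow> 'v \<Rightarrow> bool" where
  "ult_eq U f g \<longleftrightarrow>
     (\<exists>S\<in>M. S \<epsilon> U \<and>
        (\<forall>i\<in>M. i \<epsilon> S \<longleftrightarrow> (\<exists>a\<in>M. \<exists>b\<in>M. maps_to f i a \<and> maps_to g i b \<and> a = b)))"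

definition ult_mem :: "'v \<Rightarrow> 'v \<Rightarrow> 'v \<Rightarrow> bool" where
  "ult_mem U f g \<longleftrightarrow>
     (\<exists>S\<in>M. S \<epsilon> U \<and>
        (\<forall>i\<in>M. i \<epsilon> S \<longleftrightarrow> (\<exists>a\<in>M. \<exists>b\<in>M. maps_to f i a \<and> maps_to g i b \<and> a \<epsilon> b)))"

text \<open>Class functions of the structure: definable over it from parameters.\<close>

definition class_function :: "('v \<Rightarrow> 'v) \<Rightarrow> bool" where
  "class_function F \<longleftrightarrow>
     (\<forall>x\<in>M. F x \<in> M) \<and>
     (\<exists>p s. range s \<subseteq> M \<and> (\<forall>x\<in>M. \<forall>y\<in>M. sat (s(0 := x, 1 := y)) p \<longleftrightarrow> F x = y))"

text \<open>
  The map \<open>\<pi>\<close> induces an isomorphism from the quotient of the functions modulo \<open>U\<close> onto a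
  transitive class. For a countably complete ultrafilter over a model of ZFC such a map exists by
  Mostowski's theorem and, by Foundation for classes, is unique on \<open>ult_funs U\<close>; this is where
  definability of \<open>\<pi>\<close> matters, since \<open>E\<close> may be ill-founded from outside. In particular the choice
  in \<open>ult_collapse\<close> is immaterial.
\<close>

definition is_ult_collapse :: "'v \<Rightarrow> ('v \<Rightarrow> 'v) \<Rightarrow> bool" where
  "is_ult_collapse U \<pi> \<longleftrightarrow>
     class_function \<pi> \<and>
     (\<forall>f\<in>ult_funs U. \<forall>g\<in>ult_funs U. \<pi> f = \<pi> g \<longleftrightarrow> ult_eq U f g) \<and>
     (\<forall>f\<in>ult_funs U. \<forall>g\<in>ult_funs U. \<pi> f \<epsilon> \<pi> g \<longleftrightarrow> ult_mem U f g) \<and>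
     (\<forall>f\<in>ult_funs U. \<forall>y\<in>M. y \<epsilon> \<pi> f \<longrightarrow> y \<in> \<pi> ` ult_funs U)"

definition ult_collapse :: "'v \<Rightarrow> 'v \<Rightarrow> 'v" where
  "ult_collapse U = (SOME \<pi>. is_ult_collapse U \<pi>)"

definition ultrapower :: "'v \<Rightarrow> 'v set" where
  "ultrapower U = ult_collapse U ` ult_funs U"

definition const_fun :: "'v \<Rightarrow> 'v \<Rightarrow> 'v" where
  "const_fun U x =
     (THE c. c \<in> ult_funs U \<and> (\<forall>i\<in>M. \<forall>b\<in>M. maps_to c i b \<longrightarrow> b = x))"

definition ult_embedding :: "'v \<Rightarrow> 'v \<Rightarrow> 'v" where
  "ult_embedding U x = ult_collapse U (const_fun U x)"

end


subsection \<open>The internal relation and the Ultrapower Axiom\<close>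

text \<open>
  \<open>restriction_in E N F x\<close> says that the restriction of \<open>F\<close> to \<open>x\<close>, as a set of ordered pairs,
  belongs to the class \<open>N\<close>.
\<close>

definition restriction_in ::
    "('v \<Rightarrow> 'v \<Rightarrow> bool) \<Rightarrow> 'v set \<Rightarrow> ('v \<Rightarrow> 'v) \<Rightarrow> 'v \<Rightarrow> bool" where
  "restriction_in E N F x \<longleftrightarrow>
     (\<exists>r\<in>N. \<forall>p. E p r \<longleftrightarrow> (\<exists>a. E a x \<and> is_opair UNIV E a (F a) p))"

definition internal_rel :: "('v \<Rightarrow> 'v \<Rightarrow> bool) \<Rightarrow> 'v \<Rightarrow> 'v \<Rightarrow> bool" where
  "internal_rel E U W \<longleftrightarrow>
     (\<forall>x\<in>ultrapower UNIV E W.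
        restriction_in E (ultrapower UNIV E W) (ult_embedding UNIV E U) x)"

text \<open>
  An internal ultrapower embedding of \<open>M\<close> into \<open>N\<close>: the ultrapower of \<open>M\<close>, as computed inside
  \<open>(M, E)\<close>, by some \<open>Z \<in> M\<close> that is a countably complete ultrafilter in \<open>M\<close>. As a map on \<open>M\<close>,
  only the values of \<open>i\<close> on \<open>M\<close> are constrained.
\<close>

definition internal_ultrapower_embedding ::
    "('v \<Rightarrow> 'v \<Rightarrow> bool) \<Rightarrow> 'v set \<Rightarrow> 'v set \<Rightarrow> ('v \<Rightarrow> 'v) \<Rightarrow> bool" where
  "internal_ultrapower_embedding E M N i \<longleftrightarrow>
     (\<exists>Z. cc_ultrafilter M E Z \<and> N = ultrapower M E Z \<and> (\<forall>x\<in>M. i x = ult_embedding M E Z x))"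

definition ultrapower_axiom :: "('v \<Rightarrow> 'v \<Rightarrow> bool) \<Rightarrow> bool" where
  "ultrapower_axiom E \<longleftrightarrow>
     (\<forall>U W. cc_ultrafilter UNIV E U \<and> cc_ultrafilter UNIV E W \<longrightarrow>
        (\<exists>N i\<^sub>0 i\<^sub>1.
           internal_ultrapower_embedding E (ultrapower UNIV E U) N i\<^sub>0 \<and>
           internal_ultrapower_embedding E (ultrapower UNIV E W) N i\<^sub>1 \<and>
           i\<^sub>0 \<circ> ult_embedding UNIV E U = i\<^sub>1 \<circ> ult_embedding UNIV E W))"

end

theory Submission
  imports Defs
begin

text \<open>
  Let \<open>P\<close> be the product ultrafilter \<open>U \<times> W\<close>. Its ultrapower is \<open>j\<^sub>U(M\<^sub>W)\<close>, and \<open>j\<^sub>U\<close> restricts to an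
  elementary embedding of \<open>M\<^sub>W\<close> into \<open>M\<^sub>P\<close>. The Ultrapower Axiom for \<open>P\<close> and \<open>W\<close> gives an internal
  ultrapower embedding \<open>h\<close> of \<open>M\<^sub>P\<close> whose target lies inside \<open>M\<^sub>W\<close>, hence an elementary embedding
  \<open>g = h \<circ> j\<^sub>U\<close> of \<open>M\<^sub>W\<close> into a transitive subclass of \<open>M\<^sub>W\<close>.

  Inside \<open>M\<^sub>W\<close> there are unboundedly many ordinals \<open>\<eta>\<close> with \<open>h(j\<^sub>U(\<eta>)) = j\<^sub>U(\<eta>)\<close>, by a definition that
  \<open>j\<^sub>U\<close> carries to ordinals fixed by \<open>h\<close>. Given a transitive set \<open>w\<close> of \<open>M\<^sub>W\<close>, let \<open>\<sigma> \<in> M\<^sub>W\<close> index by such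
  ordinals the partial functions from \<open>j\<^sub>W(I)\<close> to \<open>w\<close>, where \<open>I\<close> is the set underlying \<open>U\<close>. Since
  \<open>g(\<sigma>(\<eta>)) = g(\<sigma>)(j\<^sub>U(\<eta>))\<close>, the hypothesis on ordinals makes \<open>g\<close> on these functions available
  in \<open>M\<^sub>W\<close>. Each element of \<open>j\<^sub>U(w)\<close> is \<open>j\<^sub>U(r)(c)\<close> for some such function \<open>r\<close>, where \<open>c \<in> M\<^sub>P\<close> is the
  class of the projection to \<open>I\<close>; therefore the pointwise image of \<open>j\<^sub>U(w)\<close> under \<open>h\<close>, which
  consists of the values \<open>g(r)(h(c))\<close>, is a set of \<open>M\<^sub>W\<close>. Its transitive collapse inverts \<open>h\<close> on
  \<open>j\<^sub>U(w)\<close>, and applied to the values for constant functions \<open>r\<close> it recovers \<open>j\<^sub>U\<close> on \<open>w\<close>.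
\<close>

section \<open>Definability\<close>

text \<open>Applying j_U to an enumeration \<sigma> of a set by ordinals would reduce j_U on that
  set to j_U on ordinals, were it not that j_U(\<sigma>) need not lie in M_W. Composing with h puts
  g(\<sigma>) into M_W. The price is twofold: g must be known on the index ordinals, hence the
  ordinals fixed by h, and h must be undone at the end, hence the collapse, for which the whole
  image of j_U(w) has to be seen. That last point is why W is compared with P and not with U: over U
  an element of j_U(w) is represented by a function of V that M_W may lack, whereas over P such
  functions are glued along W into one element of M_W with domain contained in j_W(I).

  As the model may be ill-founded from outside, induction, recursion and comprehension are available
  for definable classes only. Definability is therefore treated semantically by closure rules, in
  two forms: \<open>fdef\<close>, uniform in the carrier, for transfer by Los and elementarity, and
  \<open>pdef\<close>, with parameters in one carrier, for the axiom schemas.\<close>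

primrec fm_bound :: "fm \<Rightarrow> nat" where
  "fm_bound (Mem m n) = Suc (max m n)"
| "fm_bound (Equ m n) = Suc (max m n)"
| "fm_bound (Neg p) = fm_bound p"
| "fm_bound (Conj p q) = max (fm_bound p) (fm_bound q)"
| "fm_bound (Forall n p) = max (Suc n) (fm_bound p)"

lemma sat_cong:
  "(\<And>n. n < fm_bound p \<Longrightarrow> s n = s' n) \<Longrightarrow> sat M E s p = sat M E s' p"
proof (induction p arbitrary: s s')
  case (Forall n p)
  have "sat M E (s(n := x)) p = sat M E (s'(n := x)) p" for x
    by (rule Forall.IH) (use Forall.prems in auto)
  then show ?case by simp
next
  case (Conj p q)
  have "sat M E s p = sat M E s' p" "sat M E s q = sat M E s' q"
    by (intro Conj.IH; use Conj.prems in simp)+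
  then show ?case by simp
next
  case (Neg p)
  have "sat M E s p = sat M E s' p"
    by (rule Neg.IH) (use Neg.prems in auto)
  then show ?case by simp
qed auto

primrec fm_rename :: "(nat \<Rightarrow> nat) \<Rightarrow> fm \<Rightarrow> fm" where
  "fm_rename \<rho> (Mem m n) = Mem (\<rho> m) (\<rho> n)"
| "fm_rename \<rho> (Equ m n) = Equ (\<rho> m) (\<rho> n)"
| "fm_rename \<rho> (Neg p) = Neg (fm_rename \<rho> p)"
| "fm_rename \<rho> (Conj p q) = Conj (fm_rename \<rho> p) (fm_rename \<rho> q)"
| "fm_rename \<rho> (Forall n p) = Forall (\<rho> n) (fm_rename \<rho> p)"

text \<open>Bound names are renamed along with free ones, so injectivity is what excludes capture:
  updating at \<open>\<rho> n\<close> must disturb no other renamed variable.\<close>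

lemma sat_rename:
  assumes "inj \<rho>"
  shows "sat M E s (fm_rename \<rho> p) = sat M E (\<lambda>n. s (\<rho> n)) p"
proof (induction p arbitrary: s)
  case (Forall n p)
  have "(\<lambda>m. (s(\<rho> n := x)) (\<rho> m)) = (\<lambda>m. s (\<rho> m))(n := x)" for x
    using assms by (auto simp: fun_eq_iff inj_eq)
  then show ?case using Forall.IH by simp
qed auto

text \<open>A single formula must serve all carriers at once. This uniformity is what lets a
  property be moved between a structure and its ultrapower without ever writing the formula
  down.\<close>

definition fdef :: "('v \<Rightarrow> 'v \<Rightarrow> bool) \<Rightarrow> ('v set \<Rightarrow> (nat \<Rightarrow> 'v) \<Rightarrow> bool) \<Rightarrow> bool" where
  "fdef E P \<longleftrightarrow> (\<exists>p. \<forall>M s. range s \<subseteq> M \<longrightarrow> (P M s \<longleftrightarrow> sat M E s p))"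

lemma range_case_nat [simp]: "range (case_nat y s) \<subseteq> M \<longleftrightarrow> y \<in> M \<and> range s \<subseteq> M"
proof
  assume *: "range (case_nat y s) \<subseteq> M"
  have **: "case_nat y s n \<in> M" for n using * by blast
  have "s n \<in> M" for n using **[of "Suc n"] by simp
  moreover have "y \<in> M" using **[of 0] by simp
  ultimately show "y \<in> M \<and> range s \<subseteq> M" by blast
qed (auto simp: image_subset_iff split: nat.split)

lemma fdef_cong:
  assumes "fdef E P" "\<And>M s. range s \<subseteq> M \<Longrightarrow> P M s = Q M s"
  shows "fdef E Q"
  using assms unfolding fdef_def by metis

lemma fdef_sat: "fdef E (\<lambda>M s. sat M E s p)"
  unfolding fdef_def by blast

lemma fdef_mem: "fdef E (\<lambda>M e. E (e m) (e n))"
  unfolding fdef_def by (rule exI[of _ "Mem m n"]) simp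

lemma fdef_eq: "fdef E (\<lambda>M e. e m = e n)"
  unfolding fdef_def by (rule exI[of _ "Equ m n"]) simp

lemma fdef_not:
  assumes "fdef E P" shows "fdef E (\<lambda>M e. \<not> P M e)"
proof -
  obtain p where "\<And>M s. range s \<subseteq> M \<Longrightarrow> P M s \<longleftrightarrow> sat M E s p"
    using assms unfolding fdef_def by blast
  then show ?thesis unfolding fdef_def by (intro exI[of _ "Neg p"]) simp
qed

lemma fdef_conj:
  assumes "fdef E P" "fdef E Q"
  shows "fdef E (\<lambda>M e. P M e \<and> Q M e)"
proof -
  obtain p where "\<And>M s. range s \<subseteq> M \<Longrightarrow> P M s \<longleftrightarrow> sat M E s p"
    using assms(1) unfolding fdef_def by blast
  moreover obtain q where "\<And>M s. range s \<subseteq> M \<Longrightarrow> Q M s \<longleftrightarrow> sat M E s q"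
    using assms(2) unfolding fdef_def by blast
  ultimately show ?thesis
    unfolding fdef_def by (intro exI[of _ "Conj p q"]) simp
qed

lemma fdef_disj:
  assumes "fdef E P" "fdef E Q" shows "fdef E (\<lambda>M e. P M e \<or> Q M e)"
proof -
  have "fdef E (\<lambda>M e. \<not> (\<not> P M e \<and> \<not> Q M e))"
    by (intro fdef_not fdef_conj assms)
  then show ?thesis by simp
qed

lemma fdef_imp:
  assumes "fdef E P" "fdef E Q" shows "fdef E (\<lambda>M e. P M e \<longrightarrow> Q M e)"
proof -
  have "fdef E (\<lambda>M e. \<not> P M e \<or> Q M e)"
    by (intro fdef_not fdef_disj assms)
  then show ?thesis by (simp only: imp_conv_disj)
qed

lemma fdef_iff:
  assumes "fdef E P" "fdef E Q" shows "fdef E (\<lambda>M e. P M e \<longleftrightarrow> Q M e)"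
proof -
  have "fdef E (\<lambda>M e. (P M e \<longrightarrow> Q M e) \<and> (Q M e \<longrightarrow> P M e))"
    by (intro fdef_imp fdef_conj assms)
  then show ?thesis by (simp only: iff_conv_conj_imp)
qed

text \<open>
  Variables are de Bruijn indices on the semantic side. The bound variable becomes a fresh name
  \<open>K\<close>, and the cycle \<open>0 \<rightarrow> K \<rightarrow> K - 1 \<rightarrow> \<dots>\<close> renames the remaining ones.
\<close>

lemma fdef_all:
  assumes "fdef E (\<lambda>M e. P M (\<lambda>n. e (Suc n)) (e 0))"
  shows "fdef E (\<lambda>M e. \<forall>y\<in>M. P M e y)"
proof -
  obtain p where p: "\<And>M s. range s \<subseteq> M \<Longrightarrow> P M (\<lambda>n. s (Suc n)) (s 0) \<longleftrightarrow> sat M E s p"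
    using assms unfolding fdef_def by blast
  define K where "K = fm_bound p"
  define \<rho> where "\<rho> n = (if n = 0 then K else if n \<le> K then n - 1 else n)" for n
  have inj: "inj \<rho>" unfolding \<rho>_def inj_def by auto
  have "(\<forall>y\<in>M. P M s y) \<longleftrightarrow> sat M E s (Forall K (fm_rename \<rho> p))" if "range s \<subseteq> M" for M s
  proof -
    have "P M s y \<longleftrightarrow> sat M E (s(K := y)) (fm_rename \<rho> p)" if "y \<in> M" for y
    proof -
      have "P M s y \<longleftrightarrow> sat M E (case_nat y s) p"
        using p[of "case_nat y s" M] that \<open>range s \<subseteq> M\<close> by simp
      also have "\<dots> \<longleftrightarrow> sat M E (\<lambda>n. (s(K := y)) (\<rho> n)) p"
        by (rule sat_cong) (auto simp: \<rho>_def K_def split: nat.split)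
      finally show ?thesis by (simp add: sat_rename[OF inj])
    qed
    then show ?thesis by simp
  qed
  then show ?thesis unfolding fdef_def by blast
qed

lemma fdef_ex:
  assumes "fdef E (\<lambda>M e. P M (\<lambda>n. e (Suc n)) (e 0))"
  shows "fdef E (\<lambda>M e. \<exists>y\<in>M. P M e y)"
proof -
  have "fdef E (\<lambda>M e. \<not> (\<forall>y\<in>M. \<not> P M e y))"
    by (intro fdef_not fdef_all assms)
  then show ?thesis by simp
qed

text \<open>Here \<open>\<rho>\<close> may identify variables, so a syntactic renaming could
  capture. The formula is rebuilt instead: each quantifier passes through \<open>fdef_all\<close>,
  which supplies a fresh name.\<close>

lemma fdef_subst:
  assumes "fdef E P"
  shows "fdef E (\<lambda>M e. P M (\<lambda>n. e (\<rho> n)))"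
proof -
  have *: "fdef E (\<lambda>M e. sat M E (\<lambda>n. e (\<rho> n)) p)" for \<rho> :: "nat \<Rightarrow> nat" and p
  proof (induction p arbitrary: \<rho>)
    case (Mem m n) show ?case by (simp add: fdef_mem)
  next
    case (Equ m n) show ?case by (simp add: fdef_eq)
  next
    case (Neg p) then show ?case by (simp add: fdef_not)
  next
    case (Conj p q) then show ?case by (simp add: fdef_conj)
  next
    case (Forall n p)
    have eq: "((\<lambda>m. e (Suc (\<rho> m)))(n := e 0)) = (\<lambda>m. e (((Suc \<circ> \<rho>)(n := 0)) m))"
      for e :: "nat \<Rightarrow> 'a" by auto
    have "fdef E (\<lambda>M e. sat M E ((\<lambda>m. e (Suc (\<rho> m)))(n := e 0)) p)"
      unfolding eq by (rule Forall.IH)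
    then have "fdef E (\<lambda>M e. \<forall>y\<in>M. sat M E ((\<lambda>m. e (\<rho> m))(n := y)) p)"
      by (rule fdef_all)
    then show ?case by simp
  qed
  obtain p where p: "\<And>M s. range s \<subseteq> M \<Longrightarrow> P M s \<longleftrightarrow> sat M E s p"
    using assms unfolding fdef_def by blast
  show ?thesis
    by (rule fdef_cong[OF *[of \<rho> p]]) (use p in \<open>auto simp: image_subset_iff\<close>)
qed

lemma fdef_ex1:
  assumes "fdef E (\<lambda>M e. P M (\<lambda>n. e (Suc n)) (e 0))"
  shows "fdef E (\<lambda>M e. \<exists>!y. y \<in> M \<and> P M e y)"
proof -
  have "fdef E (\<lambda>M e. \<exists>y\<in>M. P M e y \<and> (\<forall>z\<in>M. P M e z \<longrightarrow> z = y))"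
    apply (rule fdef_ex, rule fdef_conj[OF assms], rule fdef_all, rule fdef_imp)
    \<comment> \<open>With z at index 0 and y at index 1, the property of z must skip index 1 to
      reach the outer variables.\<close>
    using fdef_subst[OF assms, of "case_nat 0 (\<lambda>n. Suc (Suc n))"] apply simp
    by (rule fdef_eq)
  then show ?thesis by (rule fdef_cong) blast
qed

lemma fdef_sat_subst: "fdef E (\<lambda>M e. sat M E (\<lambda>n. e (\<rho> n)) p)"
  by (rule fdef_subst[OF fdef_sat])

named_theorems fdef_intros

lemmas [fdef_intros] = fdef_mem fdef_eq fdef_not fdef_conj fdef_disj fdef_imp fdef_iff
  fdef_all fdef_ex fdef_ex1

lemma fdef_is_empty: "fdef E (\<lambda>M e. is_empty M E (e i))"
  unfolding is_empty_def by (intro fdef_intros)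

lemma fdef_is_subset: "fdef E (\<lambda>M e. is_subset M E (e i) (e j))"
  unfolding is_subset_def by (intro fdef_intros)

lemma fdef_is_union: "fdef E (\<lambda>M e. is_union M E (e i) (e j))"
  unfolding is_union_def by (intro fdef_intros)

lemma fdef_is_succ: "fdef E (\<lambda>M e. is_succ M E (e i) (e j))"
  unfolding is_succ_def by (intro fdef_intros)

lemma fdef_is_inductive: "fdef E (\<lambda>M e. is_inductive M E (e i))"
  unfolding is_inductive_def by (intro fdef_intros fdef_is_empty fdef_is_succ)

lemma fdef_is_upair: "fdef E (\<lambda>M e. is_upair M E (e i) (e j) (e k))"
  unfolding is_upair_def by (intro fdef_intros)

lemma fdef_is_opair: "fdef E (\<lambda>M e. is_opair M E (e i) (e j) (e k))"
  unfolding is_opair_def by (intro fdef_intros fdef_is_upair)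

lemma fdef_maps_to: "fdef E (\<lambda>M e. maps_to M E (e i) (e j) (e k))"
  unfolding maps_to_def by (intro fdef_intros fdef_is_opair)

lemma fdef_is_fun_on: "fdef E (\<lambda>M e. is_fun_on M E (e i) (e j))"
  unfolding is_fun_on_def by (intro fdef_intros fdef_is_opair fdef_maps_to)

lemma fdef_is_ordinal: "fdef E (\<lambda>M e. is_ordinal M E (e i))"
  unfolding is_ordinal_def by (intro fdef_intros fdef_is_subset)

lemmas [fdef_intros] = fdef_is_empty fdef_is_subset fdef_is_union fdef_is_succ
  fdef_is_inductive fdef_is_upair fdef_is_opair fdef_maps_to fdef_is_fun_on fdef_is_ordinal

subsection \<open>Definability with parameters\<close>

definition interleave :: "(nat \<Rightarrow> 'v) \<Rightarrow> (nat \<Rightarrow> 'v) \<Rightarrow> nat \<Rightarrow> 'v" where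
  "interleave s c n = (if even n then s (n div 2) else c (n div 2))"

lemma interleave_simps [simp]:
  "interleave s c (2 * n) = s n" "interleave s c (Suc (2 * n)) = c n"
  "interleave s c 0 = s 0" "interleave s c (Suc 0) = c 0"
  by (auto simp: interleave_def)

lemma range_interleave [simp]:
  "range (interleave s c) \<subseteq> M \<longleftrightarrow> range s \<subseteq> M \<and> range c \<subseteq> M"
proof
  assume "range (interleave s c) \<subseteq> M"
  then have *: "interleave s c n \<in> M" for n by blast
  have "s n \<in> M" "c n \<in> M" for n using *[of "2 * n"] *[of "Suc (2 * n)"] by simp_all
  then show "range s \<subseteq> M \<and> range c \<subseteq> M" by blast
qed (auto simp: interleave_def)

text \<open>Variables sit at the even places and parameters at the odd ones. A whole sequence of
  parameters is allowed for convenience, although a formula reads only finitely many of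
  them.\<close>

definition pdef :: "'v set \<Rightarrow> ('v \<Rightarrow> 'v \<Rightarrow> bool) \<Rightarrow> ((nat \<Rightarrow> 'v) \<Rightarrow> bool) \<Rightarrow> bool" where
  "pdef M E P \<longleftrightarrow> (\<exists>Q c. fdef E Q \<and> range c \<subseteq> M \<and>
     (\<forall>s. range s \<subseteq> M \<longrightarrow> (P s \<longleftrightarrow> Q M (interleave s c))))"

lemma pdefI:
  assumes "fdef E Q" "range c \<subseteq> M"
    "\<And>s. range s \<subseteq> M \<Longrightarrow> P s \<longleftrightarrow> Q M (\<lambda>n. interleave s c (\<rho> n))"
  shows "pdef M E P"
  unfolding pdef_def
proof (intro exI conjI allI impI)
  show "fdef E (\<lambda>M e. Q M (\<lambda>n. e (\<rho> n)))" by (rule fdef_subst[OF assms(1)])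
qed (fact assms)+

lemma pdef_cong:
  assumes "pdef M E P" "\<And>s. range s \<subseteq> M \<Longrightarrow> P s = Q s"
  shows "pdef M E Q"
proof -
  obtain P' c where "fdef E P'" "range c \<subseteq> M"
    "\<And>s. range s \<subseteq> M \<Longrightarrow> P s \<longleftrightarrow> P' M (interleave s c)"
    using assms(1) unfolding pdef_def by auto
  then show ?thesis
    using assms(2) unfolding pdef_def by (intro exI[of _ P'] exI[of _ c]) auto
qed

lemma pdef_not:
  assumes "pdef M E P" shows "pdef M E (\<lambda>e. \<not> P e)"
proof -
  obtain P' c where "fdef E P'" "range c \<subseteq> M"
    "\<And>s. range s \<subseteq> M \<Longrightarrow> P s \<longleftrightarrow> P' M (interleave s c)"
    using assms unfolding pdef_def by auto
  then show ?thesis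
    unfolding pdef_def by (intro exI[of _ "\<lambda>M e. \<not> P' M e"] exI[of _ c]) (auto intro: fdef_not)
qed

lemma pdef_conj:
  assumes "pdef M E P" "pdef M E Q"
  shows "pdef M E (\<lambda>e. P e \<and> Q e)"
proof -
  obtain P' c where P: "fdef E P'" "range c \<subseteq> M"
    "\<And>s. range s \<subseteq> M \<Longrightarrow> P s \<longleftrightarrow> P' M (interleave s c)"
    using assms(1) unfolding pdef_def by auto
  obtain Q' d where Q: "fdef E Q'" "range d \<subseteq> M"
    "\<And>s. range s \<subseteq> M \<Longrightarrow> Q s \<longleftrightarrow> Q' M (interleave s d)"
    using assms(2) unfolding pdef_def by auto
  \<comment> \<open>The common parameter sequence is \<open>interleave c d\<close>: the parameter
    \<open>c k\<close>, formerly at 2k+1, is now at 2(2k)+1, and \<open>d k\<close> is at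
    2(2k+1)+1.\<close>
  define \<rho> where "\<rho> n = (if even n then n else Suc (2 * (2 * (n div 2))))" for n :: nat
  define \<sigma> where "\<sigma> n = (if even n then n else Suc (2 * (Suc (2 * (n div 2)))))" for n :: nat
  have \<rho>: "(\<lambda>n. interleave s (interleave c d) (\<rho> n)) = interleave s c" for s
  proof
    fix n
    show "interleave s (interleave c d) (\<rho> n) = interleave s c n"
    proof (cases "even n")
      case True then show ?thesis by (simp add: \<rho>_def interleave_def)
    next
      case False
      then show ?thesis unfolding \<rho>_def if_not_P[OF False] interleave_simps
        by (simp add: interleave_def)
    qed
  qed
  have \<sigma>: "(\<lambda>n. interleave s (interleave c d) (\<sigma> n)) = interleave s d" for s
  proof
    fix n
    show "interleave s (interleave c d) (\<sigma> n) = interleave s d n"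
    proof (cases "even n")
      case True then show ?thesis by (simp add: \<sigma>_def interleave_def)
    next
      case False
      then show ?thesis unfolding \<sigma>_def if_not_P[OF False] interleave_simps
        by (simp add: interleave_def)
    qed
  qed
  show ?thesis
  proof (rule pdefI)
    show "fdef E (\<lambda>M e. P' M (\<lambda>n. e (\<rho> n)) \<and> Q' M (\<lambda>n. e (\<sigma> n)))"
      by (rule fdef_conj[OF fdef_subst[OF P(1)] fdef_subst[OF Q(1)]])
    show "range (interleave c d) \<subseteq> M" using P Q by simp
    show "P s \<and> Q s \<longleftrightarrow> P' M (\<lambda>n. interleave s (interleave c d) (\<rho> n)) \<and>
        Q' M (\<lambda>n. interleave s (interleave c d) (\<sigma> n))" if "range s \<subseteq> M" for s
      unfolding \<rho> \<sigma> using that P Q by simp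
  qed
qed

lemma pdef_disj:
  assumes "pdef M E P" "pdef M E Q" shows "pdef M E (\<lambda>e. P e \<or> Q e)"
proof -
  have "pdef M E (\<lambda>e. \<not> (\<not> P e \<and> \<not> Q e))"
    by (intro pdef_not pdef_conj assms)
  then show ?thesis by simp
qed

lemma pdef_imp:
  assumes "pdef M E P" "pdef M E Q" shows "pdef M E (\<lambda>e. P e \<longrightarrow> Q e)"
proof -
  have "pdef M E (\<lambda>e. \<not> P e \<or> Q e)"
    by (intro pdef_not pdef_disj assms)
  then show ?thesis by (simp only: imp_conv_disj)
qed

lemma pdef_iff:
  assumes "pdef M E P" "pdef M E Q" shows "pdef M E (\<lambda>e. P e \<longleftrightarrow> Q e)"
proof -
  have "pdef M E (\<lambda>e. (P e \<longrightarrow> Q e) \<and> (Q e \<longrightarrow> P e))"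
    by (intro pdef_imp pdef_conj assms)
  then show ?thesis by (simp only: iff_conv_conj_imp)
qed

lemma pdef_all:
  assumes "pdef M E (\<lambda>e. P (\<lambda>n. e (Suc n)) (e 0))"
  shows "pdef M E (\<lambda>e. \<forall>y\<in>M. P e y)"
proof -
  obtain Q c where Q: "fdef E Q" "range c \<subseteq> M"
    "\<And>s. range s \<subseteq> M \<Longrightarrow> P (\<lambda>n. s (Suc n)) (s 0) \<longleftrightarrow> Q M (interleave s c)"
    using assms unfolding pdef_def by auto
  \<comment> \<open>On the left, y is the new variable 0, the old variable \<open>s j\<close> is at
    2j+2, and \<open>c k\<close> is at 2k+1. On the right the entire interleaving has moved up by
    one, so positive even places step down and odd places step up.\<close>
  define \<rho> where "\<rho> n = (if n = 0 then 0 else if even n then n - 1 else Suc n)" for n :: nat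
  have \<rho>: "interleave (case_nat y s) c = (\<lambda>n. case_nat y (interleave s c) (\<rho> n))" for y s
  proof
    fix n
    show "interleave (case_nat y s) c n = case_nat y (interleave s c) (\<rho> n)"
    proof (cases "even n")
      case True
      then obtain k where "n = 2 * k" by blast
      then show ?thesis by (cases k) (auto simp: \<rho>_def interleave_def)
    next
      case False
      then obtain k where "n = Suc (2 * k)" by (metis oddE Suc_eq_plus1)
      then show ?thesis by (simp add: \<rho>_def)
    qed
  qed
  have 1: "fdef E (\<lambda>M e. \<forall>y\<in>M. Q M (\<lambda>n. case_nat y e (\<rho> n)))"
  proof (rule fdef_all)
    have "(\<lambda>n. case_nat (e 0) (\<lambda>n. e (Suc n)) (\<rho> n)) = (\<lambda>n. e (\<rho> n))" for e :: "nat \<Rightarrow> 'a"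
      by (rule ext) (simp split: nat.split)
    then show "fdef E (\<lambda>M e. Q M (\<lambda>n. case_nat (e 0) (\<lambda>n. e (Suc n)) (\<rho> n)))"
      using fdef_subst[OF Q(1), of \<rho>] by simp
  qed
  have "(\<forall>y\<in>M. P s y) \<longleftrightarrow> (\<forall>y\<in>M. Q M (\<lambda>n. case_nat y (interleave s c) (\<rho> n)))"
    if "range s \<subseteq> M" for s
  proof (rule ball_cong[OF refl])
    fix y assume "y \<in> M"
    then show "P s y \<longleftrightarrow> Q M (\<lambda>n. case_nat y (interleave s c) (\<rho> n))"
      using Q(3)[of "case_nat y s"] that by (simp add: \<rho>)
  qed
  with 1 Q(2) show ?thesis
    unfolding pdef_def
    by (intro exI[of _ "\<lambda>M e. \<forall>y\<in>M. Q M (\<lambda>n. case_nat y e (\<rho> n))"] exI[of _ c]) simp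
qed

lemma pdef_ex:
  assumes "pdef M E (\<lambda>e. P (\<lambda>n. e (Suc n)) (e 0))"
  shows "pdef M E (\<lambda>e. \<exists>y\<in>M. P e y)"
proof -
  have "pdef M E (\<lambda>e. \<not> (\<forall>y\<in>M. \<not> P e y))"
    by (intro pdef_not pdef_all assms)
  then show ?thesis by simp
qed

lemma pdef_rename:
  assumes "pdef M E P"
  shows "pdef M E (\<lambda>e. P (\<lambda>n. e (\<rho> n)))"
proof -
  obtain Q c where Q: "fdef E Q" "range c \<subseteq> M"
    "\<And>s. range s \<subseteq> M \<Longrightarrow> P s \<longleftrightarrow> Q M (interleave s c)"
    using assms unfolding pdef_def by auto
  have "interleave (\<lambda>n. s (\<rho> n)) c
      = (\<lambda>n. interleave s c (if even n then 2 * \<rho> (n div 2) else n))" for s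
    by (auto simp: interleave_def)
  moreover have "range (\<lambda>n. s (\<rho> n)) \<subseteq> M" if "range s \<subseteq> M" for s using that by auto
  ultimately show ?thesis
    by (intro pdefI[OF Q(1,2), of _ "\<lambda>n. if even n then 2 * \<rho> (n div 2) else n"])
      (simp add: Q(3))
qed

lemma pdef_fdef:
  assumes "M \<noteq> {}" "fdef E Q" shows "pdef M E (Q M)"
proof (rule pdefI[of E Q "\<lambda>_. SOME x. x \<in> M" M _ "\<lambda>n. 2 * n"])
  show "range (\<lambda>_. SOME x. x \<in> M) \<subseteq> M" using assms(1) by (auto simp: some_in_eq)
qed (simp_all add: assms)

lemma pdef_eq_const: "c \<in> M \<Longrightarrow> pdef M E (\<lambda>e. e n = c)"
  by (rule pdefI[OF fdef_eq[of E 0 "Suc 0"], of "\<lambda>_. c" _ _ "case_nat (2 * n) (\<lambda>_. Suc 0)"])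
    auto

section \<open>Definable functions and substitution of terms\<close>

definition tdef :: "'v set \<Rightarrow> ('v \<Rightarrow> 'v \<Rightarrow> bool) \<Rightarrow> ((nat \<Rightarrow> 'v) \<Rightarrow> 'v) \<Rightarrow> bool" where
  "tdef M E t \<longleftrightarrow> (\<forall>s. range s \<subseteq> M \<longrightarrow> t s \<in> M) \<and>
     pdef M E (\<lambda>e. e 0 = t (\<lambda>n. e (Suc n)))"

lemma tdef_closed: "tdef M E t \<Longrightarrow> range s \<subseteq> M \<Longrightarrow> t s \<in> M"
  by (simp add: tdef_def)

lemma tdef_const: "c \<in> M \<Longrightarrow> tdef M E (\<lambda>e. c)"
  by (simp add: tdef_def pdef_eq_const)

lemma tdef_rename:
  assumes "tdef M E t" shows "tdef M E (\<lambda>e. t (\<lambda>n. e (\<rho> n)))"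
  unfolding tdef_def
proof (intro conjI allI impI)
  show "t (\<lambda>n. s (\<rho> n)) \<in> M" if "range s \<subseteq> M" for s
    by (rule tdef_closed[OF assms]) (use that in auto)
  have "pdef M E (\<lambda>e. e 0 = t (\<lambda>n. e (Suc n)))" using assms by (simp add: tdef_def)
  from pdef_rename[OF this, of "case_nat 0 (\<lambda>n. Suc (\<rho> n))"]
  show "pdef M E (\<lambda>e. e 0 = t (\<lambda>n. e (Suc (\<rho> n))))" by simp
qed

lemma pdef_eq_var: "M \<noteq> {} \<Longrightarrow> pdef M E (\<lambda>e. e m = e n)"
  using pdef_fdef[OF _ fdef_eq] .

lemma tdef_var: "M \<noteq> {} \<Longrightarrow> tdef M E (\<lambda>e. e n)"
  unfolding tdef_def by (intro conjI allI impI pdef_eq_var) auto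

text \<open>A term is substituted through a quantifier: some y equals \<open>t e\<close> and
  satisfies P. Closure of M under t guarantees that the quantifier finds this y.\<close>

lemma pdef_let:
  assumes "pdef M E (\<lambda>e. P (\<lambda>n. e (Suc n)) (e 0))" "tdef M E t"
  shows "pdef M E (\<lambda>e. P e (t e))"
proof -
  have "pdef M E (\<lambda>e. \<exists>y\<in>M. y = t e \<and> P e y)"
    by (intro pdef_ex pdef_conj) (use assms in \<open>simp_all add: tdef_def\<close>)
  then show ?thesis by (rule pdef_cong) (use assms(2) in \<open>auto simp: tdef_def\<close>)
qed

abbreviation "pdef1 M E P \<equiv> pdef M E (\<lambda>e. P (e 0))"
abbreviation "pdef2 M E P \<equiv> pdef M E (\<lambda>e. P (e 0) (e (Suc 0)))"
abbreviation "pdef3 M E P \<equiv> pdef M E (\<lambda>e. P (e 0) (e (Suc 0)) (e (Suc (Suc 0))))"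
abbreviation "tdef1 M E F \<equiv> tdef M E (\<lambda>e. F (e 0))"
abbreviation "tdef2 M E F \<equiv> tdef M E (\<lambda>e. F (e 0) (e (Suc 0)))"

lemma pdef_pred1:
  assumes "pdef1 M E P" "tdef M E t" shows "pdef M E (\<lambda>e. P (t e))"
  by (rule pdef_let[where P = "\<lambda>e y. P y", OF assms])

lemma pdef_pred2:
  assumes "pdef2 M E P" "tdef M E t" "tdef M E u"
  shows "pdef M E (\<lambda>e. P (t e) (u e))"
proof -
  have "pdef M E (\<lambda>e. P (e (Suc 0)) (e 0))"
    using pdef_rename[OF assms(1), of "case_nat (Suc 0) (\<lambda>_. 0)"] by simp
  from pdef_let[where P = "\<lambda>e y. P (e 0) y", OF this tdef_rename[OF assms(3), of Suc]]
  have "pdef M E (\<lambda>e. P (e 0) (u (\<lambda>n. e (Suc n))))" .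
  from pdef_let[where P = "\<lambda>e y. P y (u e)", OF this assms(2)] show ?thesis .
qed

lemma pdef_pred3:
  assumes "pdef3 M E P" "tdef M E t" "tdef M E u" "tdef M E v"
  shows "pdef M E (\<lambda>e. P (t e) (u e) (v e))"
proof -
  have "pdef M E (\<lambda>e. P (e (Suc (Suc 0))) (e (Suc 0)) (e 0))"
    using pdef_rename[OF assms(1), of "case_nat (Suc (Suc 0)) (case_nat (Suc 0) (\<lambda>_. 0))"] by simp
  from pdef_let[where P = "\<lambda>e y. P (e (Suc 0)) (e 0) y", OF this
      tdef_rename[OF assms(4), of "\<lambda>n. Suc (Suc n)"]]
  have "pdef M E (\<lambda>e. P (e (Suc 0)) (e 0) (v (\<lambda>n. e (Suc (Suc n)))))" .
  from pdef_let[where P = "\<lambda>e y. P (e 0) y (v (\<lambda>n. e (Suc n)))", OF this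
      tdef_rename[OF assms(3), of Suc]]
  have "pdef M E (\<lambda>e. P (e 0) (u (\<lambda>n. e (Suc n))) (v (\<lambda>n. e (Suc n))))" .
  from pdef_let[where P = "\<lambda>e y. P y (u e) (v e)", OF this assms(2)] show ?thesis .
qed

lemma pdef_nonempty: "pdef M E P \<Longrightarrow> M \<noteq> {}"
  by (auto simp: pdef_def)

lemma tdef_nonempty: "tdef M E t \<Longrightarrow> M \<noteq> {}"
  unfolding tdef_def using pdef_nonempty by blast

lemma tdef_comp1:
  assumes "tdef1 M E F" "tdef M E t"
  shows "tdef M E (\<lambda>e. F (t e))"
proof -
  have ne: "M \<noteq> {}" using assms(2) by (rule tdef_nonempty)
  have "pdef2 M E (\<lambda>y x. y = F x)" using assms(1) by (simp add: tdef_def)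
  from pdef_pred2[OF this tdef_var[OF ne, of E 0] tdef_rename[OF assms(2), of Suc]]
  have "pdef M E (\<lambda>e. e 0 = F (t (\<lambda>n. e (Suc n))))" .
  moreover have "F (t s) \<in> M" if "range s \<subseteq> M" for s
    using tdef_closed[OF assms(1), of "\<lambda>_. t s"] tdef_closed[OF assms(2) that] by auto
  ultimately show ?thesis by (simp add: tdef_def)
qed

lemma tdef_comp2:
  assumes "tdef2 M E F" "tdef M E t" "tdef M E u"
  shows "tdef M E (\<lambda>e. F (t e) (u e))"
proof -
  have ne: "M \<noteq> {}" using assms(2) by (rule tdef_nonempty)
  have "pdef3 M E (\<lambda>y x z. y = F x z)" using assms(1) by (simp add: tdef_def)
  from pdef_pred3[OF this tdef_var[OF ne, of E 0] tdef_rename[OF assms(2), of Suc]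
      tdef_rename[OF assms(3), of Suc]]
  have "pdef M E (\<lambda>e. e 0 = F (t (\<lambda>n. e (Suc n))) (u (\<lambda>n. e (Suc n))))" .
  moreover have "F (t s) (u s) \<in> M" if "range s \<subseteq> M" for s
    using tdef_closed[OF assms(1), of "case_nat (t s) (\<lambda>_. u s)"]
      tdef_closed[OF assms(2) that] tdef_closed[OF assms(3) that] by auto
  ultimately show ?thesis by (simp add: tdef_def)
qed

text \<open>Terms are allowed as values of the variables because the theorem of Los needs the truth
  of a formula at the values \<open>app (f n) i\<close> to be a definable condition on i.\<close>

lemma pdef_sat:
  assumes "M \<noteq> {}" "\<And>n. tdef M E (t n)"
  shows "pdef M E (\<lambda>e. sat M E (\<lambda>n. t n e) p)"
  using assms(2)
proof (induction p arbitrary: t)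
  case (Mem m n)
  then show ?case
    using pdef_pred2[OF pdef_fdef[OF assms(1) fdef_mem[of E 0 "Suc 0"]], of "t m" "t n"]
    by simp
next
  case (Equ m n)
  then show ?case
    using pdef_pred2[OF pdef_fdef[OF assms(1) fdef_eq[of E 0 "Suc 0"]], of "t m" "t n"]
    by simp
next
  case (Neg p) then show ?case by (simp add: pdef_not)
next
  case (Conj p q) then show ?case by (simp add: pdef_conj)
next
  case (Forall k p)
  have "pdef M E (\<lambda>e. sat M E (\<lambda>n. ((\<lambda>n e. t n (\<lambda>m. e (Suc m)))(k := \<lambda>e. e 0)) n e) p)"
  proof (rule Forall.IH)
    show "tdef M E (((\<lambda>n e. t n (\<lambda>m. e (Suc m)))(k := \<lambda>e. e 0)) n)" for n
      using tdef_var[OF assms(1), of E 0] tdef_rename[OF Forall.prems, of n Suc] by auto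
  qed
  moreover have "(\<lambda>n. ((\<lambda>n e. t n (\<lambda>m. e (Suc m)))(k := \<lambda>e. e 0)) n e)
      = (\<lambda>n. t n (\<lambda>m. e (Suc m)))(k := e 0)" for e
    by auto
  ultimately have "pdef M E (\<lambda>e. sat M E ((\<lambda>n. t n (\<lambda>m. e (Suc m)))(k := e 0)) p)"
    by simp
  then have "pdef M E (\<lambda>e. \<forall>y\<in>M. sat M E ((\<lambda>n. t n e)(k := y)) p)"
    by (rule pdef_all)
  then show ?case by simp
qed

section \<open>Sets and functions in a model of ZFC\<close>

text \<open>This goes back from semantic definability to syntax. Replacement and
  \<open>class_function\<close> reserve the variables 0 and 1 for the two arguments, so the
  parameters have to move to the places from 2 on.\<close>

lemma pdef2_sat:
  assumes "pdef2 M E R"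
  obtains s p where "range s \<subseteq> M"
    "\<And>x y. x \<in> M \<Longrightarrow> y \<in> M \<Longrightarrow> sat M E (s(0 := x, 1 := y)) p \<longleftrightarrow> R x y"
proof -
  obtain Q c where Q: "fdef E Q" "range c \<subseteq> M"
    "\<And>s. range s \<subseteq> M \<Longrightarrow> R (s 0) (s (Suc 0)) \<longleftrightarrow> Q M (interleave s c)"
    using assms unfolding pdef_def by auto
  define \<rho> :: "nat \<Rightarrow> nat"
    where "\<rho> n = (if n = 0 then 0 else if n = 2 then 1 else Suc (Suc n))" for n
  obtain p where p: "\<And>s. range s \<subseteq> M \<Longrightarrow> Q M (\<lambda>n. s (\<rho> n)) \<longleftrightarrow> sat M E s p"
    using fdef_subst[OF Q(1), of \<rho>] unfolding fdef_def by blast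
  \<comment> \<open>A dummy element of M for the variables that the binary predicate does not
    read.\<close>
  define a where "a = c 0"
  have a: "a \<in> M" using Q(2) unfolding a_def by blast
  define s where "s = case_nat a (case_nat a (interleave (\<lambda>_. a) c))"
  have s: "range s \<subseteq> M"
    unfolding s_def range_case_nat range_interleave using a Q(2) by auto
  show thesis
  proof (rule that[OF s])
    fix x y assume that: "x \<in> M" "y \<in> M"
    have "(\<lambda>n. (s(0 := x, 1 := y)) (\<rho> n)) = interleave (case_nat x (case_nat y (\<lambda>_. a))) c"
    proof
      fix n :: nat
      consider "n = 0" | "n = 2" | "n \<noteq> 0" "n \<noteq> 2" by blast
      then show "(s(0 := x, 1 := y)) (\<rho> n) = interleave (case_nat x (case_nat y (\<lambda>_. a))) c n"
        by cases (auto simp: \<rho>_def s_def interleave_def split: nat.split)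
    qed
    moreover have "range (s(0 := x, 1 := y)) \<subseteq> M" using s that by auto
    moreover have "range (case_nat x (case_nat y (\<lambda>_. a))) \<subseteq> M"
      unfolding range_case_nat using that a by auto
    ultimately show "sat M E (s(0 := x, 1 := y)) p \<longleftrightarrow> R x y"
      using Q(3)[of "case_nat x (case_nat y (\<lambda>_. a))"] p[of "s(0 := x, 1 := y)"] by simp
  qed
qed

locale zfc_model =
  fixes M :: "'v set" and E :: "'v \<Rightarrow> 'v \<Rightarrow> bool"
  assumes zfc: "ZFC M E"
begin

text \<open>Internal sets are handled through their external extensions: \<open>els\<close> decodes,
  \<open>mk\<close> encodes, and \<open>small\<close> says that an external set has a code. Every
  existence axiom is restated below as a closure property of \<open>small\<close>.\<close>

definition els :: "'v \<Rightarrow> 'v set" where "els a = {x \<in> M. E x a}"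
definition small :: "'v set \<Rightarrow> bool" where "small S \<longleftrightarrow> (\<exists>b\<in>M. els b = S)"
definition mk :: "'v set \<Rightarrow> 'v" where "mk S = (THE b. b \<in> M \<and> els b = S)"

lemma els_iff: "x \<in> els a \<longleftrightarrow> x \<in> M \<and> E x a" by (auto simp: els_def)
lemma els_in_M: "x \<in> els a \<Longrightarrow> x \<in> M" by (auto simp: els_def)

lemma els_inject: assumes "a \<in> M" "b \<in> M" "els a = els b" shows "a = b"
proof -
  have "\<forall>x\<in>M. \<forall>y\<in>M. (\<forall>z\<in>M. E z x \<longleftrightarrow> E z y) \<longrightarrow> x = y"
    using zfc unfolding ZFC_def by (elim conjE)
  with assms show ?thesis by (auto simp: els_def set_eq_iff)
qed

lemma foundation:
  assumes "a \<in> M" "els a \<noteq> {}"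
  obtains x where "x \<in> els a" "\<And>y. y \<in> els x \<Longrightarrow> y \<notin> els a"
proof -
  have "\<forall>a\<in>M. (\<exists>x\<in>M. E x a) \<longrightarrow> (\<exists>x\<in>M. E x a \<and> (\<forall>y\<in>M. E y x \<longrightarrow> \<not> E y a))"
    using zfc unfolding ZFC_def by (elim conjE)
  with assms that show thesis by (fastforce simp: els_def)
qed

lemma M_nonempty: "M \<noteq> {}"
proof -
  have "\<exists>w\<in>M. is_inductive M E w" using zfc unfolding ZFC_def by (elim conjE)
  then show ?thesis by auto
qed

lemma mk_props: assumes "small S" shows mk_in_M: "mk S \<in> M" and els_mk: "els (mk S) = S"
proof -
  obtain b where "b \<in> M" "els b = S" using assms by (auto simp: small_def)
  then have "\<exists>!b. b \<in> M \<and> els b = S" using els_inject by blast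
  from theI'[OF this] show "mk S \<in> M" "els (mk S) = S" unfolding mk_def by auto
qed

lemma mk_els: "a \<in> M \<Longrightarrow> mk (els a) = a"
  unfolding mk_def by (rule the_equality) (auto intro: els_inject)

lemma small_els: "a \<in> M \<Longrightarrow> small (els a)" by (auto simp: small_def)
lemma small_in_M: "small S \<Longrightarrow> S \<subseteq> M" by (auto simp: small_def els_def)

lemma mk_eq_iff: "small S \<Longrightarrow> y \<in> M \<Longrightarrow> y = mk S \<longleftrightarrow> els y = S"
  using els_mk[of S] mk_els[of y] by auto

subsection \<open>Definability rules\<close>

lemmas td_var = tdef_var[OF M_nonempty]
lemmas td_const = tdef_const[of _ M E]

lemma pd_mem: "tdef M E t \<Longrightarrow> tdef M E u \<Longrightarrow> pdef M E (\<lambda>e. E (t e) (u e))"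
  using pdef_pred2[OF pdef_fdef[OF M_nonempty fdef_mem[of E 0 "Suc 0"]], of t u] .

lemma pd_eq: "tdef M E t \<Longrightarrow> tdef M E u \<Longrightarrow> pdef M E (\<lambda>e. t e = u e)"
  using pdef_pred2[OF pdef_fdef[OF M_nonempty fdef_eq[of E 0 "Suc 0"]], of t u] .

lemma pd_const: "pdef M E (\<lambda>e. b)"
proof (cases b)
  case True
  then show ?thesis using pd_eq[OF td_var[of E 0] td_var[of E 0]] by simp
next
  case False
  then show ?thesis using pdef_not[OF pd_eq[OF td_var[of E 0] td_var[of E 0]]] by simp
qed

named_theorems pdi

lemmas [pdi] = pdef_not pdef_conj pdef_disj pdef_imp pdef_iff pdef_all pdef_ex
  pd_mem pd_eq td_var td_const pd_const

lemma separation_els: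
  assumes "a \<in> M" "pdef1 M E P"
  shows "small {x \<in> els a. P x}"
proof -
  obtain Q c where Q: "fdef E Q" "range c \<subseteq> M"
    "\<And>s. range s \<subseteq> M \<Longrightarrow> P (s 0) \<longleftrightarrow> Q M (interleave s c)"
    using assms(2) unfolding pdef_def by auto
  obtain p where p: "\<And>s. range s \<subseteq> M \<Longrightarrow> Q M s \<longleftrightarrow> sat M E s p"
    using Q(1) unfolding fdef_def by blast
  define s where "s = interleave (\<lambda>_. a) c"
  have s: "range s \<subseteq> M" unfolding s_def range_interleave using assms(1) Q(2) by auto
  have "\<forall>p s. \<forall>a\<in>M. range s \<subseteq> M \<longrightarrow>
        (\<exists>b\<in>M. \<forall>x\<in>M. E x b \<longleftrightarrow> E x a \<and> sat M E (s(0 := x)) p)"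
    using zfc unfolding ZFC_def by (elim conjE)
  then obtain b where b: "b \<in> M" "\<forall>x\<in>M. E x b \<longleftrightarrow> E x a \<and> sat M E (s(0 := x)) p"
    using assms(1) s by blast
  have "sat M E (s(0 := x)) p \<longleftrightarrow> P x" if "x \<in> M" for x
  proof -
    have "s(0 := x) = interleave (case_nat x (\<lambda>_. a)) c"
    proof
      fix n
      show "(s(0 := x)) n = interleave (case_nat x (\<lambda>_. a)) c n"
        by (cases "n = 0") (auto simp: s_def interleave_def split: nat.split)
    qed
    then show ?thesis
      using that assms(1) Q(2) Q(3)[of "case_nat x (\<lambda>_. a)"]
        p[of "interleave (case_nat x (\<lambda>_. a)) c"] by simp
  qed
  then have "els b = {x \<in> els a. P x}" using b by (auto simp: els_def)
  with b show ?thesis by (auto simp: small_def)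
qed

lemma separation: assumes "small S" "pdef1 M E P" shows "small {x \<in> S. P x}"
  using separation_els[OF mk_in_M[OF assms(1)] assms(2)] by (simp add: els_mk[OF assms(1)])

lemma small_subset:
  assumes "small S" "pdef1 M E P" "\<And>x. x \<in> M \<Longrightarrow> P x \<Longrightarrow> x \<in> S"
  shows "small {x \<in> M. P x}"
proof -
  have "{x \<in> M. P x} = {x \<in> S. P x}" using assms(3) small_in_M[OF assms(1)] by auto
  then show ?thesis using separation[OF assms(1,2)] by simp
qed

lemma replacement_total:
  assumes "a \<in> M" "pdef2 M E R" "\<And>x. x \<in> els a \<Longrightarrow> \<exists>!y. y \<in> M \<and> R x y"
  shows "small {y \<in> M. \<exists>x\<in>els a. R x y}"
proof -
  obtain s p where s: "range s \<subseteq> M"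
    and eq: "\<And>x y. x \<in> M \<Longrightarrow> y \<in> M \<Longrightarrow> sat M E (s(0 := x, 1 := y)) p \<longleftrightarrow> R x y"
    using pdef2_sat[OF assms(2)] by blast
  have ax: "\<forall>p s. \<forall>a\<in>M. range s \<subseteq> M \<longrightarrow>
        (\<forall>x\<in>M. E x a \<longrightarrow> (\<exists>!y. y \<in> M \<and> sat M E (s(0 := x, 1 := y)) p)) \<longrightarrow>
        (\<exists>b\<in>M. \<forall>y\<in>M. E y b \<longleftrightarrow> (\<exists>x\<in>M. E x a \<and> sat M E (s(0 := x, 1 := y)) p))"
    using zfc unfolding ZFC_def by (elim conjE)
  have tot: "\<forall>x\<in>M. E x a \<longrightarrow> (\<exists>!y. y \<in> M \<and> sat M E (s(0 := x, 1 := y)) p)"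
  proof (intro ballI impI)
    fix x assume x: "x \<in> M" "E x a"
    then have "\<exists>!y. y \<in> M \<and> R x y" using assms(3) by (auto simp: els_def)
    then show "\<exists>!y. y \<in> M \<and> sat M E (s(0 := x, 1 := y)) p" using eq[OF x(1)] by metis
  qed
  from ax[THEN spec[of _ p], THEN spec[of _ s], THEN bspec[OF _ assms(1)], THEN mp, OF s,
      THEN mp, OF tot]
  obtain b where b: "b \<in> M"
    "\<forall>y\<in>M. E y b \<longleftrightarrow> (\<exists>x\<in>M. E x a \<and> sat M E (s(0 := x, 1 := y)) p)"
    by blast
  then have "els b = {y \<in> M. \<exists>x\<in>els a. R x y}" using eq by (auto simp: els_def)
  with b show ?thesis by (auto simp: small_def)
qed

text \<open>The axiom asks for a function that is total on the given set. A partial one is first cut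
  down to its domain, which Separation provides.\<close>

lemma replacement:
  assumes "small S" "pdef2 M E R"
    "\<And>x y y'. x \<in> S \<Longrightarrow> y \<in> M \<Longrightarrow> y' \<in> M \<Longrightarrow> R x y \<Longrightarrow> R x y' \<Longrightarrow> y = y'"
  shows "small {y \<in> M. \<exists>x\<in>S. R x y}"
proof -
  have "pdef1 M E (\<lambda>x. \<exists>y\<in>M. R x y)"
    using pdef_rename[OF assms(2), of "case_nat (Suc 0) (\<lambda>_. 0)"] by (intro pdef_ex) simp
  from separation[OF assms(1) this] have T: "small {x \<in> S. \<exists>y\<in>M. R x y}" .
  have "small {y \<in> M. \<exists>x\<in>els (mk {x \<in> S. \<exists>y\<in>M. R x y}). R x y}"
    by (rule replacement_total[OF mk_in_M[OF T] assms(2)])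
      (use assms(3) in \<open>auto simp: els_mk[OF T]\<close>)
  moreover have "{y \<in> M. \<exists>x\<in>els (mk {x \<in> S. \<exists>y\<in>M. R x y}). R x y} = {y \<in> M. \<exists>x\<in>S. R x y}"
    by (auto simp: els_mk[OF T])
  ultimately show ?thesis by simp
qed

lemma tdef1_in_M: "tdef1 M E F \<Longrightarrow> x \<in> M \<Longrightarrow> F x \<in> M"
  using tdef_closed[of M E "\<lambda>e. F (e 0)" "\<lambda>_. x"] by auto

lemma tdef2_in_M: "tdef2 M E F \<Longrightarrow> x \<in> M \<Longrightarrow> y \<in> M \<Longrightarrow> F x y \<in> M"
  using tdef_closed[of M E "\<lambda>e. F (e 0) (e (Suc 0))" "case_nat x (\<lambda>_. y)"] by auto

lemma small_image:
  assumes "small S" "tdef1 M E F"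
  shows "small (F ` S)"
proof -
  have "pdef2 M E (\<lambda>x y. y = F x)" by (intro pdi tdef_comp1[OF assms(2)])
  from replacement[OF assms(1) this] have "small {y \<in> M. \<exists>x\<in>S. y = F x}" by blast
  moreover have "{y \<in> M. \<exists>x\<in>S. y = F x} = F ` S"
    using tdef1_in_M[OF assms(2)] small_in_M[OF assms(1)] by auto
  ultimately show ?thesis by simp
qed

text \<open>This rule turns comprehension into a definable operation. Operations such as
  \<open>upr\<close>, \<open>times\<close> and \<open>lam\<close> are written as \<open>mk\<close>
  of a comprehension so that it applies to them.\<close>

lemma td_mk:
  assumes "pdef M E (\<lambda>e. P (\<lambda>n. e (Suc n)) (e 0))"
    "\<And>e. range e \<subseteq> M \<Longrightarrow> small {y \<in> M. P e y}"
  shows "tdef M E (\<lambda>e. mk {y \<in> M. P e y})"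
  unfolding tdef_def
proof (intro conjI allI impI)
  fix s :: "nat \<Rightarrow> 'v" assume "range s \<subseteq> M"
  then show "mk {y \<in> M. P s y} \<in> M" using mk_in_M assms(2) by blast
next
  have "pdef M E (\<lambda>e. P (\<lambda>n. e (Suc (Suc n))) (e 0))"
    using pdef_rename[OF assms(1), of "case_nat 0 (\<lambda>n. Suc (Suc n))"] by simp
  then have "pdef M E (\<lambda>e. \<forall>y\<in>M. E y (e 0) \<longleftrightarrow> P (\<lambda>n. e (Suc n)) y)"
    by (intro pdef_all pdef_iff pd_mem td_var)
  then show "pdef M E (\<lambda>e. e 0 = mk {y \<in> M. P (\<lambda>n. e (Suc n)) y})"
  proof (rule pdef_cong)
    fix s :: "nat \<Rightarrow> 'v" assume s: "range s \<subseteq> M"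
    have "range (\<lambda>n. s (Suc n)) \<subseteq> M" "s 0 \<in> M" using s by auto
    then show "(\<forall>y\<in>M. E y (s 0) = P (\<lambda>n. s (Suc n)) y) = (s 0 = mk {y \<in> M. P (\<lambda>n. s (Suc n)) y})"
      using mk_eq_iff[OF assms(2), of "\<lambda>n. s (Suc n)" "s 0"] by (auto simp: els_def)
  qed
qed

subsection \<open>Elementary operations\<close>

lemma small_upair: assumes "a \<in> M" "b \<in> M" shows "small {a, b}"
proof -
  have "\<forall>a\<in>M. \<forall>b\<in>M. \<exists>p\<in>M. is_upair M E a b p" using zfc unfolding ZFC_def by (elim conjE)
  then obtain p where "p \<in> M" "\<forall>z\<in>M. E z p \<longleftrightarrow> z = a \<or> z = b"
    using assms unfolding is_upair_def by blast
  then have "els p = {a, b}" using assms by (auto simp: els_def)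
  with \<open>p \<in> M\<close> show ?thesis by (auto simp: small_def)
qed

lemma small_Union_els: assumes "a \<in> M" shows "small (\<Union>x\<in>els a. els x)"
proof -
  have "\<forall>a\<in>M. \<exists>u\<in>M. is_union M E a u" using zfc unfolding ZFC_def by (elim conjE)
  then obtain u where "u \<in> M" "\<forall>x\<in>M. E x u \<longleftrightarrow> (\<exists>y\<in>M. E y a \<and> E x y)"
    using assms unfolding is_union_def by blast
  then have "els u = (\<Union>x\<in>els a. els x)" by (auto simp: els_def)
  with \<open>u \<in> M\<close> show ?thesis by (auto simp: small_def)
qed

lemma small_Union: assumes "small S" shows "small (\<Union>x\<in>S. els x)"
  using small_Union_els[OF mk_in_M[OF assms]] by (simp add: els_mk[OF assms])

lemma small_UN: "small S \<Longrightarrow> tdef1 M E F \<Longrightarrow> small (\<Union>x\<in>S. els (F x))"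
  using small_Union[OF small_image, of S F] by simp

lemma small_Un: assumes "small S" "small T" shows "small (S \<union> T)"
  using small_Union[OF small_upair[OF mk_in_M[OF assms(1)] mk_in_M[OF assms(2)]]]
  by (simp add: els_mk assms)

lemma small_singleton: "a \<in> M \<Longrightarrow> small {a}" using small_upair[of a a] by simp

lemma small_insert: "a \<in> M \<Longrightarrow> small S \<Longrightarrow> small (insert a S)"
  using small_Un[OF small_singleton, of a S] by simp

lemma small_empty: "small {}"
proof -
  obtain a where "a \<in> M" using M_nonempty by blast
  from separation_els[OF this pd_const[of False]] show ?thesis by simp
qed

lemma small_Pow: assumes "a \<in> M" shows "small {x \<in> M. els x \<subseteq> els a}"
proof -
  have "\<forall>a\<in>M. \<exists>p\<in>M. \<forall>x\<in>M. E x p \<longleftrightarrow> is_subset M E x a" using zfc unfolding ZFC_def by (elim conjE)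
  then obtain p where "p \<in> M" "\<forall>x\<in>M. E x p \<longleftrightarrow> is_subset M E x a" using assms by blast
  then have "els p = {x \<in> M. els x \<subseteq> els a}" by (auto simp: els_def is_subset_def)
  with \<open>p \<in> M\<close> show ?thesis by (auto simp: small_def)
qed

definition emp :: 'v where "emp = mk {}"
definition upr :: "'v \<Rightarrow> 'v \<Rightarrow> 'v" where "upr a b = mk {y \<in> M. y = a \<or> y = b}"
definition opr :: "'v \<Rightarrow> 'v \<Rightarrow> 'v" where "opr a b = upr (upr a a) (upr a b)"
definition pow :: "'v \<Rightarrow> 'v" where "pow a = mk {y \<in> M. \<forall>x\<in>M. E x y \<longrightarrow> E x a}"
definition un :: "'v \<Rightarrow> 'v" where "un a = mk {y \<in> M. \<exists>x\<in>M. E x a \<and> E y x}"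
definition suc :: "'v \<Rightarrow> 'v" where "suc a = mk {y \<in> M. E y a \<or> y = a}"

lemma emp_in_M: "emp \<in> M" and els_emp: "els emp = {}"
  unfolding emp_def using mk_props[OF small_empty] by auto

lemma small_upr: "a \<in> M \<Longrightarrow> b \<in> M \<Longrightarrow> small {y \<in> M. y = a \<or> y = b}"
proof -
  assume "a \<in> M" "b \<in> M"
  moreover from this have "{y \<in> M. y = a \<or> y = b} = {a, b}" by auto
  ultimately show ?thesis using small_upair by simp
qed

lemma upr_in_M: "a \<in> M \<Longrightarrow> b \<in> M \<Longrightarrow> upr a b \<in> M"
  and els_upr: "a \<in> M \<Longrightarrow> b \<in> M \<Longrightarrow> els (upr a b) = {a, b}"
  unfolding upr_def using mk_props[OF small_upr] by auto

lemma td_upr0: "tdef2 M E upr"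
  unfolding upr_def
  by (rule td_mk[where P = "\<lambda>e y. y = e 0 \<or> y = e (Suc 0)"], intro pdi)
    (rule small_upr, auto)

lemma td_upr [pdi]: "tdef M E t \<Longrightarrow> tdef M E u \<Longrightarrow> tdef M E (\<lambda>e. upr (t e) (u e))"
  by (rule tdef_comp2[OF td_upr0])

lemma td_opr [pdi]: "tdef M E t \<Longrightarrow> tdef M E u \<Longrightarrow> tdef M E (\<lambda>e. opr (t e) (u e))"
  unfolding opr_def by (intro td_upr)

lemma opr_in_M: "a \<in> M \<Longrightarrow> b \<in> M \<Longrightarrow> opr a b \<in> M"
  unfolding opr_def by (intro upr_in_M)

lemma upr_eq_iff:
  assumes "a \<in> M" "b \<in> M" "c \<in> M" "d \<in> M"
  shows "upr a b = upr c d \<longleftrightarrow> {a, b} = {c, d}"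
  using els_inject[of "upr a b" "upr c d"] els_upr[OF assms(1,2)] els_upr[OF assms(3,4)]
    upr_in_M[OF assms(1,2)] upr_in_M[OF assms(3,4)] by auto

lemma opr_eq_iff:
  assumes "a \<in> M" "b \<in> M" "c \<in> M" "d \<in> M"
  shows "opr a b = opr c d \<longleftrightarrow> a = c \<and> b = d"
  unfolding opr_def
  by (simp only: upr_eq_iff upr_in_M assms doubleton_eq_iff insert_absorb2) auto

lemma is_upair_iff: "a \<in> M \<Longrightarrow> b \<in> M \<Longrightarrow> p \<in> M \<Longrightarrow> is_upair M E a b p \<longleftrightarrow> p = upr a b"
  unfolding upr_def mk_eq_iff[OF small_upr] by (auto simp: is_upair_def els_def)

lemma is_opair_iff: "a \<in> M \<Longrightarrow> b \<in> M \<Longrightarrow> p \<in> M \<Longrightarrow> is_opair M E a b p \<longleftrightarrow> p = opr a b"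
  unfolding is_opair_def opr_def by (auto simp: is_upair_iff upr_in_M)

lemma maps_to_iff: "a \<in> M \<Longrightarrow> b \<in> M \<Longrightarrow> maps_to M E f a b \<longleftrightarrow> E (opr a b) f"
  unfolding maps_to_def by (auto simp: is_opair_iff opr_in_M)

lemma small_pow: "a \<in> M \<Longrightarrow> small {y \<in> M. \<forall>x\<in>M. E x y \<longrightarrow> E x a}"
proof -
  assume "a \<in> M"
  moreover have "{y \<in> M. \<forall>x\<in>M. E x y \<longrightarrow> E x a} = {x \<in> M. els x \<subseteq> els a}" by (auto simp: els_def)
  ultimately show ?thesis using small_Pow by simp
qed

lemma pow_in_M: "a \<in> M \<Longrightarrow> pow a \<in> M"
  and els_pow: "a \<in> M \<Longrightarrow> els (pow a) = {x \<in> M. els x \<subseteq> els a}"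
  unfolding pow_def using mk_props[OF small_pow] by (auto simp: els_def)

lemma td_pow [pdi]: assumes "tdef M E t" shows "tdef M E (\<lambda>e. pow (t e))"
proof (rule tdef_comp1[OF _ assms])
  show "tdef1 M E pow"
    unfolding pow_def
    by (rule td_mk[where P = "\<lambda>e y. \<forall>x\<in>M. E x y \<longrightarrow> E x (e 0)"], intro pdi)
      (rule small_pow, auto)
qed

lemma small_un: "a \<in> M \<Longrightarrow> small {y \<in> M. \<exists>x\<in>M. E x a \<and> E y x}"
proof -
  assume "a \<in> M"
  moreover have "{y \<in> M. \<exists>x\<in>M. E x a \<and> E y x} = (\<Union>x\<in>els a. els x)" by (auto simp: els_def)
  ultimately show ?thesis using small_Union_els by simp
qed

lemma un_in_M: "a \<in> M \<Longrightarrow> un a \<in> M"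
  and els_un: "a \<in> M \<Longrightarrow> els (un a) = (\<Union>x\<in>els a. els x)"
  unfolding un_def using mk_props[OF small_un] by (auto simp: els_def)

lemma td_un [pdi]: assumes "tdef M E t" shows "tdef M E (\<lambda>e. un (t e))"
proof (rule tdef_comp1[OF _ assms])
  show "tdef1 M E un"
    unfolding un_def
    by (rule td_mk[where P = "\<lambda>e y. \<exists>x\<in>M. E x (e 0) \<and> E y x"], intro pdi)
      (rule small_un, auto)
qed

lemma is_union_iff: "a \<in> M \<Longrightarrow> u \<in> M \<Longrightarrow> is_union M E a u \<longleftrightarrow> u = un a"
  unfolding un_def mk_eq_iff[OF small_un] by (auto simp: is_union_def els_def)

lemma small_suc: "a \<in> M \<Longrightarrow> small {y \<in> M. E y a \<or> y = a}"
proof -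
  assume "a \<in> M"
  moreover from this have "{y \<in> M. E y a \<or> y = a} = insert a (els a)" by (auto simp: els_def)
  ultimately show ?thesis using small_insert small_els by simp
qed

lemma suc_in_M: "a \<in> M \<Longrightarrow> suc a \<in> M"
  and els_suc: "a \<in> M \<Longrightarrow> els (suc a) = insert a (els a)"
  unfolding suc_def using mk_props[OF small_suc] by (auto simp: els_def)

lemma td_suc [pdi]: assumes "tdef M E t" shows "tdef M E (\<lambda>e. suc (t e))"
proof (rule tdef_comp1[OF _ assms])
  show "tdef1 M E suc"
    unfolding suc_def
    by (rule td_mk[where P = "\<lambda>e y. E y (e 0) \<or> y = e 0"], intro pdi)
      (rule small_suc, auto)
qed

lemma is_succ_iff: "a \<in> M \<Longrightarrow> u \<in> M \<Longrightarrow> is_succ M E a u \<longleftrightarrow> u = suc a"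
  unfolding suc_def mk_eq_iff[OF small_suc] by (auto simp: is_succ_def els_def)

lemma not_mem_self: assumes "a \<in> M" shows "\<not> E a a"
proof
  assume "E a a"
  have e: "els (upr a a) = {a}" using els_upr[OF assms assms] by simp
  then have "els (upr a a) \<noteq> {}" by simp
  then obtain x where "x \<in> els (upr a a)" "\<And>y. y \<in> els x \<Longrightarrow> y \<notin> els (upr a a)"
    using foundation[OF upr_in_M[OF assms assms]] by metis
  with e \<open>E a a\<close> assms show False by (auto simp: els_iff)
qed

lemma not_mem_cycle: assumes "a \<in> M" "b \<in> M" "E a b" shows "\<not> E b a"
proof
  assume "E b a"
  have e: "els (upr a b) = {a, b}" using els_upr[OF assms(1,2)] by simp
  then have "els (upr a b) \<noteq> {}" by simp
  then obtain x where "x \<in> els (upr a b)" "\<And>y. y \<in> els x \<Longrightarrow> y \<notin> els (upr a b)"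
    using foundation[OF upr_in_M[OF assms(1,2)]] by metis
  with e \<open>E b a\<close> assms show False by (auto simp: els_iff)
qed

subsection \<open>Products and functions\<close>

definition times :: "'v \<Rightarrow> 'v \<Rightarrow> 'v" where
  "times a b = mk {p \<in> M. \<exists>x\<in>M. \<exists>y\<in>M. E x a \<and> E y b \<and> p = opr x y}"

lemma small_times:
  assumes "a \<in> M" "b \<in> M"
  shows "small {p \<in> M. \<exists>x\<in>M. \<exists>y\<in>M. E x a \<and> E y b \<and> p = opr x y}"
proof -
  have s: "small {p \<in> M. \<exists>y\<in>M. E y b \<and> p = opr x y}" if "x \<in> M" for x
  proof -
    have "tdef1 M E (\<lambda>y. opr x y)" by (intro pdi that)
    from small_image[OF small_els[OF assms(2)] this]
    have "small (opr x ` els b)" .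
    moreover have "opr x ` els b = {p \<in> M. \<exists>y\<in>M. E y b \<and> p = opr x y}"
      using opr_in_M that by (auto simp: els_def)
    ultimately show ?thesis by simp
  qed
  have "tdef1 M E (\<lambda>x. mk {p \<in> M. \<exists>y\<in>M. E y b \<and> p = opr x y})"
    by (rule td_mk[where P = "\<lambda>e p. \<exists>y\<in>M. E y b \<and> p = opr (e 0) y"], intro pdi assms)
      (rule s, auto)
  from small_UN[OF small_els[OF assms(1)] this]
  have "small (\<Union>x\<in>els a. {p \<in> M. \<exists>y\<in>M. E y b \<and> p = opr x y})"
    using s els_mk by (simp add: els_def)
  moreover have "(\<Union>x\<in>els a. {p \<in> M. \<exists>y\<in>M. E y b \<and> p = opr x y})
      = {p \<in> M. \<exists>x\<in>M. \<exists>y\<in>M. E x a \<and> E y b \<and> p = opr x y}" by (auto simp: els_def)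
  ultimately show ?thesis by simp
qed

lemma times_in_M: "a \<in> M \<Longrightarrow> b \<in> M \<Longrightarrow> times a b \<in> M"
  and els_times: "a \<in> M \<Longrightarrow> b \<in> M \<Longrightarrow> els (times a b) = {opr x y |x y. x \<in> els a \<and> y \<in> els b}"
  unfolding times_def using mk_props[OF small_times] opr_in_M by (auto simp: els_def)

lemma td_times [pdi]:
  assumes "tdef M E t" "tdef M E u" shows "tdef M E (\<lambda>e. times (t e) (u e))"
proof (rule tdef_comp2[OF _ assms])
  show "tdef2 M E times"
    unfolding times_def
    by (rule td_mk[where P = "\<lambda>e p. \<exists>x\<in>M. \<exists>y\<in>M. E x (e 0) \<and> E y (e (Suc 0)) \<and> p = opr x y"],
        intro pdi) (rule small_times, auto)
qed

definition func :: "'v \<Rightarrow> bool" where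
  "func f \<longleftrightarrow> (\<forall>x\<in>M. \<forall>y\<in>M. \<forall>z\<in>M. E (opr x y) f \<and> E (opr x z) f \<longrightarrow> y = z)"

text \<open>The default value \<open>emp\<close> makes application total, hence a definable term
  without side conditions.\<close>

definition app :: "'v \<Rightarrow> 'v \<Rightarrow> 'v" where
  "app f x = (if \<exists>!y. y \<in> M \<and> E (opr x y) f then THE y. y \<in> M \<and> E (opr x y) f else emp)"

lemma app_eqI: "func f \<Longrightarrow> x \<in> M \<Longrightarrow> y \<in> M \<Longrightarrow> E (opr x y) f \<Longrightarrow> app f x = y"
  unfolding app_def func_def by (auto intro!: the_equality)

lemma app_cases:
  "app f x = y \<longleftrightarrow> (\<exists>!y. y \<in> M \<and> E (opr x y) f) \<and> y \<in> M \<and> E (opr x y) f \<or>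
     \<not> (\<exists>!y. y \<in> M \<and> E (opr x y) f) \<and> y = emp"
proof (cases "\<exists>!y. y \<in> M \<and> E (opr x y) f")
  case True
  from theI'[OF this] True show ?thesis unfolding app_def by auto
qed (auto simp: app_def)

lemma app_in_M: "app f x \<in> M"
  using app_cases[of f x "app f x"] emp_in_M by auto

lemma td_app0: "tdef2 M E app"
  unfolding tdef_def
proof (intro conjI allI impI app_in_M)
  have "pdef M E (\<lambda>e. (\<exists>y\<in>M. E (opr (e (Suc (Suc 0))) y) (e (Suc 0)) \<and>
          (\<forall>z\<in>M. E (opr (e (Suc (Suc 0))) z) (e (Suc 0)) \<longrightarrow> z = y)) \<and>
        E (opr (e (Suc (Suc 0))) (e 0)) (e (Suc 0)) \<or>
      \<not> (\<exists>y\<in>M. E (opr (e (Suc (Suc 0))) y) (e (Suc 0)) \<and>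
          (\<forall>z\<in>M. E (opr (e (Suc (Suc 0))) z) (e (Suc 0)) \<longrightarrow> z = y)) \<and> e 0 = emp)"
    by (intro pdi emp_in_M)
  then show "pdef M E (\<lambda>e. e 0 = app (e (Suc 0)) (e (Suc (Suc 0))))"
  proof (rule pdef_cong)
    fix s :: "nat \<Rightarrow> 'v" assume "range s \<subseteq> M"
    then have "s 0 \<in> M" by auto
    moreover have "(\<exists>y\<in>M. P y \<and> (\<forall>z\<in>M. P z \<longrightarrow> z = y)) \<longleftrightarrow> (\<exists>!y. y \<in> M \<and> P y)" for P
      by blast
    ultimately show "((\<exists>y\<in>M. E (opr (s (Suc (Suc 0))) y) (s (Suc 0)) \<and>
          (\<forall>z\<in>M. E (opr (s (Suc (Suc 0))) z) (s (Suc 0)) \<longrightarrow> z = y)) \<and>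
        E (opr (s (Suc (Suc 0))) (s 0)) (s (Suc 0)) \<or>
      \<not> (\<exists>y\<in>M. E (opr (s (Suc (Suc 0))) y) (s (Suc 0)) \<and>
          (\<forall>z\<in>M. E (opr (s (Suc (Suc 0))) z) (s (Suc 0)) \<longrightarrow> z = y)) \<and> s 0 = emp)
      = (s 0 = app (s (Suc 0)) (s (Suc (Suc 0))))"
      using app_cases[of "s (Suc 0)" "s (Suc (Suc 0))" "s 0"] by (simp only: eq_commute[of "s 0"]) simp
  qed
qed

lemma td_app [pdi]: "tdef M E t \<Longrightarrow> tdef M E u \<Longrightarrow> tdef M E (\<lambda>e. app (t e) (u e))"
  by (rule tdef_comp2[OF td_app0])

definition lam :: "'v \<Rightarrow> ('v \<Rightarrow> 'v) \<Rightarrow> 'v" where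
  "lam a F = mk {p \<in> M. \<exists>x\<in>M. E x a \<and> p = opr x (F x)}"

lemma small_lam:
  assumes "a \<in> M" "tdef1 M E F"
  shows "small {p \<in> M. \<exists>x\<in>M. E x a \<and> p = opr x (F x)}"
proof -
  have "tdef1 M E (\<lambda>x. opr x (F x))" by (intro pdi assms)
  from small_image[OF small_els[OF assms(1)] this]
  have "small ((\<lambda>x. opr x (F x)) ` els a)" .
  moreover have "(\<lambda>x. opr x (F x)) ` els a = {p \<in> M. \<exists>x\<in>M. E x a \<and> p = opr x (F x)}"
    using opr_in_M tdef1_in_M[OF assms(2)] by (auto simp: els_def)
  ultimately show ?thesis by simp
qed

lemma td_lam:
  assumes "tdef M E t" "tdef M E (\<lambda>e. F (\<lambda>n. e (Suc n)) (e 0))"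
    "\<And>e. range e \<subseteq> M \<Longrightarrow> tdef1 M E (F e)"
  shows "tdef M E (\<lambda>e. lam (t e) (F e))"
  unfolding lam_def
proof (rule td_mk[where P = "\<lambda>e p. \<exists>x\<in>M. E x (t e) \<and> p = opr x (F e x)"])
  have "tdef M E (\<lambda>e. F (\<lambda>n. e (Suc (Suc n))) (e 0))"
    using tdef_rename[OF assms(2), of "case_nat 0 (\<lambda>n. Suc (Suc n))"] by simp
  then show "pdef M E (\<lambda>e. \<exists>x\<in>M. E x (t (\<lambda>n. e (Suc n))) \<and> e 0 = opr x (F (\<lambda>n. e (Suc n)) x))"
    using tdef_rename[OF assms(1), of "\<lambda>n. Suc (Suc n)"] by (intro pdi)
  show "small {p \<in> M. \<exists>x\<in>M. E x (t e) \<and> p = opr x (F e x)}" if "range e \<subseteq> M" for e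
    using small_lam[OF tdef_closed[OF assms(1) that] assms(3)[OF that]] .
qed

lemma lam_in_M: "a \<in> M \<Longrightarrow> tdef1 M E F \<Longrightarrow> lam a F \<in> M"
  and els_lam: "a \<in> M \<Longrightarrow> tdef1 M E F \<Longrightarrow> els (lam a F) = {opr x (F x) |x. x \<in> els a}"
  unfolding lam_def using mk_props[OF small_lam] opr_in_M tdef1_in_M by (auto simp: els_def)

lemma E_lam_iff:
  assumes "a \<in> M" "tdef1 M E F" "x \<in> M" "y \<in> M"
  shows "E (opr x y) (lam a F) \<longleftrightarrow> E x a \<and> y = F x"
proof -
  have "E (opr x y) (lam a F) \<longleftrightarrow> (\<exists>x'. opr x y = opr x' (F x') \<and> x' \<in> els a)"
  proof -
    have "E (opr x y) (lam a F) \<longleftrightarrow> opr x y \<in> els (lam a F)"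
      using opr_in_M[OF assms(3,4)] by (simp add: els_iff)
    then show ?thesis by (simp add: els_lam[OF assms(1,2)] conj_commute)
  qed
  also have "\<dots> \<longleftrightarrow> E x a \<and> y = F x"
    using opr_eq_iff[OF assms(3,4)] tdef1_in_M[OF assms(2)] assms(3,4) by (auto simp: els_def)
  finally show ?thesis .
qed

lemma func_lam: "a \<in> M \<Longrightarrow> tdef1 M E F \<Longrightarrow> func (lam a F)"
  unfolding func_def using E_lam_iff by auto

lemma app_lam: "a \<in> M \<Longrightarrow> tdef1 M E F \<Longrightarrow> x \<in> els a \<Longrightarrow> app (lam a F) x = F x"
  by (rule app_eqI[OF func_lam]) (auto simp: E_lam_iff els_def tdef1_in_M)

lemma is_fun_on_iff:
  assumes "f \<in> M" "X \<in> M"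
  shows "is_fun_on M E f X \<longleftrightarrow> els f \<subseteq> {opr x y |x y. x \<in> els X \<and> y \<in> M} \<and>
    (\<forall>x\<in>els X. \<exists>!y. y \<in> M \<and> E (opr x y) f)"
proof -
  have "(\<forall>p\<in>M. E p f \<longrightarrow> (\<exists>a\<in>M. \<exists>b\<in>M. E a X \<and> is_opair M E a b p)) \<longleftrightarrow>
      els f \<subseteq> {opr x y |x y. x \<in> els X \<and> y \<in> M}"
    using is_opair_iff by (fastforce simp: els_def)
  moreover have "(\<exists>!b. b \<in> M \<and> maps_to M E f a b) \<longleftrightarrow> (\<exists>!y. y \<in> M \<and> E (opr a y) f)"
    if "a \<in> M" for a using that by (auto simp: maps_to_iff)
  then have "(\<forall>a\<in>M. E a X \<longrightarrow> (\<exists>!b. b \<in> M \<and> maps_to M E f a b)) \<longleftrightarrow>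
      (\<forall>x\<in>els X. \<exists>!y. y \<in> M \<and> E (opr x y) f)"
    unfolding Ball_def els_iff imp_conjL by simp
  ultimately show ?thesis unfolding is_fun_on_def by simp
qed

lemma fun_app:
  assumes "f \<in> M" "X \<in> M" "is_fun_on M E f X" "x \<in> els X"
  shows "E (opr x (app f x)) f"
  using assms app_cases[of f x "app f x"] by (auto simp: is_fun_on_iff)

lemma fun_func:
  assumes "f \<in> M" "X \<in> M" "is_fun_on M E f X"
  shows "func f"
  unfolding func_def
proof (intro ballI impI)
  fix x y z assume *: "x \<in> M" "y \<in> M" "z \<in> M" "E (opr x y) f \<and> E (opr x z) f"
  have "opr x y \<in> els f" using * opr_in_M by (auto simp: els_def)
  then obtain x' y' where "opr x y = opr x' y'" "x' \<in> els X" "y' \<in> M"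
    using assms is_fun_on_iff[OF assms(1,2)] by blast
  then have "x \<in> els X" using * opr_eq_iff[of x y x' y'] els_in_M by auto
  then show "y = z" using * assms(3) is_fun_on_iff[OF assms(1,2)] by blast
qed

lemma E_fun_iff:
  assumes "f \<in> M" "X \<in> M" "is_fun_on M E f X" "x \<in> M" "y \<in> M"
  shows "E (opr x y) f \<longleftrightarrow> x \<in> els X \<and> y = app f x"
proof
  assume *: "E (opr x y) f"
  have "opr x y \<in> els f" using * assms opr_in_M by (auto simp: els_def)
  then obtain x' y' where "opr x y = opr x' y'" "x' \<in> els X" "y' \<in> M"
    using assms is_fun_on_iff[OF assms(1,2)] by blast
  then have "x \<in> els X" using assms opr_eq_iff[of x y x' y'] els_in_M by auto
  then show "x \<in> els X \<and> y = app f x"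
    using app_eqI[OF fun_func[OF assms(1-3)] assms(4,5) *] by simp
qed (use fun_app[OF assms(1-3)] in auto)

lemma fun_ext:
  assumes "f \<in> M" "g \<in> M" "X \<in> M" "is_fun_on M E f X" "is_fun_on M E g X"
    "\<And>x. x \<in> els X \<Longrightarrow> app f x = app g x"
  shows "f = g"
proof (rule els_inject[OF assms(1,2)])
  have "els f \<subseteq> els g" if A: "f \<in> M" "g \<in> M" "is_fun_on M E f X" "is_fun_on M E g X"
    "\<And>x. x \<in> els X \<Longrightarrow> app f x = app g x" for f g
  proof
    fix p assume p: "p \<in> els f"
    then obtain x y where xy: "p = opr x y" "x \<in> els X" "y \<in> M"
      using A(3) is_fun_on_iff[OF A(1) assms(3)] by blast
    then have "E (opr x y) f" using p by (auto simp: els_def)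
    then have "E (opr x y) g"
      using E_fun_iff[OF A(1) assms(3) A(3)] E_fun_iff[OF A(2) assms(3) A(4)]
        A(5)[OF xy(2)] xy els_in_M by auto
    then show "p \<in> els g" using xy p by (auto simp: els_def)
  qed
  from this[of f g] this[of g f] show "els f = els g" using assms by auto
qed

lemma is_fun_on_lam:
  assumes "X \<in> M" "tdef1 M E F" shows "is_fun_on M E (lam X F) X"
  unfolding is_fun_on_iff[OF lam_in_M[OF assms] assms(1)]
proof (intro conjI ballI)
  show "els (lam X F) \<subseteq> {opr x y |x y. x \<in> els X \<and> y \<in> M}"
    using tdef1_in_M[OF assms(2)] els_in_M by (fastforce simp: els_lam[OF assms])
  fix x assume "x \<in> els X"
  then show "\<exists>!y. y \<in> M \<and> E (opr x y) (lam X F)"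
    using E_lam_iff[OF assms] tdef1_in_M[OF assms(2)] by (auto simp: els_def)
qed

lemma lam_cong:
  assumes "\<And>x. x \<in> els a \<Longrightarrow> F x = G x" shows "lam a F = lam a G"
proof -
  have "{p \<in> M. \<exists>x\<in>M. E x a \<and> p = opr x (F x)} = {p \<in> M. \<exists>x\<in>M. E x a \<and> p = opr x (G x)}"
    using assms by (auto simp: els_def)
  then show ?thesis by (simp add: lam_def)
qed

lemma pd_func [pdi]: assumes "tdef M E t" shows "pdef M E (\<lambda>e. func (t e))"
proof (rule pdef_pred1[OF _ assms])
  show "pdef1 M E func" unfolding func_def by (intro pdi)
qed

lemma pd_is_fun_on [pdi]:
  "tdef M E t \<Longrightarrow> tdef M E u \<Longrightarrow> pdef M E (\<lambda>e. is_fun_on M E (t e) (u e))"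
  using pdef_pred2[OF pdef_fdef[OF M_nonempty fdef_is_fun_on[of E 0 "Suc 0"]], of t u] .

lemma pd_is_ordinal [pdi]: "tdef M E t \<Longrightarrow> pdef M E (\<lambda>e. is_ordinal M E (t e))"
  using pdef_pred1[OF pdef_fdef[OF M_nonempty fdef_is_ordinal[of E 0]], of t] .

lemma td_if:
  assumes "pdef M E P" "tdef M E t" "tdef M E u"
  shows "tdef M E (\<lambda>e. if P e then t e else u e)"
  unfolding tdef_def
proof (intro conjI allI impI)
  show "(if P s then t s else u s) \<in> M" if "range s \<subseteq> M" for s
    using that assms(2,3) tdef_closed by auto
  have "pdef M E (\<lambda>e. P (\<lambda>n. e (Suc n)) \<and> e 0 = t (\<lambda>n. e (Suc n)) \<or>
      \<not> P (\<lambda>n. e (Suc n)) \<and> e 0 = u (\<lambda>n. e (Suc n)))"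
    using pdef_rename[OF assms(1), of Suc] tdef_rename[OF assms(2), of Suc]
      tdef_rename[OF assms(3), of Suc] by (intro pdi)
  then show "pdef M E (\<lambda>e. e 0 = (if P (\<lambda>n. e (Suc n)) then t (\<lambda>n. e (Suc n))
      else u (\<lambda>n. e (Suc n))))"
    by (rule pdef_cong) auto
qed

lemma els_memI: "x \<in> els a \<Longrightarrow> E x a" by (simp add: els_def)

lemma E_opr_parts:
  assumes "a \<in> M" "b \<in> M" "f \<in> M" "E (opr a b) f"
  shows "a \<in> els (un (un f))" "b \<in> els (un (un f))"
proof -
  have "opr a b \<in> els f" using assms opr_in_M by (simp add: els_iff)
  moreover have "upr a b \<in> els (opr a b)" using assms(1,2) upr_in_M by (simp add: opr_def els_upr)
  ultimately have "upr a b \<in> els (un f)" using els_un[OF assms(3)] by blast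
  moreover have "a \<in> els (upr a b)" "b \<in> els (upr a b)" using assms(1,2) by (simp_all add: els_upr)
  ultimately show "a \<in> els (un (un f))" "b \<in> els (un (un f))"
    using els_un[OF un_in_M[OF assms(3)]] by blast+
qed

section \<open>Recursion\<close>

text \<open>
  The relation \<open>R\<close> is well-founded on sets only, but since every element lies in a downward
  closed set this is enough for induction on definable classes.
\<close>

definition locally_wf :: "('v \<Rightarrow> bool) \<Rightarrow> ('v \<Rightarrow> 'v \<Rightarrow> bool) \<Rightarrow> bool" where
  "locally_wf A R \<longleftrightarrow> pdef1 M E A \<and> pdef2 M E R \<and>
     (\<forall>x\<in>M. A x \<longrightarrow> (\<exists>d\<in>M. E x d \<and> (\<forall>y\<in>els d. A y \<and> (\<forall>z\<in>M. A z \<and> R z y \<longrightarrow> E z d)))) \<and>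
     (\<forall>z\<in>M. els z \<noteq> {} \<and> (\<forall>y\<in>els z. A y) \<longrightarrow> (\<exists>m\<in>els z. \<forall>y\<in>els z. \<not> R y m))"

text \<open>A counterexample lies in a downward closed set d. Separation collects the
  counterexamples in d into a set, and a minimal one contradicts the step because all its
  predecessors stay in d.\<close>

lemma class_induct:
  assumes "locally_wf A R" "pdef1 M E P"
    and step: "\<And>x. x \<in> M \<Longrightarrow> A x \<Longrightarrow> (\<And>z. z \<in> M \<Longrightarrow> A z \<Longrightarrow> R z x \<Longrightarrow> P z) \<Longrightarrow> P x"
    and x: "x \<in> M" "A x"
  shows "P x"
proof (rule ccontr)
  assume "\<not> P x"
  obtain d where d: "d \<in> M" "E x d"
    "\<And>y. y \<in> els d \<Longrightarrow> A y" "\<And>y z. y \<in> els d \<Longrightarrow> z \<in> M \<Longrightarrow> A z \<Longrightarrow> R z y \<Longrightarrow> E z d"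
    using assms(1) x unfolding locally_wf_def by meson
  have s: "small {y \<in> els d. \<not> P y}"
    by (rule separation_els[OF d(1) pdef_not[OF assms(2)]])
  define b where "b = mk {y \<in> els d. \<not> P y}"
  have b: "b \<in> M" "els b = {y \<in> els d. \<not> P y}" unfolding b_def using mk_props[OF s] by auto
  have "x \<in> els b" unfolding b(2) using d(2) x \<open>\<not> P x\<close> by (simp add: els_iff)
  then have "els b \<noteq> {}" by blast
  moreover have "\<forall>y\<in>els b. A y" unfolding b(2) using d(3) by blast
  ultimately obtain m where m: "m \<in> els b" "\<And>y. y \<in> els b \<Longrightarrow> \<not> R y m"
    using assms(1) b(1) unfolding locally_wf_def by meson
  have md: "m \<in> els d" "\<not> P m" using m(1) b(2) by auto
  have "P m"
  proof (rule step)
    show "m \<in> M" "A m" using els_in_M[OF md(1)] d(3)[OF md(1)] by auto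
    fix z assume z: "z \<in> M" "A z" "R z m"
    then have "z \<in> els d" using d(4)[OF md(1)] by (simp add: els_iff)
    then show "P z" using m(2)[of z] z(3) unfolding b(2) by blast
  qed
  with md show False by simp
qed

lemma small_pred:
  assumes "locally_wf A R" "x \<in> M" "A x"
  shows "small {z \<in> M. A z \<and> R z x}"
proof -
  obtain d where d: "d \<in> M" "E x d"
    "\<And>y z. y \<in> els d \<Longrightarrow> z \<in> M \<Longrightarrow> A z \<Longrightarrow> R z y \<Longrightarrow> E z d"
    using assms unfolding locally_wf_def by meson
  have A: "pdef1 M E A" and R: "pdef2 M E R" using assms(1) by (auto simp: locally_wf_def)
  show ?thesis
  proof (rule small_subset[OF small_els[OF d(1)]])
    show "pdef1 M E (\<lambda>z. A z \<and> R z x)"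
      by (intro pdi A pdef_pred2[OF R] assms)
    show "z \<in> els d" if "z \<in> M" "A z \<and> R z x" for z
      using that d(3)[of x z] d(2) assms(2) by (simp add: els_iff)
  qed
qed

text \<open>F is the union of all set-sized approximations, and any two of these agree by induction
  along R. A minimal point x without an approximation is impossible: F itself, cut down to a set
  containing the predecessors of x and given one further value at x, would be one.\<close>

theorem recursion:
  assumes wf: "locally_wf A R" and G: "tdef2 M E G"
  obtains F where "tdef1 M E F"
    "\<And>x. x \<in> M \<Longrightarrow> A x \<Longrightarrow> F x = G x (lam (mk {z \<in> M. A z \<and> R z x}) F)"
proof -
  have A: "pdef1 M E A" and R: "pdef2 M E R" using wf by (auto simp: locally_wf_def)
  note [pdi] = pdef_pred1[OF A] pdef_pred2[OF R] tdef_comp2[OF G]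
  define pr where "pr x = mk {z \<in> M. A z \<and> R z x}" for x
  have pr: "pr x \<in> M" "els (pr x) = {z \<in> M. A z \<and> R z x}" if "x \<in> M" "A x" for x
    unfolding pr_def using mk_props[OF small_pred[OF wf that]] by auto
  define cl where "cl d \<longleftrightarrow> (\<forall>y\<in>M. E y d \<longrightarrow> A y \<and> (\<forall>z\<in>M. A z \<and> R z y \<longrightarrow> E z d))" for d
  \<comment> \<open>An approximation is a set function a that obeys the recursion on a downward
    closed set d. The restriction of a to the predecessors of y appears as an element q described by
    a formula, which lets the definability rules see through it.\<close>
  define ap where "ap a d \<longleftrightarrow> cl d \<and> (\<forall>y\<in>M. E y d \<longrightarrow> (\<exists>q\<in>M. (\<forall>p\<in>M. E p q \<longleftrightarrow>
      (\<exists>z\<in>M. (A z \<and> R z y) \<and> p = opr z (app a z))) \<and> app a y = G y q))" for a d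
  define good where "good x v \<longleftrightarrow> (\<exists>a\<in>M. \<exists>d\<in>M. ap a d \<and> E x d \<and> v = app a x)" for x v
  define F where "F x = (if \<exists>v\<in>M. good x v then THE v. v \<in> M \<and> good x v else emp)" for x
  have good_def2: "pdef2 M E good"
    unfolding good_def ap_def cl_def by (intro pdi)
  have ap_cl: "cl d" if "ap a d" for a d using that unfolding ap_def by (rule conjunct1)
  have cl_A: "A y" if "cl d" "y \<in> M" "E y d" for d y
    using that(1)[unfolded cl_def, THEN bspec, OF that(2), THEN mp, OF that(3)] by (rule conjunct1)
  have cl_down: "E z d" if "cl d" "y \<in> M" "E y d" "z \<in> M" "A z" "R z y" for d y z
    using that(1)[unfolded cl_def, THEN bspec, OF that(2), THEN mp, OF that(3), THEN conjunct2,
        THEN bspec, OF that(4)] that(5,6) by simp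
  have goodI: "good x (app a x)" if "ap a d" "E x d" "a \<in> M" "d \<in> M" for a d x
    using that unfolding good_def by (intro bexI[of _ a] bexI[of _ d]) simp_all
  have goodE: "\<exists>a d. ap a d \<and> E x d \<and> a \<in> M \<and> d \<in> M \<and> v = app a x" if "good x v" for x v
    using that unfolding good_def by (elim bexE) (intro exI conjI; simp)
  have tapp: "tdef1 M E (app a)" if "a \<in> M" for a by (intro pdi that)
  have ap_eq: "app a y = G y (lam (pr y) (app a))" if "ap a d" "E y d" "a \<in> M" "y \<in> M" for a d y
  proof -
    have "A y" using cl_A[OF ap_cl[OF that(1)] that(4,2)] .
    from that(1)[unfolded ap_def, THEN conjunct2, THEN bspec, OF that(4), THEN mp, OF that(2)]
    obtain q where q: "q \<in> M" "\<forall>p\<in>M. E p q \<longleftrightarrow>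
        (\<exists>z\<in>M. (A z \<and> R z y) \<and> p = opr z (app a z))" "app a y = G y q"
      by (elim bexE conjE)
    have "els q = els (lam (pr y) (app a))"
      unfolding els_lam[OF pr(1)[OF that(4) \<open>A y\<close>] tapp[OF that(3)]] pr(2)[OF that(4) \<open>A y\<close>]
    proof (rule set_eqI)
      fix p
      have "p \<in> els q \<longleftrightarrow> p \<in> M \<and> (\<exists>z\<in>M. (A z \<and> R z y) \<and> p = opr z (app a z))"
        using q(2)[THEN bspec, of p] by (simp add: els_iff cong: conj_cong)
      also have "\<dots> \<longleftrightarrow> p \<in> {opr z (app a z) |z. z \<in> {z \<in> M. A z \<and> R z y}}"
        using opr_in_M app_in_M by blast
      finally show "p \<in> els q \<longleftrightarrow> p \<in> {opr z (app a z) |z. z \<in> {z \<in> M. A z \<and> R z y}}" .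
    qed
    then have "q = lam (pr y) (app a)"
      using els_inject q(1) lam_in_M[OF pr(1)[OF that(4) \<open>A y\<close>] tapp[OF that(3)]] by blast
    with q(3) show ?thesis by simp
  qed
  have apI: "ap a d" if "cl d" "a \<in> M" "d \<in> M"
    "\<And>y. y \<in> M \<Longrightarrow> E y d \<Longrightarrow> app a y = G y (lam (pr y) (app a))" for a d
    unfolding ap_def
  proof (intro conjI that ballI impI)
    fix y assume y: "y \<in> M" "E y d"
    then have "A y" using cl_A[OF that(1)] by simp
    note p = pr[OF y(1) \<open>A y\<close>]
    have "E p (lam (pr y) (app a)) \<longleftrightarrow> (\<exists>z\<in>M. (A z \<and> R z y) \<and> p = opr z (app a z))"
      if "p \<in> M" for p
    proof -
      have "E p (lam (pr y) (app a)) \<longleftrightarrow> p \<in> els (lam (pr y) (app a))"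
        using that by (simp add: els_iff)
      then show ?thesis unfolding els_lam[OF p(1) tapp[OF \<open>a \<in> M\<close>]] p(2) by blast
    qed
    then show "\<exists>q\<in>M. (\<forall>p\<in>M. E p q \<longleftrightarrow> (\<exists>z\<in>M. (A z \<and> R z y) \<and> p = opr z (app a z))) \<and>
        app a y = G y q"
      using that(4)[OF y] by (intro bexI[OF _ lam_in_M[OF p(1) tapp[OF \<open>a \<in> M\<close>]]] conjI ballI)
  qed
  have uniq: "app a y = app a' y"
    if "ap a d" "ap a' d'" "E y d" "E y d'" "a \<in> M" "a' \<in> M" "d \<in> M" "d' \<in> M" "y \<in> M" for a a' d d' y
  proof -
    have "E y d \<and> E y d' \<longrightarrow> app a y = app a' y"
    proof (rule class_induct[OF wf, where P = "\<lambda>y. E y d \<and> E y d' \<longrightarrow> app a y = app a' y"])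
      show "pdef1 M E (\<lambda>y. E y d \<and> E y d' \<longrightarrow> app a y = app a' y)" by (intro pdi that)
      show "A y" using cl_A[OF ap_cl[OF that(1)] that(9,3)] .
      fix x assume x: "x \<in> M" "A x"
        and IH: "\<And>z. z \<in> M \<Longrightarrow> A z \<Longrightarrow> R z x \<Longrightarrow> E z d \<and> E z d' \<longrightarrow> app a z = app a' z"
      show "E x d \<and> E x d' \<longrightarrow> app a x = app a' x"
      proof
        assume *: "E x d \<and> E x d'"
        have "lam (pr x) (app a) = lam (pr x) (app a')"
        proof (rule lam_cong)
          fix z assume "z \<in> els (pr x)"
          then have z: "z \<in> M" "A z" "R z x" unfolding pr(2)[OF x] by simp_all
          then have "E z d" "E z d'"
            using cl_down[OF ap_cl[OF that(1)] x(1)] cl_down[OF ap_cl[OF that(2)] x(1)] * by simp_all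
          then show "app a z = app a' z" using IH[OF z] by simp
        qed
        then show "app a x = app a' x"
          using ap_eq[OF that(1) _ that(5) x(1)] ap_eq[OF that(2) _ that(6) x(1)] * by simp
      qed
    qed (fact that)
    with that show ?thesis by simp
  qed
  have F_eq: "F x = app a x" if "ap a d" "E x d" "a \<in> M" "d \<in> M" "x \<in> M" for a d x
  proof -
    have "good x (app a x)" using goodI[OF that(1-4)] .
    moreover have "v = app a x" if "good x v" for v
      using goodE[OF that] uniq[OF _ \<open>ap a d\<close> _ \<open>E x d\<close> _ \<open>a \<in> M\<close> _ \<open>d \<in> M\<close> \<open>x \<in> M\<close>] by metis
    ultimately have g: "good x v \<longleftrightarrow> v = app a x" for v by blast
    then have "\<exists>v\<in>M. good x v" using app_in_M by blast
    moreover have "(THE v. v \<in> M \<and> good x v) = app a x"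
      unfolding g by (rule the_equality) (simp_all add: app_in_M)
    ultimately show ?thesis unfolding F_def by simp
  qed
  have F_tdef: "tdef1 M E F"
    unfolding tdef_def
  proof (intro conjI allI impI)
    fix s :: "nat \<Rightarrow> 'v" assume s: "range s \<subseteq> M"
    show "F (s 0) \<in> M"
    proof (cases "\<exists>v\<in>M. good (s 0) v")
      case True
      then obtain a d where "ap a d" "E (s 0) d" "a \<in> M" "d \<in> M" using goodE by blast
      moreover have "s 0 \<in> M" using s by auto
      ultimately show ?thesis using F_eq app_in_M by simp
    qed (auto simp: F_def emp_in_M)
  next
    have "pdef M E (\<lambda>e. good (e (Suc 0)) (e 0) \<or> \<not> (\<exists>v\<in>M. good (e (Suc 0)) v) \<and> e 0 = emp)"
      by (intro pdi pdef_pred2[OF good_def2] emp_in_M)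
    then show "pdef M E (\<lambda>e. e 0 = F (e (Suc 0)))"
    proof (rule pdef_cong)
      fix s :: "nat \<Rightarrow> 'v" assume "range s \<subseteq> M"
      then have s: "s 0 \<in> M" "s (Suc 0) \<in> M" by auto
      show "(good (s (Suc 0)) (s 0) \<or> \<not> (\<exists>v\<in>M. good (s (Suc 0)) v) \<and> s 0 = emp)
          = (s 0 = F (s (Suc 0)))"
      proof (cases "\<exists>v\<in>M. good (s (Suc 0)) v")
        case True
        then obtain a d where a: "ap a d" "E (s (Suc 0)) d" "a \<in> M" "d \<in> M"
          using goodE by blast
        have "good (s (Suc 0)) v \<longleftrightarrow> v = F (s (Suc 0))" for v
        proof
          assume "good (s (Suc 0)) v"
          then show "v = F (s (Suc 0))" using goodE F_eq s(2) by metis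
        next
          assume "v = F (s (Suc 0))"
          with F_eq[OF a s(2)] goodI[OF a] show "good (s (Suc 0)) v" by simp
        qed
        with True show ?thesis by simp
      qed (use s in \<open>auto simp: F_def\<close>)
    qed
  qed
  have G_in: "G x y \<in> M" if "x \<in> M" "y \<in> M" for x y using tdef2_in_M[OF G that] .
  have ex: "\<exists>v\<in>M. good x v" if "x \<in> M" "A x" for x
  proof (rule class_induct[OF wf _ _ that, where P = "\<lambda>x. \<exists>v\<in>M. good x v"])
    show "pdef1 M E (\<lambda>x. \<exists>v\<in>M. good x v)" by (intro pdi pdef_pred2[OF good_def2])
    fix x assume x: "x \<in> M" "A x"
      and IH: "\<And>z. z \<in> M \<Longrightarrow> A z \<Longrightarrow> R z x \<Longrightarrow> \<exists>v\<in>M. good z v"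
    show "\<exists>v\<in>M. good x v"
    proof (rule ccontr)
      assume nx: "\<not> (\<exists>v\<in>M. good x v)"
      obtain d where d: "d \<in> M" "E x d"
        "\<And>y. y \<in> els d \<Longrightarrow> A y" "\<And>y z. y \<in> els d \<Longrightarrow> z \<in> M \<Longrightarrow> A z \<Longrightarrow> R z y \<Longrightarrow> E z d"
        using wf x unfolding locally_wf_def by meson
      \<comment> \<open>The part of d where approximations exist. It is downward closed and, by the
        induction hypothesis, contains all predecessors of x, so \<open>insert x D\<close> can serve
        as the domain of an approximation.\<close>
      define D where "D = {y \<in> els d. \<exists>v\<in>M. good y v}"
      have sD: "small D" unfolding D_def
        by (rule separation_els[OF d(1)]) (intro pdi pdef_pred2[OF good_def2])
      have xd: "x \<in> els d" using x d by (simp add: els_iff)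
      have D_cl: "z \<in> D" if "y \<in> D" "z \<in> M" "A z" "R z y" for y z
      proof -
        have yd: "y \<in> els d" "\<exists>v\<in>M. good y v" using that(1) unfolding D_def by simp_all
        obtain a d' where a: "ap a d'" "E y d'" "a \<in> M" "d' \<in> M"
          using yd(2) goodE by blast
        have "E z d'" using cl_down[OF ap_cl[OF a(1)] els_in_M[OF yd(1)] a(2) that(2-4)] .
        then have "good z (app a z)" using goodI[OF a(1) _ a(3,4)] by simp
        moreover have "z \<in> els d" using d(4)[OF yd(1) that(2-4)] that(2) by (simp add: els_iff)
        ultimately show ?thesis unfolding D_def using app_in_M by blast
      qed
      have x_cl: "z \<in> D" if "z \<in> M" "A z" "R z x" for z
        unfolding D_def using that d(4)[OF xd that] IH[OF that] by (simp add: els_iff)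
      define D' where "D' = mk (insert x D)"
      have D': "D' \<in> M" "els D' = insert x D"
        unfolding D'_def using mk_props[OF small_insert[OF x(1) sD]] by auto
      define w where "w = G x (lam (pr x) F)"
      have w: "w \<in> M" unfolding w_def by (intro G_in x lam_in_M pr F_tdef)
      define F' where "F' y = (if y = x then w else F y)" for y
      have F': "tdef1 M E F'" unfolding F'_def
        by (intro td_if pdi tdef_comp1[OF F_tdef] x w)
      define a where "a = lam D' F'"
      have a: "a \<in> M" unfolding a_def by (intro lam_in_M D' F')
      have a_app: "app a y = F' y" if "y \<in> insert x D" for y
        unfolding a_def by (rule app_lam[OF D'(1) F']) (use that in \<open>unfold D'(2)\<close>)
      have "x \<notin> D" using nx by (simp add: D_def)
      then have a_D: "app a y = F y" if "y \<in> D" for y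
        using a_app[of y] that by (auto simp: F'_def)
      have "ap a D'"
      proof (rule apI[OF _ a D'(1)])
        show "cl D'" unfolding cl_def
        proof (intro ballI impI conjI)
          fix y assume y: "y \<in> M" "E y D'"
          then have "y \<in> els D'" by (simp add: els_iff)
          then have yD: "y \<in> insert x D" unfolding D'(2) .
          then show "A y" using x d(3) unfolding D_def by blast
          fix z assume "z \<in> M" "A z \<and> R z y"
          then have "z \<in> els D'" using yD D_cl x_cl unfolding D'(2) by blast
          then show "E z D'" by (rule els_memI)
        qed
        fix y assume y: "y \<in> M" "E y D'"
        then have "y \<in> els D'" by (simp add: els_iff)
        then consider "y = x" | "y \<in> D" unfolding D'(2) by blast
        then show "app a y = G y (lam (pr y) (app a))"
        proof cases
          case 1
          have "lam (pr x) (app a) = lam (pr x) F"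
            by (rule lam_cong) (use x_cl a_D in \<open>unfold pr(2)[OF x], blast\<close>)
          then show ?thesis using 1 a_app[of x] by (simp add: F'_def w_def)
        next
          case 2
          then have "\<exists>v\<in>M. good y v" unfolding D_def by simp
          then obtain a' d' where a': "ap a' d'" "E y d'" "a' \<in> M" "d' \<in> M"
            using goodE by blast
          have "A y" using 2 d(3) unfolding D_def by blast
          have "lam (pr y) (app a) = lam (pr y) (app a')"
          proof (rule lam_cong)
            fix z assume "z \<in> els (pr y)"
            then have z: "z \<in> M" "A z" "R z y" unfolding pr(2)[OF y(1) \<open>A y\<close>] by simp_all
            then have "E z d'" using cl_down[OF ap_cl[OF a'(1)] y(1) a'(2)] by simp
            then show "app a z = app a' z"
              using a_D[OF D_cl[OF 2 z]] F_eq[OF a'(1) _ a'(3,4) z(1)] by simp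
          qed
          then show ?thesis
            using a_D[OF 2] F_eq[OF a' y(1)] ap_eq[OF a'(1,2,3) y(1)] by simp
        qed
      qed
      moreover have "E x D'" using D' by (intro els_memI) simp
      ultimately have "good x (app a x)" using goodI[OF _ _ a D'(1)] by simp
      with nx app_in_M show False by blast
    qed
  qed
  have "F x = G x (lam (pr x) F)" if x: "x \<in> M" "A x" for x
  proof -
    obtain a d where a: "ap a d" "E x d" "a \<in> M" "d \<in> M"
      using ex[OF x] goodE by blast
    have "lam (pr x) (app a) = lam (pr x) F"
    proof (rule lam_cong)
      fix z assume "z \<in> els (pr x)"
      then have z: "z \<in> M" "A z" "R z x" unfolding pr(2)[OF x] by simp_all
      then have "E z d" using cl_down[OF ap_cl[OF a(1)] x(1) a(2)] by simp
      then show "app a z = F z" using F_eq[OF a(1) _ a(3,4) z(1)] by simp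
    qed
    then show ?thesis using F_eq[OF a x(1)] ap_eq[OF a(1-3) x(1)] by simp
  qed
  with F_tdef show thesis using that unfolding pr_def by blast
qed

subsection \<open>Closure and induction on membership\<close>

lemma inductive_exists:
  obtains w where "w \<in> M" "emp \<in> els w" "\<And>x. x \<in> els w \<Longrightarrow> suc x \<in> els w"
proof -
  have "\<exists>w\<in>M. is_inductive M E w" using zfc unfolding ZFC_def by (elim conjE)
  then obtain w where w: "w \<in> M" "is_inductive M E w" by blast
  obtain e where e: "e \<in> M" "is_empty M E e" "E e w"
    using w(2) unfolding is_inductive_def by blast
  have "els e = els emp" using e(2) unfolding els_emp by (auto simp: is_empty_def els_def)
  then have "e = emp" using els_inject e(1) emp_in_M by blast
  show thesis
  proof (rule that[OF w(1)])
    show "emp \<in> els w" using e \<open>e = emp\<close> by (simp add: els_iff)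
    fix x assume x: "x \<in> els w"
    then obtain y where "y \<in> M" "is_succ M E x y" "E y w"
      using w(2) unfolding is_inductive_def els_iff by blast
    then show "suc x \<in> els w" using is_succ_iff[OF els_in_M[OF x]] by (simp add: els_iff)
  qed
qed

lemma locally_wf_mem_set:
  assumes "d \<in> M" shows "locally_wf (\<lambda>x. E x d) E"
  unfolding locally_wf_def
proof (intro conjI ballI impI)
  show "pdef1 M E (\<lambda>x. E x d)" "pdef2 M E E" by (intro pdi assms)+
  fix x assume "x \<in> M" "E x d"
  then show "\<exists>da\<in>M. E x da \<and> (\<forall>y\<in>els da. E y d \<and> (\<forall>z\<in>M. E z d \<and> E z y \<longrightarrow> E z da))"
    by (intro bexI[OF _ assms]) (simp add: els_iff)
next
  fix z assume "z \<in> M" "els z \<noteq> {} \<and> (\<forall>y\<in>els z. E y d)"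
  then obtain m where "m \<in> els z" "\<And>y. y \<in> els m \<Longrightarrow> y \<notin> els z" using foundation by metis
  then show "\<exists>m\<in>els z. \<forall>y\<in>els z. \<not> E y m" by (intro bexI[of _ m]) (auto simp: els_iff)
qed

text \<open>In a recursion f holds the earlier values, so \<open>gUn H f\<close> is the union of
  \<open>H (F m)\<close> over all predecessors m. This replaces a split into zero, successor and
  limit stages.\<close>

definition gUn :: "('v \<Rightarrow> 'v) \<Rightarrow> 'v \<Rightarrow> 'v" where
  "gUn H f = mk {v \<in> M. \<exists>m\<in>M. \<exists>t\<in>M. E (opr m t) f \<and> E v (H t)}"

lemma gUn_props:
  assumes H: "tdef1 M E H" and f: "f \<in> M"
  shows small_gUn: "small {v \<in> M. \<exists>m\<in>M. \<exists>t\<in>M. E (opr m t) f \<and> E v (H t)}"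
    and gUn_in_M: "gUn H f \<in> M"
    and els_gUn: "els (gUn H f) = {v \<in> M. \<exists>m\<in>M. \<exists>t\<in>M. E (opr m t) f \<and> E v (H t)}"
proof -
  note [pdi] = tdef_comp1[OF H]
  have "small (\<Union>t\<in>els (un (un f)). els (H t))"
    by (rule small_UN[OF small_els[OF un_in_M[OF un_in_M[OF f]]] H])
  then show s: "small {v \<in> M. \<exists>m\<in>M. \<exists>t\<in>M. E (opr m t) f \<and> E v (H t)}"
  proof (rule small_subset)
    show "pdef1 M E (\<lambda>v. \<exists>m\<in>M. \<exists>t\<in>M. E (opr m t) f \<and> E v (H t))" by (intro pdi f)
    fix x assume x: "x \<in> M" "\<exists>m\<in>M. \<exists>t\<in>M. E (opr m t) f \<and> E x (H t)"
    then obtain m t where "m \<in> M" "t \<in> M" "E (opr m t) f" "E x (H t)" by blast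
    then show "x \<in> (\<Union>t\<in>els (un (un f)). els (H t))"
      using E_opr_parts(2)[OF _ _ f] x(1) by (auto simp: els_iff[of x])
  qed
  show "gUn H f \<in> M" "els (gUn H f) = {v \<in> M. \<exists>m\<in>M. \<exists>t\<in>M. E (opr m t) f \<and> E v (H t)}"
    unfolding gUn_def by (rule mk_props[OF s])+
qed

lemma td_gUn: assumes "tdef1 M E H" shows "tdef1 M E (gUn H)"
  unfolding gUn_def
proof (rule td_mk[where P = "\<lambda>e v. \<exists>m\<in>M. \<exists>t\<in>M. E (opr m t) (e 0) \<and> E v (H t)"])
  note [pdi] = tdef_comp1[OF assms]
  show "pdef M E (\<lambda>e. \<exists>m\<in>M. \<exists>t\<in>M. E (opr m t) (e (Suc 0)) \<and> E (e 0) (H t))" by (intro pdi)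
  show "small {v \<in> M. \<exists>m\<in>M. \<exists>t\<in>M. E (opr m t) (e 0) \<and> E v (H t)}" if "range e \<subseteq> M" for e
    using small_gUn[OF assms, of "e 0"] that by auto
qed

lemma els_gUn_lam:
  assumes "tdef1 M E H" "a \<in> M" "tdef1 M E F"
  shows "els (gUn H (lam a F)) = (\<Union>m\<in>els a. els (H (F m)))"
proof -
  have "(\<exists>m\<in>M. \<exists>t\<in>M. E (opr m t) (lam a F) \<and> E v (H t)) \<longleftrightarrow> (\<exists>m\<in>els a. E v (H (F m)))" for v
    using E_lam_iff[OF assms(2,3)] tdef1_in_M[OF assms(3)] by (auto simp: els_iff)
  then show ?thesis
    unfolding els_gUn[OF assms(1) lam_in_M[OF assms(2,3)]] by (auto simp: els_iff)
qed

text \<open>The set t is the union of the F n, where F n consists of x and of the sets H u for u in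
  some F m with m in n. Any inductive w can index the stages, as only emp \<in> w and n \<in> suc n
  \<in> w matter.\<close>

lemma closure:
  assumes x: "x \<in> M" and H: "tdef1 M E H"
  obtains t where "t \<in> M" "els x \<subseteq> els t" "\<And>u. u \<in> els t \<Longrightarrow> els (H u) \<subseteq> els t"
proof -
  obtain w where w: "w \<in> M" "emp \<in> els w" "\<And>x. x \<in> els w \<Longrightarrow> suc x \<in> els w"
    using inductive_exists by metis
  define K where "K t = mk {v \<in> M. \<exists>u\<in>M. E u t \<and> E v (H u)}" for t
  have sK: "small {v \<in> M. \<exists>u\<in>M. E u t \<and> E v (H u)}" if "t \<in> M" for t
  proof -
    have "{v \<in> M. \<exists>u\<in>M. E u t \<and> E v (H u)} = (\<Union>u\<in>els t. els (H u))" by (auto simp: els_iff)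
    then show ?thesis using small_UN[OF small_els[OF that] H] by simp
  qed
  have K: "tdef1 M E K"
    unfolding K_def
  proof (rule td_mk[where P = "\<lambda>e v. \<exists>u\<in>M. E u (e 0) \<and> E v (H u)"])
    show "pdef M E (\<lambda>e. \<exists>u\<in>M. E u (e (Suc 0)) \<and> E (e 0) (H u))"
      by (intro pdi tdef_comp1[OF H])
    show "small {v \<in> M. \<exists>u\<in>M. E u (e 0) \<and> E v (H u)}" if "range e \<subseteq> M" for e
      using sK[of "e 0"] that by auto
  qed
  have elsK: "els (K t) = (\<Union>u\<in>els t. els (H u))" if "t \<in> M" for t
    unfolding K_def els_mk[OF sK[OF that]] by (auto simp: els_iff)
  define G where "G n f = un (upr x (gUn K f))" for n f :: 'v
  have "tdef2 M E G" unfolding G_def by (intro pdi x tdef_comp1[OF td_gUn[OF K]])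
  from recursion[OF locally_wf_mem_set[OF w(1)] this]
  obtain F where F: "tdef1 M E F"
    "\<And>n. n \<in> M \<Longrightarrow> E n w \<Longrightarrow> F n = G n (lam (mk {z \<in> M. E z w \<and> E z n}) F)" by blast
  have elsF: "els (F n) = els x \<union> (\<Union>m\<in>{z \<in> M. E z w \<and> E z n}. \<Union>u\<in>els (F m). els (H u))"
    if n: "n \<in> els w" for n
  proof -
    have n': "n \<in> M" "E n w" using n by (auto simp: els_iff)
    have s: "small {z \<in> M. E z w \<and> E z n}"
      by (rule small_pred[OF locally_wf_mem_set[OF w(1)] n'])
    have g: "gUn K (lam (mk {z \<in> M. E z w \<and> E z n}) F) \<in> M"
      by (intro gUn_in_M[OF K] lam_in_M mk_in_M s F(1))
    have "els (gUn K (lam (mk {z \<in> M. E z w \<and> E z n}) F))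
        = (\<Union>m\<in>{z \<in> M. E z w \<and> E z n}. els (K (F m)))"
      using els_gUn_lam[OF K mk_in_M[OF s] F(1)] unfolding els_mk[OF s] .
    also have "\<dots> = (\<Union>m\<in>{z \<in> M. E z w \<and> E z n}. \<Union>u\<in>els (F m). els (H u))"
      using elsK tdef1_in_M[OF F(1)] by simp
    finally show ?thesis
      unfolding F(2)[OF n'] G_def els_un[OF upr_in_M[OF x g]] els_upr[OF x g] by simp
  qed
  have st: "small (\<Union>n\<in>els w. els (F n))" by (rule small_UN[OF small_els[OF w(1)] F(1)])
  show thesis
  proof (rule that)
    show "mk (\<Union>n\<in>els w. els (F n)) \<in> M" by (rule mk_in_M[OF st])
    show "els x \<subseteq> els (mk (\<Union>n\<in>els w. els (F n)))"
      unfolding els_mk[OF st] using elsF[OF w(2)] w(2) by blast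
    fix u assume "u \<in> els (mk (\<Union>n\<in>els w. els (F n)))"
    then obtain n where n: "n \<in> els w" "u \<in> els (F n)" unfolding els_mk[OF st] by blast
    have "n \<in> {z \<in> M. E z w \<and> E z (suc n)}"
      using n(1) els_suc[OF els_in_M[OF n(1)]] by (auto simp: els_iff)
    then have "els (H u) \<subseteq> els (F (suc n))" using elsF[OF w(3)[OF n(1)]] n(2) by blast
    then show "els (H u) \<subseteq> els (mk (\<Union>n\<in>els w. els (F n)))"
      unfolding els_mk[OF st] using w(3)[OF n(1)] by blast
  qed
qed

definition tran :: "'v \<Rightarrow> bool" where "tran a \<longleftrightarrow> (\<forall>x\<in>els a. els x \<subseteq> els a)"

lemma transD: "tran a \<Longrightarrow> x \<in> els a \<Longrightarrow> y \<in> els x \<Longrightarrow> y \<in> els a"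
  unfolding tran_def by blast

lemma transitive_superset:
  assumes "x \<in> M"
  obtains t where "t \<in> M" "els x \<subseteq> els t" "tran t"
  using closure[OF assms td_var[of E 0]] unfolding tran_def by metis

lemma transitive_member:
  assumes "x \<in> M"
  obtains t where "t \<in> M" "x \<in> els t" "tran t"
  using transitive_superset[OF upr_in_M[OF assms assms]] els_upr[OF assms assms] by auto

lemma locally_wf_mem:
  assumes "pdef1 M E A" shows "locally_wf A E"
  unfolding locally_wf_def
proof (intro conjI ballI impI)
  show "pdef1 M E A" "pdef2 M E E" by (intro pdi assms)+
  fix x assume x: "x \<in> M" "A x"
  obtain t where t: "t \<in> M" "x \<in> els t" "tran t" using transitive_member[OF x(1)] .
  have s: "small {y \<in> els t. A y}" by (rule separation_els[OF t(1) assms])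
  show "\<exists>d\<in>M. E x d \<and> (\<forall>y\<in>els d. A y \<and> (\<forall>z\<in>M. A z \<and> E z y \<longrightarrow> E z d))"
  proof (intro bexI conjI ballI impI)
    show "mk {y \<in> els t. A y} \<in> M" by (rule mk_in_M[OF s])
    have "x \<in> els (mk {y \<in> els t. A y})" unfolding els_mk[OF s] using t x by simp
    then show "E x (mk {y \<in> els t. A y})" by (rule els_memI)
    fix y assume "y \<in> els (mk {y \<in> els t. A y})"
    then have y: "y \<in> els t" "A y" unfolding els_mk[OF s] by auto
    show "A y" by fact
    fix z assume z: "z \<in> M" "A z \<and> E z y"
    then have "z \<in> els t" using transD[OF t(3) y(1)] by (simp add: els_iff)
    with z have "z \<in> els (mk {y \<in> els t. A y})" unfolding els_mk[OF s] by simp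
    then show "E z (mk {y \<in> els t. A y})" by (rule els_memI)
  qed
next
  fix z assume "z \<in> M" "els z \<noteq> {} \<and> (\<forall>y\<in>els z. A y)"
  then obtain m where "m \<in> els z" "\<And>y. y \<in> els m \<Longrightarrow> y \<notin> els z" using foundation by metis
  then show "\<exists>m\<in>els z. \<forall>y\<in>els z. \<not> E y m" by (intro bexI[of _ m]) (auto simp: els_iff)
qed

lemma mem_induct:
  assumes "pdef1 M E P" "\<And>x. x \<in> M \<Longrightarrow> (\<And>y. y \<in> els x \<Longrightarrow> P y) \<Longrightarrow> P x" "x \<in> M"
  shows "P x"
proof (rule class_induct[OF locally_wf_mem[OF pd_const[of True]] assms(1)])
  show "P x" if "x \<in> M" "\<And>z. z \<in> M \<Longrightarrow> True \<Longrightarrow> E z x \<Longrightarrow> P z" for x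
    by (rule assms(2)[OF that(1)]) (use that(2) in \<open>simp add: els_iff\<close>)
qed (use assms(3) in simp_all)

subsection \<open>Ordinals\<close>

abbreviation ord :: "'v \<Rightarrow> bool" where "ord a \<equiv> is_ordinal M E a"

lemma ord_iff: "ord a \<longleftrightarrow> tran a \<and> (\<forall>x\<in>els a. \<forall>y\<in>els a. E x y \<or> x = y \<or> E y x)"
proof -
  have "(\<forall>x\<in>M. E x a \<longrightarrow> is_subset M E x a) \<longleftrightarrow> tran a"
    unfolding tran_def is_subset_def Ball_def subset_iff els_iff imp_conjL by blast
  moreover have "(\<forall>x\<in>M. \<forall>y\<in>M. E x a \<and> E y a \<longrightarrow> E x y \<or> x = y \<or> E y x) \<longleftrightarrow>
      (\<forall>x\<in>els a. \<forall>y\<in>els a. E x y \<or> x = y \<or> E y x)"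
    unfolding Ball_def els_iff imp_conjL by blast
  ultimately show ?thesis unfolding is_ordinal_def by simp
qed

lemma ord_transD: "ord a \<Longrightarrow> x \<in> els a \<Longrightarrow> y \<in> els x \<Longrightarrow> y \<in> els a"
  unfolding ord_iff using transD by blast

lemma not_mem_cycle3:
  assumes "a \<in> M" "b \<in> M" "c \<in> M" "E a b" "E b c" shows "\<not> E c a"
proof
  assume "E c a"
  have s: "small {a, b, c}" using assms by (intro small_insert small_singleton)
  have "els (mk {a, b, c}) \<noteq> {}" unfolding els_mk[OF s] by simp
  then obtain x where x: "x \<in> els (mk {a, b, c})" "\<And>y. y \<in> els x \<Longrightarrow> y \<notin> els (mk {a, b, c})"
    using foundation[OF mk_in_M[OF s]] by metis
  then have "x = a \<or> x = b \<or> x = c" "c \<notin> els x" "a \<notin> els x" "b \<notin> els x"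
    unfolding els_mk[OF s] by auto
  then show False using \<open>E c a\<close> assms by (auto simp: els_iff)
qed

lemma ord_mem: assumes "ord a" "x \<in> els a" shows "ord x"
proof -
  have xM: "x \<in> M" using els_in_M[OF assms(2)] .
  have sub: "y \<in> els a" if "y \<in> els x" for y using ord_transD[OF assms that] .
  have lin: "E u v \<or> u = v \<or> E v u" if "u \<in> els a" "v \<in> els a" for u v
    using assms(1) that unfolding ord_iff by blast
  have "tran x"
    unfolding tran_def
  proof (intro ballI subsetI)
    fix y z assume y: "y \<in> els x" and z: "z \<in> els y"
    have "z \<in> els a" using ord_transD[OF assms(1) sub[OF y] z] .
    from lin[OF this assms(2)] show "z \<in> els x"
    proof (elim disjE)
      assume "z = x" then show ?thesis
        using not_mem_cycle[OF els_in_M[OF y] xM] y z by (auto simp: els_iff)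
    next
      assume "E x z" then show ?thesis
        using not_mem_cycle3[OF els_in_M[OF z] els_in_M[OF y] xM] y z by (auto simp: els_iff)
    qed (use z in \<open>simp add: els_iff\<close>)
  qed
  with lin sub show ?thesis unfolding ord_iff by blast
qed

text \<open>If the inclusion is proper, a membership-minimal element of b outside a has exactly the
  elements of a, and so it is a.\<close>

lemma ord_subset:
  assumes "a \<in> M" "b \<in> M" "ord a" "ord b" "els a \<subseteq> els b"
  shows "a = b \<or> a \<in> els b"
proof (cases "els b \<subseteq> els a")
  case True
  then show ?thesis using assms els_inject[of a b] by blast
next
  case False
  have "pdef1 M E (\<lambda>x. \<not> E x a)" by (intro pdi assms)
  from separation_els[OF assms(2) this] have s: "small {x \<in> els b. \<not> E x a}" .
  have "els (mk {x \<in> els b. \<not> E x a}) \<noteq> {}"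
    unfolding els_mk[OF s] using False by (auto simp: els_iff)
  then obtain m where m: "m \<in> els (mk {x \<in> els b. \<not> E x a})"
    "\<And>y. y \<in> els m \<Longrightarrow> y \<notin> els (mk {x \<in> els b. \<not> E x a})"
    using foundation[OF mk_in_M[OF s]] by metis
  then have mb: "m \<in> els b" "\<not> E m a" and min: "\<And>y. y \<in> els m \<Longrightarrow> y \<notin> {x \<in> els b. \<not> E x a}"
    unfolding els_mk[OF s] by auto
  have "els m = els a"
  proof
    show "els m \<subseteq> els a"
    proof
      fix y assume y: "y \<in> els m"
      then have "y \<in> els b" using ord_transD[OF assms(4) mb(1)] by blast
      then show "y \<in> els a" using min[OF y] els_in_M[OF y] by (simp add: els_iff)
    qed
    show "els a \<subseteq> els m"
    proof
      fix y assume y: "y \<in> els a"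
      then have "E y m \<or> y = m \<or> E m y"
        using assms(4,5) mb(1) unfolding ord_iff by blast
      then show "y \<in> els m"
      proof (elim disjE)
        assume "y = m" then show ?thesis using y mb(2) by (simp add: els_iff)
      next
        assume "E m y"
        then have "m \<in> els a" using ord_transD[OF assms(3) y] els_in_M[OF mb(1)]
          by (simp add: els_iff)
        then show ?thesis using mb(2) by (simp add: els_iff)
      qed (use els_in_M[OF y] in \<open>simp add: els_iff\<close>)
    qed
  qed
  then have "m = a" using els_inject els_in_M[OF mb(1)] assms(1) by blast
  then show ?thesis using mb(1) by simp
qed

text \<open>The intersection of a and b is an ordinal, hence by \<open>ord_subset\<close> equal to
  or a member of each of them. It cannot be a member of both, for then it would be a member of
  itself.\<close>

lemma ord_linear:
  assumes "a \<in> M" "b \<in> M" "ord a" "ord b"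
  shows "a \<in> els b \<or> a = b \<or> b \<in> els a"
proof -
  have "pdef1 M E (\<lambda>x. E x b)" by (intro pdi assms)
  from separation_els[OF assms(1) this] have s: "small {x \<in> els a. E x b}" .
  define c where "c = mk {x \<in> els a. E x b}"
  have c: "c \<in> M" "els c = els a \<inter> els b"
    unfolding c_def els_mk[OF s] using mk_in_M[OF s] els_iff by blast+
  have "ord c"
    unfolding ord_iff
  proof (intro conjI ballI)
    show "tran c" unfolding tran_def c(2) using ord_transD[OF assms(3)] ord_transD[OF assms(4)] by blast
    show "E x y \<or> x = y \<or> E y x" if "x \<in> els c" "y \<in> els c" for x y
      using that assms(3) unfolding c(2) ord_iff by blast
  qed
  have "c = a \<or> c \<in> els a" by (rule ord_subset) (use c assms \<open>ord c\<close> in auto)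
  moreover have "c = b \<or> c \<in> els b" by (rule ord_subset) (use c assms \<open>ord c\<close> in auto)
  moreover have "\<not> (c \<in> els a \<and> c \<in> els b)"
  proof
    assume "c \<in> els a \<and> c \<in> els b"
    then have "c \<in> els c" unfolding c(2) by simp
    then show False using not_mem_self[OF c(1)] by (simp add: els_iff)
  qed
  ultimately show ?thesis by blast
qed

lemma ordI:
  assumes "a \<in> M" "\<And>x. x \<in> els a \<Longrightarrow> ord x" "\<And>x y. x \<in> els a \<Longrightarrow> y \<in> els x \<Longrightarrow> y \<in> els a"
  shows "ord a"
  unfolding ord_iff tran_def
proof (intro conjI ballI subsetI)
  show "E x y \<or> x = y \<or> E y x" if "x \<in> els a" "y \<in> els a" for x y
    using ord_linear[OF els_in_M els_in_M, OF that] assms(2) that by (auto simp: els_iff)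
qed (rule assms(3))

lemma ord_suc: assumes "a \<in> M" "ord a" shows "ord (suc a)"
proof (rule ordI[OF suc_in_M[OF assms(1)]])
  show "ord x" if "x \<in> els (suc a)" for x using that ord_mem[OF assms(2)] assms by (auto simp: els_suc)
  show "y \<in> els (suc a)" if "x \<in> els (suc a)" "y \<in> els x" for x y
    using that ord_transD[OF assms(2)] assms by (auto simp: els_suc)
qed

lemma ord_un: assumes "a \<in> M" "\<And>x. x \<in> els a \<Longrightarrow> ord x" shows "ord (un a)"
proof (rule ordI[OF un_in_M[OF assms(1)]])
  show "ord x" if "x \<in> els (un a)" for x
    using that ord_mem assms(2) unfolding els_un[OF assms(1)] by blast
  show "y \<in> els (un a)" if "x \<in> els (un a)" "y \<in> els x" for x y
    using that ord_transD assms(2) unfolding els_un[OF assms(1)] by blast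
qed

lemma ord_least:
  assumes "pdef1 M E P" "a \<in> M" "ord a" "P a"
  obtains m where "m \<in> M" "ord m" "P m" "\<And>x. x \<in> els m \<Longrightarrow> \<not> P x"
proof -
  have "\<exists>m\<in>M. ord m \<and> P m \<and> (\<forall>x\<in>els m. \<not> P x)"
  proof (rule ccontr)
    assume no: "\<not> (\<exists>m\<in>M. ord m \<and> P m \<and> (\<forall>x\<in>els m. \<not> P x))"
    have "ord a \<longrightarrow> \<not> P a"
    proof (rule mem_induct[where P = "\<lambda>a. ord a \<longrightarrow> \<not> P a", OF _ _ assms(2)])
      show "pdef1 M E (\<lambda>a. ord a \<longrightarrow> \<not> P a)" by (intro pdi assms)
      fix x assume "x \<in> M" "\<And>y. y \<in> els x \<Longrightarrow> ord y \<longrightarrow> \<not> P y"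
      with no show "ord x \<longrightarrow> \<not> P x" using ord_mem by blast
    qed
    with assms show False by simp
  qed
  with that show thesis by blast
qed

subsection \<open>The cumulative hierarchy, Collection and Choice\<close>

text \<open>The recursion V_a = union of the power sets of V_b for b \<in> a treats all ordinals
  alike. That every set occurs is shown by membership induction: the least levels of the elements of
  x form a set by Replacement, and the successor of its union is a level containing x.\<close>

lemma hierarchy:
  obtains F where "tdef1 M E F"
    "\<And>a b. a \<in> M \<Longrightarrow> b \<in> M \<Longrightarrow> ord a \<Longrightarrow> ord b \<Longrightarrow> els a \<subseteq> els b \<Longrightarrow> els (F a) \<subseteq> els (F b)"
    "\<And>x. x \<in> M \<Longrightarrow> \<exists>a\<in>M. ord a \<and> x \<in> els (F a)"
proof -
  have po: "pdef1 M E ord" by (intro pdi)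
  have tp: "tdef1 M E pow" by (intro pdi)
  have "tdef2 M E (\<lambda>n f. gUn pow f)" by (intro tdef_comp1[OF td_gUn[OF tp]] pdi)
  from recursion[OF locally_wf_mem[OF po] this]
  obtain F where F: "tdef1 M E F"
    "\<And>a. a \<in> M \<Longrightarrow> ord a \<Longrightarrow> F a = gUn pow (lam (mk {z \<in> M. ord z \<and> E z a}) F)" by blast
  have elsF: "els (F a) = (\<Union>b\<in>els a. els (pow (F b)))" if "a \<in> M" "ord a" for a
  proof -
    have s: "small {z \<in> M. ord z \<and> E z a}" by (rule small_pred[OF locally_wf_mem[OF po] that])
    have "{z \<in> M. ord z \<and> E z a} = els a" using ord_mem[OF that(2)] by (auto simp: els_iff)
    then show ?thesis
      unfolding F(2)[OF that] els_gUn_lam[OF tp mk_in_M[OF s] F(1)] els_mk[OF s] by simp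
  qed
  have FM: "F a \<in> M" if "a \<in> M" for a by (rule tdef1_in_M[OF F(1) that])
  have mono: "els (F a) \<subseteq> els (F b)"
    if "a \<in> M" "b \<in> M" "ord a" "ord b" "els a \<subseteq> els b" for a b
    unfolding elsF[OF that(1,3)] elsF[OF that(2,4)] using that(5) by blast
  have "\<exists>a\<in>M. ord a \<and> E x (F a)" if "x \<in> M" for x
  proof (rule mem_induct[where P = "\<lambda>x. \<exists>a\<in>M. ord a \<and> E x (F a)", OF _ _ that])
    show "pdef1 M E (\<lambda>x. \<exists>a\<in>M. ord a \<and> E x (F a))" by (intro pdi tdef_comp1[OF F(1)])
    fix x assume x: "x \<in> M" and IH: "\<And>y. y \<in> els x \<Longrightarrow> \<exists>a\<in>M. ord a \<and> E y (F a)"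
    define R where "R y a \<longleftrightarrow> ord a \<and> E y (F a) \<and> (\<forall>b\<in>M. E b a \<longrightarrow> \<not> E y (F b))" for y a
    have R: "pdef2 M E R" unfolding R_def by (intro pdi tdef_comp1[OF F(1)])
    have Rex: "\<exists>a\<in>M. R y a" if y: "y \<in> els x" for y
    proof -
      obtain a where a: "a \<in> M" "ord a" "E y (F a)" using IH[OF y] by blast
      have "pdef1 M E (\<lambda>a. E y (F a))" by (intro pdi tdef_comp1[OF F(1)] els_in_M[OF y])
      from ord_least[OF this a] obtain m where "m \<in> M" "ord m" "E y (F m)"
        "\<And>x. x \<in> els m \<Longrightarrow> \<not> E y (F x)" by blast
      then show ?thesis unfolding R_def els_iff by blast
    qed
    have Runi: "a = b" if "a \<in> M" "b \<in> M" "R y a" "R y b" for y a b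
      using ord_linear[of a b] that unfolding R_def els_iff by blast
    have s: "small {a \<in> M. \<exists>y\<in>els x. R y a}"
      by (rule replacement[OF small_els[OF x] R]) (use Runi in blast)
    define S where "S = mk {a \<in> M. \<exists>y\<in>els x. R y a}"
    have S: "S \<in> M" "els S = {a \<in> M. \<exists>y\<in>els x. R y a}" unfolding S_def using mk_props[OF s] by auto
    have So: "ord a" if "a \<in> els S" for a using that unfolding S(2) R_def by blast
    define g where "g = un S"
    have g: "g \<in> M" "ord g" unfolding g_def using un_in_M[OF S(1)] ord_un[OF S(1) So] by auto
    have "els x \<subseteq> els (F g)"
    proof
      fix y assume y: "y \<in> els x"
      then obtain a where a: "a \<in> M" "R y a" using Rex by blast
      have "els a \<subseteq> els g" unfolding g_def els_un[OF S(1)] S(2) using a y by blast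
      moreover have "ord a" "E y (F a)" using a(2) by (auto simp: R_def)
      moreover from this have "y \<in> els (F a)" using els_in_M[OF y] by (simp add: els_iff)
      ultimately show "y \<in> els (F g)" using mono[OF a(1) g(1) _ g(2)] by blast
    qed
    then have "x \<in> els (pow (F g))" using els_pow[OF FM[OF g(1)]] x by simp
    then have "x \<in> els (F (suc g))"
      unfolding elsF[OF suc_in_M[OF g(1)] ord_suc[OF g]] els_suc[OF g(1)] by simp
    then show "\<exists>a\<in>M. ord a \<and> E x (F a)"
      using suc_in_M[OF g(1)] ord_suc[OF g] by (auto simp: els_iff)
  qed
  then have "\<exists>a\<in>M. ord a \<and> x \<in> els (F a)" if "x \<in> M" for x using that by (simp add: els_iff)
  with F(1) mono show thesis using that by blast
qed

text \<open>Scott's trick: the least level of the hierarchy that contains a witness is a function of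
  i, so Replacement applies to levels where it would not apply to witnesses.\<close>

lemma collection:
  assumes X: "X \<in> M" and P: "pdef2 M E P" and ex: "\<And>i. i \<in> els X \<Longrightarrow> \<exists>y\<in>M. P i y"
  obtains B where "B \<in> M" "\<And>i. i \<in> els X \<Longrightarrow> \<exists>y\<in>els B. P i y"
proof -
  obtain F where F: "tdef1 M E F" "\<And>x. x \<in> M \<Longrightarrow> \<exists>a\<in>M. ord a \<and> x \<in> els (F a)"
    using hierarchy by metis
  note [pdi] = tdef_comp1[OF F(1)] pdef_pred2[OF P]
  define Q where "Q i a \<longleftrightarrow> (\<exists>y\<in>M. E y (F a) \<and> P i y)" for i a
  have Q: "pdef2 M E Q" unfolding Q_def by (intro pdi)
  note [pdi] = pdef_pred2[OF Q]
  define R where "R i a \<longleftrightarrow> ord a \<and> Q i a \<and> (\<forall>b\<in>M. E b a \<longrightarrow> \<not> Q i b)" for i a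
  have R: "pdef2 M E R" unfolding R_def by (intro pdi)
  have Rex: "\<exists>a\<in>M. R i a" if i: "i \<in> els X" for i
  proof -
    obtain y where y: "y \<in> M" "P i y" using ex[OF i] by blast
    obtain a where a: "a \<in> M" "ord a" "y \<in> els (F a)" using F(2)[OF y(1)] by blast
    then have "Q i a" unfolding Q_def using y by (auto simp: els_iff)
    have "pdef1 M E (Q i)" by (intro pdi els_in_M[OF i])
    from ord_least[OF this a(1,2) \<open>Q i a\<close>] obtain m where "m \<in> M" "ord m" "Q i m"
      "\<And>x. x \<in> els m \<Longrightarrow> \<not> Q i x" by blast
    then show ?thesis unfolding R_def els_iff by blast
  qed
  have Runi: "a = b" if "a \<in> M" "b \<in> M" "R i a" "R i b" for i a b
    using ord_linear[of a b] that unfolding R_def els_iff by blast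
  have s: "small {a \<in> M. \<exists>i\<in>els X. R i a}"
    by (rule replacement[OF small_els[OF X] R]) (use Runi in blast)
  have sB: "small (\<Union>a\<in>{a \<in> M. \<exists>i\<in>els X. R i a}. els (F a))" by (rule small_UN[OF s F(1)])
  show thesis
  proof (rule that[OF mk_in_M[OF sB]])
    fix i assume i: "i \<in> els X"
    then obtain a where a: "a \<in> M" "R i a" using Rex by blast
    then obtain y where "y \<in> M" "E y (F a)" "P i y" unfolding R_def Q_def by blast
    then have "y \<in> els (F a)" "P i y" by (simp_all add: els_iff)
    then show "\<exists>y\<in>els (mk (\<Union>a\<in>{a \<in> M. \<exists>i\<in>els X. R i a}. els (F a))). P i y"
      unfolding els_mk[OF sB] using a i by blast
  qed
qed

lemma choice_function:
  assumes z: "z \<in> M"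
  obtains ch where "ch \<in> M" "\<And>x. x \<in> els z \<Longrightarrow> els x \<noteq> {} \<Longrightarrow> app ch x \<in> els x"
proof -
  \<comment> \<open>The axiom of Choice is stated for disjoint families; tagging each x as {x}
    \<times> x makes the members disjoint.\<close>
  define Fam where "Fam = (\<lambda>x. times (upr x x) x) ` {x \<in> els z. \<exists>y\<in>M. E y x}"
  have sF: "small Fam" unfolding Fam_def
  proof (rule small_image)
    show "small {x \<in> els z. \<exists>y\<in>M. E y x}" by (rule separation_els[OF z]) (intro pdi)
    show "tdef1 M E (\<lambda>x. times (upr x x) x)" by (intro pdi)
  qed
  have els_t: "els (times (upr x x) x) = opr x ` els x" if "x \<in> M" for x
    using els_times[OF upr_in_M[OF that that] that] els_upr[OF that that] by auto
  have ax: "\<forall>a\<in>M. (\<forall>x\<in>M. E x a \<longrightarrow> (\<exists>z\<in>M. E z x)) \<longrightarrow>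
        (\<forall>x\<in>M. \<forall>y\<in>M. E x a \<and> E y a \<and> x \<noteq> y \<longrightarrow> (\<forall>z\<in>M. \<not> (E z x \<and> E z y))) \<longrightarrow>
        (\<exists>c\<in>M. \<forall>x\<in>M. E x a \<longrightarrow> (\<exists>!z. z \<in> M \<and> E z x \<and> E z c))"
    using zfc unfolding ZFC_def by (elim conjE)
  have FamD: "\<exists>u\<in>els z. x = times (upr u u) u \<and> els u \<noteq> {}" if "x \<in> M" "E x (mk Fam)" for x
  proof -
    have "x \<in> els (mk Fam)" using that by (simp add: els_iff)
    then obtain u y where "u \<in> els z" "x = times (upr u u) u" "y \<in> M" "E y u"
      unfolding els_mk[OF sF] unfolding Fam_def by blast
    moreover from this have "y \<in> els u" by (simp add: els_iff)
    ultimately show ?thesis by blast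
  qed
  have "\<forall>x\<in>M. E x (mk Fam) \<longrightarrow> (\<exists>z\<in>M. E z x)"
  proof (intro ballI impI)
    fix x assume "x \<in> M" "E x (mk Fam)"
    then obtain u where u: "u \<in> els z" "x = times (upr u u) u" "els u \<noteq> {}" using FamD by blast
    then obtain y where "y \<in> els u" by blast
    then have "opr u y \<in> els x" unfolding u(2) els_t[OF els_in_M[OF u(1)]] by blast
    then show "\<exists>z\<in>M. E z x" by (auto simp: els_iff)
  qed
  moreover have "\<forall>x\<in>M. \<forall>y\<in>M. E x (mk Fam) \<and> E y (mk Fam) \<and> x \<noteq> y \<longrightarrow>
      (\<forall>z\<in>M. \<not> (E z x \<and> E z y))"
  proof (intro ballI impI notI)
    fix x y p assume xy: "x \<in> M" "y \<in> M" "E x (mk Fam) \<and> E y (mk Fam) \<and> x \<noteq> y" "p \<in> M"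
      "E p x \<and> E p y"
    then obtain u v where u: "u \<in> els z" "x = times (upr u u) u"
      and v: "v \<in> els z" "y = times (upr v v) v" using FamD by meson
    have "p \<in> els x" "p \<in> els y" using xy by (auto simp: els_iff)
    then obtain s t where "s \<in> els u" "p = opr u s" "t \<in> els v" "p = opr v t"
      unfolding u(2) v(2) els_t[OF els_in_M[OF u(1)]] els_t[OF els_in_M[OF v(1)]] by blast
    then have "u = v"
      using opr_eq_iff[OF els_in_M[OF u(1)] els_in_M els_in_M[OF v(1)] els_in_M] by blast
    with u v xy show False by simp
  qed
  ultimately obtain c where c: "c \<in> M"
    "\<forall>x\<in>M. E x (mk Fam) \<longrightarrow> (\<exists>!z. z \<in> M \<and> E z x \<and> E z c)"
    using ax[THEN bspec, OF mk_in_M[OF sF]] by blast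
  define ch where "ch = mk {p \<in> els c. \<exists>x\<in>M. \<exists>y\<in>M. E y x \<and> p = opr x y}"
  have s: "small {p \<in> els c. \<exists>x\<in>M. \<exists>y\<in>M. E y x \<and> p = opr x y}"
    by (rule separation_els[OF c(1)]) (intro pdi)
  have chE: "E (opr x y) ch \<longleftrightarrow> E (opr x y) c \<and> E y x" if "x \<in> M" "y \<in> M" for x y
  proof -
    have "E (opr x y) ch \<longleftrightarrow> opr x y \<in> els ch" using opr_in_M[OF that] by (simp add: els_iff)
    then show ?thesis unfolding ch_def els_mk[OF s]
      using opr_in_M[OF that] opr_eq_iff[OF that] that by (auto simp: els_iff)
  qed
  show thesis
  proof (rule that)
    show "ch \<in> M" unfolding ch_def by (rule mk_in_M[OF s])
    fix x assume x: "x \<in> els z" "els x \<noteq> {}"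
    have xM: "x \<in> M" by (rule els_in_M[OF x(1)])
    have "times (upr x x) x \<in> els (mk Fam)"
    proof -
      have "\<exists>y\<in>M. E y x" using x(2) by (auto simp: els_def)
      then show ?thesis unfolding els_mk[OF sF] unfolding Fam_def using x(1) by blast
    qed
    then have "\<exists>!p. p \<in> M \<and> E p (times (upr x x) x) \<and> E p c" using c(2) by (simp add: els_iff)
    then have "\<exists>!p. p \<in> opr x ` els x \<and> E p c"
      unfolding els_t[OF xM, symmetric] els_iff by simp
    then obtain y where y: "y \<in> els x" "E (opr x y) c" and
      uni: "\<And>y'. y' \<in> els x \<Longrightarrow> E (opr x y') c \<Longrightarrow> opr x y' = opr x y" by blast
    have "\<exists>!y. y \<in> M \<and> E (opr x y) ch"
    proof (rule ex1I[of _ y])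
      show "y \<in> M \<and> E (opr x y) ch" using y chE[OF xM els_in_M[OF y(1)]] by (simp add: els_iff)
      fix y' assume y': "y' \<in> M \<and> E (opr x y') ch"
      then have "y' \<in> els x" "E (opr x y') c" using chE[OF xM] by (auto simp: els_iff)
      from uni[OF this] show "y' = y" using opr_eq_iff[OF xM _ xM els_in_M[OF y(1)]] y' by blast
    qed
    then have "app ch x \<in> M \<and> E (opr x (app ch x)) ch" using app_cases[of ch x "app ch x"] by blast
    then show "app ch x \<in> els x" using chE[OF xM app_in_M] by (simp add: els_iff)
  qed
qed

text \<open>The witnesses may range over a proper class. Collection bounds them by a set B, and a
  choice function on the power set of B selects among the witnesses for each i.\<close>

lemma choice:
  assumes X: "X \<in> M" and P: "pdef2 M E P" and ex: "\<And>i. i \<in> els X \<Longrightarrow> \<exists>y\<in>M. P i y"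
  obtains f where "f \<in> M" "is_fun_on M E f X" "\<And>i. i \<in> els X \<Longrightarrow> P i (app f i)"
proof -
  obtain B where B: "B \<in> M" "\<And>i. i \<in> els X \<Longrightarrow> \<exists>y\<in>els B. P i y"
    using collection[OF assms] by blast
  obtain ch where ch: "ch \<in> M" "\<And>x. x \<in> els (pow B) \<Longrightarrow> els x \<noteq> {} \<Longrightarrow> app ch x \<in> els x"
    using choice_function[OF pow_in_M[OF B(1)]] by blast
  note [pdi] = pdef_pred2[OF P]
  have s: "small {y \<in> M. E y B \<and> P i y}" if "i \<in> M" for i
    by (rule small_subset[OF small_els[OF B(1)]]) (intro pdi that B(1), simp add: els_iff)
  have t: "tdef1 M E (\<lambda>i. mk {y \<in> M. E y B \<and> P i y})"
  proof (rule td_mk[where P = "\<lambda>e y. E y B \<and> P (e 0) y"])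
    show "pdef M E (\<lambda>e. E (e 0) B \<and> P (e (Suc 0)) (e 0))" by (intro pdi B(1))
    show "small {y \<in> M. E y B \<and> P (e 0) y}" if "range e \<subseteq> M" for e
      using s[of "e 0"] that by auto
  qed
  have t2: "tdef1 M E (\<lambda>i. app ch (mk {y \<in> M. E y B \<and> P i y}))" by (intro td_app td_const ch(1) t)
  show thesis
  proof (rule that)
    show "lam X (\<lambda>i. app ch (mk {y \<in> M. E y B \<and> P i y})) \<in> M" by (rule lam_in_M[OF X t2])
    show "is_fun_on M E (lam X (\<lambda>i. app ch (mk {y \<in> M. E y B \<and> P i y}))) X"
      by (rule is_fun_on_lam[OF X t2])
    fix i assume i: "i \<in> els X"
    note s' = s[OF els_in_M[OF i]]
    have "els (mk {y \<in> M. E y B \<and> P i y}) \<subseteq> els B"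
      unfolding els_mk[OF s'] by (auto simp: els_def)
    then have "mk {y \<in> M. E y B \<and> P i y} \<in> els (pow B)"
      unfolding els_pow[OF B(1)] using mk_in_M[OF s'] by blast
    moreover have "els (mk {y \<in> M. E y B \<and> P i y}) \<noteq> {}"
    proof -
      obtain y where "y \<in> els B" "P i y" using B(2)[OF i] by blast
      then have "y \<in> {y \<in> M. E y B \<and> P i y}" by (simp add: els_iff)
      then show ?thesis unfolding els_mk[OF s'] by blast
    qed
    ultimately have "app ch (mk {y \<in> M. E y B \<and> P i y}) \<in> els (mk {y \<in> M. E y B \<and> P i y})"
      by (rule ch(2))
    then have "P i (app ch (mk {y \<in> M. E y B \<and> P i y}))" unfolding els_mk[OF s'] by simp
    then show "P i (app (lam X (\<lambda>i. app ch (mk {y \<in> M. E y B \<and> P i y}))) i)"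
      unfolding app_lam[OF X t2 i] .
  qed
qed

end

section \<open>Ordinals fixed by all ultrapowers on a given set\<close>

text \<open>
  \<open>nice \<xi> Y\<close>: for some \<open>T\<close> with \<open>Y \<times> T \<subseteq> T\<close>, \<open>\<xi>\<close> is the set of ordinals onto which the power set
  of \<open>T\<close> can be mapped. As the power set of \<open>T\<close> maps onto its own \<open>Y\<close>-th power, \<open>\<xi>\<close> is fixed by
  the ultrapower embeddings of ultrafilters on subsets of \<open>Y\<close>.
\<close>

definition nice :: "'v set \<Rightarrow> ('v \<Rightarrow> 'v \<Rightarrow> bool) \<Rightarrow> 'v \<Rightarrow> 'v \<Rightarrow> bool" where
  "nice M E \<xi> Y \<longleftrightarrow> (\<exists>T\<in>M.
     (\<forall>y\<in>M. \<forall>t\<in>M. \<forall>p\<in>M. E y Y \<and> E t T \<and> is_opair M E y t p \<longrightarrow> E p T) \<and>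
     (\<forall>\<eta>\<in>M. E \<eta> \<xi> \<longleftrightarrow> is_ordinal M E \<eta> \<and> (\<exists>f\<in>M. \<forall>\<beta>\<in>M. E \<beta> \<eta> \<longrightarrow>
        (\<exists>A\<in>M. is_subset M E A T \<and> maps_to M E f A \<beta> \<and>
           (\<forall>\<gamma>\<in>M. maps_to M E f A \<gamma> \<longrightarrow> \<gamma> = \<beta>)))))"

lemma fdef_nice: "fdef E (\<lambda>M e. nice M E (e i) (e j))"
  unfolding nice_def by (intro fdef_intros)

context zfc_model
begin

lemma pd_nice [pdi]: "tdef M E t \<Longrightarrow> tdef M E u \<Longrightarrow> pdef M E (\<lambda>e. nice M E (t e) (u e))"
  using pdef_pred2[OF pdef_fdef[OF M_nonempty fdef_nice[of E 0 "Suc 0"]], of t u] .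

definition covers :: "'v \<Rightarrow> 'v \<Rightarrow> bool" where
  "covers Z \<eta> \<longleftrightarrow> (\<exists>f\<in>M. \<forall>\<beta>\<in>M. E \<beta> \<eta> \<longrightarrow> (\<exists>z\<in>M. E z Z \<and> \<beta> = app f z))"

lemma pd_covers [pdi]:
  assumes "tdef M E t" "tdef M E u" shows "pdef M E (\<lambda>e. covers (t e) (u e))"
proof (rule pdef_pred2[OF _ assms])
  show "pdef2 M E covers" unfolding covers_def by (intro pdi)
qed

text \<open>\<open>nice\<close> speaks of \<open>maps_to\<close>, so that \<open>fdef\<close>
  applies, whereas \<open>covers\<close> speaks of \<open>app\<close>. Uniqueness of the value makes
  \<open>app\<close> return it; conversely, restricting by \<open>lam Z\<close> turns default values
  of \<open>app\<close> into genuine ones.\<close>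

lemma covers_iff:
  assumes "Z \<in> M" "\<eta> \<in> M"
  shows "covers Z \<eta> \<longleftrightarrow> (\<exists>f\<in>M. \<forall>\<beta>\<in>M. E \<beta> \<eta> \<longrightarrow> (\<exists>z\<in>M. E z Z \<and> maps_to M E f z \<beta> \<and>
           (\<forall>\<gamma>\<in>M. maps_to M E f z \<gamma> \<longrightarrow> \<gamma> = \<beta>)))" (is "_ \<longleftrightarrow> ?R")
proof
  assume "covers Z \<eta>"
  then obtain f where f: "f \<in> M" "\<And>\<beta>. \<beta> \<in> M \<Longrightarrow> E \<beta> \<eta> \<Longrightarrow> \<exists>z\<in>M. E z Z \<and> \<beta> = app f z"
    unfolding covers_def by blast
  have t: "tdef1 M E (app f)" by (intro pdi f(1))
  show ?R
  proof (rule bexI[OF _ lam_in_M[OF assms(1) t]], intro ballI impI)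
    fix \<beta> assume b: "\<beta> \<in> M" "E \<beta> \<eta>"
    then obtain z where z: "z \<in> M" "E z Z" "\<beta> = app f z" using f(2) by blast
    have "maps_to M E (lam Z (app f)) z \<gamma> \<longleftrightarrow> \<gamma> = \<beta>" if "\<gamma> \<in> M" for \<gamma>
      using maps_to_iff[OF z(1) that] E_lam_iff[OF assms(1) t z(1) that] z by simp
    then show "\<exists>z\<in>M. E z Z \<and> maps_to M E (lam Z (app f)) z \<beta> \<and>
        (\<forall>\<gamma>\<in>M. maps_to M E (lam Z (app f)) z \<gamma> \<longrightarrow> \<gamma> = \<beta>)"
      using z b by (intro bexI[of _ z]) simp_all
  qed
next
  assume ?R
  then obtain f where f: "f \<in> M" "\<And>\<beta>. \<beta> \<in> M \<Longrightarrow> E \<beta> \<eta> \<Longrightarrow> \<exists>z\<in>M. E z Z \<and> maps_to M E f z \<beta> \<and>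
           (\<forall>\<gamma>\<in>M. maps_to M E f z \<gamma> \<longrightarrow> \<gamma> = \<beta>)" by blast
  show "covers Z \<eta>"
    unfolding covers_def
  proof (rule bexI[OF _ f(1)], intro ballI impI)
    fix \<beta> assume b: "\<beta> \<in> M" "E \<beta> \<eta>"
    from f(2)[OF b] obtain z where z: "z \<in> M" "E z Z" "maps_to M E f z \<beta>"
      "\<And>\<gamma>. \<gamma> \<in> M \<Longrightarrow> maps_to M E f z \<gamma> \<Longrightarrow> \<gamma> = \<beta>" by blast
    have "E (opr z \<beta>) f" using z(3) unfolding maps_to_iff[OF z(1) b(1)] .
    moreover have "\<gamma> = \<beta>" if "\<gamma> \<in> M" "E (opr z \<gamma>) f" for \<gamma>
      using z(4)[OF that(1)] that(2) unfolding maps_to_iff[OF z(1) that(1)] by blast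
    ultimately have "app f z = \<beta>" using app_cases[of f z \<beta>] b(1) by blast
    with z show "\<exists>z\<in>M. E z Z \<and> \<beta> = app f z" by blast
  qed
qed

lemma nice_iff:
  assumes "\<xi> \<in> M" "Y \<in> M"
  shows "nice M E \<xi> Y \<longleftrightarrow> (\<exists>T\<in>M. (\<forall>y\<in>els Y. \<forall>t\<in>els T. opr y t \<in> els T) \<and>
     els \<xi> = {\<eta> \<in> M. ord \<eta> \<and> covers (pow T) \<eta>})"
proof -
  have 1: "(\<forall>y\<in>M. \<forall>t\<in>M. \<forall>p\<in>M. E y Y \<and> E t T \<and> is_opair M E y t p \<longrightarrow> E p T) \<longleftrightarrow>
      (\<forall>y\<in>els Y. \<forall>t\<in>els T. opr y t \<in> els T)" for T
  proof (intro iffI ballI impI)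
    fix y t assume *: "\<forall>y\<in>M. \<forall>t\<in>M. \<forall>p\<in>M. E y Y \<and> E t T \<and> is_opair M E y t p \<longrightarrow> E p T"
      "y \<in> els Y" "t \<in> els T"
    have m: "y \<in> M" "t \<in> M" "opr y t \<in> M" using * els_in_M opr_in_M by blast+
    then have "is_opair M E y t (opr y t)" by (simp add: is_opair_iff)
    then show "opr y t \<in> els T" using *(1)[THEN bspec, OF m(1), THEN bspec, OF m(2), THEN bspec, OF m(3)]
        *(2,3) m by (simp add: els_iff)
  next
    fix y t p assume *: "\<forall>y\<in>els Y. \<forall>t\<in>els T. opr y t \<in> els T"
      "y \<in> M" "t \<in> M" "p \<in> M" "E y Y \<and> E t T \<and> is_opair M E y t p"
    then have "p = opr y t" "y \<in> els Y" "t \<in> els T" by (simp_all add: is_opair_iff els_iff)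
    with *(1) show "E p T" by (simp add: els_iff)
  qed
  have 2: "(\<exists>f\<in>M. \<forall>\<beta>\<in>M. E \<beta> \<eta> \<longrightarrow> (\<exists>A\<in>M. is_subset M E A T \<and> maps_to M E f A \<beta> \<and>
           (\<forall>\<gamma>\<in>M. maps_to M E f A \<gamma> \<longrightarrow> \<gamma> = \<beta>))) \<longleftrightarrow> covers (pow T) \<eta>"
    if "T \<in> M" "\<eta> \<in> M" for T \<eta>
  proof -
    have "is_subset M E A T \<longleftrightarrow> E A (pow T)" if "A \<in> M" for A
    proof -
      have "E A (pow T) \<longleftrightarrow> A \<in> els (pow T)" using that by (simp add: els_iff)
      then show ?thesis unfolding els_pow[OF \<open>T \<in> M\<close>]
        using that by (auto simp: is_subset_def els_def)
    qed
    then show ?thesis unfolding covers_iff[OF pow_in_M[OF that(1)] that(2)] by simp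
  qed
  have 3: "(\<forall>\<eta>\<in>M. E \<eta> \<xi> \<longleftrightarrow> P \<eta>) \<longleftrightarrow> els \<xi> = {\<eta> \<in> M. P \<eta>}" for P
    by (auto simp: els_def)
  show ?thesis
    unfolding nice_def 1 by (rule bex_cong[OF refl]) (simp add: 2 3[symmetric])
qed

text \<open>A map onto an ordinal is determined by its domain and the pullback of membership.\<close>

lemma small_covered:
  assumes Z: "Z \<in> M" shows "small {\<eta> \<in> M. ord \<eta> \<and> covers Z \<eta>}"
proof -
  \<comment> \<open>Here i codes a pair (d, r), and f is the Mostowski collapse of the relation r on
    d, with \<eta> as its range.\<close>
  define R where "R i \<eta> \<longleftrightarrow> (\<exists>d\<in>M. \<exists>r\<in>M. \<exists>f\<in>M. i = opr d r \<and>
      (\<forall>A\<in>M. E A d \<longrightarrow> (\<forall>u\<in>M. E u (app f A) \<longleftrightarrow>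
          (\<exists>B\<in>M. E B d \<and> E (opr B A) r \<and> u = app f B))) \<and>
      (\<forall>v\<in>M. E v \<eta> \<longleftrightarrow> (\<exists>A\<in>M. E A d \<and> v = app f A)))" for i \<eta>
  have R: "pdef2 M E R" unfolding R_def by (intro pdi)
  have RD: "\<exists>f\<in>M. (\<forall>A\<in>els d. els (app f A) = app f ` {B \<in> els d. E (opr B A) r}) \<and>
      els \<eta> = app f ` els d" if dr: "d \<in> M" "r \<in> M" "R (opr d r) \<eta>" for d r \<eta>
  proof -
    obtain d' r' f where f: "d' \<in> M" "r' \<in> M" "f \<in> M" "opr d r = opr d' r'"
      "\<forall>A\<in>M. E A d' \<longrightarrow> (\<forall>u\<in>M. E u (app f A) \<longleftrightarrow> (\<exists>B\<in>M. E B d' \<and> E (opr B A) r' \<and> u = app f B))"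
      "\<forall>v\<in>M. E v \<eta> \<longleftrightarrow> (\<exists>A\<in>M. E A d' \<and> v = app f A)"
      using \<open>R (opr d r) \<eta>\<close> unfolding R_def by blast
    have [simp]: "d' = d" "r' = r" using f(4) opr_eq_iff[OF dr(1,2) f(1,2)] by auto
    have "els (app f A) = app f ` {B \<in> els d. E (opr B A) r}" if A: "A \<in> els d" for A
    proof -
      have "A \<in> M" "E A d'" using A by (simp_all add: els_iff)
      from f(5)[THEN bspec, OF this(1), THEN mp, OF this(2)]
      show ?thesis using app_in_M[of f] by (auto simp: els_def)
    qed
    moreover have "els \<eta> = app f ` els d" using f(6) app_in_M[of f] by (auto simp: els_def)
    ultimately show ?thesis using f(3) by blast
  qed
  have uni: "\<eta> = \<eta>'" if dm: "d \<in> M" "r \<in> M" "\<eta> \<in> M" "\<eta>' \<in> M"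
    and Rs: "R (opr d r) \<eta>" "R (opr d r) \<eta>'" for d r \<eta> \<eta>'
  proof -
    from RD[OF dm(1,2) Rs(1)] obtain f where f': "f \<in> M"
      "\<forall>A\<in>els d. els (app f A) = app f ` {B \<in> els d. E (opr B A) r}"
      "els \<eta> = app f ` els d" by (elim bexE conjE)
    note f = f'(1) f'(2)[THEN bspec] f'(3)
    from RD[OF dm(1,2) Rs(2)] obtain g where g': "g \<in> M"
      "\<forall>A\<in>els d. els (app g A) = app g ` {B \<in> els d. E (opr B A) r}"
      "els \<eta>' = app g ` els d" by (elim bexE conjE)
    note g = g'(1) g'(2)[THEN bspec] g'(3)
    \<comment> \<open>Two collapses of the same relation agree: Foundation gives a point of
      disagreement B with \<open>app f B\<close> membership-minimal, and below B the two maps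
      coincide.\<close>
    have "app f A = app g A" if A: "A \<in> els d" for A
    proof (rule ccontr)
      assume ne: "app f A \<noteq> app g A"
      have s: "small (app f ` {A \<in> els d. app f A \<noteq> app g A})"
        by (rule small_image[OF separation_els[OF \<open>d \<in> M\<close>]]) (intro pdi f g)+
      define b where "b = mk (app f ` {A \<in> els d. app f A \<noteq> app g A})"
      have b: "b \<in> M" "els b = app f ` {A \<in> els d. app f A \<noteq> app g A}"
        unfolding b_def by (rule mk_props[OF s])+
      have "els b \<noteq> {}" unfolding b(2) using A ne by blast
      then obtain v where v: "v \<in> els b" "\<And>y. y \<in> els v \<Longrightarrow> y \<notin> els b"
        using foundation[OF b(1)] by metis
      then obtain B where B: "B \<in> els d" "app f B \<noteq> app g B" "v = app f B" unfolding b(2) by blast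
      have "app f C = app g C" if "C \<in> els d" "E (opr C B) r" for C
      proof (rule ccontr)
        assume "app f C \<noteq> app g C"
        then have "app f C \<in> els b" unfolding b(2) using that by blast
        moreover have "app f C \<in> els v" unfolding B(3) f(2)[OF B(1)] using that by blast
        ultimately show False using v(2) by blast
      qed
      then have "app f ` {C \<in> els d. E (opr C B) r} = app g ` {C \<in> els d. E (opr C B) r}"
        by (intro image_cong) auto
      then have "els (app f B) = els (app g B)" using f(2)[OF B(1)] g(2)[OF B(1)] by simp
      then show False using els_inject[OF app_in_M app_in_M] B(2) by blast
    qed
    then have "els \<eta> = els \<eta>'" unfolding f(3) g(3) by (rule image_cong[OF refl])
    then show ?thesis using els_inject that by blast
  qed
  define I where "I = times (pow Z) (pow (times Z Z))"
  have I: "I \<in> M" unfolding I_def by (intro times_in_M pow_in_M Z)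
  have elsI: "els I = {opr d r |d r. d \<in> els (pow Z) \<and> r \<in> els (pow (times Z Z))}"
    unfolding I_def by (intro els_times times_in_M pow_in_M Z)
  have s: "small {\<eta> \<in> M. \<exists>i\<in>els I. R i \<eta>}"
  proof (rule replacement[OF small_els[OF I] R])
    fix i y y' assume "i \<in> els I" and y: "y \<in> M" "y' \<in> M" "R i y" "R i y'"
    then obtain d r where "i = opr d r" "d \<in> M" "r \<in> M" unfolding elsI using els_in_M by blast
    with uni y show "y = y'" by blast
  qed
  show ?thesis
  proof (rule small_subset[OF s])
    show "pdef1 M E (\<lambda>\<eta>. ord \<eta> \<and> covers Z \<eta>)" by (intro pdi Z)
    fix \<eta> assume \<eta>: "\<eta> \<in> M" "ord \<eta> \<and> covers Z \<eta>"
    then obtain f where f: "f \<in> M" "\<And>\<beta>. \<beta> \<in> M \<Longrightarrow> E \<beta> \<eta> \<Longrightarrow> \<exists>z\<in>M. E z Z \<and> \<beta> = app f z"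
      unfolding covers_def by blast
    have sd: "small {A \<in> els Z. E (app f A) \<eta>}" by (rule separation_els[OF Z]) (intro pdi f \<eta>(1))
    \<comment> \<open>For a map f covering \<eta>, d is the preimage of \<eta> in Z, and r below is
      membership of values pulled back to Z. The pair ranges over a set because d \<subseteq> Z and
      r \<subseteq> Z \<times> Z.\<close>
    define d where "d = mk {A \<in> els Z. E (app f A) \<eta>}"
    have d: "d \<in> M" "els d = {A \<in> els Z. E (app f A) \<eta>}" unfolding d_def by (rule mk_props[OF sd])+
    have tZ: "times Z Z \<in> M" by (intro times_in_M Z)
    have sr: "small {p \<in> els (times Z Z). \<exists>A\<in>M. \<exists>B\<in>M. p = opr B A \<and> E (app f B) (app f A)}"
      by (rule separation_els[OF tZ]) (intro pdi f(1))
    define r where "r = mk {p \<in> els (times Z Z). \<exists>A\<in>M. \<exists>B\<in>M. p = opr B A \<and> E (app f B) (app f A)}"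
    have r: "r \<in> M" "els r = {p \<in> els (times Z Z). \<exists>A\<in>M. \<exists>B\<in>M. p = opr B A \<and> E (app f B) (app f A)}"
      unfolding r_def by (rule mk_props[OF sr])+
    have rE: "E (opr B A) r \<longleftrightarrow> E (app f B) (app f A)" if "A \<in> els d" "B \<in> els d" for A B
    proof -
      have m: "A \<in> els Z" "B \<in> els Z" "A \<in> M" "B \<in> M" using that d els_in_M by auto
      have "E (opr B A) r \<longleftrightarrow> opr B A \<in> els r" using opr_in_M m by (simp add: els_iff)
      moreover have "opr B A \<in> els (times Z Z)" unfolding els_times[OF Z Z] using m by blast
      moreover have "(\<exists>A'\<in>M. \<exists>B'\<in>M. opr B A = opr B' A' \<and> E (app f B') (app f A')) \<longleftrightarrow>
          E (app f B) (app f A)"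
        using opr_eq_iff[OF m(4,3)] m by auto
      ultimately show ?thesis unfolding r(2) by simp
    qed
    have onto: "\<exists>A\<in>M. E A d \<and> v = app f A" if v: "v \<in> M" "E v \<eta>" for v
    proof -
      obtain z where "z \<in> M" "E z Z" "v = app f z" using f(2)[OF v] by blast
      then have "z \<in> els d" unfolding d(2) using v by (simp add: els_iff)
      with \<open>v = app f z\<close> show ?thesis by (auto simp: els_iff)
    qed
    have "R (opr d r) \<eta>"
      unfolding R_def
    proof (rule bexI[OF _ d(1)], rule bexI[OF _ r(1)], rule bexI[OF _ f(1)],
        intro conjI ballI impI refl)
      fix A u assume A: "A \<in> M" "E A d" and u: "u \<in> M"
      have Ad: "A \<in> els d" using A by (simp add: els_iff)
      then have "app f A \<in> els \<eta>" using d(2) app_in_M by (simp add: els_iff)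
      show "E u (app f A) \<longleftrightarrow> (\<exists>B\<in>M. E B d \<and> E (opr B A) r \<and> u = app f B)"
      proof
        assume *: "E u (app f A)"
        then have "u \<in> els (app f A)" using u by (simp add: els_iff)
        then have "u \<in> els \<eta>" using ord_transD \<eta>(2) \<open>app f A \<in> els \<eta>\<close> by blast
        then have "E u \<eta>" by (rule els_memI)
        then obtain B where B: "B \<in> M" "E B d" "u = app f B" using onto[OF u] by blast
        then have "B \<in> els d" by (simp add: els_iff)
        then have "E (opr B A) r" using rE[OF Ad] * B(3) by simp
        with B show "\<exists>B\<in>M. E B d \<and> E (opr B A) r \<and> u = app f B" by blast
      next
        assume "\<exists>B\<in>M. E B d \<and> E (opr B A) r \<and> u = app f B"
        then obtain B where B: "B \<in> M" "E B d" "E (opr B A) r" "u = app f B" by blast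
        then have "B \<in> els d" by (simp add: els_iff)
        with rE[OF Ad] B show "E u (app f A)" by simp
      qed
    next
      fix v assume v: "v \<in> M"
      show "E v \<eta> \<longleftrightarrow> (\<exists>A\<in>M. E A d \<and> v = app f A)"
      proof
        assume "\<exists>A\<in>M. E A d \<and> v = app f A"
        then obtain A where "A \<in> els d" "v = app f A" by (auto simp: els_def)
        then show "E v \<eta>" unfolding d(2) by simp
      qed (use onto[OF v] in simp)
    qed
    moreover have "opr d r \<in> els I"
    proof -
      have "d \<in> els (pow Z)" unfolding els_pow[OF Z] using d by auto
      moreover have "r \<in> els (pow (times Z Z))" unfolding els_pow[OF tZ] using r by auto
      ultimately show ?thesis unfolding elsI by blast
    qed
    ultimately show "\<eta> \<in> {\<eta> \<in> M. \<exists>i\<in>els I. R i \<eta>}" using \<eta>(1) by blast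
  qed
qed

text \<open>T is chosen to include the union of S as well as Y \<times> T, and \<xi> is the set of
  ordinals covered by the power set of T. If \<xi> were in S, then \<xi> \<subseteq> T, so the
  singletons of elements of T would cover \<xi> and give \<xi> \<in> \<xi>.\<close>

lemma nice_unbounded:
  assumes Y: "Y \<in> M" and S: "S \<in> M"
  obtains \<xi> where "\<xi> \<in> M" "ord \<xi>" "nice M E \<xi> Y" "\<not> E \<xi> S"
proof -
  \<comment> \<open>\<open>times Y (upr u u)\<close> is Y \<times> {u}; closing under it yields Y
    \<times> T \<subseteq> T.\<close>
  have tH: "tdef1 M E (\<lambda>u. times Y (upr u u))" by (intro pdi Y)
  obtain T where T: "T \<in> M" "els (un S) \<subseteq> els T" "\<And>u. u \<in> els T \<Longrightarrow> els (times Y (upr u u)) \<subseteq> els T"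
    using closure[OF un_in_M[OF S] tH] by blast
  have TY: "opr y t \<in> els T" if "y \<in> els Y" "t \<in> els T" for y t
  proof -
    have t: "t \<in> M" by (rule els_in_M[OF that(2)])
    have "opr y t \<in> els (times Y (upr t t))"
      unfolding els_times[OF Y upr_in_M[OF t t]] els_upr[OF t t] using that by blast
    then show ?thesis using T(3)[OF that(2)] by blast
  qed
  have s: "small {\<eta> \<in> M. ord \<eta> \<and> covers (pow T) \<eta>}" by (rule small_covered[OF pow_in_M[OF T(1)]])
  define \<xi> where "\<xi> = mk {\<eta> \<in> M. ord \<eta> \<and> covers (pow T) \<eta>}"
  have \<xi>: "\<xi> \<in> M" "els \<xi> = {\<eta> \<in> M. ord \<eta> \<and> covers (pow T) \<eta>}"
    unfolding \<xi>_def by (rule mk_props[OF s])+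
  have "ord \<xi>"
  proof (rule ordI[OF \<xi>(1)])
    show "ord x" if "x \<in> els \<xi>" for x using that unfolding \<xi>(2) by blast
    fix x y assume x: "x \<in> els \<xi>" and y: "y \<in> els x"
    have ox: "ord x" "covers (pow T) x" using x unfolding \<xi>(2) by auto
    have "E u x" if "u \<in> M" "E u y" for u
      using ord_transD[OF ox(1) y, of u] that by (simp add: els_iff)
    then have "covers (pow T) y" using ox(2) unfolding covers_def by blast
    then show "y \<in> els \<xi>" unfolding \<xi>(2) using ord_mem[OF ox(1) y] els_in_M[OF y] by blast
  qed
  moreover have "nice M E \<xi> Y"
    unfolding nice_iff[OF \<xi>(1) Y] using T(1) TY \<xi>(2) by blast
  moreover have "\<not> E \<xi> S"
  proof
    assume "E \<xi> S"
    then have "\<xi> \<in> els S" using \<xi>(1) by (simp add: els_iff)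
    then have "els \<xi> \<subseteq> els (un S)" unfolding els_un[OF S] by blast
    then have sub: "els \<xi> \<subseteq> els T" using T(2) by blast
    have tu: "tdef1 M E un" by (intro pdi)
    have "covers (pow T) \<xi>"
      unfolding covers_def
    proof (rule bexI[OF _ lam_in_M[OF pow_in_M[OF T(1)] tu]], intro ballI impI)
      fix \<beta> assume b: "\<beta> \<in> M" "E \<beta> \<xi>"
      then have "\<beta> \<in> els \<xi>" by (simp add: els_iff)
      then have "\<beta> \<in> els T" using sub by blast
      then have p: "upr \<beta> \<beta> \<in> els (pow T)"
        unfolding els_pow[OF T(1)] using upr_in_M[OF b(1) b(1)] els_upr[OF b(1) b(1)] by simp
      have "els (un (upr \<beta> \<beta>)) = els \<beta>"
        unfolding els_un[OF upr_in_M[OF b(1) b(1)]] els_upr[OF b(1) b(1)] by simp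
      then have "un (upr \<beta> \<beta>) = \<beta>" using els_inject un_in_M upr_in_M b(1) by blast
      then have "\<beta> = app (lam (pow T) un) (upr \<beta> \<beta>)"
        using app_lam[OF pow_in_M[OF T(1)] tu p] by simp
      then show "\<exists>z\<in>M. E z (pow T) \<and> \<beta> = app (lam (pow T) un) z"
        using p by (intro bexI[of _ "upr \<beta> \<beta>"]) (simp_all add: els_iff)
    qed
    then have "\<xi> \<in> els \<xi>" unfolding \<xi>(2) using \<xi>(1) \<open>ord \<xi>\<close> by blast
    then show False using not_mem_self[OF \<xi>(1)] by (simp add: els_iff)
  qed
  ultimately show thesis using that \<xi>(1) by blast
qed

lemma nice_enumeration:
  assumes Y: "Y \<in> M" and z: "z \<in> M"
  obtains \<xi> C \<sigma> where "\<xi> \<in> M" "C \<in> M" "\<sigma> \<in> M" "ord \<xi>" "els C \<subseteq> els \<xi>"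
    "\<And>\<eta>. \<eta> \<in> els C \<Longrightarrow> nice M E \<eta> Y" "is_fun_on M E \<sigma> C"
    "\<And>\<eta>. \<eta> \<in> els C \<Longrightarrow> app \<sigma> \<eta> \<in> els z" "\<And>v. v \<in> els z \<Longrightarrow> \<exists>\<eta>\<in>els C. app \<sigma> \<eta> = v"
proof -
  define A where "A x \<longleftrightarrow> ord x \<and> nice M E x Y" for x
  have A: "pdef1 M E A" unfolding A_def by (intro pdi Y)
  note wf = locally_wf_mem[OF A]
  obtain ch where ch: "ch \<in> M" "\<And>x. x \<in> els (pow z) \<Longrightarrow> els x \<noteq> {} \<Longrightarrow> app ch x \<in> els x"
    using choice_function[OF pow_in_M[OF z]] by blast
  define rest where "rest f = mk {v \<in> M. E v z \<and> \<not> (\<exists>m\<in>M. E (opr m v) f)}" for f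
  have s: "small {v \<in> M. E v z \<and> \<not> (\<exists>m\<in>M. E (opr m v) f)}" if "f \<in> M" for f
    by (rule small_subset[OF small_els[OF z]]) (intro pdi z that, simp add: els_iff)
  have rest: "tdef1 M E rest"
    unfolding rest_def
  proof (rule td_mk[where P = "\<lambda>e v. E v z \<and> \<not> (\<exists>m\<in>M. E (opr m v) (e 0))"])
    show "pdef M E (\<lambda>e. E (e 0) z \<and> \<not> (\<exists>m\<in>M. E (opr m (e 0)) (e (Suc 0))))" by (intro pdi z)
    show "small {v \<in> M. E v z \<and> \<not> (\<exists>m\<in>M. E (opr m v) (e 0))}" if "range e \<subseteq> M" for e
      using s[of "e 0"] that by auto
  qed
  \<comment> \<open>The value z is not a member of z and so signals exhaustion; the definition of C
    discards the indices that receive it.\<close>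
  define G where "G x f = (if \<exists>v\<in>M. E v (rest f) then app ch (rest f) else z)" for x f :: 'v
  have "tdef2 M E G" unfolding G_def by (intro td_if pdi ch(1) z tdef_comp1[OF rest])
  from recursion[OF wf this]
  obtain F where F: "tdef1 M E F"
    "\<And>x. x \<in> M \<Longrightarrow> A x \<Longrightarrow> F x = G x (lam (mk {y \<in> M. A y \<and> E y x}) F)" by blast
  have FM: "F x \<in> M" if "x \<in> M" for x using tdef1_in_M[OF F(1) that] .
  have els_rest: "els (rest (lam (mk {y \<in> M. A y \<and> E y x}) F)) =
      els z - F ` {y \<in> M. A y \<and> E y x}" if x: "x \<in> M" "A x" for x
  proof -
    have sp: "small {y \<in> M. A y \<and> E y x}" by (rule small_pred[OF wf x])
    note l = mk_in_M[OF sp]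
    have "(\<exists>m\<in>M. E (opr m v) (lam (mk {y \<in> M. A y \<and> E y x}) F)) \<longleftrightarrow>
        v \<in> F ` {y \<in> M. A y \<and> E y x}" if "v \<in> M" for v
    proof -
      have "(\<exists>m\<in>M. E (opr m v) (lam (mk {y \<in> M. A y \<and> E y x}) F)) \<longleftrightarrow>
          (\<exists>m\<in>M. m \<in> els (mk {y \<in> M. A y \<and> E y x}) \<and> v = F m)"
        using E_lam_iff[OF l F(1) _ that] by (simp add: els_iff)
      then show ?thesis unfolding els_mk[OF sp] by auto
    qed
    then show ?thesis
      unfolding rest_def els_mk[OF s[OF lam_in_M[OF l F(1)]]] by (auto simp: els_def)
  qed
  have F_val: "F x \<in> els z - F ` {y \<in> M. A y \<and> E y x}"
    if x: "x \<in> M" "A x" and ne: "\<not> els z \<subseteq> F ` {y \<in> M. A y \<and> E y x}" for x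
  proof -
    define f where "f = lam (mk {y \<in> M. A y \<and> E y x}) F"
    have e: "els (rest f) = els z - F ` {y \<in> M. A y \<and> E y x}" unfolding f_def by (rule els_rest[OF x])
    have f: "f \<in> M" unfolding f_def by (rule lam_in_M[OF mk_in_M[OF small_pred[OF wf x]] F(1)])
    have "els (rest f) \<noteq> {}" unfolding e using ne by blast
    moreover from this have "\<exists>v\<in>M. E v (rest f)" by (auto simp: els_def)
    moreover have "rest f \<in> els (pow z)"
      unfolding els_pow[OF z] using tdef1_in_M[OF rest f] e by blast
    ultimately have "app ch (rest f) \<in> els (rest f)" "F x = app ch (rest f)"
      using ch(2) F(2)[OF x] by (simp_all add: G_def f_def)
    with e show ?thesis by simp
  qed
  have "\<exists>x\<in>M. A x \<and> els z \<subseteq> F ` {y \<in> M. A y \<and> E y x}"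
  proof (rule ccontr)
    assume no: "\<not> (\<exists>x\<in>M. A x \<and> els z \<subseteq> F ` {y \<in> M. A y \<and> E y x})"
    have val: "F x \<in> els z - F ` {y \<in> M. A y \<and> E y x}" if "x \<in> M" "A x" for x
      using F_val[OF that] no that by blast
    have inj: "x = y" if "x \<in> M" "y \<in> M" "A x" "A y" "F x = F y" for x y
    proof (rule ccontr)
      assume "x \<noteq> y"
      then have "E x y \<or> E y x" using ord_linear[of x y] that by (auto simp: A_def els_iff)
      then show False
      proof
        assume "E x y"
        then have "F x \<in> F ` {z \<in> M. A z \<and> E z y}" using that(1,3) by (intro imageI) simp
        then show False using val[OF that(2,4)] that(5) by simp
      next
        assume "E y x"
        then have "F y \<in> F ` {z \<in> M. A z \<and> E z x}" using that(2,4) by (intro imageI) simp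
        then show False using val[OF that(1,3)] that(5) by simp
      qed
    qed
    have "pdef2 M E (\<lambda>v x. A x \<and> v = F x)" by (intro pdi pdef_pred1[OF A] tdef_comp1[OF F(1)])
    from replacement[OF small_els[OF z] this]
    have sA: "small {x \<in> M. \<exists>v\<in>els z. A x \<and> v = F x}" using inj by blast
    have "{x \<in> M. \<exists>v\<in>els z. A x \<and> v = F x} = {x \<in> M. A x}" using val by blast
    with sA have sA': "small {x \<in> M. A x}" by simp
    obtain \<xi> where "\<xi> \<in> M" "A \<xi>" "\<not> E \<xi> (mk {x \<in> M. A x})"
      using nice_unbounded[OF Y mk_in_M[OF sA']] unfolding A_def by blast
    moreover from this have "\<xi> \<in> els (mk {x \<in> M. A x})" unfolding els_mk[OF sA'] by simp
    ultimately show False by (simp add: els_iff)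
  qed
  then obtain x where x: "x \<in> M" "A x" "els z \<subseteq> F ` {y \<in> M. A y \<and> E y x}" by blast
  have P: "pdef1 M E (\<lambda>y. E (F y) z)" by (intro pdi z tdef_comp1[OF F(1)])
  note sp = separation[OF small_pred[OF wf x(1,2)] P]
  define C where "C = mk {y \<in> {y \<in> M. A y \<and> E y x}. E (F y) z}"
  have C: "C \<in> M" "els C = {y \<in> {y \<in> M. A y \<and> E y x}. E (F y) z}"
    unfolding C_def by (rule mk_props[OF sp])+
  have CA: "A y" if "y \<in> els C" for y using that unfolding C(2) by blast
  show thesis
  proof (rule that[OF x(1) C(1) lam_in_M[OF C(1) F(1)]])
    show "ord x" using x(2) by (simp add: A_def)
    show "els C \<subseteq> els x" unfolding C(2) by (auto simp: els_def)
    show "nice M E \<eta> Y" if "\<eta> \<in> els C" for \<eta> using CA[OF that] unfolding A_def by blast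
    show "is_fun_on M E (lam C F) C" by (rule is_fun_on_lam[OF C(1) F(1)])
    show "app (lam C F) \<eta> \<in> els z" if "\<eta> \<in> els C" for \<eta>
      using that FM[OF els_in_M[OF that]] unfolding app_lam[OF C(1) F(1) that]
      unfolding C(2) by (simp add: els_iff)
    fix v assume v: "v \<in> els z"
    then obtain y where y: "y \<in> {y \<in> M. A y \<and> E y x}" "v = F y" using x(3) by blast
    then have "y \<in> els C" unfolding C(2) using v by (simp add: els_iff)
    then show "\<exists>\<eta>\<in>els C. app (lam C F) \<eta> = v" using app_lam[OF C(1) F(1)] y(2) by blast
  qed
qed

end

section \<open>Ultrapowers\<close>

context zfc_model
begin

text \<open>This connects the syntactic condition in the definition of the collapse with the
  semantic one, for which closure rules and recursion are available.\<close>

lemma class_function_iff: "class_function M E F \<longleftrightarrow> tdef1 M E F"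
proof
  assume F: "tdef1 M E F"
  have "pdef2 M E (\<lambda>x y. F x = y)" by (intro pdi tdef_comp1[OF F])
  from pdef2_sat[where R = "\<lambda>x y. F x = y", OF this] obtain s p where s: "range s \<subseteq> M"
    "\<And>x y. x \<in> M \<Longrightarrow> y \<in> M \<Longrightarrow> sat M E (s(0 := x, 1 := y)) p \<longleftrightarrow> F x = y"
    by blast
  show "class_function M E F"
    unfolding class_function_def
  proof (intro conjI ballI exI)
    show "F x \<in> M" if "x \<in> M" for x by (rule tdef1_in_M[OF F that])
  qed (fact s)+
next
  assume F: "class_function M E F"
  then obtain p s where s: "range s \<subseteq> M"
    "\<forall>x\<in>M. \<forall>y\<in>M. sat M E (s(0 := x, 1 := y)) p \<longleftrightarrow> F x = y"
    unfolding class_function_def by blast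
  define t where "t n = (if n = 0 then (\<lambda>e. e (Suc 0)) else if n = 1 then (\<lambda>e. e 0)
      else (\<lambda>e. s n))" for n and e :: "nat \<Rightarrow> 'v"
  have "s n \<in> M" for n using s(1) by blast
  then have "tdef M E (t n)" for n unfolding t_def by (simp add: td_var td_const)
  from pdef_sat[OF M_nonempty this]
  have "pdef M E (\<lambda>e. sat M E (\<lambda>n. t n e) p)" .
  moreover have "(\<lambda>n. t n e) = s(0 := e (Suc 0), 1 := e 0)" for e by (auto simp: t_def)
  ultimately have "pdef M E (\<lambda>e. sat M E (s(0 := e (Suc 0), 1 := e 0)) p)" by simp
  then have "pdef M E (\<lambda>e. e 0 = F (e (Suc 0)))"
  proof (rule pdef_cong)
    fix v :: "nat \<Rightarrow> 'v" assume "range v \<subseteq> M"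
    then have "v 0 \<in> M" "v (Suc 0) \<in> M" by auto
    with s(2) show "sat M E (s(0 := v (Suc 0), 1 := v 0)) p \<longleftrightarrow> v 0 = F (v (Suc 0))" by metis
  qed
  moreover have "F (v 0) \<in> M" if "range v \<subseteq> M" for v :: "nat \<Rightarrow> 'v"
    using F that unfolding class_function_def by blast
  ultimately show "tdef1 M E F" unfolding tdef_def by blast
qed

lemma E_els: "i \<in> M \<Longrightarrow> E i S \<longleftrightarrow> i \<in> els S" by (simp add: els_iff)

lemma is_subset_iff: "is_subset M E A B \<longleftrightarrow> els A \<subseteq> els B"
  unfolding is_subset_def by (auto simp: els_def)

section \<open>Ranges, collapse of a set, and the set omega\<close>

definition rng :: "'v \<Rightarrow> 'v" where "rng f = mk {v \<in> M. \<exists>m\<in>M. E (opr m v) f}"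

lemma small_rng: assumes "f \<in> M" shows "small {v \<in> M. \<exists>m\<in>M. E (opr m v) f}"
proof (rule small_subset[OF small_els[OF un_in_M[OF un_in_M[OF assms]]]])
  show "pdef1 M E (\<lambda>v. \<exists>m\<in>M. E (opr m v) f)" by (intro pdi assms)
  show "x \<in> els (un (un f))" if "x \<in> M" "\<exists>m\<in>M. E (opr m x) f" for x
    using that E_opr_parts(2)[OF _ _ assms] by blast
qed

lemma td_rng: "tdef1 M E rng"
  unfolding rng_def
proof (rule td_mk[where P = "\<lambda>e v. \<exists>m\<in>M. E (opr m v) (e 0)"])
  show "pdef M E (\<lambda>e. \<exists>m\<in>M. E (opr m (e 0)) (e (Suc 0)))" by (intro pdi)
  show "small {v \<in> M. \<exists>m\<in>M. E (opr m v) (e 0)}" if "range e \<subseteq> M" for e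
    using small_rng[of "e 0"] that by auto
qed

lemma els_rng_lam:
  assumes "a \<in> M" "tdef1 M E F" shows "els (rng (lam a F)) = F ` els a"
  unfolding rng_def els_mk[OF small_rng[OF lam_in_M[OF assms]]]
  using E_lam_iff[OF assms] tdef1_in_M[OF assms(2)] els_in_M by (auto simp: els_iff)

text \<open>Recursion on membership restricted to T. Inside an inner model this will recover the
  arguments of an embedding from its pointwise image T.\<close>

lemma collapse_set:
  assumes T: "T \<in> M"
  obtains F where "tdef1 M E F" "\<And>t. t \<in> els T \<Longrightarrow> els (F t) = F ` (els T \<inter> els t)"
proof -
  have "tdef2 M E (\<lambda>x f. rng f)" by (rule tdef_comp1[OF td_rng td_var])
  from recursion[OF locally_wf_mem_set[OF T] this] obtain F where F: "tdef1 M E F"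
    "\<And>x. x \<in> M \<Longrightarrow> E x T \<Longrightarrow> F x = rng (lam (mk {z \<in> M. E z T \<and> E z x}) F)" by blast
  have "els (F t) = F ` (els T \<inter> els t)" if t: "t \<in> els T" for t
  proof -
    have t': "t \<in> M" "E t T" using t by (simp_all add: els_iff)
    have s: "small {z \<in> M. E z T \<and> E z t}" by (rule small_pred[OF locally_wf_mem_set[OF T] t'])
    have "{z \<in> M. E z T \<and> E z t} = els T \<inter> els t" by (auto simp: els_def)
    then show ?thesis
      unfolding F(2)[OF t'] els_rng_lam[OF mk_in_M[OF s] F(1)] els_mk[OF s] by simp
  qed
  with F(1) show thesis using that by blast
qed

definition omega :: 'v where
  "omega = mk {x \<in> M. \<forall>v\<in>M. is_inductive M E v \<longrightarrow> E x v}"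

lemma is_inductive_iff:
  assumes "v \<in> M" shows "is_inductive M E v \<longleftrightarrow> emp \<in> els v \<and> (\<forall>x\<in>els v. suc x \<in> els v)"
proof -
  have "is_empty M E e \<longleftrightarrow> e = emp" if "e \<in> M" for e
  proof
    assume "is_empty M E e"
    then have "els e = els emp" unfolding els_emp by (auto simp: is_empty_def els_def)
    then show "e = emp" using els_inject that emp_in_M by blast
  next
    assume "e = emp"
    then show "is_empty M E e" using els_emp by (auto simp: is_empty_def els_def)
  qed
  then have "(\<exists>e\<in>M. is_empty M E e \<and> E e v) \<longleftrightarrow> emp \<in> els v" using emp_in_M by (auto simp: els_iff)
  moreover have "(\<forall>x\<in>M. E x v \<longrightarrow> (\<exists>y\<in>M. is_succ M E x y \<and> E y v)) \<longleftrightarrow> (\<forall>x\<in>els v. suc x \<in> els v)"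
  proof -
    have "(\<exists>y\<in>M. is_succ M E x y \<and> E y v) \<longleftrightarrow> suc x \<in> els v" if "x \<in> M" for x
      using is_succ_iff[OF that] suc_in_M[OF that] by (auto simp: els_iff)
    then show ?thesis unfolding Ball_def els_iff[of _ v] imp_conjL by blast
  qed
  ultimately show ?thesis unfolding is_inductive_def by simp
qed

lemma omega:
  shows omega_in_M: "omega \<in> M" and is_omega_omega: "is_omega M E omega"
    and emp_omega: "emp \<in> els omega" and suc_omega: "x \<in> els omega \<Longrightarrow> suc x \<in> els omega"
    and omega_least: "v \<in> M \<Longrightarrow> emp \<in> els v \<Longrightarrow> (\<And>x. x \<in> els v \<Longrightarrow> suc x \<in> els v) \<Longrightarrow>
      els omega \<subseteq> els v"
proof -
  obtain w where w: "w \<in> M" "emp \<in> els w" "\<And>x. x \<in> els w \<Longrightarrow> suc x \<in> els w"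
    using inductive_exists by metis
  then have wi: "is_inductive M E w" using is_inductive_iff by blast
  have "pdef1 M E (is_inductive M E)"
    using pdef_fdef[OF M_nonempty fdef_is_inductive[of E 0]] .
  then have s: "small {x \<in> M. \<forall>v\<in>M. is_inductive M E v \<longrightarrow> E x v}"
  proof (intro small_subset[OF small_els[OF w(1)]])
    show "pdef1 M E (\<lambda>x. \<forall>v\<in>M. is_inductive M E v \<longrightarrow> E x v)"
      by (intro pdi pdef_pred1[OF \<open>pdef1 M E (is_inductive M E)\<close>])
    show "x \<in> els w" if "x \<in> M" "\<forall>v\<in>M. is_inductive M E v \<longrightarrow> E x v" for x
      using that w(1) wi by (simp add: els_iff)
  qed
  show o: "omega \<in> M" unfolding omega_def by (rule mk_in_M[OF s])
  have e: "els omega = {x \<in> M. \<forall>v\<in>M. is_inductive M E v \<longrightarrow> E x v}"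
    unfolding omega_def by (rule els_mk[OF s])
  have e': "x \<in> els omega \<longleftrightarrow> x \<in> M \<and> (\<forall>v\<in>M. is_inductive M E v \<longrightarrow> x \<in> els v)" for x
    unfolding e by (auto simp: els_def)
  show emp: "emp \<in> els omega" unfolding e' using is_inductive_iff emp_in_M by blast
  show suc: "suc x \<in> els omega" if "x \<in> els omega" for x
    using that unfolding e' using is_inductive_iff suc_in_M by blast
  show least: "els omega \<subseteq> els v" if "v \<in> M" "emp \<in> els v" "\<And>x. x \<in> els v \<Longrightarrow> suc x \<in> els v" for v
    using that e' is_inductive_iff by blast
  have "is_inductive M E omega" using is_inductive_iff[OF o] emp suc by blast
  moreover have "is_subset M E omega v" if "v \<in> M" "is_inductive M E v" for v
    using that e unfolding is_subset_def els_def by blast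
  ultimately show "is_omega M E omega" unfolding is_omega_def by blast
qed

end

section \<open>Ultrafilters as quantifiers\<close>

locale ultra = zfc_model M E for M :: "'v set" and E +
  fixes U :: 'v
  assumes cc: "cc_ultrafilter M E U"
begin

definition X :: 'v where "X = un U"

lemma U_in_M: "U \<in> M" using cc by (simp add: cc_ultrafilter_def)

lemma X_in_M: "X \<in> M" unfolding X_def by (rule un_in_M[OF U_in_M])

lemma is_ultrafilter: "is_ultrafilter_on M E U X"
proof -
  obtain X' where X': "X' \<in> M" "is_ultrafilter_on M E U X'"
    using cc by (auto simp: cc_ultrafilter_def)
  have "\<forall>A\<in>M. E A U \<longrightarrow> is_subset M E A X'" "E X' U"
    using X'(2)[unfolded is_ultrafilter_on_def, THEN conjunct1]
      X'(2)[unfolded is_ultrafilter_on_def, THEN conjunct2, THEN conjunct1] .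
  then have "\<And>A. A \<in> els U \<Longrightarrow> els A \<subseteq> els X'" "X' \<in> els U"
    using X'(1) by (simp_all add: is_subset_iff els_iff[of _ U])
  then have "els X' = els (un U)"
    unfolding els_un[OF U_in_M] by blast
  then have "X' = X" unfolding X_def using els_inject X'(1) un_in_M[OF U_in_M] by blast
  with X' show ?thesis by simp
qed

text \<open>\<open>ae P\<close> includes the existence of the set of all i with P i. For an
  undefinable P it can fail on that account alone, which is why the rules that enlarge or negate a
  property assume definability.\<close>

definition ae :: "('v \<Rightarrow> bool) \<Rightarrow> bool" where
  "ae P \<longleftrightarrow> (\<exists>S\<in>M. E S U \<and> (\<forall>i\<in>M. E i S \<longleftrightarrow> E i X \<and> P i))"

lemma ae_iff: "ae P \<longleftrightarrow> (\<exists>S\<in>M. E S U \<and> els S = {i \<in> els X. P i})"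
proof -
  have "(\<forall>i\<in>M. E i S \<longleftrightarrow> E i X \<and> P i) \<longleftrightarrow> els S = {i \<in> els X. P i}" for S
    unfolding set_eq_iff by (auto simp: els_iff)
  then show ?thesis unfolding ae_def by simp
qed

lemma aeI: "S \<in> M \<Longrightarrow> E S U \<Longrightarrow> els S = {i \<in> els X. P i} \<Longrightarrow> ae P"
  unfolding ae_iff by blast

lemma aeE: assumes "ae P" obtains S where "S \<in> M" "E S U" "els S = {i \<in> els X. P i}"
  using assms unfolding ae_iff by blast

lemma ae_cong: assumes "\<And>i. i \<in> els X \<Longrightarrow> P i = Q i" shows "ae P = ae Q"
proof -
  have "{i \<in> els X. P i} = {i \<in> els X. Q i}" using assms by blast
  then show ?thesis unfolding ae_iff by simp
qed

lemma pd_ae: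
  assumes "pdef M E (\<lambda>e. P (\<lambda>n. e (Suc n)) (e 0))"
  shows "pdef M E (\<lambda>e. ae (P e))"
proof -
  have "pdef M E (\<lambda>e. P (\<lambda>n. e (Suc (Suc n))) (e 0))"
    using pdef_rename[OF assms, of "case_nat 0 (\<lambda>n. Suc (Suc n))"] by simp
  then show ?thesis unfolding ae_def by (intro pdi U_in_M X_in_M)
qed

lemma ae_mono:
  assumes "ae P" "pdef1 M E Q" "\<And>i. i \<in> els X \<Longrightarrow> P i \<Longrightarrow> Q i"
  shows "ae Q"
proof -
  obtain S where S: "S \<in> M" "E S U" "els S = {i \<in> els X. P i}" using aeE[OF assms(1)] .
  have s: "small {i \<in> els X. Q i}" by (rule separation_els[OF X_in_M assms(2)])
  have up: "\<forall>A\<in>M. \<forall>B\<in>M. E A U \<and> is_subset M E A B \<and> is_subset M E B X \<longrightarrow> E B U"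
    using is_ultrafilter unfolding is_ultrafilter_on_def by (elim conjE)
  have "is_subset M E S (mk {i \<in> els X. Q i})" "is_subset M E (mk {i \<in> els X. Q i}) X"
    unfolding is_subset_iff els_mk[OF s] S(3) using assms(3) by blast+
  then have "E (mk {i \<in> els X. Q i}) U" using up S(1,2) mk_in_M[OF s] by blast
  then show ?thesis by (rule aeI[OF mk_in_M[OF s] _ els_mk[OF s]])
qed

lemma ae_True: "ae (\<lambda>i. True)"
proof (rule aeI[OF X_in_M])
  show "E X U" using is_ultrafilter unfolding is_ultrafilter_on_def by (elim conjE)
qed simp

lemma ae_conj:
  assumes "ae P" "ae Q" shows "ae (\<lambda>i. P i \<and> Q i)"
proof -
  obtain S where S: "S \<in> M" "E S U" "els S = {i \<in> els X. P i}" using aeE[OF assms(1)] .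
  obtain T where T: "T \<in> M" "E T U" "els T = {i \<in> els X. Q i}" using aeE[OF assms(2)] .
  have "pdef1 M E (\<lambda>i. E i T)" by (intro pdi T(1))
  from separation_els[OF S(1) this] have s: "small {i \<in> els S. E i T}" .
  have e: "els (mk {i \<in> els S. E i T}) = els S \<inter> els T" unfolding els_mk[OF s] by (auto simp: els_def)
  have int: "\<forall>A\<in>M. \<forall>B\<in>M. \<forall>C\<in>M. E A U \<and> E B U \<and> (\<forall>i\<in>M. E i C \<longleftrightarrow> E i A \<and> E i B) \<longrightarrow> E C U"
    using is_ultrafilter unfolding is_ultrafilter_on_def by (elim conjE)
  have "\<forall>i\<in>M. E i (mk {i \<in> els S. E i T}) \<longleftrightarrow> E i S \<and> E i T"
    using e by (simp add: E_els)
  then have "E (mk {i \<in> els S. E i T}) U" using int S(1,2) T(1,2) mk_in_M[OF s] by blast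
  moreover have "els S \<inter> els T = {i \<in> els X. P i \<and> Q i}" unfolding S(3) T(3) by blast
  ultimately show ?thesis using aeI[OF mk_in_M[OF s]] e by simp
qed

lemma ae_ex: assumes "ae P" shows "\<exists>i\<in>els X. P i"
proof -
  obtain S where S: "S \<in> M" "E S U" "els S = {i \<in> els X. P i}" using aeE[OF assms(1)] .
  have "\<forall>A\<in>M. is_empty M E A \<longrightarrow> \<not> E A U"
    using is_ultrafilter unfolding is_ultrafilter_on_def by (elim conjE)
  then have "\<not> is_empty M E S" using S(1,2) by blast
  then have "els S \<noteq> {}" unfolding is_empty_def by (auto simp: els_def)
  then show ?thesis unfolding S(3) by blast
qed

lemma ae_not: assumes "pdef1 M E P" shows "ae (\<lambda>i. \<not> P i) \<longleftrightarrow> \<not> ae P"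
proof
  assume "ae (\<lambda>i. \<not> P i)"
  then show "\<not> ae P" using ae_ex[OF ae_conj, of "\<lambda>i. \<not> P i" P] by blast
next
  assume n: "\<not> ae P"
  have s: "small {i \<in> els X. P i}" by (rule separation_els[OF X_in_M assms])
  have s': "small {i \<in> els X. \<not> P i}" by (rule separation_els[OF X_in_M pdef_not[OF assms]])
  have "\<forall>A\<in>M. \<forall>B\<in>M. is_subset M E A X \<and> (\<forall>i\<in>M. E i B \<longleftrightarrow> E i X \<and> \<not> E i A) \<longrightarrow> E A U \<or> E B U"
    using is_ultrafilter unfolding is_ultrafilter_on_def by (elim conjE)
  moreover have "is_subset M E (mk {i \<in> els X. P i}) X"
    unfolding is_subset_iff els_mk[OF s] by blast
  moreover have "\<forall>i\<in>M. E i (mk {i \<in> els X. \<not> P i}) \<longleftrightarrow> E i X \<and> \<not> E i (mk {i \<in> els X. P i})"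
    by (auto simp: E_els els_mk[OF s] els_mk[OF s'])
  ultimately have "E (mk {i \<in> els X. P i}) U \<or> E (mk {i \<in> els X. \<not> P i}) U"
    using mk_in_M[OF s] mk_in_M[OF s'] by blast
  moreover have "\<not> E (mk {i \<in> els X. P i}) U" using n aeI[OF mk_in_M[OF s] _ els_mk[OF s]] by blast
  ultimately show "ae (\<lambda>i. \<not> P i)" using aeI[OF mk_in_M[OF s'] _ els_mk[OF s']] by blast
qed

lemma ae_const: "ae (\<lambda>i. b) \<longleftrightarrow> b"
  using ae_True ae_ex[of "\<lambda>i. b"] by (cases b) auto

abbreviation funs :: "'v set" where "funs \<equiv> ult_funs M E U"

lemma funs_iff: "f \<in> funs \<longleftrightarrow> f \<in> M \<and> is_fun_on M E f X"
  unfolding ult_funs_def using is_union_iff[OF U_in_M] X_in_M by (auto simp: X_def)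

lemma lam_funs: "tdef1 M E F \<Longrightarrow> lam X F \<in> funs"
  unfolding funs_iff using lam_in_M[OF X_in_M] is_fun_on_lam[OF X_in_M] by blast

lemma app_lam_X: "tdef1 M E F \<Longrightarrow> i \<in> els X \<Longrightarrow> app (lam X F) i = F i"
  by (rule app_lam[OF X_in_M])

lemma pd_funs: "pdef1 M E (\<lambda>f. f \<in> funs)"
proof -
  have "pdef1 M E (\<lambda>f. is_fun_on M E f X)" by (intro pdi X_in_M)
  then show ?thesis by (rule pdef_cong) (auto simp: funs_iff)
qed

lemma maps_to_funs:
  "f \<in> funs \<Longrightarrow> i \<in> M \<Longrightarrow> a \<in> M \<Longrightarrow> maps_to M E f i a \<longleftrightarrow> i \<in> els X \<and> a = app f i"
  using maps_to_iff E_fun_iff[OF _ X_in_M] by (simp add: funs_iff)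

lemma maps_to_pair:
  assumes "f \<in> funs" "g \<in> funs" "i \<in> M"
  shows "(\<exists>a\<in>M. \<exists>b\<in>M. maps_to M E f i a \<and> maps_to M E g i b \<and> P a b) \<longleftrightarrow>
    E i X \<and> P (app f i) (app g i)"
  using maps_to_funs[OF assms(1,3)] maps_to_funs[OF assms(2,3)] app_in_M assms(3)
  by (auto simp: els_iff)

lemma ult_eq_iff: "f \<in> funs \<Longrightarrow> g \<in> funs \<Longrightarrow> ult_eq M E U f g \<longleftrightarrow> ae (\<lambda>i. app f i = app g i)"
  unfolding ult_eq_def ae_def using maps_to_pair[of f g _ "(=)"]
  by (intro bex_cong[OF refl] conj_cong[OF refl] ball_cong[OF refl]) simp

lemma ult_mem_iff: "f \<in> funs \<Longrightarrow> g \<in> funs \<Longrightarrow> ult_mem M E U f g \<longleftrightarrow> ae (\<lambda>i. E (app f i) (app g i))"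
  unfolding ult_mem_def ae_def using maps_to_pair[of f g _ E]
  by (intro bex_cong[OF refl] conj_cong[OF refl] ball_cong[OF refl]) simp

lemma funs_in_M: "f \<in> funs \<Longrightarrow> f \<in> M" by (simp add: funs_iff)

text \<open>Countable completeness is stated for internal sequences of sets; Replacement turns the
  definable family S into such a sequence, namely \<open>lam omega F\<close>.\<close>

lemma ae_countable:
  assumes S: "pdef2 M E S" and ae: "\<And>n. n \<in> els omega \<Longrightarrow> ae (S n)"
  shows "ae (\<lambda>i. \<forall>n\<in>M. E n omega \<longrightarrow> S n i)"
proof -
  note [pdi] = pdef_pred2[OF S]
  have s: "small {i \<in> M. E i X \<and> S n i}" if "n \<in> M" for n
    by (rule small_subset[OF small_els[OF X_in_M]]) (intro pdi X_in_M that, simp add: els_iff)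
  define F where "F n = mk {i \<in> M. E i X \<and> S n i}" for n
  have F: "tdef1 M E F"
    unfolding F_def
  proof (rule td_mk[where P = "\<lambda>e i. E i X \<and> S (e 0) i"])
    show "pdef M E (\<lambda>e. E (e 0) X \<and> S (e (Suc 0)) (e 0))" by (intro pdi X_in_M)
    show "small {i \<in> M. E i X \<and> S (e 0) i}" if "range e \<subseteq> M" for e using s[of "e 0"] that by auto
  qed
  have EF: "E i (F n) \<longleftrightarrow> E i X \<and> S n i" if "i \<in> M" "n \<in> M" for i n
  proof -
    have "E i (F n) \<longleftrightarrow> i \<in> els (F n)" using that by (simp add: els_iff)
    then show ?thesis unfolding F_def els_mk[OF s[OF that(2)]] using that by simp
  qed
  have FU: "E (F n) U" if n: "n \<in> els omega" for n
  proof -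
    obtain A where A: "A \<in> M" "E A U" "els A = {i \<in> els X. S n i}" using aeE[OF ae[OF n]] .
    have "els A = els (F n)" unfolding A(3) F_def els_mk[OF s[OF els_in_M[OF n]]] by (auto simp: els_def)
    then have "A = F n" using els_inject A(1) tdef1_in_M[OF F els_in_M[OF n]] by blast
    with A show ?thesis by simp
  qed
  have P: "pdef1 M E (\<lambda>i. \<forall>n\<in>M. E n omega \<longrightarrow> S n i)" by (intro pdi omega_in_M)
  have sS: "small {i \<in> els X. \<forall>n\<in>M. E n omega \<longrightarrow> S n i}" by (rule separation_els[OF X_in_M P])
  define B where "B = mk {i \<in> els X. \<forall>n\<in>M. E n omega \<longrightarrow> S n i}"
  have B: "B \<in> M" "els B = {i \<in> els X. \<forall>n\<in>M. E n omega \<longrightarrow> S n i}"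
    unfolding B_def by (rule mk_props[OF sS])+
  define G where "G = lam omega F"
  have G: "G \<in> M" "is_fun_on M E G omega"
    unfolding G_def by (rule lam_in_M[OF omega_in_M F], rule is_fun_on_lam[OF omega_in_M F])
  have mG: "maps_to M E G n A \<longleftrightarrow> n \<in> els omega \<and> A = F n" if "n \<in> M" "A \<in> M" for n A
    using maps_to_iff[OF that] E_lam_iff[OF omega_in_M F that] that by (simp add: G_def els_iff)
  have emp: "E emp omega" using emp_omega by (simp add: els_iff)
  have "is_countably_complete M E U" using cc by (simp add: cc_ultrafilter_def)
  then have "is_omega M E omega \<and> is_fun_on M E G omega \<and>
        (\<forall>n\<in>M. \<forall>A\<in>M. E n omega \<and> maps_to M E G n A \<longrightarrow> E A U) \<and>
        (\<forall>i\<in>M. E i B \<longleftrightarrow> (\<forall>n\<in>M. \<forall>A\<in>M. E n omega \<and> maps_to M E G n A \<longrightarrow> E i A))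
        \<longrightarrow> E B U"
    unfolding is_countably_complete_def using omega_in_M G(1) B(1) by blast
  moreover have "\<forall>n\<in>M. \<forall>A\<in>M. E n omega \<and> maps_to M E G n A \<longrightarrow> E A U"
    using mG FU by blast
  moreover have "E i B \<longleftrightarrow> (\<forall>n\<in>M. \<forall>A\<in>M. E n omega \<and> maps_to M E G n A \<longrightarrow> E i A)" if i: "i \<in> M" for i
  proof -
    have "(\<forall>n\<in>M. \<forall>A\<in>M. E n omega \<and> maps_to M E G n A \<longrightarrow> E i A) \<longleftrightarrow>
        (\<forall>n\<in>M. E n omega \<longrightarrow> E i (F n))"
      using mG tdef1_in_M[OF F] by (auto simp: els_iff)
    also have "\<dots> \<longleftrightarrow> E i X \<and> (\<forall>n\<in>M. E n omega \<longrightarrow> S n i)"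
      using EF[OF i] emp emp_in_M by blast
    also have "\<dots> \<longleftrightarrow> i \<in> els B" unfolding B(2) using i by (simp add: els_iff)
    also have "\<dots> \<longleftrightarrow> E i B" using i by (simp add: els_iff)
    finally show ?thesis by simp
  qed
  ultimately have "E B U" using is_omega_omega G(2) by blast
  then show ?thesis by (rule aeI[OF B(1) _ B(2)])
qed

section \<open>Well-foundedness of membership modulo the ultrafilter\<close>

definition memU :: "'v \<Rightarrow> 'v \<Rightarrow> bool" where "memU h f \<longleftrightarrow> ae (\<lambda>i. E (app h i) (app f i))"

lemma pd_memU [pdi]:
  assumes "tdef M E t" "tdef M E u" shows "pdef M E (\<lambda>e. memU (t e) (u e))"
proof (rule pdef_pred2[OF _ assms])
  show "pdef2 M E memU"
    unfolding memU_def by (rule pd_ae[where P = "\<lambda>e i. E (app (e 0) i) (app (e (Suc 0)) i)"]) (intro pdi)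
qed

text \<open>Otherwise choice and recursion on omega produce an internal sequence F in which each F
  (suc n) is below F n modulo U. Countable completeness finds a single index i witnessing all these
  steps, and the values \<open>app (F n) i\<close> violate Foundation. The sequence has to be built
  inside M, since Foundation speaks of internal sets only.\<close>

lemma memU_wf:
  assumes z: "z \<in> M" "els z \<noteq> {}" shows "\<exists>m\<in>els z. \<forall>h\<in>els z. \<not> memU h m"
proof (rule ccontr)
  assume no: "\<not> (\<exists>m\<in>els z. \<forall>h\<in>els z. \<not> memU h m)"
  have "pdef2 M E (\<lambda>m h. E h z \<and> memU h m)" by (intro pdi z(1))
  moreover have "\<exists>h\<in>M. E h z \<and> memU h m" if "m \<in> els z" for m
    using no that by (auto simp: els_def)
  ultimately obtain s where s: "s \<in> M" "is_fun_on M E s z"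
    "\<And>m. m \<in> els z \<Longrightarrow> E (app s m) z \<and> memU (app s m) m"
    using choice[OF z(1), of "\<lambda>m h. E h z \<and> memU h m"] by blast
  obtain z0 where z0: "z0 \<in> els z" using z(2) by blast
  \<comment> \<open>The recursion hands over all earlier values. This term extracts the one at the
    predecessor m of n and applies s to it; it is empty when n is not a successor.\<close>
  define step where "step n f = mk {v \<in> M. \<exists>m\<in>M. n = suc m \<and> E v (app s (app f m))}" for n f
  have suc_inj: "m = m'" if "m \<in> M" "m' \<in> M" "suc m = suc m'" for m m'
  proof -
    have "insert m (els m) = insert m' (els m')" using that els_suc by metis
    then have "m \<in> insert m' (els m')" "m' \<in> insert m (els m)" by (metis insertI1)+
    then show ?thesis using not_mem_cycle[OF that(1,2)] that(1,2) by (auto simp: els_iff)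
  qed
  have ss: "small {v \<in> M. \<exists>m\<in>M. n = suc m \<and> E v (app s (app f m))}" if "n \<in> M" "f \<in> M" for n f
  proof (cases "\<exists>m\<in>M. n = suc m")
    case True
    then obtain m where m: "m \<in> M" "n = suc m" by blast
    have "{v \<in> M. \<exists>m\<in>M. n = suc m \<and> E v (app s (app f m))} = els (app s (app f m))"
      using m suc_inj by (auto simp: els_def)
    then show ?thesis using small_els[OF app_in_M] by simp
  next
    case False
    then have e: "{v \<in> M. \<exists>m\<in>M. n = suc m \<and> E v (app s (app f m))} = {}" by blast
    show ?thesis unfolding e by (rule small_empty)
  qed
  have step_suc: "step (suc m) f = app s (app f m)" if "m \<in> M" "f \<in> M" for m f
  proof -
    have "els (step (suc m) f) = els (app s (app f m))"
      unfolding step_def els_mk[OF ss[OF suc_in_M[OF that(1)] that(2)]]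
      using that suc_inj by (auto simp: els_def)
    then show ?thesis
      using els_inject app_in_M mk_in_M[OF ss[OF suc_in_M[OF that(1)] that(2)]]
      unfolding step_def by blast
  qed
  have tstep: "tdef2 M E step"
    unfolding step_def
  proof (rule td_mk[where P = "\<lambda>e v. \<exists>m\<in>M. e 0 = suc m \<and> E v (app s (app (e (Suc 0)) m))"])
    show "pdef M E (\<lambda>e. \<exists>m\<in>M. e (Suc 0) = suc m \<and> E (e 0) (app s (app (e (Suc (Suc 0))) m)))"
      by (intro pdi s(1))
    show "small {v \<in> M. \<exists>m\<in>M. e 0 = suc m \<and> E v (app s (app (e (Suc 0)) m))}"
      if "range e \<subseteq> M" for e using ss[of "e 0" "e (Suc 0)"] that by auto
  qed
  define G where "G n f = (if n = emp then z0 else step n f)" for n f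
  have "tdef2 M E G"
    unfolding G_def by (intro td_if pdi tdef_comp2[OF tstep] emp_in_M els_in_M[OF z0])
  from recursion[OF locally_wf_mem_set[OF omega_in_M] this] obtain F where F: "tdef1 M E F"
    "\<And>n. n \<in> M \<Longrightarrow> E n omega \<Longrightarrow> F n = G n (lam (mk {m \<in> M. E m omega \<and> E m n}) F)" by blast
  have F0: "F emp = z0"
    using F(2)[OF emp_in_M els_memI[OF emp_omega]] by (simp add: G_def)
  have FS: "F (suc n) = app s (F n)" if n: "n \<in> els omega" for n
  proof -
    have nM: "n \<in> M" by (rule els_in_M[OF n])
    have sn: "suc n \<in> M" "E (suc n) omega" using suc_omega[OF n] by (simp_all add: els_iff)
    have sp: "small {m \<in> M. E m omega \<and> E m (suc n)}"
      by (rule small_pred[OF locally_wf_mem_set[OF omega_in_M] sn])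
    have nin: "n \<in> els (suc n)" unfolding els_suc[OF nM] by simp
    then have "suc n \<noteq> emp" using els_emp by auto
    moreover have "app (lam (mk {m \<in> M. E m omega \<and> E m (suc n)}) F) n = F n"
      by (rule app_lam[OF mk_in_M[OF sp] F(1)]) (use n nin in \<open>simp add: els_mk[OF sp] els_iff\<close>)
    ultimately show ?thesis
      using F(2)[OF sn] step_suc[OF nM lam_in_M[OF mk_in_M[OF sp] F(1)]] by (simp add: G_def)
  qed
  have Fz: "F n \<in> els z" if n: "n \<in> els omega" for n
  proof -
    have sv: "small {n \<in> els omega. E (F n) z}"
      by (rule separation_els[OF omega_in_M]) (intro pdi z(1) tdef_comp1[OF F(1)])
    have "els omega \<subseteq> els (mk {n \<in> els omega. E (F n) z})"
    proof (rule omega_least[OF mk_in_M[OF sv]])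
      show "emp \<in> els (mk {n \<in> els omega. E (F n) z})"
        unfolding els_mk[OF sv] using F0 z0 emp_omega by (simp add: els_iff)
      fix x assume "x \<in> els (mk {n \<in> els omega. E (F n) z})"
      then have x: "x \<in> els omega" "E (F x) z" unfolding els_mk[OF sv] by auto
      then have "F x \<in> els z" using tdef1_in_M[OF F(1) els_in_M] by (simp add: els_iff)
      then have "E (F (suc x)) z" using s(3) FS[OF x(1)] by simp
      then show "suc x \<in> els (mk {n \<in> els omega. E (F n) z})"
        unfolding els_mk[OF sv] using suc_omega[OF x(1)] by simp
    qed
    with n have "E (F n) z" unfolding els_mk[OF sv] by blast
    then show ?thesis using tdef1_in_M[OF F(1) els_in_M[OF n]] by (simp add: els_iff)
  qed
  have "pdef2 M E (\<lambda>n i. E (app (F (suc n)) i) (app (F n) i))"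
    by (intro pdi tdef_comp1[OF F(1)])
  moreover have "ae (\<lambda>i. E (app (F (suc n)) i) (app (F n) i))" if "n \<in> els omega" for n
    using s(3)[OF Fz[OF that]] FS[OF that] by (simp add: memU_def)
  ultimately have "ae (\<lambda>i. \<forall>n\<in>M. E n omega \<longrightarrow> E (app (F (suc n)) i) (app (F n) i))"
    by (rule ae_countable)
  then obtain i where i: "i \<in> els X"
    "\<And>n. n \<in> els omega \<Longrightarrow> E (app (F (suc n)) i) (app (F n) i)"
    using ae_ex by (metis (no_types, lifting) els_iff)
  have sb: "small ((\<lambda>n. app (F n) i) ` els omega)"
    by (rule small_image[OF small_els[OF omega_in_M]]) (intro pdi tdef_comp1[OF F(1)] els_in_M[OF i(1)])
  have "els (mk ((\<lambda>n. app (F n) i) ` els omega)) \<noteq> {}" unfolding els_mk[OF sb] using emp_omega by blast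
  then obtain v where v: "v \<in> (\<lambda>n. app (F n) i) ` els omega"
    "\<And>y. y \<in> els v \<Longrightarrow> y \<notin> (\<lambda>n. app (F n) i) ` els omega"
    using foundation[OF mk_in_M[OF sb]] unfolding els_mk[OF sb] by metis
  then obtain n where n: "n \<in> els omega" "v = app (F n) i" by blast
  have "app (F (suc n)) i \<in> els v" using i(2)[OF n(1)] n(2) app_in_M by (simp add: els_iff)
  then show False using v(2) suc_omega[OF n(1)] by blast
qed

subsection \<open>Existence of the transitive collapse\<close>

text \<open>
  The predecessors of \<open>f\<close> modulo the ultrafilter form a proper class; \<open>pred_fun\<close> selects a set of
  representatives.
\<close>

definition pred_fun :: "'v \<Rightarrow> 'v \<Rightarrow> bool" where
  "pred_fun h f \<longleftrightarrow> memU h f \<and> (\<forall>i\<in>M. E i X \<longrightarrow> E (app h i) (app f i) \<or> app h i = emp)"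

lemma pd_pred_fun: "pdef2 M E pred_fun"
  unfolding pred_fun_def by (intro pdi X_in_M emp_in_M)

text \<open>The functions from X into a transitive set t that contains \<open>emp\<close> and the
  values of f form a set. It is closed under predecessors, whose values are \<open>emp\<close> or
  elements of elements of t. Minimal elements come from \<open>memU_wf\<close>.\<close>

lemma locally_wf_pred_fun: "locally_wf (\<lambda>f. f \<in> funs) pred_fun"
  unfolding locally_wf_def
proof (intro conjI ballI impI pd_funs pd_pred_fun)
  fix f assume "f \<in> M" and f: "f \<in> funs"
  note fM = \<open>f \<in> M\<close>
  \<comment> \<open>\<open>suc emp\<close> is {emp}, so the union of the displayed pair consists of
    \<open>emp\<close> and the double union of f, where all values of f are found.\<close>
  obtain t where t: "t \<in> M" "els (un (upr (suc emp) (un (un f)))) \<subseteq> els t" "tran t"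
    using transitive_superset[OF un_in_M[OF upr_in_M[OF suc_in_M[OF emp_in_M] un_in_M[OF un_in_M[OF fM]]]]]
    by blast
  have e: "els (un (upr (suc emp) (un (un f)))) = insert emp (els (un (un f)))"
    using els_un[OF upr_in_M[OF suc_in_M[OF emp_in_M] un_in_M[OF un_in_M[OF fM]]]]
      els_upr[OF suc_in_M[OF emp_in_M] un_in_M[OF un_in_M[OF fM]]] els_suc[OF emp_in_M] els_emp
    by simp
  have et: "emp \<in> els t" using t(2) e by blast
  have P: "pdef1 M E (\<lambda>h. is_fun_on M E h X \<and> (\<forall>i\<in>M. E i X \<longrightarrow> E (app h i) t))"
    by (intro pdi X_in_M t(1))
  have s: "small {h \<in> M. is_fun_on M E h X \<and> (\<forall>i\<in>M. E i X \<longrightarrow> E (app h i) t)}"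
  proof (rule small_subset[OF small_Pow[OF times_in_M[OF X_in_M t(1)]] P])
    fix h assume h: "h \<in> M" "is_fun_on M E h X \<and> (\<forall>i\<in>M. E i X \<longrightarrow> E (app h i) t)"
    have "els h \<subseteq> els (times X t)"
    proof
      fix p assume p: "p \<in> els h"
      then obtain i v where iv: "p = opr i v" "i \<in> els X" "v \<in> M"
        using h is_fun_on_iff[OF h(1) X_in_M] by blast
      then have "v = app h i"
        using p E_fun_iff[OF h(1) X_in_M _ els_in_M[OF iv(2)] iv(3)] h(2) els_memI by blast
      moreover have "E (app h i) t" using h(2) iv(2) by (simp add: els_iff)
      ultimately have "v \<in> els t" using iv(3) by (simp add: els_iff)
      then show "p \<in> els (times X t)" unfolding els_times[OF X_in_M t(1)] using iv by blast
    qed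
    with h(1) show "h \<in> {x \<in> M. els x \<subseteq> els (times X t)}" by blast
  qed
  define d where "d = mk {h \<in> M. is_fun_on M E h X \<and> (\<forall>i\<in>M. E i X \<longrightarrow> E (app h i) t)}"
  have d: "d \<in> M" "els d = {h \<in> M. is_fun_on M E h X \<and> (\<forall>i\<in>M. E i X \<longrightarrow> E (app h i) t)}"
    unfolding d_def by (rule mk_props[OF s])+
  show "\<exists>d\<in>M. E f d \<and> (\<forall>y\<in>els d. y \<in> funs \<and> (\<forall>z\<in>M. z \<in> funs \<and> pred_fun z y \<longrightarrow> E z d))"
  proof (rule bexI[OF _ d(1)], intro conjI ballI impI)
    have "E (app f i) t" if i: "i \<in> M" "E i X" for i
    proof -
      have "E (opr i (app f i)) f"
        using fun_app[OF fM X_in_M] f i by (simp add: funs_iff els_iff)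
      then have "app f i \<in> els (un (un f))" using E_opr_parts(2)[OF i(1) app_in_M fM] by blast
      then have "app f i \<in> els t" using t(2) e by blast
      then show ?thesis by (rule els_memI)
    qed
    then have "f \<in> els d" unfolding d(2) using f by (simp add: funs_iff)
    then show "E f d" by (rule els_memI)
    fix y assume "y \<in> els d"
    then have y: "y \<in> M" "is_fun_on M E y X" "\<And>i. i \<in> M \<Longrightarrow> E i X \<Longrightarrow> E (app y i) t"
      unfolding d(2) by blast+
    then show "y \<in> funs" by (simp add: funs_iff)
    fix z assume z: "z \<in> M" "z \<in> funs \<and> pred_fun z y"
    have "E (app z i) t" if i: "i \<in> M" "E i X" for i
    proof -
      have yt: "app y i \<in> els t" using y(3)[OF i] app_in_M by (simp add: els_iff)
      from z(2) i have "E (app z i) (app y i) \<or> app z i = emp" unfolding pred_fun_def by blast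
      then have "app z i \<in> els t"
        using transD[OF t(3) yt] et app_in_M[of z i] by (auto simp: els_iff[of _ "app y i"])
      then show ?thesis by (rule els_memI)
    qed
    then have "z \<in> els d" unfolding d(2) using z by (simp add: funs_iff)
    then show "E z d" by (rule els_memI)
  qed
next
  fix z assume "z \<in> M" "els z \<noteq> {} \<and> (\<forall>y\<in>els z. y \<in> funs)"
  then obtain m where "m \<in> els z" "\<And>h. h \<in> els z \<Longrightarrow> \<not> memU h m" using memU_wf by blast
  then show "\<exists>m\<in>els z. \<forall>y\<in>els z. \<not> pred_fun y m" unfolding pred_fun_def by blast
qed

lemma if_fun:
  assumes "pdef1 M E P" "f \<in> M"
  shows "lam X (\<lambda>i. if P i then app f i else emp) \<in> funs"
    "i \<in> els X \<Longrightarrow> app (lam X (\<lambda>i. if P i then app f i else emp)) i = (if P i then app f i else emp)"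
proof -
  have t: "tdef1 M E (\<lambda>i. if P i then app f i else emp)"
    by (intro td_if assms(1) pdi assms(2) emp_in_M)
  show "lam X (\<lambda>i. if P i then app f i else emp) \<in> funs" by (rule lam_funs[OF t])
  show "app (lam X (\<lambda>i. if P i then app f i else emp)) i = (if P i then app f i else emp)"
    if "i \<in> els X" using app_lam_X[OF t that] .
qed

lemma pd_app_eq: "f \<in> M \<Longrightarrow> g \<in> M \<Longrightarrow> pdef1 M E (\<lambda>i. app f i = app g i)" by (intro pdi)
lemma pd_app_mem: "f \<in> M \<Longrightarrow> g \<in> M \<Longrightarrow> pdef1 M E (\<lambda>i. E (app f i) (app g i))" by (intro pdi)

text \<open>Changing \<open>h\<close> to \<open>emp\<close> off a large set produces a representative.\<close>

lemma pred_fun_repr: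
  assumes h: "h \<in> funs" and f: "f \<in> funs" and hf: "ae (\<lambda>i. E (app h i) (app f i))"
  obtains h' where "h' \<in> funs" "pred_fun h' f" "ae (\<lambda>i. app h i = app h' i)"
proof -
  note hM = funs_in_M[OF h] and fM = funs_in_M[OF f]
  define h' where "h' = lam X (\<lambda>i. if E (app h i) (app f i) then app h i else emp)"
  note ifs = if_fun[OF pd_app_mem[OF hM fM] hM, folded h'_def]
  have "ae (\<lambda>i. E (app h' i) (app f i))"
    by (rule ae_mono[OF hf pd_app_mem[OF funs_in_M[OF ifs(1)] fM]]) (simp add: ifs(2))
  moreover have "E (app h' i) (app f i) \<or> app h' i = emp" if "i \<in> els X" for i
    using ifs(2)[OF that] by auto
  ultimately have "pred_fun h' f" unfolding pred_fun_def memU_def by (simp add: els_iff)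
  moreover have "ae (\<lambda>i. app h i = app h' i)"
    by (rule ae_mono[OF hf pd_app_eq[OF hM funs_in_M[OF ifs(1)]]]) (simp add: ifs(2))
  ultimately show thesis using that ifs(1) by blast
qed

lemma ae_app_mem_cong:
  assumes "ae (\<lambda>i. app f i = app f' i)" "ae (\<lambda>i. app g i = app g' i)"
    "ae (\<lambda>i. E (app f i) (app g i))" "f' \<in> M" "g' \<in> M"
  shows "ae (\<lambda>i. E (app f' i) (app g' i))"
  by (rule ae_mono[OF ae_conj[OF ae_conj[OF assms(1,2)] assms(3)] pd_app_mem[OF assms(4,5)]]) auto

lemma ae_app_eq_sym: "ae (\<lambda>i. app f i = app g i) \<longleftrightarrow> ae (\<lambda>i. app g i = app f i)"
  by (rule ae_cong) auto

lemma ae_app_refl: "ae (\<lambda>i. app f i = app f i)"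
  using ae_True by simp

text \<open>The map \<pi> is the collapse along \<open>pred_fun\<close>. The predecessors of f
  depend on the representative f and not just on its class, so both directions of the equivalence
  between \<pi> f = \<pi> g and equality modulo U need an induction, \<open>eq1\<close> and
  \<open>eq2\<close>; \<open>pred_fun_repr\<close> moves representatives from one function to
  another.\<close>

theorem ult_collapse_exists: "\<exists>\<pi>. is_ult_collapse M E U \<pi>"
proof -
  have "tdef2 M E (\<lambda>x f. rng f)" by (rule tdef_comp1[OF td_rng td_var])
  from recursion[OF locally_wf_pred_fun this] obtain \<pi> where \<pi>: "tdef1 M E \<pi>"
    "\<And>f. f \<in> M \<Longrightarrow> f \<in> funs \<Longrightarrow> \<pi> f = rng (lam (mk {h \<in> M. h \<in> funs \<and> pred_fun h f}) \<pi>)" by blast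
  have \<pi>M: "\<pi> f \<in> M" if "f \<in> funs" for f using tdef1_in_M[OF \<pi>(1) funs_in_M[OF that]] .
  have els\<pi>: "els (\<pi> f) = \<pi> ` {h \<in> funs. pred_fun h f}" if f: "f \<in> funs" for f
  proof -
    have s: "small {h \<in> M. h \<in> funs \<and> pred_fun h f}"
      by (rule small_pred[OF locally_wf_pred_fun funs_in_M[OF f] f])
    have "{h \<in> M. h \<in> funs \<and> pred_fun h f} = {h \<in> funs. pred_fun h f}" using funs_in_M by blast
    then show ?thesis
      unfolding \<pi>(2)[OF funs_in_M[OF f] f] els_rng_lam[OF mk_in_M[OF s] \<pi>(1)] els_mk[OF s] by simp
  qed
  have pfD: "ae (\<lambda>i. E (app h i) (app f i))" if "pred_fun h f" for h f
    using that unfolding pred_fun_def memU_def by blast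
  have pdq: "pdef2 M E (\<lambda>f g. ae (\<lambda>i. app f i = app g i))"
    by (rule pd_ae[where P = "\<lambda>e i. app (e 0) i = app (e (Suc 0)) i"]) (intro pdi)
  have eq1: "\<pi> f = \<pi> g" if "f \<in> funs" "g \<in> funs" "ae (\<lambda>i. app f i = app g i)" for f g
  proof -
    define Q where "Q f \<longleftrightarrow> (\<forall>g\<in>M. g \<in> funs \<and> ae (\<lambda>i. app f i = app g i) \<longrightarrow> \<pi> f = \<pi> g)" for f
    have "Q f"
    proof (rule class_induct[OF locally_wf_pred_fun, where P = Q])
      show "pdef1 M E Q" unfolding Q_def
        by (intro pdi pdef_pred1[OF pd_funs] pdef_pred2[OF pdq] tdef_comp1[OF \<pi>(1)])
      fix f assume f: "f \<in> M" "f \<in> funs" and IH: "\<And>z. z \<in> M \<Longrightarrow> z \<in> funs \<Longrightarrow> pred_fun z f \<Longrightarrow> Q z"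
      show "Q f" unfolding Q_def
      proof (intro ballI impI)
        fix g assume g: "g \<in> M" "g \<in> funs \<and> ae (\<lambda>i. app f i = app g i)"
        have "els (\<pi> f) \<subseteq> els (\<pi> g)"
        proof
          fix v assume "v \<in> els (\<pi> f)"
          then obtain h where h: "h \<in> funs" "pred_fun h f" "v = \<pi> h" unfolding els\<pi>[OF f(2)] by blast
          have "ae (\<lambda>i. E (app h i) (app g i))"
            using ae_app_mem_cong[OF ae_app_refl conjunct2[OF g(2)] pfD[OF h(2)] funs_in_M[OF h(1)] g(1)] .
          then obtain h' where h': "h' \<in> funs" "pred_fun h' g" "ae (\<lambda>i. app h i = app h' i)"
            using pred_fun_repr[OF h(1)] g(2) by blast
          have "\<pi> h = \<pi> h'"
            using IH[OF funs_in_M[OF h(1)] h(1,2)] h' funs_in_M[OF h'(1)] unfolding Q_def by blast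
          then show "v \<in> els (\<pi> g)" unfolding els\<pi>[OF conjunct1[OF g(2)]] using h h' by blast
        qed
        moreover have "els (\<pi> g) \<subseteq> els (\<pi> f)"
        proof
          fix v assume "v \<in> els (\<pi> g)"
          then obtain h where h: "h \<in> funs" "pred_fun h g" "v = \<pi> h"
            unfolding els\<pi>[OF conjunct1[OF g(2)]] by blast
          have "ae (\<lambda>i. E (app h i) (app f i))"
            using ae_app_mem_cong[OF ae_app_refl _ pfD[OF h(2)] funs_in_M[OF h(1)] f(1)]
              conjunct2[OF g(2)] ae_app_eq_sym by blast
          then obtain h' where h': "h' \<in> funs" "pred_fun h' f" "ae (\<lambda>i. app h i = app h' i)"
            using pred_fun_repr[OF h(1) f(2)] by blast
          have "\<pi> h' = \<pi> h"
            using IH[OF funs_in_M[OF h'(1)] h'(1,2)] h h'(3) funs_in_M[OF h(1)] ae_app_eq_sym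
            unfolding Q_def by blast
          moreover have "\<pi> h' \<in> \<pi> ` {h \<in> funs. pred_fun h f}" using h' by blast
          ultimately show "v \<in> els (\<pi> f)" unfolding els\<pi>[OF f(2)] h(3) by simp
        qed
        ultimately show "\<pi> f = \<pi> g" using els_inject[OF \<pi>M[OF f(2)] \<pi>M] g(2) by blast
      qed
    qed (use that funs_in_M in blast)+
    then show ?thesis using that funs_in_M unfolding Q_def by blast
  qed
  have mem1: "\<pi> h \<in> els (\<pi> f)" if hf: "h \<in> funs" "f \<in> funs" "ae (\<lambda>i. E (app h i) (app f i))" for h f
  proof -
    obtain h' where h': "h' \<in> funs" "pred_fun h' f" "ae (\<lambda>i. app h i = app h' i)"
      using pred_fun_repr[OF hf] .
    then show ?thesis unfolding els\<pi>[OF hf(2)] using eq1[OF hf(1) h'(1,3)] by blast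
  qed
  \<comment> \<open>Choice picks, at each i where this is possible, an element of
    \<open>app f i\<close> outside \<open>app g i\<close>; together these form a function separating
    f from g modulo U.\<close>
  have diff: "\<exists>h\<in>funs. ae (\<lambda>i. E (app h i) (app f i)) \<and> ae (\<lambda>i. \<not> E (app h i) (app g i))"
    if f: "f \<in> funs" and g: "g \<in> funs" and fg: "ae (\<lambda>i. \<exists>v\<in>M. E v (app f i) \<and> \<not> E v (app g i))" for f g
  proof -
    note fM = funs_in_M[OF f] and gM = funs_in_M[OF g]
    define Q where "Q i v \<longleftrightarrow> (\<exists>v\<in>M. E v (app f i) \<and> \<not> E v (app g i)) \<longrightarrow>
      E v (app f i) \<and> \<not> E v (app g i)" for i v
    have Q: "pdef2 M E Q" unfolding Q_def by (intro pdi fM gM)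
    have "\<exists>y\<in>M. Q i y" for i unfolding Q_def using emp_in_M by blast
    from choice[OF X_in_M Q this] obtain h where h: "h \<in> M" "is_fun_on M E h X"
      "\<And>i. i \<in> els X \<Longrightarrow> Q i (app h i)" by blast
    have "ae (\<lambda>i. E (app h i) (app f i))"
      by (rule ae_mono[OF fg pd_app_mem[OF h(1) fM]]) (use h(3) in \<open>unfold Q_def, blast\<close>)
    moreover have "ae (\<lambda>i. \<not> E (app h i) (app g i))"
      by (rule ae_mono[OF fg pdef_not[OF pd_app_mem[OF h(1) gM]]]) (use h(3) in \<open>unfold Q_def, blast\<close>)
    ultimately show ?thesis using h(1,2) funs_iff by blast
  qed
  have eq2: "ae (\<lambda>i. app f i = app g i)" if "f \<in> funs" "g \<in> funs" "\<pi> f = \<pi> g" for f g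
  proof -
    define Q where "Q f \<longleftrightarrow> (\<forall>g\<in>M. g \<in> funs \<and> \<pi> f = \<pi> g \<longrightarrow> ae (\<lambda>i. app f i = app g i))" for f
    have "Q f"
    proof (rule class_induct[OF locally_wf_pred_fun, where P = Q])
      show "pdef1 M E Q" unfolding Q_def
        by (intro pdi pdef_pred1[OF pd_funs] pdef_pred2[OF pdq] tdef_comp1[OF \<pi>(1)])
      fix f assume f: "f \<in> M" "f \<in> funs" and IH: "\<And>z. z \<in> M \<Longrightarrow> z \<in> funs \<Longrightarrow> pred_fun z f \<Longrightarrow> Q z"
      show "Q f" unfolding Q_def
      proof (intro ballI impI, rule ccontr)
        fix g assume g': "g \<in> M" "g \<in> funs \<and> \<pi> f = \<pi> g" and n: "\<not> ae (\<lambda>i. app f i = app g i)"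
        note g = conjunct1[OF g'(2)] and fg = conjunct2[OF g'(2)]
        define A where "A i \<longleftrightarrow> (\<exists>v\<in>M. E v (app f i) \<and> \<not> E v (app g i))" for i
        define B where "B i \<longleftrightarrow> (\<exists>v\<in>M. E v (app g i) \<and> \<not> E v (app f i))" for i
        have A: "pdef1 M E A" unfolding A_def by (intro pdi f g')
        have B: "pdef1 M E B" unfolding B_def by (intro pdi f g')
        \<comment> \<open>If neither one-sided difference occurred on a set in U, extensionality
          would make f and g agree on a set in U.\<close>
        have "ae A \<or> ae B"
        proof (rule ccontr)
          assume "\<not> (ae A \<or> ae B)"
          then have "ae (\<lambda>i. \<not> A i)" "ae (\<lambda>i. \<not> B i)" using ae_not[OF A] ae_not[OF B] by blast+
          from ae_conj[OF this] have "ae (\<lambda>i. app f i = app g i)"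
          proof (rule ae_mono[OF _ pd_app_eq[OF f(1) g'(1)]])
            fix i assume "\<not> A i \<and> \<not> B i"
            then have "els (app f i) = els (app g i)" unfolding A_def B_def by (auto simp: els_def)
            then show "app f i = app g i" using els_inject app_in_M by blast
          qed
          with n show False ..
        qed
        then show False
        proof
          assume "ae A"
          then obtain h where h: "h \<in> funs" "ae (\<lambda>i. E (app h i) (app f i))"
            "ae (\<lambda>i. \<not> E (app h i) (app g i))" using diff[OF f(2) g] unfolding A_def by blast
          obtain h' where h': "h' \<in> funs" "pred_fun h' f" "ae (\<lambda>i. app h i = app h' i)"
            using pred_fun_repr[OF h(1) f(2) h(2)] .
          have "\<pi> h' \<in> els (\<pi> g)" unfolding fg[symmetric] els\<pi>[OF f(2)] using h' by blast
          then obtain k where k: "k \<in> funs" "pred_fun k g" "\<pi> h' = \<pi> k" unfolding els\<pi>[OF g] by blast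
          have "ae (\<lambda>i. app h' i = app k i)"
            using IH[OF funs_in_M[OF h'(1)] h'(1,2)] k funs_in_M[OF k(1)] unfolding Q_def by blast
          then have "ae (\<lambda>i. (app h i = app h' i \<and> app h' i = app k i) \<and> (E (app k i) (app g i) \<and>
              \<not> E (app h i) (app g i)))"
            by (intro ae_conj h' pfD[OF k(2)] h(3))
          from ae_ex[OF this] show False by auto
        next
          assume "ae B"
          then obtain h where h: "h \<in> funs" "ae (\<lambda>i. E (app h i) (app g i))"
            "ae (\<lambda>i. \<not> E (app h i) (app f i))" using diff[OF g f(2)] unfolding B_def by blast
          have "\<pi> h \<in> els (\<pi> f)" unfolding fg using mem1[OF h(1) g h(2)] .
          then obtain k where k: "k \<in> funs" "pred_fun k f" "\<pi> h = \<pi> k" unfolding els\<pi>[OF f(2)] by blast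
          have "ae (\<lambda>i. app k i = app h i)"
            using IH[OF funs_in_M[OF k(1)] k(1,2)] k(3) h(1) funs_in_M[OF h(1)] unfolding Q_def by metis
          then have "ae (\<lambda>i. app k i = app h i \<and> (E (app k i) (app f i) \<and>
              \<not> E (app h i) (app f i)))"
            by (intro ae_conj pfD[OF k(2)] h(3))
          from ae_ex[OF this] show False by auto
        qed
      qed
    qed (use that funs_in_M in blast)+
    then show ?thesis using that funs_in_M unfolding Q_def by blast
  qed
  have mem2: "ae (\<lambda>i. E (app h i) (app f i))" if hf: "h \<in> funs" "f \<in> funs" "\<pi> h \<in> els (\<pi> f)" for h f
  proof -
    obtain k where k: "k \<in> funs" "pred_fun k f" "\<pi> h = \<pi> k"
      using hf(3) unfolding els\<pi>[OF hf(2)] by blast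
    have "ae (\<lambda>i. app k i = app h i)" using eq2[OF k(1) hf(1)] k(3) by simp
    from ae_app_mem_cong[OF this ae_app_refl pfD[OF k(2)] funs_in_M[OF hf(1)] funs_in_M[OF hf(2)]]
    show ?thesis .
  qed
  have "is_ult_collapse M E U \<pi>"
    unfolding is_ult_collapse_def
  proof (intro conjI ballI impI)
    show "class_function M E \<pi>" unfolding class_function_iff by (rule \<pi>(1))
    fix f assume f: "f \<in> funs"
    { fix g assume g: "g \<in> funs"
      show "\<pi> f = \<pi> g \<longleftrightarrow> ult_eq M E U f g" unfolding ult_eq_iff[OF f g] using eq1 eq2 f g by blast
      have "E (\<pi> f) (\<pi> g) \<longleftrightarrow> \<pi> f \<in> els (\<pi> g)" using \<pi>M[OF f] by (simp add: els_iff)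
      then show "E (\<pi> f) (\<pi> g) \<longleftrightarrow> ult_mem M E U f g"
        unfolding ult_mem_iff[OF f g] using mem1 mem2 f g by blast }
    fix y assume "y \<in> M" "E y (\<pi> f)"
    then have "y \<in> els (\<pi> f)" by (simp add: els_iff)
    then show "y \<in> \<pi> ` funs" unfolding els\<pi>[OF f] by blast
  qed
  then show ?thesis by blast
qed

definition col :: "'v \<Rightarrow> 'v" where "col = ult_collapse M E U"
definition N :: "'v set" where "N = ultrapower M E U"

lemma is_collapse: "is_ult_collapse M E U col"
  unfolding col_def ult_collapse_def by (rule someI_ex[OF ult_collapse_exists])

lemma N_eq: "N = col ` funs" by (simp add: N_def ultrapower_def col_def)

lemma td_col: "tdef1 M E col"
  using is_collapse class_function_iff unfolding is_ult_collapse_def by blast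

lemma col_in_M: "f \<in> funs \<Longrightarrow> col f \<in> M" using tdef1_in_M[OF td_col funs_in_M] .

lemma N_sub: "N \<subseteq> M" unfolding N_eq using col_in_M by blast

lemma col_eq_iff: "f \<in> funs \<Longrightarrow> g \<in> funs \<Longrightarrow> col f = col g \<longleftrightarrow> ae (\<lambda>i. app f i = app g i)"
  using is_collapse ult_eq_iff unfolding is_ult_collapse_def by blast

lemma col_mem_iff: "f \<in> funs \<Longrightarrow> g \<in> funs \<Longrightarrow> E (col f) (col g) \<longleftrightarrow> ae (\<lambda>i. E (app f i) (app g i))"
  using is_collapse ult_mem_iff unfolding is_ult_collapse_def by blast

lemma N_trans: "x \<in> N \<Longrightarrow> y \<in> M \<Longrightarrow> E y x \<Longrightarrow> y \<in> N"
  unfolding N_eq using is_collapse unfolding is_ult_collapse_def by blast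

subsection \<open>The theorem of Los\<close>

text \<open>Choice enters at the quantifier: if the universal statement fails on a set in U, the
  counterexamples at the individual indices are combined into one function g, and the instance at
  the class of g fails too.\<close>

theorem los:
  assumes "\<And>n. f n \<in> funs"
  shows "sat N E (\<lambda>n. col (f n)) p \<longleftrightarrow> ae (\<lambda>i. sat M E (\<lambda>n. app (f n) i) p)"
  using assms
proof (induction p arbitrary: f)
  case (Mem m n)
  then show ?case by (simp add: col_mem_iff)
next
  case (Equ m n)
  then show ?case by (simp add: col_eq_iff)
next
  case (Neg p)
  have "pdef1 M E (\<lambda>i. sat M E (\<lambda>n. app (f n) i) p)"
    by (rule pdef_sat[OF M_nonempty]) (intro pdi funs_in_M[OF Neg.prems])
  from ae_not[OF this] show ?case using Neg.IH[OF Neg.prems] by simp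
next
  case (Conj p q)
  have d: "pdef1 M E (\<lambda>i. sat M E (\<lambda>n. app (f n) i) p)" for p
    by (rule pdef_sat[OF M_nonempty]) (intro pdi funs_in_M[OF Conj.prems])
  have "ae (\<lambda>i. sat M E (\<lambda>n. app (f n) i) p \<and> sat M E (\<lambda>n. app (f n) i) q) \<longleftrightarrow>
      ae (\<lambda>i. sat M E (\<lambda>n. app (f n) i) p) \<and> ae (\<lambda>i. sat M E (\<lambda>n. app (f n) i) q)"
  proof
    assume a: "ae (\<lambda>i. sat M E (\<lambda>n. app (f n) i) p \<and> sat M E (\<lambda>n. app (f n) i) q)"
    show "ae (\<lambda>i. sat M E (\<lambda>n. app (f n) i) p) \<and> ae (\<lambda>i. sat M E (\<lambda>n. app (f n) i) q)"
      by (intro conjI ae_mono[OF a d]) simp_all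
  qed (simp add: ae_conj)
  then show ?case using Conj.IH(1)[OF Conj.prems] Conj.IH(2)[OF Conj.prems] by simp
next
  case (Forall k p)
  define Q where "Q i x \<longleftrightarrow> sat M E ((\<lambda>n. app (f n) i)(k := x)) p" for i x
  have Q: "pdef2 M E Q"
  proof -
    have "tdef M E (\<lambda>e. if n = k then e (Suc 0) else app (f n) (e 0))" for n
      by (cases "n = k") (simp_all add: td_var td_app td_const funs_in_M[OF Forall.prems])
    from pdef_sat[where p = p, OF M_nonempty this] show ?thesis
      unfolding Q_def fun_upd_def by simp
  qed
  note [pdi] = pdef_pred2[OF Q]
  have IH: "sat N E ((\<lambda>n. col (f n))(k := col g)) p \<longleftrightarrow> ae (\<lambda>i. Q i (app g i))"
    if g: "g \<in> funs" for g
  proof -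
    have "sat N E (\<lambda>n. col ((f(k := g)) n)) p \<longleftrightarrow> ae (\<lambda>i. sat M E (\<lambda>n. app ((f(k := g)) n) i) p)"
      by (rule Forall.IH) (use g Forall.prems in auto)
    moreover have "(\<lambda>n. col ((f(k := g)) n)) = (\<lambda>n. col (f n))(k := col g)" by auto
    moreover have "(\<lambda>n. app ((f(k := g)) n) i) = (\<lambda>n. app (f n) i)(k := app g i)" for i by auto
    ultimately show ?thesis by (simp add: Q_def)
  qed
  have dA: "pdef1 M E (\<lambda>i. \<forall>x\<in>M. Q i x)" by (intro pdi)
  have "(\<forall>g\<in>funs. ae (\<lambda>i. Q i (app g i))) \<longleftrightarrow> ae (\<lambda>i. \<forall>x\<in>M. Q i x)"
  proof
    assume a: "ae (\<lambda>i. \<forall>x\<in>M. Q i x)"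
    show "\<forall>g\<in>funs. ae (\<lambda>i. Q i (app g i))"
    proof
      fix g assume g: "g \<in> funs"
      have "pdef1 M E (\<lambda>i. Q i (app g i))" by (intro pdi funs_in_M[OF g])
      then show "ae (\<lambda>i. Q i (app g i))" by (rule ae_mono[OF a]) (use app_in_M in blast)
    qed
  next
    assume all: "\<forall>g\<in>funs. ae (\<lambda>i. Q i (app g i))"
    show "ae (\<lambda>i. \<forall>x\<in>M. Q i x)"
    proof (rule ccontr)
      assume "\<not> ae (\<lambda>i. \<forall>x\<in>M. Q i x)"
      then have n: "ae (\<lambda>i. \<not> (\<forall>x\<in>M. Q i x))" using ae_not[OF dA] by blast
      define R where "R i x \<longleftrightarrow> (\<forall>x\<in>M. Q i x) \<or> \<not> Q i x" for i x
      have R: "pdef2 M E R" unfolding R_def by (intro pdi)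
      have "\<exists>x\<in>M. R i x" for i unfolding R_def using emp_in_M by blast
      from choice[OF X_in_M R this] obtain g where g: "g \<in> M" "is_fun_on M E g X"
        "\<And>i. i \<in> els X \<Longrightarrow> R i (app g i)" by blast
      have "ae (\<lambda>i. Q i (app g i))" using all g funs_iff by blast
      from ae_ex[OF ae_conj[OF this n]] g(3) show False unfolding R_def by blast
    qed
  qed
  moreover have "sat N E (\<lambda>n. col (f n)) (Forall k p) \<longleftrightarrow> (\<forall>g\<in>funs. ae (\<lambda>i. Q i (app g i)))"
    using IH by (simp add: N_eq)
  ultimately show ?case by (simp add: Q_def)
qed

lemma los_fdef:
  assumes P: "fdef E P" and f: "\<And>n. f n \<in> funs"
  shows "P N (\<lambda>n. col (f n)) \<longleftrightarrow> ae (\<lambda>i. P M (\<lambda>n. app (f n) i))"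
proof -
  obtain p where p: "\<And>M s. range s \<subseteq> M \<Longrightarrow> P M s \<longleftrightarrow> sat M E s p"
    using P unfolding fdef_def by blast
  have "range (\<lambda>n. col (f n)) \<subseteq> N" unfolding N_eq using f by blast
  from p[OF this] los[of f p] f
  have "P N (\<lambda>n. col (f n)) \<longleftrightarrow> ae (\<lambda>i. sat M E (\<lambda>n. app (f n) i) p)" by simp
  moreover have "sat M E (\<lambda>n. app (f n) i) p \<longleftrightarrow> P M (\<lambda>n. app (f n) i)" for i
  proof -
    have "range (\<lambda>n. app (f n) i) \<subseteq> M" using app_in_M by blast
    from p[OF this] show ?thesis by simp
  qed
  ultimately show ?thesis by simp
qed

lemma N_env:
  assumes "range s \<subseteq> N" obtains f where "\<And>n. f n \<in> funs" "s = (\<lambda>n. col (f n))"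
proof -
  have "\<forall>n. \<exists>g\<in>funs. s n = col g" using assms unfolding N_eq by blast
  then obtain f where "\<And>n. f n \<in> funs \<and> s n = col (f n)" by metis
  then show thesis using that[of f] by (simp add: fun_eq_iff)
qed

text \<open>A property that holds in M under every assignment holds in N under every assignment.
  Each instance of an axiom schema is such a property of its parameters, which gives Separation and
  Replacement in N with parameters from N.\<close>

lemma fdef_N:
  assumes P: "fdef E P" and s: "range s \<subseteq> N" and all: "\<And>s. range s \<subseteq> M \<Longrightarrow> P M s"
  shows "P N s"
proof -
  obtain f where f: "\<And>n. f n \<in> funs" "s = (\<lambda>n. col (f n))" using N_env[OF s] by blast
  have "P M (\<lambda>n. app (f n) i)" for i by (rule all) (use app_in_M in blast)
  then show ?thesis unfolding f(2) los_fdef[OF P f(1)] using ae_True by simp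
qed

end

lemma fdef_sat_upd: "fdef E (\<lambda>M e. sat M E ((\<lambda>n. e (\<sigma> n))(k := e i)) p)"
proof -
  have eq: "((\<lambda>n. e (\<sigma> n))(k := e i)) = (\<lambda>n. e ((\<sigma>(k := i)) n))" for e :: "nat \<Rightarrow> 'a"
    by auto
  show ?thesis unfolding eq by (rule fdef_sat_subst)
qed

lemma fdef_sat_upd2: "fdef E (\<lambda>M e. sat M E ((\<lambda>n. e (\<sigma> n))(k := e i, l := e j)) p)"
proof -
  have eq: "((\<lambda>n. e (\<sigma> n))(k := e i, l := e j)) = (\<lambda>n. e ((\<sigma>(k := i, l := j)) n))"
    for e :: "nat \<Rightarrow> 'a" by auto
  show ?thesis unfolding eq by (rule fdef_sat_subst)
qed

subsection \<open>Absoluteness for transitive classes\<close>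

definition transitive_in :: "('v \<Rightarrow> 'v \<Rightarrow> bool) \<Rightarrow> 'v set \<Rightarrow> 'v set \<Rightarrow> bool" where
  "transitive_in E M N \<longleftrightarrow> N \<subseteq> M \<and> (\<forall>x\<in>N. \<forall>y\<in>M. E y x \<longrightarrow> y \<in> N)"

lemma ball_abs:
  assumes "transitive_in E M N" "x \<in> N"
  shows "(\<forall>y\<in>N. E y x \<longrightarrow> P y) \<longleftrightarrow> (\<forall>y\<in>M. E y x \<longrightarrow> P y)"
  using assms unfolding transitive_in_def by blast

lemma bex_abs:
  assumes "transitive_in E M N" "x \<in> N"
  shows "(\<exists>y\<in>N. E y x \<and> P y) \<longleftrightarrow> (\<exists>y\<in>M. E y x \<and> P y)"
  using assms unfolding transitive_in_def by blast

lemma is_subset_abs: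
  "transitive_in E M N \<Longrightarrow> x \<in> N \<Longrightarrow> is_subset N E x b \<longleftrightarrow> is_subset M E x b"
  unfolding is_subset_def by (rule ball_abs)

lemma is_ordinal_abs:
  assumes t: "transitive_in E M N" and x: "x \<in> N"
  shows "is_ordinal N E x \<longleftrightarrow> is_ordinal M E x"
proof -
  have N: "y \<in> N" if "y \<in> M" "E y x" for y using t x that unfolding transitive_in_def by blast
  have "(\<forall>y\<in>N. E y x \<longrightarrow> is_subset N E y x) \<longleftrightarrow> (\<forall>y\<in>N. E y x \<longrightarrow> is_subset M E y x)"
    using is_subset_abs[OF t] by blast
  also have "\<dots> \<longleftrightarrow> (\<forall>y\<in>M. E y x \<longrightarrow> is_subset M E y x)" by (rule ball_abs[OF t x])
  finally have 1: "(\<forall>y\<in>N. E y x \<longrightarrow> is_subset N E y x) \<longleftrightarrow>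
      (\<forall>y\<in>M. E y x \<longrightarrow> is_subset M E y x)" .
  have "(\<forall>y\<in>N. \<forall>z\<in>N. E y x \<and> E z x \<longrightarrow> E y z \<or> y = z \<or> E z y) \<longleftrightarrow>
      (\<forall>y\<in>N. E y x \<longrightarrow> (\<forall>z\<in>N. E z x \<longrightarrow> E y z \<or> y = z \<or> E z y))" by blast
  also have "\<dots> \<longleftrightarrow> (\<forall>y\<in>M. E y x \<longrightarrow> (\<forall>z\<in>M. E z x \<longrightarrow> E y z \<or> y = z \<or> E z y))"
    unfolding ball_abs[OF t x] ..
  also have "\<dots> \<longleftrightarrow> (\<forall>y\<in>M. \<forall>z\<in>M. E y x \<and> E z x \<longrightarrow> E y z \<or> y = z \<or> E z y)" by blast
  finally show ?thesis unfolding is_ordinal_def using 1 by simp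
qed

lemma is_upair_abs:
  assumes "transitive_in E M N" "a \<in> N" "b \<in> N" "p \<in> N"
  shows "is_upair N E a b p \<longleftrightarrow> is_upair M E a b p"
  using assms unfolding is_upair_def transitive_in_def by blast

lemma is_opair_abs:
  assumes t: "transitive_in E M N" and m: "a \<in> N" "b \<in> N" "p \<in> N"
  shows "is_opair N E a b p \<longleftrightarrow> is_opair M E a b p"
proof
  assume "is_opair N E a b p"
  then obtain u v where "u \<in> N" "v \<in> N" "is_upair N E a a u" "is_upair N E a b v" "is_upair N E u v p"
    unfolding is_opair_def by blast
  then show "is_opair M E a b p"
    unfolding is_opair_def using is_upair_abs[OF t] m t unfolding transitive_in_def by blast
next
  assume "is_opair M E a b p"
  then obtain u v where uv: "u \<in> M" "v \<in> M" "is_upair M E a a u" "is_upair M E a b v"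
    "is_upair M E u v p" unfolding is_opair_def by blast
  then have "E u p" "E v p" unfolding is_upair_def by blast+
  then have "u \<in> N" "v \<in> N" using t m(3) uv(1,2) unfolding transitive_in_def by blast+
  then show "is_opair N E a b p"
    unfolding is_opair_def using uv is_upair_abs[OF t] m by blast
qed

lemma maps_to_abs:
  assumes t: "transitive_in E M N" and m: "f \<in> N" "a \<in> N" "b \<in> N"
  shows "maps_to N E f a b \<longleftrightarrow> maps_to M E f a b"
proof -
  have "maps_to N E f a b \<longleftrightarrow> (\<exists>p\<in>N. E p f \<and> is_opair M E a b p)"
    unfolding maps_to_def using is_opair_abs[OF t m(2,3)] by blast
  also have "\<dots> \<longleftrightarrow> (\<exists>p\<in>M. E p f \<and> is_opair M E a b p)" by (rule bex_abs[OF t m(1)])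
  also have "\<dots> \<longleftrightarrow> maps_to M E f a b" unfolding maps_to_def by blast
  finally show ?thesis .
qed

context ultra
begin

lemma ex_fun: "lam X (\<lambda>_. emp) \<in> funs" by (rule lam_funs[OF td_const[OF emp_in_M]])

lemma sentence_N: assumes "fdef E (\<lambda>M e. P M)" "P M" shows "P N"
proof -
  have "range (\<lambda>_::nat. col (lam X (\<lambda>_. emp))) \<subseteq> N" unfolding N_eq using ex_fun by blast
  from fdef_N[OF assms(1) this] assms(2) show ?thesis by simp
qed

theorem ZFC_N: "ZFC N E"
  unfolding ZFC_def
proof (intro conjI)
  show "\<forall>x\<in>N. \<forall>y\<in>N. (\<forall>z\<in>N. E z x \<longleftrightarrow> E z y) \<longrightarrow> x = y"
    by (rule sentence_N, intro fdef_intros)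
      (use zfc in \<open>unfold ZFC_def, elim conjE\<close>)
  show "\<forall>a\<in>N. (\<exists>x\<in>N. E x a) \<longrightarrow> (\<exists>x\<in>N. E x a \<and> (\<forall>y\<in>N. E y x \<longrightarrow> \<not> E y a))"
    by (rule sentence_N, intro fdef_intros)
      (use zfc in \<open>unfold ZFC_def, elim conjE\<close>)
  show "\<forall>a\<in>N. \<forall>b\<in>N. \<exists>p\<in>N. is_upair N E a b p"
    by (rule sentence_N, intro fdef_intros)
      (use zfc in \<open>unfold ZFC_def, elim conjE\<close>)
  show "\<forall>a\<in>N. \<exists>u\<in>N. is_union N E a u"
    by (rule sentence_N, intro fdef_intros)
      (use zfc in \<open>unfold ZFC_def, elim conjE\<close>)
  show "\<forall>a\<in>N. \<exists>p\<in>N. \<forall>x\<in>N. E x p \<longleftrightarrow> is_subset N E x a"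
    by (rule sentence_N, intro fdef_intros)
      (use zfc in \<open>unfold ZFC_def, elim conjE\<close>)
  show "\<exists>w\<in>N. is_inductive N E w"
    by (rule sentence_N, intro fdef_intros)
      (use zfc in \<open>unfold ZFC_def, elim conjE\<close>)
  show "\<forall>p s. \<forall>a\<in>N. range s \<subseteq> N \<longrightarrow>
      (\<exists>b\<in>N. \<forall>x\<in>N. E x b \<longleftrightarrow> E x a \<and> sat N E (s(0 := x)) p)"
  proof (intro allI ballI impI)
    fix p and s :: "nat \<Rightarrow> 'v" and a assume a: "a \<in> N" and s: "range s \<subseteq> N"
    have "\<forall>a\<in>N. \<exists>b\<in>N. \<forall>x\<in>N. E x b \<longleftrightarrow> E x a \<and> sat N E (s(0 := x)) p"
    proof (rule fdef_N[OF _ s])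
      show "fdef E (\<lambda>M s. \<forall>a\<in>M. \<exists>b\<in>M. \<forall>x\<in>M. E x b \<longleftrightarrow> E x a \<and> sat M E (s(0 := x)) p)"
        by (intro fdef_intros fdef_sat_upd)
      fix s :: "nat \<Rightarrow> 'v" assume s: "range s \<subseteq> M"
      have "\<forall>p s. \<forall>a\<in>M. range s \<subseteq> M \<longrightarrow>
          (\<exists>b\<in>M. \<forall>x\<in>M. E x b \<longleftrightarrow> E x a \<and> sat M E (s(0 := x)) p)"
        using zfc unfolding ZFC_def by (elim conjE)
      from this[THEN spec[of _ p], THEN spec[of _ s]]
      show "\<forall>a\<in>M. \<exists>b\<in>M. \<forall>x\<in>M. E x b \<longleftrightarrow> E x a \<and> sat M E (s(0 := x)) p" using s by blast
    qed
    with a show "\<exists>b\<in>N. \<forall>x\<in>N. E x b \<longleftrightarrow> E x a \<and> sat N E (s(0 := x)) p" by blast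
  qed
  show "\<forall>p s. \<forall>a\<in>N. range s \<subseteq> N \<longrightarrow>
      (\<forall>x\<in>N. E x a \<longrightarrow> (\<exists>!y. y \<in> N \<and> sat N E (s(0 := x, 1 := y)) p)) \<longrightarrow>
      (\<exists>b\<in>N. \<forall>y\<in>N. E y b \<longleftrightarrow> (\<exists>x\<in>N. E x a \<and> sat N E (s(0 := x, 1 := y)) p))"
  proof (intro allI, rule ballI, rule impI)
    fix p and s :: "nat \<Rightarrow> 'v" and a assume a: "a \<in> N" and s: "range s \<subseteq> N"
    have "\<forall>a\<in>N. (\<forall>x\<in>N. E x a \<longrightarrow> (\<exists>!y. y \<in> N \<and> sat N E (s(0 := x, 1 := y)) p)) \<longrightarrow>
      (\<exists>b\<in>N. \<forall>y\<in>N. E y b \<longleftrightarrow> (\<exists>x\<in>N. E x a \<and> sat N E (s(0 := x, 1 := y)) p))"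
    proof (rule fdef_N[OF _ s])
      show "fdef E (\<lambda>M s. \<forall>a\<in>M. (\<forall>x\<in>M. E x a \<longrightarrow>
          (\<exists>!y. y \<in> M \<and> sat M E (s(0 := x, 1 := y)) p)) \<longrightarrow>
          (\<exists>b\<in>M. \<forall>y\<in>M. E y b \<longleftrightarrow> (\<exists>x\<in>M. E x a \<and> sat M E (s(0 := x, 1 := y)) p)))"
        by (intro fdef_intros fdef_sat_upd2)
      fix s :: "nat \<Rightarrow> 'v" assume s: "range s \<subseteq> M"
      have "\<forall>p s. \<forall>a\<in>M. range s \<subseteq> M \<longrightarrow>
          (\<forall>x\<in>M. E x a \<longrightarrow> (\<exists>!y. y \<in> M \<and> sat M E (s(0 := x, 1 := y)) p)) \<longrightarrow>
          (\<exists>b\<in>M. \<forall>y\<in>M. E y b \<longleftrightarrow> (\<exists>x\<in>M. E x a \<and> sat M E (s(0 := x, 1 := y)) p))"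
        using zfc unfolding ZFC_def by (elim conjE)
      from this[THEN spec[of _ p], THEN spec[of _ s]]
      show "\<forall>a\<in>M. (\<forall>x\<in>M. E x a \<longrightarrow> (\<exists>!y. y \<in> M \<and> sat M E (s(0 := x, 1 := y)) p)) \<longrightarrow>
          (\<exists>b\<in>M. \<forall>y\<in>M. E y b \<longleftrightarrow> (\<exists>x\<in>M. E x a \<and> sat M E (s(0 := x, 1 := y)) p))"
        using s by simp
    qed
    with a show "(\<forall>x\<in>N. E x a \<longrightarrow> (\<exists>!y. y \<in> N \<and> sat N E (s(0 := x, 1 := y)) p)) \<longrightarrow>
      (\<exists>b\<in>N. \<forall>y\<in>N. E y b \<longleftrightarrow> (\<exists>x\<in>N. E x a \<and> sat N E (s(0 := x, 1 := y)) p))"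
      by simp
  qed
  show "\<forall>a\<in>N. (\<forall>x\<in>N. E x a \<longrightarrow> (\<exists>z\<in>N. E z x)) \<longrightarrow>
      (\<forall>x\<in>N. \<forall>y\<in>N. E x a \<and> E y a \<and> x \<noteq> y \<longrightarrow> (\<forall>z\<in>N. \<not> (E z x \<and> E z y))) \<longrightarrow>
      (\<exists>c\<in>N. \<forall>x\<in>N. E x a \<longrightarrow> (\<exists>!z. z \<in> N \<and> E z x \<and> E z c))"
    by (rule sentence_N, intro fdef_intros)
      (use zfc in \<open>unfold ZFC_def, elim conjE\<close>)
qed

subsection \<open>The ultrapower embedding\<close>

definition emb :: "'v \<Rightarrow> 'v" where "emb = ult_embedding M E U"

lemma const_funs: "x \<in> M \<Longrightarrow> lam X (\<lambda>_. x) \<in> funs"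
  by (rule lam_funs[OF td_const])

lemma app_const: "x \<in> M \<Longrightarrow> i \<in> els X \<Longrightarrow> app (lam X (\<lambda>_. x)) i = x"
  by (rule app_lam_X[OF td_const])

lemma emb_eq: assumes "x \<in> M" shows "emb x = col (lam X (\<lambda>_. x))"
proof -
  have "const_fun M E U x = lam X (\<lambda>_. x)"
    unfolding const_fun_def
  proof (rule the_equality)
    show "lam X (\<lambda>_. x) \<in> funs \<and> (\<forall>i\<in>M. \<forall>b\<in>M. maps_to M E (lam X (\<lambda>_. x)) i b \<longrightarrow> b = x)"
      using const_funs[OF assms] app_const[OF assms] by (simp add: maps_to_funs)
    fix c assume c: "c \<in> funs \<and> (\<forall>i\<in>M. \<forall>b\<in>M. maps_to M E c i b \<longrightarrow> b = x)"
    show "c = lam X (\<lambda>_. x)"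
    proof (rule fun_ext[OF _ _ X_in_M])
      show "c \<in> M" "is_fun_on M E c X" "lam X (\<lambda>_. x) \<in> M" "is_fun_on M E (lam X (\<lambda>_. x)) X"
        using c const_funs[OF assms] by (simp_all add: funs_iff)
      fix i assume i: "i \<in> els X"
      then have "maps_to M E c i (app c i)"
        using maps_to_funs[OF conjunct1[OF c] els_in_M[OF i] app_in_M] by simp
      then have "app c i = x" using conjunct2[OF c] els_in_M[OF i] app_in_M by blast
      then show "app c i = app (lam X (\<lambda>_. x)) i" using app_const[OF assms i] by simp
    qed
  qed
  then show ?thesis by (simp add: emb_def ult_embedding_def col_def)
qed

lemma emb_in_N: "x \<in> M \<Longrightarrow> emb x \<in> N"
  unfolding N_eq using emb_eq const_funs by blast

lemma emb_in_M: "x \<in> M \<Longrightarrow> emb x \<in> M" using emb_in_N N_sub by blast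

lemma td_emb: "tdef1 M E emb"
proof -
  have "tdef M E (\<lambda>e. lam X ((\<lambda>e _. e 0) e))"
    by (rule td_lam[where F = "\<lambda>e _. e 0"]) (auto intro: td_const td_var X_in_M)
  then have "tdef M E (\<lambda>e. col (lam X (\<lambda>_. e 0)))" by (intro tdef_comp1[OF td_col]) simp
  then have 1: "pdef M E (\<lambda>e. e 0 = col (lam X (\<lambda>_. e (Suc 0))))" by (simp add: tdef_def)
  have "pdef M E (\<lambda>e. e 0 = emb (e (Suc 0)))"
  proof (rule pdef_cong[OF 1])
    fix s :: "nat \<Rightarrow> 'v" assume "range s \<subseteq> M"
    then have "s (Suc 0) \<in> M" by blast
    then show "s 0 = col (lam X (\<lambda>_. s (Suc 0))) \<longleftrightarrow> s 0 = emb (s (Suc 0))" by (simp add: emb_eq)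
  qed
  then show ?thesis unfolding tdef_def using emb_in_M by auto
qed

lemma emb_fdef:
  assumes "fdef E P" "range s \<subseteq> M"
  shows "P N (\<lambda>n. emb (s n)) \<longleftrightarrow> P M s"
proof -
  have s: "s n \<in> M" for n using assms(2) by blast
  have "P N (\<lambda>n. emb (s n)) \<longleftrightarrow> ae (\<lambda>i. P M (\<lambda>n. app (lam X (\<lambda>_. s n)) i))"
    using los_fdef[OF assms(1), of "\<lambda>n. lam X (\<lambda>_. s n)"] const_funs[OF s] emb_eq[OF s] by simp
  also have "\<dots> \<longleftrightarrow> ae (\<lambda>i. P M s)"
    by (rule ae_cong) (simp add: app_const[OF s])
  finally show ?thesis by (simp add: ae_const)
qed

lemma emb_mem_iff: "x \<in> M \<Longrightarrow> y \<in> M \<Longrightarrow> E (emb x) (emb y) \<longleftrightarrow> E x y"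
  using emb_fdef[OF fdef_mem[of E 0 "Suc 0"], of "case_nat x (\<lambda>_. y)"] by simp

lemma N_transitive: "transitive_in E M N"
  unfolding transitive_in_def using N_sub N_trans by blast

lemma N_ordinal_iff: "x \<in> N \<Longrightarrow> is_ordinal N E x \<longleftrightarrow> ord x"
  by (rule is_ordinal_abs[OF N_transitive])

lemma emb_ord: assumes "x \<in> M" shows "ord (emb x) \<longleftrightarrow> ord x"
  using emb_fdef[OF fdef_is_ordinal[of E 0], of "\<lambda>_. x"] N_ordinal_iff[OF emb_in_N[OF assms]] assms
  by auto

text \<open>Let y = [f] be below j(\<xi>). Choice gives maps c_i of the power set of T onto f(i).
  Then A \<mapsto> [i \<mapsto> c_i(A_i)], where A_i is the section of A at i, covers y, because any
  family of subsets B_i of T is coded by a single subset of T, by X \<times> T \<subseteq> Y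
  \<times> T \<subseteq> T. So y is itself in \<xi>, which gives j(\<xi>) \<subseteq> \<xi>; and j
  cannot move an ordinal down.\<close>

theorem emb_nice:
  assumes \<xi>: "\<xi> \<in> M" "ord \<xi>" and Y: "Y \<in> M" "els X \<subseteq> els Y" and nice: "nice M E \<xi> Y"
  shows "emb \<xi> = \<xi>"
proof -
  obtain T where T: "T \<in> M" "\<And>y t. y \<in> els Y \<Longrightarrow> t \<in> els T \<Longrightarrow> opr y t \<in> els T"
    "els \<xi> = {\<eta> \<in> M. ord \<eta> \<and> covers (pow T) \<eta>}"
    using nice unfolding nice_iff[OF \<xi>(1) Y(1)] by blast
  note pT = pow_in_M[OF T(1)]
  have "y \<in> els \<xi>" if y: "y \<in> els (emb \<xi>)" for y
  proof -
    have yM: "y \<in> M" by (rule els_in_M[OF y])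
    have "y \<in> N" by (rule N_trans[OF emb_in_N[OF \<xi>(1)] yM els_memI[OF y]])
    then obtain f where f: "f \<in> funs" "y = col f" unfolding N_eq by blast
    note fM = funs_in_M[OF f(1)]
    have "ae (\<lambda>i. E (app f i) (app (lam X (\<lambda>_. \<xi>)) i))"
      using els_memI[OF y] unfolding f(2) emb_eq[OF \<xi>(1)] col_mem_iff[OF f(1) const_funs[OF \<xi>(1)]] .
    moreover have "ae (\<lambda>i. E (app f i) (app (lam X (\<lambda>_. \<xi>)) i)) \<longleftrightarrow> ae (\<lambda>i. E (app f i) \<xi>)"
      by (rule ae_cong) (simp add: app_const[OF \<xi>(1)])
    ultimately have f\<xi>: "ae (\<lambda>i. E (app f i) \<xi>)" by simp
    define P where "P i c \<longleftrightarrow> (E (app f i) \<xi> \<longrightarrow>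
        (\<forall>\<beta>\<in>M. E \<beta> (app f i) \<longrightarrow> (\<exists>A\<in>M. E A (pow T) \<and> \<beta> = app c A)))" for i c
    have P: "pdef2 M E P" unfolding P_def by (intro pdi fM \<xi> pT)
    have "\<exists>c\<in>M. P i c" for i
    proof (cases "E (app f i) \<xi>")
      case True
      then have "app f i \<in> els \<xi>" using app_in_M by (simp add: els_iff)
      then have "covers (pow T) (app f i)" unfolding T(3) by blast
      then show ?thesis unfolding covers_def P_def by blast
    next
      case False
      then show ?thesis unfolding P_def using emp_in_M by blast
    qed
    from choice[OF X_in_M P this] obtain s where s: "s \<in> M" "\<And>i. i \<in> els X \<Longrightarrow> P i (app s i)"
      by blast
    define sect where "sect A i = mk {t \<in> M. E t T \<and> E (opr i t) A}" for A i
    have ss: "small {t \<in> M. E t T \<and> E (opr i t) A}" if "A \<in> M" "i \<in> M" for A i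
      by (rule small_subset[OF small_els[OF T(1)]]) (intro pdi T(1) that, simp add: els_iff)
    have sect: "tdef2 M E sect"
      unfolding sect_def
    proof (rule td_mk[where P = "\<lambda>e t. E t T \<and> E (opr (e (Suc 0)) t) (e 0)"])
      show "pdef M E (\<lambda>e. E (e 0) T \<and> E (opr (e (Suc (Suc 0))) (e 0)) (e (Suc 0)))"
        by (intro pdi T(1))
      show "small {t \<in> M. E t T \<and> E (opr (e (Suc 0)) t) (e 0)}" if "range e \<subseteq> M" for e
        using ss[of "e 0" "e (Suc 0)"] that by auto
    qed
    define g where "g A = lam X (\<lambda>i. app (app s i) (sect A i))" for A
    have tg0: "tdef1 M E (\<lambda>i. app (app s i) (sect A i))" if "A \<in> M" for A
      by (intro pdi s(1) that tdef_comp2[OF sect])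
    have "tdef M E (\<lambda>e. lam X ((\<lambda>e i. app (app s i) (sect (e 0) i)) e))"
    proof (rule td_lam[where F = "\<lambda>e i. app (app s i) (sect (e 0) i)"])
      show "tdef M E (\<lambda>e. X)" by (rule td_const[OF X_in_M])
      show "tdef M E (\<lambda>e. app (app s (e 0)) (sect (e (Suc 0)) (e 0)))"
        by (intro pdi s(1) tdef_comp2[OF sect])
      show "tdef1 M E (\<lambda>i. app (app s i) (sect (e 0) i))" if "range e \<subseteq> M" for e
        by (rule tg0) (use that in auto)
    qed
    then have tg: "tdef1 M E g" unfolding g_def by simp
    have g_funs: "g A \<in> funs" if "A \<in> M" for A unfolding g_def by (rule lam_funs[OF tg0[OF that]])
    have g_app: "app (g A) i = app (app s i) (sect A i)" if "A \<in> M" "i \<in> els X" for A i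
      unfolding g_def by (rule app_lam_X[OF tg0[OF that(1)] that(2)])
    have tcg: "tdef1 M E (\<lambda>A. col (g A))" by (rule tdef_comp1[OF td_col tg])
    have "covers (pow T) y"
      unfolding covers_def
    proof (rule bexI[OF _ lam_in_M[OF pT tcg]], intro ballI impI)
      fix \<beta> assume \<beta>: "\<beta> \<in> M" "E \<beta> y"
      have "\<beta> \<in> N" by (rule N_trans[OF \<open>y \<in> N\<close> \<beta>])
      then obtain h where h: "h \<in> funs" "\<beta> = col h" unfolding N_eq by blast
      note hM = funs_in_M[OF h(1)]
      have hf: "ae (\<lambda>i. E (app h i) (app f i))"
        using \<beta>(2) unfolding h(2) f(2) col_mem_iff[OF h(1) f(1)] .
      define Q where "Q i B \<longleftrightarrow> (E (app h i) (app f i) \<and> E (app f i) \<xi> \<longrightarrow>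
          E B (pow T) \<and> app h i = app (app s i) B)" for i B
      have Q: "pdef2 M E Q" unfolding Q_def by (intro pdi hM fM \<xi> pT s(1))
      have "\<exists>B\<in>M. Q i B" if i: "i \<in> els X" for i
      proof (cases "E (app h i) (app f i) \<and> E (app f i) \<xi>")
        case True
        then show ?thesis using s(2)[OF i] app_in_M unfolding P_def Q_def by blast
      next
        case False
        then show ?thesis unfolding Q_def using emp_in_M by blast
      qed
      from choice[OF X_in_M Q this] obtain b where b: "b \<in> M" "\<And>i. i \<in> els X \<Longrightarrow> Q i (app b i)"
        by blast
      have sA: "small {p \<in> els T. \<exists>i\<in>M. \<exists>t\<in>M. p = opr i t \<and> E t (app b i)}"
        by (rule separation_els[OF T(1)]) (intro pdi b(1))
      \<comment> \<open>The family of sets \<open>app b i\<close> is coded as the set of pairs (i,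
        t) with t in \<open>app b i\<close>. Intersecting with T loses none of the pairs for i in X,
        as Y \<times> T \<subseteq> T.\<close>
      define A where "A = mk {p \<in> els T. \<exists>i\<in>M. \<exists>t\<in>M. p = opr i t \<and> E t (app b i)}"
      have A: "A \<in> M" "els A = {p \<in> els T. \<exists>i\<in>M. \<exists>t\<in>M. p = opr i t \<and> E t (app b i)}"
        unfolding A_def by (rule mk_props[OF sA])+
      have AT: "A \<in> els (pow T)" unfolding els_pow[OF T(1)] using A by blast
      have "app (g A) i = app h i" if i: "i \<in> els X" "E (app h i) (app f i)" "E (app f i) \<xi>" for i
      proof -
        have iM: "i \<in> M" by (rule els_in_M[OF i(1)])
        have "E (app b i) (pow T)" and hb: "app h i = app (app s i) (app b i)"
          using b(2)[OF i(1)] i(2,3) unfolding Q_def by blast+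
        then have "app b i \<in> els (pow T)" using app_in_M by (simp add: els_iff)
        then have bT: "els (app b i) \<subseteq> els T" unfolding els_pow[OF T(1)] by blast
        have "E (opr i t) A \<longleftrightarrow> E t (app b i)" if t: "t \<in> els T" for t
        proof -
          have tM: "t \<in> M" by (rule els_in_M[OF t])
          have "E (opr i t) A \<longleftrightarrow> opr i t \<in> els A" by (rule E_els[OF opr_in_M[OF iM tM]])
          also have "\<dots> \<longleftrightarrow> opr i t \<in> els T \<and> (\<exists>i'\<in>M. \<exists>t'\<in>M. opr i t = opr i' t' \<and> E t' (app b i'))"
            unfolding A(2) by simp
          also have "\<dots> \<longleftrightarrow> E t (app b i)"
            using T(2)[OF _ t] Y(2) i(1) opr_eq_iff[OF iM tM] iM tM by blast
          finally show ?thesis .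
        qed
        then have "els (sect A i) = els (app b i)"
          unfolding sect_def els_mk[OF ss[OF A(1) iM]] using bT by (auto simp: els_def)
        then have "sect A i = app b i"
          using els_inject tdef2_in_M[OF sect A(1) iM] app_in_M by blast
        then show ?thesis using g_app[OF A(1) i(1)] hb by simp
      qed
      then have "ae (\<lambda>i. app (g A) i = app h i)"
        by (intro ae_mono[OF ae_conj[OF hf f\<xi>] pd_app_eq[OF funs_in_M[OF g_funs[OF A(1)]] hM]]) blast
      then have "col (g A) = \<beta>" unfolding h(2) col_eq_iff[OF g_funs[OF A(1)] h(1)] .
      then have "\<beta> = app (lam (pow T) (\<lambda>A. col (g A))) A" using app_lam[OF pT tcg AT] by simp
      then show "\<exists>z\<in>M. E z (pow T) \<and> \<beta> = app (lam (pow T) (\<lambda>A. col (g A))) z"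
        using AT by (intro bexI[of _ A]) (simp_all add: els_iff)
    qed
    moreover have "ord y" using ord_mem[OF _ y] emb_ord[OF \<xi>(1)] \<xi>(2) by blast
    ultimately show "y \<in> els \<xi>" unfolding T(3) using yM by blast
  qed
  then have "emb \<xi> = \<xi> \<or> emb \<xi> \<in> els \<xi>"
    using ord_subset[OF emb_in_M[OF \<xi>(1)] \<xi>(1)] emb_ord[OF \<xi>(1)] \<xi>(2) by blast
  \<comment> \<open>A least ordinal m with j(m) \<in> m is impossible: elementarity gives j(j(m))
    \<in> j(m), so j(m) is a smaller one.\<close>
  moreover have "\<not> E (emb \<xi>) \<xi>"
  proof
    assume "E (emb \<xi>) \<xi>"
    have "pdef1 M E (\<lambda>x. E (emb x) x)" by (intro pdi tdef_comp1[OF td_emb])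
    from ord_least[OF this \<xi> \<open>E (emb \<xi>) \<xi>\<close>] obtain m where m: "m \<in> M" "E (emb m) m"
      "\<And>x. x \<in> els m \<Longrightarrow> \<not> E (emb x) x" by blast
    have "emb m \<in> els m" using m(2) emb_in_M[OF m(1)] by (simp add: els_iff)
    moreover have "E (emb (emb m)) (emb m)" using emb_mem_iff[OF emb_in_M[OF m(1)] m(1)] m(2) by simp
    ultimately show False using m(3) by blast
  qed
  ultimately show ?thesis by (simp add: els_iff)
qed

end

section \<open>Products of ultrafilters\<close>

context zfc_model
begin

lemma pd_fdef_env:
  assumes "fdef E Q" "\<And>n. tdef M E (t n)" shows "pdef M E (\<lambda>e. Q M (\<lambda>n. t n e))"
proof -
  obtain p where p: "\<And>M s. range s \<subseteq> M \<Longrightarrow> Q M s \<longleftrightarrow> sat M E s p"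
    using assms(1) unfolding fdef_def by blast
  have "Q M (\<lambda>n. t n e) \<longleftrightarrow> sat M E (\<lambda>n. t n e) p" if "range e \<subseteq> M" for e
    by (rule p) (use tdef_closed[OF assms(2) that] in blast)
  then show ?thesis using pdef_cong[OF pdef_sat[where p = p, OF M_nonempty assms(2)]] by simp
qed

text \<open>The set of possible first coordinates is a singleton if b is a pair and empty otherwise;
  its union is therefore the coordinate, written as a total definable term.\<close>

definition pfst :: "'v \<Rightarrow> 'v" where
  "pfst b = un (mk {x \<in> M. \<exists>y\<in>M. b = opr x y})"
definition psnd :: "'v \<Rightarrow> 'v" where
  "psnd b = un (mk {y \<in> M. \<exists>x\<in>M. b = opr x y})"

lemma proj_sets:
  assumes "x \<in> M" "y \<in> M"
  shows "{x' \<in> M. \<exists>y'\<in>M. opr x y = opr x' y'} = {x}" "{y' \<in> M. \<exists>x'\<in>M. opr x y = opr x' y'} = {y}"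
  using assms opr_eq_iff[OF assms] by auto

lemma un_singleton: assumes "x \<in> M" shows "un (mk {x}) = x"
proof -
  have s: "small {x}" by (rule small_singleton[OF assms])
  have "els (un (mk {x})) = els x" unfolding els_un[OF mk_in_M[OF s]] els_mk[OF s] by simp
  then show ?thesis using els_inject un_in_M[OF mk_in_M[OF s]] assms by blast
qed

lemma pfst_opr: "x \<in> M \<Longrightarrow> y \<in> M \<Longrightarrow> pfst (opr x y) = x"
  and psnd_opr: "x \<in> M \<Longrightarrow> y \<in> M \<Longrightarrow> psnd (opr x y) = y"
  by (simp_all add: pfst_def psnd_def proj_sets un_singleton)

lemma small_proj:
  "small {x \<in> M. \<exists>y\<in>M. b = opr x y}" "small {y \<in> M. \<exists>x\<in>M. b = opr x y}"
proof -
  have *: "{x \<in> M. \<exists>y\<in>M. b = opr x y} = {} \<and> {y \<in> M. \<exists>x\<in>M. b = opr x y} = {} \<or>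
    (\<exists>x\<in>M. \<exists>y\<in>M. b = opr x y)" by blast
  then show "small {x \<in> M. \<exists>y\<in>M. b = opr x y}"
  proof
    assume "\<exists>x\<in>M. \<exists>y\<in>M. b = opr x y"
    then obtain x y where "x \<in> M" "y \<in> M" "b = opr x y" by blast
    then show ?thesis using proj_sets[of x y] small_singleton by simp
  qed (simp only: small_empty)
  from * show "small {y \<in> M. \<exists>x\<in>M. b = opr x y}"
  proof
    assume "\<exists>x\<in>M. \<exists>y\<in>M. b = opr x y"
    then obtain x y where "x \<in> M" "y \<in> M" "b = opr x y" by blast
    then show ?thesis using proj_sets[of x y] small_singleton by simp
  qed (simp only: small_empty)
qed

lemma td_pfst: "tdef1 M E pfst" and td_psnd: "tdef1 M E psnd"
proof -
  have "tdef M E (\<lambda>e. mk {x \<in> M. \<exists>y\<in>M. e 0 = opr x y})"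
    by (rule td_mk[where P = "\<lambda>e x. \<exists>y\<in>M. e 0 = opr x y"], intro pdi) (rule small_proj)
  then show "tdef1 M E pfst" unfolding pfst_def by (rule td_un)
  have "tdef M E (\<lambda>e. mk {y \<in> M. \<exists>x\<in>M. e 0 = opr x y})"
    by (rule td_mk[where P = "\<lambda>e y. \<exists>x\<in>M. e 0 = opr x y"], intro pdi) (rule small_proj)
  then show "tdef1 M E psnd" unfolding psnd_def by (rule td_un)
qed

end

locale two_ultra = zfc_model M E + U: ultra M E U + W: ultra M E W
  for M :: "'v set" and E and U W :: 'v
begin

text \<open>With U outside and W inside, the class of F modulo the product corresponds to the
  U-class of the function sending i to the W-class of F(i, _).\<close>

definition aa :: "('v \<Rightarrow> 'v \<Rightarrow> bool) \<Rightarrow> bool" where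
  "aa Q \<longleftrightarrow> U.ae (\<lambda>i. W.ae (\<lambda>k. Q i k))"

lemma pd_W_ae: assumes "pdef2 M E Q" shows "pdef1 M E (\<lambda>i. W.ae (Q i))"
proof (rule W.pd_ae[where P = "\<lambda>e k. Q (e 0) k"])
  show "pdef M E (\<lambda>e. Q (e (Suc 0)) (e 0))"
    using pdef_rename[OF assms, of "case_nat (Suc 0) (\<lambda>_. 0)"] by simp
qed

lemma pd_slice: assumes "pdef2 M E Q" "i \<in> M" shows "pdef1 M E (Q i)"
  by (rule pdef_pred2[OF assms(1) td_const[OF assms(2)] td_var])

lemma aa_mono:
  assumes "aa P" "pdef2 M E Q" "\<And>i k. i \<in> els U.X \<Longrightarrow> k \<in> els W.X \<Longrightarrow> P i k \<Longrightarrow> Q i k"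
  shows "aa Q"
  unfolding aa_def
proof (rule U.ae_mono[OF assms(1)[unfolded aa_def] pd_W_ae[OF assms(2)]])
  fix i assume i: "i \<in> els U.X" "W.ae (P i)"
  show "W.ae (Q i)"
    by (rule W.ae_mono[OF i(2) pd_slice[OF assms(2) els_in_M[OF i(1)]]]) (rule assms(3)[OF i(1)])
qed

lemma aa_cong:
  assumes "\<And>i k. i \<in> els U.X \<Longrightarrow> k \<in> els W.X \<Longrightarrow> P i k = Q i k"
  shows "aa P = aa Q"
  unfolding aa_def by (intro U.ae_cong W.ae_cong assms)

lemma aa_conj:
  assumes "aa P" "aa Q" "pdef2 M E P" "pdef2 M E Q" shows "aa (\<lambda>i k. P i k \<and> Q i k)"
proof -
  have d: "pdef2 M E (\<lambda>i k. P i k \<and> Q i k)" by (rule pdef_conj[OF assms(3,4)])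
  show ?thesis
    unfolding aa_def
    by (rule U.ae_mono[OF U.ae_conj[OF assms(1,2)[unfolded aa_def]] pd_W_ae[OF d]])
      (use W.ae_conj in blast)
qed

lemma aa_not: assumes "pdef2 M E Q" shows "aa (\<lambda>i k. \<not> Q i k) \<longleftrightarrow> \<not> aa Q"
proof -
  have "aa (\<lambda>i k. \<not> Q i k) \<longleftrightarrow> U.ae (\<lambda>i. \<not> W.ae (Q i))"
    unfolding aa_def by (rule U.ae_cong) (rule W.ae_not[OF pd_slice[OF assms els_in_M]])
  then show ?thesis unfolding aa_def U.ae_not[OF pd_W_ae[OF assms]] .
qed

lemma aa_const: "aa (\<lambda>i k. b) \<longleftrightarrow> b"
  unfolding aa_def by (simp add: W.ae_const U.ae_const)

lemma aa_snd: "aa (\<lambda>i k. Q k) \<longleftrightarrow> W.ae Q"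
  unfolding aa_def by (simp add: U.ae_const)

text \<open>Countable completeness is used twice: for U on the sets of those i whose fibre condition
  holds for W, and then for W within the fibre of each such i.\<close>

lemma aa_countable:
  assumes S: "pdef3 M E S" and aa: "\<And>n. n \<in> els omega \<Longrightarrow> aa (S n)"
  shows "aa (\<lambda>i k. \<forall>n\<in>M. E n omega \<longrightarrow> S n i k)"
proof -
  have "pdef M E (\<lambda>e. S (e (Suc 0)) (e (Suc (Suc 0))) (e 0))"
    using pdef_rename[OF S, of "case_nat (Suc 0) (case_nat (Suc (Suc 0)) (\<lambda>_. 0))"] by simp
  then have d: "pdef2 M E (\<lambda>n i. W.ae (S n i))"
    by (intro W.pd_ae[where P = "\<lambda>e k. S (e 0) (e (Suc 0)) k"])
  have "pdef M E (\<lambda>e. \<forall>n\<in>M. E n omega \<longrightarrow> S n (e 0) (e (Suc 0)))"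
    using S by (intro pdi omega_in_M)
  from pd_W_ae[where Q = "\<lambda>i k. \<forall>n\<in>M. E n omega \<longrightarrow> S n i k", OF this]
  have d2: "pdef1 M E (\<lambda>i. W.ae (\<lambda>k. \<forall>n\<in>M. E n omega \<longrightarrow> S n i k))" .
  show ?thesis
    unfolding aa_def
  proof (rule U.ae_mono[OF U.ae_countable[OF d aa[unfolded aa_def]] d2])
    fix i assume i: "i \<in> els U.X" "\<forall>n\<in>M. E n omega \<longrightarrow> W.ae (S n i)"
    have "pdef2 M E (\<lambda>n k. S n i k)"
      by (rule pdef_pred3[OF S td_var td_const[OF els_in_M[OF i(1)]] td_var])
    then show "W.ae (\<lambda>k. \<forall>n\<in>M. E n omega \<longrightarrow> S n i k)"
      by (rule W.ae_countable) (use i(2) in \<open>simp add: els_iff\<close>)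
  qed
qed

definition B :: 'v where "B = times U.X W.X"
definition P :: 'v where "P = mk {A \<in> els (pow B). aa (\<lambda>i k. E (opr i k) A)}"

lemma B_in_M: "B \<in> M" unfolding B_def by (rule times_in_M[OF U.X_in_M W.X_in_M])

lemma els_B: "els B = {opr i k |i k. i \<in> els U.X \<and> k \<in> els W.X}"
  unfolding B_def by (rule els_times[OF U.X_in_M W.X_in_M])

lemma opr_B: "i \<in> els U.X \<Longrightarrow> k \<in> els W.X \<Longrightarrow> opr i k \<in> els B" unfolding els_B by blast

lemma pd_opr_in: "A \<in> M \<Longrightarrow> pdef2 M E (\<lambda>i k. E (opr i k) A)" by (intro pdi)

lemma small_P: "small {A \<in> els (pow B). aa (\<lambda>i k. E (opr i k) A)}"
proof (rule separation_els[OF pow_in_M[OF B_in_M]])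
  have "pdef2 M E (\<lambda>A i. W.ae (\<lambda>k. E (opr i k) A))"
    by (rule W.pd_ae[where P = "\<lambda>e k. E (opr (e (Suc 0)) k) (e 0)"]) (intro pdi)
  then have "pdef M E (\<lambda>e. W.ae (\<lambda>k. E (opr (e 0) k) (e (Suc 0))))"
    using pdef_rename[of M E _ "case_nat (Suc 0) (\<lambda>_. 0)"] by fastforce
  then show "pdef1 M E (\<lambda>A. aa (\<lambda>i k. E (opr i k) A))"
    unfolding aa_def by (intro U.pd_ae[where P = "\<lambda>e i. W.ae (\<lambda>k. E (opr i k) (e 0))"])
qed

lemma P_in_M: "P \<in> M" unfolding P_def by (rule mk_in_M[OF small_P])

lemma els_P: "els P = {A \<in> els (pow B). aa (\<lambda>i k. E (opr i k) A)}"
  unfolding P_def by (rule els_mk[OF small_P])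

lemma E_P_iff: assumes "A \<in> M" shows "E A P \<longleftrightarrow> els A \<subseteq> els B \<and> aa (\<lambda>i k. E (opr i k) A)"
  unfolding E_els[OF assms] els_P using assms by (simp add: els_pow[OF B_in_M])

lemma ultrafilter_P: "is_ultrafilter_on M E P B"
  unfolding is_ultrafilter_on_def
proof (intro conjI ballI impI)
  show "is_subset M E A B" if "A \<in> M" "E A P" for A using that by (simp add: is_subset_iff E_P_iff)
  show "E B P"
    unfolding E_P_iff[OF B_in_M]
  proof
    have "aa (\<lambda>i k. True)" by (simp add: aa_const)
    then show "aa (\<lambda>i k. E (opr i k) B)"
      by (rule aa_mono[OF _ pd_opr_in[OF B_in_M]]) (rule els_memI[OF opr_B])
  qed simp
  show "\<not> E A P" if A: "A \<in> M" "is_empty M E A" for A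
  proof
    assume "E A P"
    then have "aa (\<lambda>i k. E (opr i k) A)" using A by (simp add: E_P_iff)
    moreover have "aa (\<lambda>i k. E (opr i k) A) \<longleftrightarrow> aa (\<lambda>i k. False)"
      by (rule aa_cong) (use A opr_in_M els_in_M in \<open>unfold is_empty_def, blast\<close>)
    ultimately show False by (simp add: aa_const)
  qed
  show "E C P" if A: "A \<in> M" "C \<in> M" "E A P \<and> is_subset M E A C \<and> is_subset M E C B" for A C
    unfolding E_P_iff[OF A(2)]
  proof
    show "els C \<subseteq> els B" using A(3) by (simp add: is_subset_iff)
    have "aa (\<lambda>i k. E (opr i k) A)" using A by (simp add: E_P_iff)
    then show "aa (\<lambda>i k. E (opr i k) C)"
      by (rule aa_mono[OF _ pd_opr_in[OF A(2)]])
        (use A(3) opr_in_M els_in_M in \<open>unfold is_subset_def, blast\<close>)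
  qed
  show "E D P" if A: "A \<in> M" "C \<in> M" "D \<in> M"
    "E A P \<and> E C P \<and> (\<forall>i\<in>M. E i D \<longleftrightarrow> E i A \<and> E i C)" for A C D
    unfolding E_P_iff[OF A(3)]
  proof
    have "els D \<subseteq> els A" using A(4) by (auto simp: els_def)
    then show "els D \<subseteq> els B" using A E_P_iff[OF A(1)] by blast
    have "aa (\<lambda>i k. E (opr i k) A)" "aa (\<lambda>i k. E (opr i k) C)" using A by (simp_all add: E_P_iff)
    from aa_conj[OF this pd_opr_in[OF A(1)] pd_opr_in[OF A(2)]]
    show "aa (\<lambda>i k. E (opr i k) D)"
      by (rule aa_mono[OF _ pd_opr_in[OF A(3)]]) (use A(4) opr_in_M els_in_M in blast)
  qed
  show "E A P \<or> E C P" if A: "A \<in> M" "C \<in> M"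
    "is_subset M E A B \<and> (\<forall>i\<in>M. E i C \<longleftrightarrow> E i B \<and> \<not> E i A)" for A C
  proof (cases "aa (\<lambda>i k. E (opr i k) A)")
    case True
    then show ?thesis using A by (simp add: E_P_iff is_subset_iff)
  next
    case False
    then have "aa (\<lambda>i k. \<not> E (opr i k) A)" using aa_not[OF pd_opr_in[OF A(1)]] by blast
    then have "aa (\<lambda>i k. E (opr i k) C)"
    proof (rule aa_mono[OF _ pd_opr_in[OF A(2)]])
      fix i k assume i: "i \<in> els U.X" "k \<in> els W.X" "\<not> E (opr i k) A"
      have "opr i k \<in> M" "E (opr i k) B" using opr_B[OF i(1,2)] by (simp_all add: els_iff)
      with A(3) i(3) show "E (opr i k) C" by blast
    qed
    moreover have "els C \<subseteq> els B" using A(3) by (auto simp: els_def)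
    ultimately show ?thesis using E_P_iff[OF A(2)] by blast
  qed
qed

lemma is_omega_unique: assumes "w \<in> M" "is_omega M E w" shows "w = omega"
proof -
  have "is_subset M E w omega" "is_subset M E omega w"
    using assms is_omega_omega omega_in_M unfolding is_omega_def by blast+
  then have "els w = els omega" by (simp add: is_subset_iff)
  then show ?thesis using els_inject assms(1) omega_in_M by blast
qed

lemma cc_P: "cc_ultrafilter M E P"
  unfolding cc_ultrafilter_def
proof (intro conjI)
  show "P \<in> M" by (rule P_in_M)
  show "\<exists>X\<in>M. is_ultrafilter_on M E P X" using ultrafilter_P B_in_M by blast
  show "is_countably_complete M E P"
    unfolding is_countably_complete_def
  proof (intro ballI impI)
    fix w F S assume m: "w \<in> M" "F \<in> M" "S \<in> M"
      and *: "is_omega M E w \<and> is_fun_on M E F w \<and>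
        (\<forall>n\<in>M. \<forall>A\<in>M. E n w \<and> maps_to M E F n A \<longrightarrow> E A P) \<and>
        (\<forall>i\<in>M. E i S \<longleftrightarrow> (\<forall>n\<in>M. \<forall>A\<in>M. E n w \<and> maps_to M E F n A \<longrightarrow> E i A))"
    have w: "w = omega" using is_omega_unique m(1) * by blast
    have F: "is_fun_on M E F omega" using * w by blast
    have mF: "maps_to M E F n A \<longleftrightarrow> n \<in> els omega \<and> A = app F n" if "n \<in> M" "A \<in> M" for n A
      using maps_to_iff[OF that] E_fun_iff[OF m(2) omega_in_M F that] by simp
    have FP: "E (app F n) P" if n: "n \<in> els omega" for n
    proof -
      have "\<forall>n\<in>M. \<forall>A\<in>M. E n w \<and> maps_to M E F n A \<longrightarrow> E A P" using * by (elim conjE)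
      moreover have "maps_to M E F n (app F n)" using mF[OF els_in_M[OF n] app_in_M] n by simp
      ultimately show ?thesis using els_in_M[OF n] els_memI[OF n] app_in_M unfolding w by blast
    qed
    have S: "E b S \<longleftrightarrow> (\<forall>n\<in>M. E n omega \<longrightarrow> E b (app F n))" if b: "b \<in> M" for b
    proof -
      have "\<forall>i\<in>M. E i S \<longleftrightarrow> (\<forall>n\<in>M. \<forall>A\<in>M. E n w \<and> maps_to M E F n A \<longrightarrow> E i A)"
        using * by (elim conjE)
      then have "E b S \<longleftrightarrow> (\<forall>n\<in>M. \<forall>A\<in>M. E n omega \<and> maps_to M E F n A \<longrightarrow> E b A)"
        using b unfolding w by (rule bspec)
      also have "\<dots> \<longleftrightarrow> (\<forall>n\<in>M. \<forall>A\<in>M. E n omega \<and> A = app F n \<longrightarrow> E b A)"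
        using mF by (simp add: els_iff cong: conj_cong)
      also have "\<dots> \<longleftrightarrow> (\<forall>n\<in>M. E n omega \<longrightarrow> E b (app F n))" using app_in_M by simp
      finally show ?thesis .
    qed
    have d: "pdef3 M E (\<lambda>n i k. E (opr i k) (app F n))" by (intro pdi m(2))
    have "aa (\<lambda>i k. E (opr i k) (app F n))" if "n \<in> els omega" for n
      using FP[OF that] E_P_iff[OF app_in_M] by blast
    from aa_countable[OF d this]
    have "aa (\<lambda>i k. \<forall>n\<in>M. E n omega \<longrightarrow> E (opr i k) (app F n))" .
    then have "aa (\<lambda>i k. E (opr i k) S)"
    proof (rule aa_mono[OF _ pd_opr_in[OF m(3)]])
      fix i k assume "i \<in> els U.X" "k \<in> els W.X" "\<forall>n\<in>M. E n omega \<longrightarrow> E (opr i k) (app F n)"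
      then show "E (opr i k) S" using S[OF opr_in_M[OF els_in_M els_in_M]] by simp
    qed
    moreover have "els S \<subseteq> els B"
    proof
      fix b assume "b \<in> els S"
      then have b: "b \<in> M" "E b S" by (auto simp: els_iff)
      then have "E b (app F emp)" using S[OF b(1)] emp_omega by (simp add: els_iff)
      then have "b \<in> els (app F emp)" using b(1) by (simp add: els_iff)
      then show "b \<in> els B" using FP[OF emp_omega] E_P_iff[OF app_in_M] by blast
    qed
    ultimately show "E S P" using E_P_iff[OF m(3)] by blast
  qed
qed

sublocale P: ultra M E P by unfold_locales (rule cc_P)

lemma P_X: "P.X = B"
proof -
  have "els P.X \<subseteq> els B"
  proof
    fix b assume "b \<in> els P.X"
    then obtain A where A: "A \<in> els P" "b \<in> els A" unfolding P.X_def els_un[OF P_in_M] by blast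
    then show "b \<in> els B" using E_P_iff[OF els_in_M[OF A(1)]] els_memI[OF A(1)] by blast
  qed
  moreover have "els B \<subseteq> els P.X"
  proof -
    have "E B P" using ultrafilter_P unfolding is_ultrafilter_on_def by (elim conjE)
    then have "B \<in> els P" using B_in_M by (simp add: els_iff)
    then show ?thesis unfolding P.X_def els_un[OF P_in_M] by blast
  qed
  ultimately show ?thesis using els_inject P.X_in_M B_in_M by blast
qed

lemma P_ae: assumes "pdef1 M E Q" shows "P.ae Q \<longleftrightarrow> aa (\<lambda>i k. Q (opr i k))"
proof -
  have s: "small {b \<in> els B. Q b}" by (rule separation_els[OF B_in_M assms])
  have e: "E (opr i k) (mk {b \<in> els B. Q b}) \<longleftrightarrow> Q (opr i k)" if "i \<in> els U.X" "k \<in> els W.X" for i k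
  proof -
    have "E (opr i k) (mk {b \<in> els B. Q b}) \<longleftrightarrow> opr i k \<in> els (mk {b \<in> els B. Q b})"
      by (rule E_els[OF opr_in_M[OF els_in_M[OF that(1)] els_in_M[OF that(2)]]])
    then show ?thesis unfolding els_mk[OF s] using opr_B[OF that] by simp
  qed
  have "P.ae Q \<longleftrightarrow> E (mk {b \<in> els B. Q b}) P"
  proof
    assume "P.ae Q"
    then obtain S where S: "S \<in> M" "E S P" "els S = {b \<in> els B. Q b}"
      using P.aeE unfolding P_X by metis
    then have "S = mk {b \<in> els B. Q b}" using mk_els[OF S(1)] by simp
    with S(2) show "E (mk {b \<in> els B. Q b}) P" by simp
  next
    assume "E (mk {b \<in> els B. Q b}) P"
    then show "P.ae Q" by (rule P.aeI[OF mk_in_M[OF s]]) (simp add: els_mk[OF s] P_X)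
  qed
  also have "\<dots> \<longleftrightarrow> aa (\<lambda>i k. E (opr i k) (mk {b \<in> els B. Q b}))"
    unfolding E_P_iff[OF mk_in_M[OF s]] els_mk[OF s] by blast
  also have "\<dots> \<longleftrightarrow> aa (\<lambda>i k. Q (opr i k))" by (rule aa_cong) (rule e)
  finally show ?thesis .
qed

section \<open>The ultrapower by the product as an iterated ultrapower\<close>

definition slice :: "'v \<Rightarrow> 'v \<Rightarrow> 'v" where "slice F i = lam W.X (\<lambda>k. app F (opr i k))"
definition slices :: "'v \<Rightarrow> 'v" where "slices F = lam U.X (\<lambda>i. W.col (slice F i))"

lemma td_slice_body: "F \<in> M \<Longrightarrow> i \<in> M \<Longrightarrow> tdef1 M E (\<lambda>k. app F (opr i k))" by (intro pdi)

lemma td_slice: "tdef2 M E slice"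
  unfolding slice_def
proof (rule td_lam[where F = "\<lambda>e k. app (e 0) (opr (e (Suc 0)) k)"])
  show "tdef M E (\<lambda>e. W.X)" by (rule td_const[OF W.X_in_M])
  show "tdef M E (\<lambda>e. app (e (Suc 0)) (opr (e (Suc (Suc 0))) (e 0)))" by (intro pdi)
  show "tdef1 M E (\<lambda>k. app (e 0) (opr (e (Suc 0)) k))" if "range e \<subseteq> M" for e
    by (rule td_slice_body) (use that in auto)
qed

lemma td_slices_body: "F \<in> M \<Longrightarrow> tdef1 M E (\<lambda>i. W.col (slice F i))"
  by (intro tdef_comp1[OF W.td_col] tdef_comp2[OF td_slice] td_const td_var)

lemma td_slices: "tdef1 M E slices"
  unfolding slices_def
proof (rule td_lam[where F = "\<lambda>e i. W.col (slice (e 0) i)"])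
  show "tdef M E (\<lambda>e. U.X)" by (rule td_const[OF U.X_in_M])
  show "tdef M E (\<lambda>e. W.col (slice (e (Suc 0)) (e 0)))"
    by (intro tdef_comp1[OF W.td_col] tdef_comp2[OF td_slice] td_var)
  show "tdef1 M E (\<lambda>i. W.col (slice (e 0) i))" if "range e \<subseteq> M" for e
    by (rule td_slices_body) (use that in auto)
qed

lemma slice_funs: "F \<in> M \<Longrightarrow> i \<in> M \<Longrightarrow> slice F i \<in> W.funs"
  unfolding slice_def by (rule W.lam_funs[OF td_slice_body])

lemma app_slice: "F \<in> M \<Longrightarrow> i \<in> M \<Longrightarrow> k \<in> els W.X \<Longrightarrow> app (slice F i) k = app F (opr i k)"
  unfolding slice_def by (rule W.app_lam_X[OF td_slice_body])

lemma slices_funs: "F \<in> M \<Longrightarrow> slices F \<in> U.funs"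
  unfolding slices_def by (rule U.lam_funs[OF td_slices_body])

lemma app_slices: "F \<in> M \<Longrightarrow> i \<in> els U.X \<Longrightarrow> app (slices F) i = W.col (slice F i)"
  unfolding slices_def by (rule U.app_lam_X[OF td_slices_body])

lemma slices_mem_iff:
  assumes F: "F \<in> M" "F' \<in> M"
  shows "E (U.col (slices F')) (U.col (slices F)) \<longleftrightarrow> P.ae (\<lambda>b. E (app F' b) (app F b))"
proof -
  have "E (U.col (slices F')) (U.col (slices F)) \<longleftrightarrow>
      U.ae (\<lambda>i. E (app (slices F') i) (app (slices F) i))"
    by (rule U.col_mem_iff[OF slices_funs[OF F(2)] slices_funs[OF F(1)]])
  also have "\<dots> \<longleftrightarrow> aa (\<lambda>i k. E (app F' (opr i k)) (app F (opr i k)))"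
    unfolding aa_def
  proof (rule U.ae_cong)
    fix i assume i: "i \<in> els U.X"
    note iM = els_in_M[OF i]
    have "E (app (slices F') i) (app (slices F) i) \<longleftrightarrow>
        W.ae (\<lambda>k. E (app (slice F' i) k) (app (slice F i) k))"
      unfolding app_slices[OF F(1) i] app_slices[OF F(2) i]
      by (rule W.col_mem_iff[OF slice_funs[OF F(2) iM] slice_funs[OF F(1) iM]])
    also have "\<dots> \<longleftrightarrow> W.ae (\<lambda>k. E (app F' (opr i k)) (app F (opr i k)))"
      by (rule W.ae_cong) (simp add: app_slice F iM)
    finally show "E (app (slices F') i) (app (slices F) i) \<longleftrightarrow>
        W.ae (\<lambda>k. E (app F' (opr i k)) (app F (opr i k)))" .
  qed
  also have "\<dots> \<longleftrightarrow> P.ae (\<lambda>b. E (app F' b) (app F b))"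
    by (rule P_ae[symmetric]) (rule P.pd_app_mem[OF F(2,1)])
  finally show ?thesis .
qed

text \<open>Write y as the U-class of h. For almost all i the value of h at i is an element of a
  member of \<open>W.N\<close>, hence in \<open>W.N\<close> by transitivity. Choice picks
  representatives s(i), and F'(i, k) = s(i)(k) glues them together.\<close>

lemma slices_onto:
  assumes F: "F \<in> M" and y: "y \<in> els (U.col (slices F))"
  obtains F' where "F' \<in> P.funs" "U.col (slices F') = y"
proof -
  have yM: "y \<in> M" by (rule els_in_M[OF y])
  have "U.col (slices F) \<in> U.N" unfolding U.N_eq using slices_funs[OF F] by blast
  then have "y \<in> U.N" using U.N_trans yM els_memI[OF y] by blast
  then obtain h where h: "h \<in> U.funs" "y = U.col h" unfolding U.N_eq by blast
  note hM = U.funs_in_M[OF h(1)]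
  have hm: "U.ae (\<lambda>i. E (app h i) (app (slices F) i))"
    using els_memI[OF y] unfolding h(2) U.col_mem_iff[OF h(1) slices_funs[OF F]] .
  define R where "R i s \<longleftrightarrow> (E (app h i) (app (slices F) i) \<longrightarrow> s \<in> W.funs \<and> W.col s = app h i)" for i s
  have R: "pdef2 M E R" unfolding R_def
    by (intro pdi hM U.funs_in_M[OF slices_funs[OF F]] pdef_pred1[OF W.pd_funs] tdef_comp1[OF W.td_col])
  have "\<exists>s\<in>M. R i s" if i: "i \<in> els U.X" for i
  proof (cases "E (app h i) (app (slices F) i)")
    case True
    have "W.col (slice F i) \<in> W.N" unfolding W.N_eq using slice_funs[OF F els_in_M[OF i]] by blast
    then have "app h i \<in> W.N"
      using W.N_trans app_in_M True unfolding app_slices[OF F i] by blast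
    then obtain s where "s \<in> W.funs" "app h i = W.col s" unfolding W.N_eq by blast
    then have "R i s" "s \<in> M" unfolding R_def using W.funs_in_M by simp_all
    then show ?thesis by (rule bexI)
  next
    case False
    then show ?thesis unfolding R_def using emp_in_M by blast
  qed
  from choice[OF U.X_in_M R this] obtain s where s: "s \<in> M" "\<And>i. i \<in> els U.X \<Longrightarrow> R i (app s i)"
    by blast
  have t: "tdef1 M E (\<lambda>b. app (app s (pfst b)) (psnd b))"
    by (intro pdi s(1) tdef_comp1[OF td_pfst] tdef_comp1[OF td_psnd])
  define F' where "F' = lam P.X (\<lambda>b. app (app s (pfst b)) (psnd b))"
  have F': "F' \<in> P.funs" unfolding F'_def by (rule P.lam_funs[OF t])
  note F'M = P.funs_in_M[OF F']
  have "app (slices F') i = app h i" if i: "i \<in> els U.X" "E (app h i) (app (slices F) i)" for i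
  proof -
    have iM: "i \<in> M" by (rule els_in_M[OF i(1)])
    have si: "app s i \<in> W.funs" "W.col (app s i) = app h i"
      using s(2)[OF i(1), unfolded R_def, THEN mp, OF i(2)] by (rule conjunct1, rule conjunct2)
    have "slice F' i = app s i"
    proof (rule fun_ext[OF _ _ W.X_in_M])
      show "slice F' i \<in> M" "is_fun_on M E (slice F' i) W.X" "app s i \<in> M" "is_fun_on M E (app s i) W.X"
        using slice_funs[OF F'M iM] si(1) by (simp_all add: W.funs_iff)
      fix k assume k: "k \<in> els W.X"
      have "opr i k \<in> els P.X" unfolding P_X by (rule opr_B[OF i(1) k])
      from P.app_lam_X[OF t this] have "app F' (opr i k) = app (app s i) k"
        unfolding F'_def by (simp add: pfst_opr psnd_opr iM els_in_M[OF k])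
      then show "app (slice F' i) k = app (app s i) k" using app_slice[OF F'M iM k] by simp
    qed
    then show ?thesis using app_slices[OF F'M i(1)] si(2) by simp
  qed
  then have "U.ae (\<lambda>i. app (slices F') i = app h i)"
    by (intro U.ae_mono[OF hm U.pd_app_eq[OF U.funs_in_M[OF slices_funs[OF F'M]] hM]])
  then have "U.col (slices F') = y" unfolding h(2) U.col_eq_iff[OF slices_funs[OF F'M] h(1)] .
  with F' show thesis by (rule that)
qed

text \<open>
  By this identity the ultrapower by \<open>P\<close> is the image under \<open>U.emb\<close> of the class \<open>W.N\<close>, so that
  \<open>U.emb\<close> restricts to an elementary embedding of \<open>W.N\<close> into it.
\<close>

lemma P_col: assumes F: "F \<in> P.funs" shows "P.col F = U.col (slices F)"
proof -
  define Q where "Q v \<longleftrightarrow> (\<forall>F\<in>M. F \<in> P.funs \<and> P.col F = v \<longrightarrow> P.col F = U.col (slices F))" for v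
  have "Q (P.col F)"
  proof (rule mem_induct[where P = Q])
    show "pdef1 M E Q" unfolding Q_def
      by (intro pdi pdef_pred1[OF P.pd_funs] tdef_comp1[OF P.td_col] tdef_comp1[OF U.td_col]
          tdef_comp1[OF td_slices])
    show "P.col F \<in> M" by (rule P.col_in_M[OF F])
    fix v assume v: "v \<in> M" and IH: "\<And>y. y \<in> els v \<Longrightarrow> Q y"
    show "Q v" unfolding Q_def
    proof (intro ballI impI)
      fix F assume "F \<in> M" and F': "F \<in> P.funs \<and> P.col F = v"
      note FM = \<open>F \<in> M\<close> and F = conjunct1[OF F']
      have IH': "P.col G = U.col (slices G)" if "G \<in> P.funs" "P.col G \<in> els (P.col F)" for G
        using IH[of "P.col G"] that P.funs_in_M[OF that(1)] F' unfolding Q_def by blast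
      have mem: "P.col G \<in> els (P.col F) \<longleftrightarrow> U.col (slices G) \<in> els (U.col (slices F))"
        if G: "G \<in> P.funs" for G
      proof -
        have "P.col G \<in> els (P.col F) \<longleftrightarrow> E (P.col G) (P.col F)"
          using P.col_in_M[OF G] by (simp add: els_iff)
        also have "\<dots> \<longleftrightarrow> E (U.col (slices G)) (U.col (slices F))"
          unfolding P.col_mem_iff[OF G F] slices_mem_iff[OF FM P.funs_in_M[OF G]] ..
        also have "\<dots> \<longleftrightarrow> U.col (slices G) \<in> els (U.col (slices F))"
          using U.col_in_M[OF slices_funs[OF P.funs_in_M[OF G]]] by (simp add: els_iff)
        finally show ?thesis .
      qed
      have "els (P.col F) = els (U.col (slices F))"
      proof
        show "els (P.col F) \<subseteq> els (U.col (slices F))"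
        proof
          fix y assume y: "y \<in> els (P.col F)"
          have "P.col F \<in> P.N" unfolding P.N_eq using F by blast
          then have "y \<in> P.N" using P.N_trans els_in_M[OF y] els_memI[OF y] by blast
          then obtain G where G: "G \<in> P.funs" "y = P.col G" unfolding P.N_eq by blast
          then show "y \<in> els (U.col (slices F))" using mem[OF G(1)] IH'[OF G(1)] y by simp
        qed
        show "els (U.col (slices F)) \<subseteq> els (P.col F)"
        proof
          fix y assume y: "y \<in> els (U.col (slices F))"
          obtain G where G: "G \<in> P.funs" "U.col (slices G) = y" using slices_onto[OF FM y] .
          then have "P.col G \<in> els (P.col F)" using mem[OF G(1)] y by simp
          with IH'[OF G(1)] G(2) show "y \<in> els (P.col F)" by simp
        qed
      qed
      then show "P.col F = U.col (slices F)"
        using els_inject P.col_in_M[OF F] U.col_in_M[OF slices_funs[OF FM]] by blast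
    qed
  qed
  with F P.funs_in_M show ?thesis unfolding Q_def by blast
qed

section \<open>Elementarity of \<open>U.emb\<close> from \<open>W.N\<close> to
  \<open>P.N\<close>\<close>

definition hat :: "'v \<Rightarrow> 'v" where "hat f = lam P.X (\<lambda>b. app f (psnd b))"

lemma td_hat_body: "f \<in> M \<Longrightarrow> tdef1 M E (\<lambda>b. app f (psnd b))"
  by (intro pdi tdef_comp1[OF td_psnd])

lemma hat_funs: "f \<in> M \<Longrightarrow> hat f \<in> P.funs"
  unfolding hat_def by (rule P.lam_funs[OF td_hat_body])

lemma app_hat:
  assumes "f \<in> M" "i \<in> els U.X" "k \<in> els W.X" shows "app (hat f) (opr i k) = app f k"
proof -
  have "opr i k \<in> els P.X" unfolding P_X by (rule opr_B[OF assms(2,3)])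
  from P.app_lam_X[OF td_hat_body[OF assms(1)] this]
  show ?thesis unfolding hat_def by (simp add: psnd_opr els_in_M[OF assms(2)] els_in_M[OF assms(3)])
qed

text \<open>Every slice of \<open>hat f\<close> is f, so the function whose U-class is taken is
  constant with value the W-class of f.\<close>

lemma P_col_hat: assumes f: "f \<in> W.funs" shows "P.col (hat f) = U.emb (W.col f)"
proof -
  note fM = W.funs_in_M[OF f] and hM = P.funs_in_M[OF hat_funs[OF W.funs_in_M[OF f]]]
  have "slices (hat f) = lam U.X (\<lambda>_. W.col f)"
    unfolding slices_def
  proof (rule lam_cong)
    fix i assume i: "i \<in> els U.X"
    have "slice (hat f) i = f"
    proof (rule fun_ext[OF _ fM W.X_in_M])
      show "slice (hat f) i \<in> M" "is_fun_on M E (slice (hat f) i) W.X" "is_fun_on M E f W.X"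
        using slice_funs[OF hM els_in_M[OF i]] f by (simp_all add: W.funs_iff)
      show "app (slice (hat f) i) k = app f k" if "k \<in> els W.X" for k
        using app_slice[OF hM els_in_M[OF i] that] app_hat[OF fM i that] by simp
    qed
    then show "W.col (slice (hat f) i) = W.col f" by simp
  qed
  then show ?thesis using P_col[OF hat_funs[OF fM]] U.emb_eq[OF W.col_in_M[OF f]] by simp
qed

lemma emb_in_P_N: "x \<in> W.N \<Longrightarrow> U.emb x \<in> P.N"
  unfolding W.N_eq P.N_eq using P_col_hat hat_funs W.funs_in_M by force

text \<open>Los for P expresses truth at the functions \<open>hat (f n)\<close> by the iterated
  quantifier. These functions ignore the first coordinate, so the quantifier for U is vacuous and
  Los for W remains.\<close>

lemma P_emb_fdef:
  assumes Q: "fdef E Q" and s: "range s \<subseteq> W.N"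
  shows "Q P.N (\<lambda>n. U.emb (s n)) \<longleftrightarrow> Q W.N s"
proof -
  obtain f where f: "\<And>n. f n \<in> W.funs" "s = (\<lambda>n. W.col (f n))" using W.N_env[OF s] by blast
  note fM = W.funs_in_M[OF f(1)]
  have "Q P.N (\<lambda>n. U.emb (s n)) \<longleftrightarrow> Q P.N (\<lambda>n. P.col (hat (f n)))"
    unfolding f(2) using P_col_hat[OF f(1)] by simp
  also have "\<dots> \<longleftrightarrow> P.ae (\<lambda>b. Q M (\<lambda>n. app (hat (f n)) b))"
    by (rule P.los_fdef[OF Q hat_funs[OF fM]])
  also have "\<dots> \<longleftrightarrow> aa (\<lambda>i k. Q M (\<lambda>n. app (hat (f n)) (opr i k)))"
    by (rule P_ae, rule pd_fdef_env[OF Q]) (intro pdi P.funs_in_M[OF hat_funs[OF fM]])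
  also have "\<dots> \<longleftrightarrow> aa (\<lambda>i k. Q M (\<lambda>n. app (f n) k))"
    by (rule aa_cong) (simp add: app_hat[OF fM])
  also have "\<dots> \<longleftrightarrow> W.ae (\<lambda>k. Q M (\<lambda>n. app (f n) k))" by (rule aa_snd)
  also have "\<dots> \<longleftrightarrow> Q W.N s" unfolding f(2) by (rule W.los_fdef[OF Q f(1), symmetric])
  finally show ?thesis .
qed

end

section \<open>Recovering the embedding inside the other ultrapower\<close>

text \<open>Partial functions are used because a representing function can have values outside x at
  some arguments, and x need not contain an element to serve as default there.\<close>

definition is_partial_fun :: "'v set \<Rightarrow> ('v \<Rightarrow> 'v \<Rightarrow> bool) \<Rightarrow> 'v \<Rightarrow> 'v \<Rightarrow> 'v \<Rightarrow> bool" where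
  "is_partial_fun M E r d x \<longleftrightarrow>
     (\<forall>p\<in>M. E p r \<longrightarrow> (\<exists>a\<in>M. \<exists>b\<in>M. E a d \<and> E b x \<and> is_opair M E a b p)) \<and>
     (\<forall>a\<in>M. \<forall>b\<in>M. \<forall>b'\<in>M. maps_to M E r a b \<and> maps_to M E r a b' \<longrightarrow> b = b')"

lemma fdef_is_partial_fun: "fdef E (\<lambda>M e. is_partial_fun M E (e i) (e j) (e k))"
  unfolding is_partial_fun_def by (intro fdef_intros)

context zfc_model
begin

lemma is_partial_fun_iff:
  assumes "d \<in> M" "x \<in> M"
  shows "is_partial_fun M E r d x \<longleftrightarrow> els r \<subseteq> els (times d x) \<and> func r"
proof -
  have "(\<forall>p\<in>M. E p r \<longrightarrow> (\<exists>a\<in>M. \<exists>b\<in>M. E a d \<and> E b x \<and> is_opair M E a b p)) \<longleftrightarrow>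
      (\<forall>p\<in>els r. \<exists>a b. p = opr a b \<and> a \<in> els d \<and> b \<in> els x)"
    unfolding Ball_def els_iff[of _ r] imp_conjL
    using is_opair_iff by (intro all_cong imp_cong refl) (auto simp: els_iff)
  also have "\<dots> \<longleftrightarrow> els r \<subseteq> els (times d x)" unfolding els_times[OF assms] by blast
  finally have 1: "(\<forall>p\<in>M. E p r \<longrightarrow> (\<exists>a\<in>M. \<exists>b\<in>M. E a d \<and> E b x \<and> is_opair M E a b p)) \<longleftrightarrow>
      els r \<subseteq> els (times d x)" .
  have 2: "(\<forall>a\<in>M. \<forall>b\<in>M. \<forall>b'\<in>M. maps_to M E r a b \<and> maps_to M E r a b' \<longrightarrow> b = b') \<longleftrightarrow> func r"
    unfolding func_def by (intro ball_cong refl) (simp add: maps_to_iff)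
  show ?thesis unfolding is_partial_fun_def 1 2 ..
qed

lemma is_partial_fun_maps_to:
  assumes r: "is_partial_fun M E r d x" and m: "a \<in> M" "b \<in> M" "maps_to M E r a b"
  shows "E b x"
proof -
  have "E (opr a b) r" using m by (simp add: maps_to_iff)
  with r obtain a' b' where "a' \<in> M" "b' \<in> M" "E b' x" "is_opair M E a' b' (opr a b)"
    unfolding is_partial_fun_def using opr_in_M[OF m(1,2)] by blast
  then show ?thesis using is_opair_iff opr_in_M m opr_eq_iff[OF m(1,2)] by simp
qed

lemma els_inner:
  assumes "zfc_model N E" "transitive_in E M N" "x \<in> N" shows "zfc_model.els N E x = els x"
  unfolding zfc_model.els_def[OF assms(1)] els_def using assms(2,3) by (auto simp: transitive_in_def)

lemma opr_inner:
  assumes "zfc_model N E" "transitive_in E M N" "a \<in> N" "b \<in> N"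
  shows "zfc_model.opr N E a b = opr a b"
proof -
  interpret N: zfc_model N E by (rule assms(1))
  have "N.opr a b \<in> N" by (rule N.opr_in_M[OF assms(3,4)])
  then have "is_opair N E a b (N.opr a b)" using N.is_opair_iff[OF assms(3,4)] by simp
  then have "is_opair M E a b (N.opr a b)"
    using is_opair_abs[OF assms(2-4) \<open>N.opr a b \<in> N\<close>] by simp
  then show ?thesis
    using is_opair_iff assms(2-4) \<open>N.opr a b \<in> N\<close> unfolding transitive_in_def by blast
qed

end

lemma (in ultra) los3:
  assumes "fdef E (\<lambda>M e. R M (e 0) (e (Suc 0)) (e (Suc (Suc 0))))"
    and "f \<in> funs" "g \<in> funs" "h \<in> funs"
  shows "R N (col f) (col g) (col h) \<longleftrightarrow> ae (\<lambda>i. R M (app f i) (app g i) (app h i))"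
  using los_fdef[OF assms(1), of "case_nat f (case_nat g (\<lambda>_. h))"] assms(2-4)
  by (simp split: nat.split)

lemma (in ultra) emb_fdef3:
  assumes "fdef E (\<lambda>M e. R M (e 0) (e (Suc 0)) (e (Suc (Suc 0))))"
    and "x \<in> M" "y \<in> M" "z \<in> M"
  shows "R N (emb x) (emb y) (emb z) \<longleftrightarrow> R M x y z"
  using emb_fdef[OF assms(1), of "case_nat x (case_nat y (\<lambda>_. z))"] assms(2-4) by simp

context two_ultra
begin

lemma P_emb_fdef3:
  assumes "fdef E (\<lambda>M e. R M (e 0) (e (Suc 0)) (e (Suc (Suc 0))))"
    and "x \<in> W.N" "y \<in> W.N" "z \<in> W.N"
  shows "R P.N (U.emb x) (U.emb y) (U.emb z) \<longleftrightarrow> R W.N x y z"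
  using P_emb_fdef[OF assms(1), of "case_nat x (case_nat y (\<lambda>_. z))"] assms(2-4) by simp

definition seed :: 'v where "seed = P.col (lam P.X pfst)"

lemma seed_funs: "lam P.X pfst \<in> P.funs" by (rule P.lam_funs[OF td_pfst])

lemma app_seed: "i \<in> els U.X \<Longrightarrow> k \<in> els W.X \<Longrightarrow> app (lam P.X pfst) (opr i k) = i"
  using P.app_lam_X[OF td_pfst, of "opr i k"] opr_B[of i k] by (simp add: P_X pfst_opr els_in_M)

lemma seed_in_N: "seed \<in> P.N" unfolding seed_def P.N_eq using seed_funs by blast

lemma P_los3:
  assumes R: "fdef E (\<lambda>M e. R M (e 0) (e (Suc 0)) (e (Suc (Suc 0))))"
    and m: "f \<in> P.funs" "g \<in> P.funs" "h \<in> P.funs"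
  shows "R P.N (P.col f) (P.col g) (P.col h) \<longleftrightarrow>
    aa (\<lambda>i k. R M (app f (opr i k)) (app g (opr i k)) (app h (opr i k)))"
proof -
  have "pdef M E (\<lambda>e. R M (e 0) (e (Suc 0)) (e (Suc (Suc 0))))" by (rule pdef_fdef[OF M_nonempty R])
  then have "pdef1 M E (\<lambda>b. R M (app f b) (app g b) (app h b))"
    by (rule pdef_pred3) (intro pdi P.funs_in_M m)+
  from P_ae[OF this] show ?thesis unfolding P.los3[OF R m] by simp
qed

lemma seed_mem: "E seed (U.emb (W.emb U.X))"
proof -
  note c = W.const_funs[OF U.X_in_M]
  have "E seed (U.emb (W.emb U.X)) \<longleftrightarrow> E (P.col (lam P.X pfst)) (P.col (hat (lam W.X (\<lambda>_. U.X))))"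
    unfolding seed_def W.emb_eq[OF U.X_in_M] P_col_hat[OF c] ..
  also have "\<dots> \<longleftrightarrow> aa (\<lambda>i k. E (app (lam P.X pfst) (opr i k)) (app (hat (lam W.X (\<lambda>_. U.X))) (opr i k)))"
    by (rule P_los3[where R = "\<lambda>_ a b _. E a b", OF fdef_mem seed_funs hat_funs seed_funs])
      (rule W.funs_in_M[OF c])
  also have "\<dots> \<longleftrightarrow> aa (\<lambda>i k. True)"
    by (rule aa_cong) (simp add: app_seed app_hat[OF W.funs_in_M[OF c]] W.app_const U.X_in_M els_memI)
  finally show ?thesis by (simp add: aa_const)
qed

text \<open>With z the P-class of F and x the W-class of f, let r be the W-class of the map sending
  k to the set of pairs (i, F(i,k)) with F(i,k) in f(k). The seed is represented by (i,k) \<mapsto>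
  i, where this set has the value F(i,k). Thus r belongs to \<open>W.N\<close> although z comes from
  \<open>P.N\<close>.\<close>

lemma cover:
  assumes x: "x \<in> W.N" and z: "z \<in> els (U.emb x)"
  obtains r where "r \<in> W.N" "is_partial_fun W.N E r (W.emb U.X) x" "maps_to P.N E (U.emb r) seed z"
proof -
  obtain f where f: "f \<in> W.funs" "x = W.col f" using x unfolding W.N_eq by blast
  have "z \<in> P.N" by (rule P.N_trans[OF emb_in_P_N[OF x] els_in_M[OF z] els_memI[OF z]])
  then obtain F where F: "F \<in> P.funs" "z = P.col F" unfolding P.N_eq by blast
  note fM = W.funs_in_M[OF f(1)] and FM = P.funs_in_M[OF F(1)]
  have "E (P.col F) (P.col (hat f))" using els_memI[OF z] unfolding f(2) F(2) P_col_hat[OF f(1)] .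
  then have "aa (\<lambda>i k. E (app F (opr i k)) (app (hat f) (opr i k)))"
    unfolding P_los3[where R = "\<lambda>_ a b _. E a b", OF fdef_mem F(1) hat_funs[OF fM] F(1)] .
  moreover have "aa (\<lambda>i k. E (app F (opr i k)) (app (hat f) (opr i k))) \<longleftrightarrow>
      aa (\<lambda>i k. E (app F (opr i k)) (app f k))"
    by (rule aa_cong) (simp add: app_hat[OF fM])
  ultimately have Ff: "aa (\<lambda>i k. E (app F (opr i k)) (app f k))" by blast
  \<comment> \<open>Keeping only those i with F(i,k) in f(k) makes \<open>G k\<close> a partial
    function into f(k) for every k, while the value at (i,k) survives for almost all pairs.\<close>
  define G where "G k = mk {p \<in> M. \<exists>i\<in>M. E i U.X \<and> p = opr i (app F (opr i k)) \<and>
      E (app F (opr i k)) (app f k)}" for k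
  have tF: "tdef1 M E (\<lambda>i. app F (opr i k))" if "k \<in> M" for k by (intro pdi FM that)
  have sG: "small {p \<in> M. \<exists>i\<in>M. E i U.X \<and> p = opr i (app F (opr i k)) \<and>
      E (app F (opr i k)) (app f k)}" if k: "k \<in> M" for k
  proof (rule small_subset[OF small_els[OF lam_in_M[OF U.X_in_M tF[OF k]]]])
    show "pdef1 M E (\<lambda>p. \<exists>i\<in>M. E i U.X \<and> p = opr i (app F (opr i k)) \<and>
      E (app F (opr i k)) (app f k))" by (intro pdi FM fM k U.X_in_M)
    show "p \<in> els (lam U.X (\<lambda>i. app F (opr i k)))"
      if "\<exists>i\<in>M. E i U.X \<and> p = opr i (app F (opr i k)) \<and> E (app F (opr i k)) (app f k)" for p
      unfolding els_lam[OF U.X_in_M tF[OF k]] using that by (auto simp: els_iff)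
  qed
  have tG: "tdef1 M E G"
    unfolding G_def
  proof (rule td_mk[where P = "\<lambda>e p. \<exists>i\<in>M. E i U.X \<and> p = opr i (app F (opr i (e 0))) \<and>
      E (app F (opr i (e 0))) (app f (e 0))"])
    show "pdef M E (\<lambda>e. \<exists>i\<in>M. E i U.X \<and> e 0 = opr i (app F (opr i (e (Suc 0)))) \<and>
      E (app F (opr i (e (Suc 0)))) (app f (e (Suc 0))))" by (intro pdi FM fM U.X_in_M)
    show "small {p \<in> M. \<exists>i\<in>M. E i U.X \<and> p = opr i (app F (opr i (e 0))) \<and>
      E (app F (opr i (e 0))) (app f (e 0))}" if "range e \<subseteq> M" for e
      by (rule sG) (use that in blast)
  qed
  have GM: "G k \<in> M" if "k \<in> M" for k by (rule tdef1_in_M[OF tG that])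
  have elsG: "els (G k) = {p \<in> M. \<exists>i\<in>M. E i U.X \<and> p = opr i (app F (opr i k)) \<and>
      E (app F (opr i k)) (app f k)}" if "k \<in> M" for k
    unfolding G_def by (rule els_mk[OF sG[OF that]])
  have EG: "E (opr i v) (G k) \<longleftrightarrow> E i U.X \<and> v = app F (opr i k) \<and> E (app F (opr i k)) (app f k)"
    if "i \<in> M" "v \<in> M" "k \<in> M" for i v k
  proof -
    have "E (opr i v) (G k) \<longleftrightarrow> opr i v \<in> els (G k)" by (rule E_els[OF opr_in_M[OF that(1,2)]])
    also have "\<dots> \<longleftrightarrow> (\<exists>i'\<in>M. E i' U.X \<and> opr i v = opr i' (app F (opr i' k)) \<and>
        E (app F (opr i' k)) (app f k))"
      unfolding elsG[OF that(3)] using opr_in_M[OF that(1,2)] by simp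
    also have "\<dots> \<longleftrightarrow> E i U.X \<and> v = app F (opr i k) \<and> E (app F (opr i k)) (app f k)"
      using opr_eq_iff[OF that(1,2) _ app_in_M] that(1) by auto
    finally show ?thesis .
  qed
  define h where "h = lam W.X G"
  have h: "h \<in> W.funs" unfolding h_def by (rule W.lam_funs[OF tG])
  have app_h: "app h k = G k" if "k \<in> els W.X" for k unfolding h_def by (rule W.app_lam_X[OF tG that])
  note c = W.const_funs[OF U.X_in_M]
  show thesis
  proof (rule that)
    show "W.col h \<in> W.N" unfolding W.N_eq using h by blast
    have pf: "is_partial_fun M E (G k) U.X (app f k)" if k: "k \<in> M" for k
      unfolding is_partial_fun_iff[OF U.X_in_M app_in_M]
    proof
      show "els (G k) \<subseteq> els (times U.X (app f k))"
      proof
        fix p assume "p \<in> els (G k)"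
        then obtain i where "i \<in> M" "E i U.X" "p = opr i (app F (opr i k))"
          "E (app F (opr i k)) (app f k)" unfolding elsG[OF k] by blast
        then show "p \<in> els (times U.X (app f k))"
          unfolding els_times[OF U.X_in_M app_in_M] els_iff using app_in_M by blast
      qed
      show "func (G k)" unfolding func_def using EG k by simp
    qed
    have "is_partial_fun W.N E (W.col h) (W.col (lam W.X (\<lambda>_. U.X))) (W.col f) \<longleftrightarrow>
        W.ae (\<lambda>k. is_partial_fun M E (app h k) (app (lam W.X (\<lambda>_. U.X)) k) (app f k))"
      by (rule W.los3[where R = "\<lambda>M. is_partial_fun M E", OF fdef_is_partial_fun h c f(1)])
    also have "\<dots> \<longleftrightarrow> W.ae (\<lambda>k. True)"
      by (rule W.ae_cong) (simp add: app_h W.app_const U.X_in_M pf els_in_M)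
    finally show "is_partial_fun W.N E (W.col h) (W.emb U.X) x"
      unfolding f(2) W.emb_eq[OF U.X_in_M] by (simp add: W.ae_const)
    note hM = W.funs_in_M[OF h]
    have "maps_to P.N E (P.col (hat h)) (P.col (lam P.X pfst)) (P.col F) \<longleftrightarrow>
        aa (\<lambda>i k. maps_to M E (app (hat h) (opr i k)) (app (lam P.X pfst) (opr i k)) (app F (opr i k)))"
      by (rule P_los3[where R = "\<lambda>M. maps_to M E", OF fdef_maps_to hat_funs[OF hM] seed_funs F(1)])
    also have "\<dots> \<longleftrightarrow> aa (\<lambda>i k. E (app F (opr i k)) (app f k))"
    proof (rule aa_cong)
      fix i k assume i: "i \<in> els U.X" "k \<in> els W.X"
      show "maps_to M E (app (hat h) (opr i k)) (app (lam P.X pfst) (opr i k)) (app F (opr i k)) \<longleftrightarrow>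
          E (app F (opr i k)) (app f k)"
        unfolding app_hat[OF hM i] app_seed[OF i] app_h[OF i(2)] maps_to_iff[OF els_in_M[OF i(1)] app_in_M]
        using EG[OF els_in_M[OF i(1)] app_in_M els_in_M[OF i(2)]] els_memI[OF i(1)] by simp
    qed
    finally show "maps_to P.N E (U.emb (W.col h)) seed z"
      using Ff unfolding seed_def F(2) P_col_hat[OF h] by blast
  qed
qed

text \<open>If S is the P-class of G, let Y be the W-class of the map sending k to the union of the
  G(i,k) over i. It is needed for the set underlying an ultrafilter of \<open>P.N\<close>: niceness
  can be carried over from \<open>W.N\<close> only with respect to sets of the form
  \<open>U.emb Y\<close>.\<close>

lemma bound_in_W:
  assumes S: "S \<in> P.N"
  obtains Y where "Y \<in> W.N" "is_subset P.N E S (U.emb Y)"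
proof -
  obtain G where G: "G \<in> P.funs" "S = P.col G" using S unfolding P.N_eq by blast
  note GM = P.funs_in_M[OF G(1)]
  define D where "D k = mk {v \<in> M. \<exists>i\<in>M. E i U.X \<and> E v (app G (opr i k))}" for k
  have tG: "tdef1 M E (\<lambda>i. app G (opr i k))" if "k \<in> M" for k by (intro pdi GM that)
  have sD: "small {v \<in> M. \<exists>i\<in>M. E i U.X \<and> E v (app G (opr i k))}" if k: "k \<in> M" for k
  proof -
    have "(\<Union>i\<in>els U.X. els (app G (opr i k))) = {v \<in> M. \<exists>i\<in>M. E i U.X \<and> E v (app G (opr i k))}"
      by (auto simp: els_iff)
    then show ?thesis using small_UN[OF small_els[OF U.X_in_M] tG[OF k]] by simp
  qed
  have tD: "tdef1 M E D"
    unfolding D_def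
  proof (rule td_mk[where P = "\<lambda>e v. \<exists>i\<in>M. E i U.X \<and> E v (app G (opr i (e 0)))"])
    show "pdef M E (\<lambda>e. \<exists>i\<in>M. E i U.X \<and> E (e 0) (app G (opr i (e (Suc 0)))))"
      by (intro pdi GM U.X_in_M)
    show "small {v \<in> M. \<exists>i\<in>M. E i U.X \<and> E v (app G (opr i (e 0)))}" if "range e \<subseteq> M" for e
      by (rule sD) (use that in blast)
  qed
  define h where "h = lam W.X D"
  have h: "h \<in> W.funs" unfolding h_def by (rule W.lam_funs[OF tD])
  note hM = W.funs_in_M[OF h]
  show thesis
  proof (rule that)
    show "W.col h \<in> W.N" unfolding W.N_eq using h by blast
    have "is_subset P.N E (P.col G) (P.col (hat h)) \<longleftrightarrow>
        aa (\<lambda>i k. is_subset M E (app G (opr i k)) (app (hat h) (opr i k)))"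
      by (rule P_los3[where R = "\<lambda>M a b _. is_subset M E a b", OF fdef_is_subset G(1) hat_funs[OF hM] G(1)])
    also have "\<dots> \<longleftrightarrow> aa (\<lambda>i k. True)"
    proof (rule aa_cong)
      fix i k assume i: "i \<in> els U.X" "k \<in> els W.X"
      have "app (hat h) (opr i k) = D k"
        unfolding app_hat[OF hM i] using W.app_lam_X[OF tD i(2)] by (simp add: h_def)
      moreover have "els (app G (opr i k)) \<subseteq> els (D k)"
        unfolding D_def els_mk[OF sD[OF els_in_M[OF i(2)]]] using i(1) by (auto simp: els_iff)
      ultimately show "is_subset M E (app G (opr i k)) (app (hat h) (opr i k)) \<longleftrightarrow> True"
        by (simp add: is_subset_iff)
    qed
    finally show "is_subset P.N E S (U.emb (W.col h))"
      unfolding G(2) P_col_hat[OF h] by (simp add: aa_const)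
  qed
qed

end

section \<open>Pairs and graphs in transitive classes\<close>

context zfc_model
begin

lemma opr_inner_parts:
  assumes t: "transitive_in E M N" and m: "a \<in> M" "b \<in> M" "opr a b \<in> N"
  shows "a \<in> N" "b \<in> N"
proof -
  have N: "y \<in> N" if "x \<in> N" "y \<in> els x" for x y
    using t that unfolding transitive_in_def els_iff by blast
  have "upr a b \<in> els (opr a b)" using m(1,2) by (simp add: opr_def els_upr upr_in_M)
  then have "upr a b \<in> N" by (rule N[OF m(3)])
  then show "a \<in> N" "b \<in> N" using N[of "upr a b"] by (simp_all add: els_upr m(1,2))
qed

text \<open>A pair belonging to an element of a transitive class brings both coordinates into that
  class. Graphs in different inner models can therefore be compared through membership in M.\<close>

lemma E_opr_inner:
  assumes t: "transitive_in E M N" and f: "f \<in> N" and m: "a \<in> M" "b \<in> M"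
  shows "E (opr a b) f \<longleftrightarrow> a \<in> N \<and> b \<in> N \<and> maps_to N E f a b"
proof -
  have "a \<in> N \<and> b \<in> N" if "E (opr a b) f"
  proof -
    have "opr a b \<in> N" using t f that opr_in_M[OF m] unfolding transitive_in_def by blast
    then show ?thesis using opr_inner_parts[OF t m] by simp
  qed
  then show ?thesis using maps_to_abs[OF t f, of a b] maps_to_iff[OF m, of f] by blast
qed

lemma E_lam_inner:
  assumes zN: "zfc_model N E" and t: "transitive_in E M N" and a: "a \<in> N" and F: "tdef1 N E F"
    and m: "x \<in> M" "y \<in> M"
  shows "E (opr x y) (zfc_model.lam N E a F) \<longleftrightarrow> E x a \<and> y = F x"
proof -
  interpret N: zfc_model N E by (rule zN)
  have l: "N.lam a F \<in> N" by (rule N.lam_in_M[OF a F])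
  have "x \<in> N" if "E x a" using that t a m(1) unfolding transitive_in_def by blast
  moreover have "F x \<in> N" if "x \<in> N" by (rule N.tdef1_in_M[OF F that])
  moreover have "maps_to N E (N.lam a F) x y \<longleftrightarrow> E x a \<and> y = F x" if "x \<in> N" "y \<in> N"
    unfolding N.maps_to_iff[OF that] by (rule N.E_lam_iff[OF a F that])
  ultimately show ?thesis unfolding E_opr_inner[OF t l m] by blast
qed

lemma pd_is_partial_fun [pdi]:
  "tdef M E t \<Longrightarrow> tdef M E u \<Longrightarrow> tdef M E v \<Longrightarrow> pdef M E (\<lambda>e. is_partial_fun M E (t e) (u e) (v e))"
  using pdef_pred3[OF pdef_fdef[OF M_nonempty fdef_is_partial_fun[of E 0 "Suc 0" "Suc (Suc 0)"]],
      of t u v] .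

end

context two_ultra
begin

sublocale MW: zfc_model W.N E by unfold_locales (rule W.ZFC_N)
sublocale MP: zfc_model P.N E by unfold_locales (rule P.ZFC_N)

end

text \<open>Z is the ultrafilter that the Ultrapower Axiom supplies on the side of P. The inclusion
  expresses that the common target is at the same time an internal ultrapower of
  \<open>W.N\<close>.\<close>

locale comparison = two_ultra +
  fixes Z
  assumes cc_Z: "cc_ultrafilter P.N E Z" and ultrapower_sub: "ultrapower P.N E Z \<subseteq> W.N"
begin

sublocale Q: ultra P.N E Z by unfold_locales (rule cc_Z)

lemma Q_N_sub: "Q.N \<subseteq> W.N" using ultrapower_sub by (simp add: Q.N_def)

lemma Q_transitive: "transitive_in E M Q.N"
  using P.N_transitive Q.N_transitive unfolding transitive_in_def by blast

text \<open>The map g of the overview, with \<open>Q.emb\<close> in the role of h.\<close>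

definition comp :: "'a \<Rightarrow> 'a" where "comp x = Q.emb (U.emb x)"

lemma comp_in_N: "x \<in> W.N \<Longrightarrow> comp x \<in> Q.N"
  unfolding comp_def by (intro Q.emb_in_N emb_in_P_N)

lemma comp_fdef3:
  assumes R: "fdef E (\<lambda>M e. R M (e 0) (e (Suc 0)) (e (Suc (Suc 0))))"
    and m: "x \<in> W.N" "y \<in> W.N" "z \<in> W.N"
  shows "R Q.N (comp x) (comp y) (comp z) \<longleftrightarrow> R W.N x y z"
  unfolding comp_def Q.emb_fdef3[OF R m[THEN emb_in_P_N]] by (rule P_emb_fdef3[OF R m])

text \<open>\<open>U.emb\<close> carries niceness with respect to Y in \<open>W.N\<close> to
  niceness with respect to \<open>U.emb Y\<close> in \<open>P.N\<close>. As this set includes the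
  one underlying Z, \<open>emb_nice\<close> applied inside \<open>P.N\<close> fixes
  \<open>U.emb \<eta>\<close>; no claim is made about \<eta> itself.\<close>

lemma comp_nice:
  assumes "\<eta> \<in> W.N" "MW.ord \<eta>" "Y \<in> W.N" "nice W.N E \<eta> Y" "is_subset P.N E Q.X (U.emb Y)"
  shows "comp \<eta> = U.emb \<eta>"
  unfolding comp_def
proof (rule Q.emb_nice)
  show "U.emb \<eta> \<in> P.N" "U.emb Y \<in> P.N" using assms(1,3) by (simp_all add: emb_in_P_N)
  show "MP.ord (U.emb \<eta>)"
    using P_emb_fdef3[where R = "\<lambda>M a _ _. is_ordinal M E a", OF fdef_is_ordinal] assms(1,2) by blast
  show "nice P.N E (U.emb \<eta>) (U.emb Y)"
    using P_emb_fdef3[where R = "\<lambda>M a b _. nice M E a b", OF fdef_nice] assms(1,3,4) by blast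
  show "MP.els Q.X \<subseteq> MP.els (U.emb Y)" using assms(5) by (simp add: MP.is_subset_iff)
qed

text \<open>That a value exists at a given argument, and that it is unique, are first-order and so
  preserved by \<open>Q.emb\<close>. Hence \<open>comp r\<close> is defined at the image of the seed
  exactly when \<open>U.emb r\<close> is defined at the seed, and its value is the image of the
  value.\<close>

lemma comp_seed_iff:
  assumes r: "r \<in> W.N" "is_partial_fun W.N E r d x" "d \<in> W.N" "x \<in> W.N" and t: "t \<in> M"
  shows "E (opr (Q.emb seed) t) (comp r) \<longleftrightarrow>
    (\<exists>z\<in>P.N. maps_to P.N E (U.emb r) seed z \<and> t = Q.emb z)"
proof -
  note rP = emb_in_P_N[OF r(1)] and rc = Q.emb_in_N[OF seed_in_N]
  have rcM: "Q.emb seed \<in> M" using rc Q_N_sub W.N_sub by blast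
  have up: "maps_to Q.N E (comp r) (Q.emb seed) (Q.emb z) \<longleftrightarrow> maps_to P.N E (U.emb r) seed z"
    if "z \<in> P.N" for z
    unfolding comp_def
    by (rule Q.emb_fdef3[where R = "\<lambda>M. maps_to M E", OF fdef_maps_to rP seed_in_N that])
  have E: "E (opr (Q.emb seed) t) (comp r) \<longleftrightarrow> t \<in> Q.N \<and> maps_to Q.N E (comp r) (Q.emb seed) t"
    unfolding E_opr_inner[OF Q_transitive comp_in_N[OF r(1)] rcM t] using rc by blast
  show ?thesis
    unfolding E
  proof
    assume t: "t \<in> Q.N \<and> maps_to Q.N E (comp r) (Q.emb seed) t"
    have "fdef E (\<lambda>M e. \<exists>v\<in>M. maps_to M E (e 0) (e (Suc 0)) v)" by (intro fdef_intros)
    from Q.emb_fdef3[where R = "\<lambda>M r c _. \<exists>v\<in>M. maps_to M E r c v", OF this rP seed_in_N seed_in_N]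
    have "(\<exists>v\<in>Q.N. maps_to Q.N E (comp r) (Q.emb seed) v) \<longleftrightarrow>
        (\<exists>v\<in>P.N. maps_to P.N E (U.emb r) seed v)" unfolding comp_def .
    then obtain z where z: "z \<in> P.N" "maps_to P.N E (U.emb r) seed z" using t by blast
    have "is_partial_fun Q.N E (comp r) (comp d) (comp x)"
      using comp_fdef3[where R = "\<lambda>M. is_partial_fun M E", OF fdef_is_partial_fun r(1,3,4)] r(2) by blast
    then have "\<forall>a\<in>Q.N. \<forall>b\<in>Q.N. \<forall>b'\<in>Q.N.
        maps_to Q.N E (comp r) a b \<and> maps_to Q.N E (comp r) a b' \<longrightarrow> b = b'"
      unfolding is_partial_fun_def by (rule conjunct2)
    then have "t = Q.emb z" using t up[OF z(1)] z(2) rc Q.emb_in_N[OF z(1)] by blast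
    with z show "\<exists>z\<in>P.N. maps_to P.N E (U.emb r) seed z \<and> t = Q.emb z" by blast
  next
    assume "\<exists>z\<in>P.N. maps_to P.N E (U.emb r) seed z \<and> t = Q.emb z"
    then show "t \<in> Q.N \<and> maps_to Q.N E (comp r) (Q.emb seed) t" using up Q.emb_in_N by blast
  qed
qed

text \<open>The collapse of T inverts \<open>Q.emb\<close> by membership induction on a. The
  obstacle is that F is definable over \<open>W.N\<close> and \<open>Q.emb\<close> over
  \<open>P.N\<close>, so F (Q.emb z) = z is not a formula of either structure. Restricting the two
  maps to the sets T and a gives elements \<kappa> and \<rho> of M, with which the induction
  statement S is definable over M.\<close>

lemma collapse_image:
  assumes a: "a \<in> P.N" and tr: "\<And>y z. z \<in> els a \<Longrightarrow> y \<in> els z \<Longrightarrow> y \<in> els a"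
    and T: "T \<in> W.N" "els T = Q.emb ` els a"
  obtains F where "tdef1 W.N E F" "\<And>z. z \<in> els a \<Longrightarrow> F (Q.emb z) = z"
proof -
  obtain F where F: "tdef1 W.N E F"
    "\<And>t. t \<in> MW.els T \<Longrightarrow> MW.els (F t) = F ` (MW.els T \<inter> MW.els t)"
    using MW.collapse_set[OF T(1)] by blast
  note WE = els_inner[OF MW.zfc_model_axioms W.N_transitive]
  have aN: "z \<in> P.N" if "z \<in> els a" for z
    using P.N_trans[OF a els_in_M[OF that] els_memI[OF that]] .
  have QM: "Q.emb z \<in> M" "Q.emb z \<in> W.N" if "z \<in> els a" for z
    using Q.emb_in_N[OF aN[OF that]] Q_N_sub W.N_sub by blast+
  define \<rho> where "\<rho> = MP.lam a Q.emb"
  define \<kappa> where "\<kappa> = MW.lam T F"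
  have \<rho>: "\<rho> \<in> M" unfolding \<rho>_def using MP.lam_in_M[OF a Q.td_emb] P.N_sub by blast
  have \<kappa>: "\<kappa> \<in> M" unfolding \<kappa>_def using MW.lam_in_M[OF T(1) F(1)] W.N_sub by blast
  have aM: "a \<in> M" using a P.N_sub by blast
  define S where "S z \<longleftrightarrow> (E z a \<longrightarrow> (\<exists>q\<in>M. E (opr z q) \<rho> \<and> E (opr q z) \<kappa>))" for z
  have S_iff: "S z \<longleftrightarrow> F (Q.emb z) = z" if z: "z \<in> els a" for z
  proof -
    note zM = els_in_M[OF z]
    have "S z \<longleftrightarrow> (\<exists>q\<in>M. E (opr z q) \<rho> \<and> E (opr q z) \<kappa>)" unfolding S_def using els_memI[OF z] by simp
    also have "\<dots> \<longleftrightarrow> (\<exists>q\<in>M. q = Q.emb z \<and> E q T \<and> z = F q)"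
      using E_lam_inner[OF MP.zfc_model_axioms P.N_transitive a Q.td_emb zM, folded \<rho>_def]
        E_lam_inner[OF MW.zfc_model_axioms W.N_transitive T(1) F(1) _ zM, folded \<kappa>_def]
        els_memI[OF z] by (intro bex_cong refl) simp
    also have "\<dots> \<longleftrightarrow> F (Q.emb z) = z"
    proof -
      have "Q.emb z \<in> els T" unfolding T(2) using z by (rule imageI)
      then show ?thesis using els_memI QM(1)[OF z] by auto
    qed
    finally show ?thesis .
  qed
  have "S z" if "z \<in> M" for z
  proof (rule mem_induct[where P = S, OF _ _ that])
    show "pdef1 M E S" unfolding S_def by (intro pdi aM \<rho> \<kappa>)
    fix z assume z: "z \<in> M" and IH: "\<And>y. y \<in> els z \<Longrightarrow> S y"
    show "S z"
    proof (cases "z \<in> els a")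
      case True
      have m: "E (Q.emb y) (Q.emb z) \<longleftrightarrow> E y z" if "y \<in> els a" for y
        by (rule Q.emb_mem_iff[OF aN[OF that] aN[OF True]])
      have zT: "Q.emb z \<in> els T" unfolding T(2) using True by (rule imageI)
      \<comment> \<open>\<open>Q.emb z\<close> may have elements that are not images. Collapsing
        along membership in T ignores them, and on images \<open>Q.emb\<close> preserves and
        reflects membership.\<close>
      have "els T \<inter> els (Q.emb z) = Q.emb ` els z"
      proof
        show "els T \<inter> els (Q.emb z) \<subseteq> Q.emb ` els z"
          unfolding T(2) using m els_in_M by (auto simp: els_iff[of _ z] els_iff[of _ "Q.emb z"])
        show "Q.emb ` els z \<subseteq> els T \<inter> els (Q.emb z)"
          unfolding T(2) using m tr[OF True] QM(1) els_memI by (auto simp: els_iff[of _ "Q.emb z"])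
      qed
      moreover have "MW.els (F (Q.emb z)) = F ` (MW.els T \<inter> MW.els (Q.emb z))"
        by (rule F(2)) (use zT WE[OF T(1)] in simp)
      moreover have FW: "F (Q.emb z) \<in> W.N" by (rule MW.tdef1_in_M[OF F(1) QM(2)[OF True]])
      ultimately have "els (F (Q.emb z)) = F ` Q.emb ` els z"
        using WE[OF FW] WE[OF T(1)] WE[OF QM(2)[OF True]] by simp
      also have "\<dots> = els z"
      proof -
        have "F (Q.emb y) = y" if "y \<in> els z" for y
          using IH[OF that] S_iff[OF tr[OF True that]] by simp
        then show ?thesis unfolding image_image by simp
      qed
      finally have "F (Q.emb z) = z" using els_inject[OF _ z] FW W.N_sub by blast
      then show ?thesis using S_iff[OF True] by simp
    next
      case False
      then show ?thesis unfolding S_def using z by (simp add: els_iff)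
    qed
  qed
  then have "F (Q.emb z) = z" if "z \<in> els a" for z using S_iff[OF that] els_in_M[OF that] by simp
  with F(1) show thesis using that by blast
qed

abbreviation \<delta> :: 'a where "\<delta> \<equiv> W.emb U.X"

lemma els_W: "x \<in> W.N \<Longrightarrow> MW.els x = els x"
  by (rule els_inner[OF MW.zfc_model_axioms W.N_transitive])

lemma opr_W: "x \<in> W.N \<Longrightarrow> y \<in> W.N \<Longrightarrow> MW.opr x y = opr x y"
  by (rule opr_inner[OF MW.zfc_model_axioms W.N_transitive])

lemma in_W: "x \<in> W.N \<Longrightarrow> y \<in> els x \<Longrightarrow> y \<in> W.N"
  using W.N_trans els_in_M els_memI by blast

lemma W_in_M: "x \<in> W.N \<Longrightarrow> x \<in> M" using W.N_sub by blast

text \<open>That \<sigma> has exactly one given value at \<eta> is first-order and preserved by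
  \<open>comp\<close>. The conclusion is stated through membership of pairs because
  \<open>comp \<sigma>\<close> is an object of the comparison target but has to be read inside
  \<open>W.N\<close>.\<close>

lemma comp_graph:
  assumes \<sigma>: "\<sigma> \<in> W.N" "C \<in> W.N" "is_fun_on W.N E \<sigma> C" and \<eta>: "\<eta> \<in> els C" and v: "v \<in> W.N"
  shows "E (MW.opr (comp \<eta>) v) (comp \<sigma>) \<longleftrightarrow> v = comp (MW.app \<sigma> \<eta>)"
proof -
  note \<eta>N = in_W[OF \<sigma>(2) \<eta>]
  have cW: "comp \<eta> \<in> W.N" using comp_in_N[OF \<eta>N] Q_N_sub by blast
  have "fdef E (\<lambda>M e. \<forall>v\<in>M. maps_to M E (e 0) (e (Suc 0)) v \<longleftrightarrow> v = e (Suc (Suc 0)))"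
    by (intro fdef_intros)
  from comp_fdef3[where R = "\<lambda>M s a b. \<forall>v\<in>M. maps_to M E s a v \<longleftrightarrow> v = b", OF this \<sigma>(1) \<eta>N MW.app_in_M]
  have "(\<forall>v\<in>Q.N. maps_to Q.N E (comp \<sigma>) (comp \<eta>) v \<longleftrightarrow> v = comp (MW.app \<sigma> \<eta>)) \<longleftrightarrow>
      (\<forall>v\<in>W.N. maps_to W.N E \<sigma> \<eta> v \<longleftrightarrow> v = MW.app \<sigma> \<eta>)" .
  moreover have "maps_to W.N E \<sigma> \<eta> v \<longleftrightarrow> v = MW.app \<sigma> \<eta>" if "v \<in> W.N" for v
    unfolding MW.maps_to_iff[OF \<eta>N that] MW.E_fun_iff[OF \<sigma> \<eta>N that] els_W[OF \<sigma>(2)] using \<eta> by simp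
  ultimately have "v \<in> Q.N \<Longrightarrow> maps_to Q.N E (comp \<sigma>) (comp \<eta>) v \<longleftrightarrow> v = comp (MW.app \<sigma> \<eta>)" by blast
  then show ?thesis
    unfolding opr_W[OF cW v] E_opr_inner[OF Q_transitive comp_in_N[OF \<sigma>(1)] W_in_M[OF cW] W_in_M[OF v]]
    using comp_in_N[OF \<eta>N] comp_in_N[OF MW.app_in_M[of \<sigma> \<eta>]] by blast
qed

text \<open>That s has value y throughout \<delta> is first-order, so \<open>U.emb s\<close> has
  value \<open>U.emb y\<close> throughout \<open>U.emb \<delta>\<close>, and the seed is an element
  of that set.\<close>

lemma seed_of_constant:
  assumes s: "s \<in> W.N" and y: "y \<in> W.N" and const: "\<And>i. i \<in> els \<delta> \<Longrightarrow> E (MW.opr i y) s"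
  shows "maps_to P.N E (U.emb s) seed (U.emb y)"
proof -
  have \<delta>: "\<delta> \<in> W.N" by (rule W.emb_in_N[OF U.X_in_M])
  have "fdef E (\<lambda>M e. \<forall>i\<in>M. E i (e (Suc 0)) \<longrightarrow> maps_to M E (e 0) i (e (Suc (Suc 0))))"
    by (intro fdef_intros)
  from P_emb_fdef3[where R = "\<lambda>M s d y. \<forall>i\<in>M. E i d \<longrightarrow> maps_to M E s i y", OF this s \<delta> y]
  have "(\<forall>i\<in>P.N. E i (U.emb \<delta>) \<longrightarrow> maps_to P.N E (U.emb s) i (U.emb y)) \<longleftrightarrow>
      (\<forall>i\<in>W.N. E i \<delta> \<longrightarrow> maps_to W.N E s i y)" .
  moreover have "maps_to W.N E s i y" if "i \<in> W.N" "E i \<delta>" for i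
    using const[of i] MW.maps_to_iff[OF that(1) y] that W_in_M by (simp add: els_iff)
  ultimately show ?thesis using seed_in_N seed_mem by blast
qed

text \<open>The computation is definable over \<open>W.N\<close>. Its parameters carrying
  information about the embeddings are the restriction of \<open>U.emb\<close> to the ordinal \<xi>,
  the set \<open>comp \<sigma>\<close>, the image of the seed, and those entering the collapse F of
  T. From them \<open>TT\<close> computes the image under \<open>Q.emb\<close> of the value of
  \<open>U.emb (\<sigma>(\<eta>))\<close> at the seed, and \<open>R\<close> computes
  \<open>U.emb y\<close>.\<close>

theorem restriction_to_set:
  assumes restr: "\<And>\<xi>. \<xi> \<in> M \<Longrightarrow> ord \<xi> \<Longrightarrow>
      \<exists>r\<in>W.N. \<forall>p\<in>M. E p r \<longleftrightarrow> (\<exists>a\<in>M. E a \<xi> \<and> p = opr a (U.emb a))"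
    and x: "x \<in> W.N"
  shows "\<exists>r\<in>W.N. \<forall>p\<in>M. E p r \<longleftrightarrow> (\<exists>a\<in>M. E a x \<and> p = opr a (U.emb a))"
proof -
  have \<delta>: "\<delta> \<in> W.N" by (rule W.emb_in_N[OF U.X_in_M])
  \<comment> \<open>Transitivity of w passes to \<open>U.emb w\<close>, as shown in
    \<open>trw\<close>, and the collapse argument needs it there.\<close>
  obtain w where w: "w \<in> W.N" "els x \<subseteq> els w" and tr: "MW.tran w"
    using MW.transitive_superset[OF x] els_W x by metis
  note Uw = emb_in_P_N[OF w(1)]
  \<comment> \<open>Y bounds the set underlying Z, so that \<open>comp_nice\<close> is available for
    all ordinals that are nice for Y in \<open>W.N\<close>.\<close>
  obtain Y where Y: "Y \<in> W.N" "is_subset P.N E Q.X (U.emb Y)" using bound_in_W[OF Q.X_in_M] .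
  have sFF: "MW.small {r \<in> W.N. is_partial_fun W.N E r \<delta> w}"
  proof (rule MW.small_subset[OF MW.small_els[OF MW.pow_in_M[OF MW.times_in_M[OF \<delta> w(1)]]]])
    show "pdef1 W.N E (\<lambda>r. is_partial_fun W.N E r \<delta> w)"
      by (rule MW.pd_is_partial_fun[OF MW.td_var MW.td_const[OF \<delta>] MW.td_const[OF w(1)]])
    show "r \<in> MW.els (MW.pow (MW.times \<delta> w))" if "r \<in> W.N" "is_partial_fun W.N E r \<delta> w" for r
      using that unfolding MW.is_partial_fun_iff[OF \<delta> w(1)] MW.els_pow[OF MW.times_in_M[OF \<delta> w(1)]]
      by blast
  qed
  define FF where "FF = MW.mk {r \<in> W.N. is_partial_fun W.N E r \<delta> w}"
  have FF: "FF \<in> W.N" "MW.els FF = {r \<in> W.N. is_partial_fun W.N E r \<delta> w}"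
    unfolding FF_def by (rule MW.mk_props[OF sFF])+
  obtain \<xi> C \<sigma> where \<xi>: "\<xi> \<in> W.N" "C \<in> W.N" "\<sigma> \<in> W.N" "MW.ord \<xi>" "MW.els C \<subseteq> MW.els \<xi>"
    "\<And>\<eta>. \<eta> \<in> MW.els C \<Longrightarrow> nice W.N E \<eta> Y" "is_fun_on W.N E \<sigma> C"
    "\<And>\<eta>. \<eta> \<in> MW.els C \<Longrightarrow> MW.app \<sigma> \<eta> \<in> MW.els FF"
    "\<And>v. v \<in> MW.els FF \<Longrightarrow> \<exists>\<eta>\<in>MW.els C. MW.app \<sigma> \<eta> = v"
    using MW.nice_enumeration[OF Y(1) FF(1)] by blast
  note C = els_W[OF \<xi>(2)]
  have \<sigma>_pf: "is_partial_fun W.N E (MW.app \<sigma> \<eta>) \<delta> w" if "\<eta> \<in> els C" for \<eta>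
    using \<xi>(8)[of \<eta>] that unfolding C FF(2) by blast
  have \<sigma>_onto: "\<exists>\<eta>\<in>els C. MW.app \<sigma> \<eta> = r" if "r \<in> W.N" "is_partial_fun W.N E r \<delta> w" for r
    using \<xi>(9)[of r] that unfolding C FF(2) by blast
  \<comment> \<open>This is where the hypothesis on ordinals is used: the set C of indices is
    contained in the single ordinal \<xi>.\<close>
  obtain e\<xi> where e\<xi>: "e\<xi> \<in> W.N" "\<And>p. p \<in> M \<Longrightarrow> E p e\<xi> \<longleftrightarrow> (\<exists>a\<in>M. E a \<xi> \<and> p = opr a (U.emb a))"
    using restr[OF W_in_M[OF \<xi>(1)]] \<xi>(4) W.N_ordinal_iff[OF \<xi>(1)] by blast
  have comp_C: "comp \<eta> = U.emb \<eta>" if \<eta>: "\<eta> \<in> els C" for \<eta>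
  proof (rule comp_nice[OF in_W[OF \<xi>(2) \<eta>] _ Y(1) _ Y(2)])
    have "\<eta> \<in> MW.els C" using \<eta> C by simp
    then show "MW.ord \<eta>" "nice W.N E \<eta> Y" using MW.ord_mem[OF \<xi>(4)] \<xi>(5,6) by blast+
  qed
  define rc where "rc = Q.emb seed"
  have rc: "rc \<in> W.N" unfolding rc_def using Q.emb_in_N[OF seed_in_N] Q_N_sub by blast
  have c\<sigma>: "comp \<sigma> \<in> W.N" using comp_in_N[OF \<xi>(3)] Q_N_sub by blast
  \<comment> \<open>The first condition forces e = U.emb \<eta> = comp \<eta>, since \<eta> is nice.
    The second then makes r = comp (\<sigma>(\<eta>)), and the third takes the value t of r at the
    image \<open>rc\<close> of the seed.\<close>
  define TT where "TT \<eta> t \<longleftrightarrow> (\<exists>e\<in>W.N. \<exists>r\<in>W.N. E (MW.opr \<eta> e) e\<xi> \<and>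
      E (MW.opr e r) (comp \<sigma>) \<and> E (MW.opr rc t) r)" for \<eta> t
  have TT: "TT \<eta> t \<longleftrightarrow> (\<exists>z\<in>P.N. maps_to P.N E (U.emb (MW.app \<sigma> \<eta>)) seed z \<and> t = Q.emb z)"
    if \<eta>: "\<eta> \<in> els C" and t: "t \<in> W.N" for \<eta> t
  proof -
    note \<eta>N = in_W[OF \<xi>(2) \<eta>]
    have cW: "comp \<eta> \<in> W.N" using comp_in_N[OF \<eta>N] Q_N_sub by blast
    have rW: "comp (MW.app \<sigma> \<eta>) \<in> W.N" using comp_in_N[OF MW.app_in_M] Q_N_sub by blast
    have "E \<eta> \<xi>" using \<xi>(5) \<eta> unfolding C els_W[OF \<xi>(1)] by (auto dest: els_memI)
    have e: "E (MW.opr \<eta> e) e\<xi> \<longleftrightarrow> e = comp \<eta>" if "e \<in> W.N" for e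
    proof -
      note m = W_in_M[OF \<eta>N] W_in_M[OF that]
      have "E (MW.opr \<eta> e) e\<xi> \<longleftrightarrow> (\<exists>a\<in>M. E a \<xi> \<and> opr \<eta> e = opr a (U.emb a))"
        unfolding opr_W[OF \<eta>N that] by (rule e\<xi>(2)[OF opr_in_M[OF m]])
      also have "\<dots> \<longleftrightarrow> e = U.emb \<eta>" using opr_eq_iff[OF m] m(1) U.emb_in_M \<open>E \<eta> \<xi>\<close> by auto
      finally show ?thesis using comp_C[OF \<eta>] by simp
    qed
    have "TT \<eta> t \<longleftrightarrow> E (MW.opr rc t) (comp (MW.app \<sigma> \<eta>))"
      unfolding TT_def using e cW rW comp_graph[OF \<xi>(3,2,7) \<eta>] by blast
    also have "\<dots> \<longleftrightarrow> (\<exists>z\<in>P.N. maps_to P.N E (U.emb (MW.app \<sigma> \<eta>)) seed z \<and> t = Q.emb z)"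
      unfolding opr_W[OF rc t] unfolding rc_def
      by (rule comp_seed_iff[OF MW.app_in_M \<sigma>_pf[OF \<eta>] \<delta> w(1) W_in_M[OF t]])
    finally show ?thesis .
  qed
  have TT_pd: "pdef2 W.N E TT" unfolding TT_def by (intro MW.pdi e\<xi>(1) c\<sigma> rc)
  have sT: "MW.small {t \<in> W.N. \<exists>\<eta>\<in>W.N. E \<eta> C \<and> TT \<eta> t}"
  proof (rule MW.small_subset)
    \<comment> \<open>Two unions of \<open>comp \<sigma>\<close> reach r as a coordinate of a pair,
      a third reaches the elements of r, and two more reach their coordinates t.\<close>
    show "MW.small (MW.els (MW.un (MW.un (MW.un (MW.un (MW.un (comp \<sigma>)))))))"
      by (intro MW.small_els MW.un_in_M c\<sigma>)
    show "pdef1 W.N E (\<lambda>t. \<exists>\<eta>\<in>W.N. E \<eta> C \<and> TT \<eta> t)" by (intro MW.pdi \<xi>(2) pdef_pred2[OF TT_pd])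
    fix t assume t: "t \<in> W.N" "\<exists>\<eta>\<in>W.N. E \<eta> C \<and> TT \<eta> t"
    then obtain e r where er: "e \<in> W.N" "r \<in> W.N" "E (MW.opr e r) (comp \<sigma>)" "E (MW.opr rc t) r"
      unfolding TT_def by blast
    have "r \<in> MW.els (MW.un (MW.un (comp \<sigma>)))" by (rule MW.E_opr_parts(2)[OF er(1,2) c\<sigma> er(3)])
    moreover have "t \<in> MW.els (MW.un (MW.un r))" by (rule MW.E_opr_parts(2)[OF rc t(1) er(2,4)])
    ultimately show "t \<in> MW.els (MW.un (MW.un (MW.un (MW.un (MW.un (comp \<sigma>))))))"
      by (simp add: MW.els_un MW.un_in_M c\<sigma> er(2)) blast
  qed
  define T where "T = MW.mk {t \<in> W.N. \<exists>\<eta>\<in>W.N. E \<eta> C \<and> TT \<eta> t}"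
  have T: "T \<in> W.N" "MW.els T = {t \<in> W.N. \<exists>\<eta>\<in>W.N. E \<eta> C \<and> TT \<eta> t}"
    unfolding T_def by (rule MW.mk_props[OF sT])+
  have Q_W: "Q.emb z \<in> W.N" if "z \<in> P.N" for z using Q.emb_in_N[OF that] Q_N_sub by blast
  have UwN: "z \<in> P.N" if "z \<in> els (U.emb w)" for z
    using P.N_trans[OF Uw els_in_M[OF that] els_memI[OF that]] .
  \<comment> \<open>From left to right, a value of \<open>U.emb (\<sigma>(\<eta>))\<close> lies in
    \<open>U.emb w\<close> because \<sigma>(\<eta>) has values in w. From right to left,
    \<open>cover\<close> represents each element by a partial function, and \<sigma> enumerates all
    of these.\<close>
  have elsT: "els T = Q.emb ` els (U.emb w)"
  proof
    show "els T \<subseteq> Q.emb ` els (U.emb w)"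
    proof
      fix t assume "t \<in> els T"
      then have "t \<in> W.N" "\<exists>\<eta>\<in>W.N. E \<eta> C \<and> TT \<eta> t" using els_W[OF T(1)] T(2) by auto
      then obtain \<eta> where t: "t \<in> W.N" and \<eta>: "\<eta> \<in> els C" "TT \<eta> t" using W_in_M by (auto simp: els_iff)
      obtain z where z: "z \<in> P.N" "maps_to P.N E (U.emb (MW.app \<sigma> \<eta>)) seed z" "t = Q.emb z"
        using TT[OF \<eta>(1) t] \<eta>(2) by blast
      have "is_partial_fun P.N E (U.emb (MW.app \<sigma> \<eta>)) (U.emb \<delta>) (U.emb w)"
        using P_emb_fdef3[where R = "\<lambda>M. is_partial_fun M E", OF fdef_is_partial_fun MW.app_in_M \<delta> w(1)]
          \<sigma>_pf[OF \<eta>(1)] by blast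
      from MP.is_partial_fun_maps_to[OF this seed_in_N z(1,2)]
      have "z \<in> els (U.emb w)" using z(1) P.N_sub by (auto simp: els_iff)
      then show "t \<in> Q.emb ` els (U.emb w)" using z(3) by blast
    qed
    show "Q.emb ` els (U.emb w) \<subseteq> els T"
    proof
      fix t assume "t \<in> Q.emb ` els (U.emb w)"
      then obtain z where z: "z \<in> els (U.emb w)" "t = Q.emb z" by blast
      note zN = UwN[OF z(1)]
      obtain r where r: "r \<in> W.N" "is_partial_fun W.N E r \<delta> w" "maps_to P.N E (U.emb r) seed z"
        using cover[OF w(1) z(1)] .
      obtain \<eta> where \<eta>: "\<eta> \<in> els C" "MW.app \<sigma> \<eta> = r" using \<sigma>_onto[OF r(1,2)] by blast
      have t: "t \<in> W.N" using Q_W[OF zN] z(2) by simp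
      have "TT \<eta> t" using TT[OF \<eta>(1) t] \<eta>(2) r(3) zN z(2) by blast
      then have "t \<in> MW.els T" unfolding T(2) using t in_W[OF \<xi>(2) \<eta>(1)] els_memI[OF \<eta>(1)] by blast
      then show "t \<in> els T" using els_W[OF T(1)] by simp
    qed
  qed
  have trw: "y \<in> els (U.emb w)" if "z \<in> els (U.emb w)" "y \<in> els z" for y z
  proof -
    have "fdef E (\<lambda>M e. \<forall>z\<in>M. \<forall>y\<in>M. E z (e 0) \<and> E y z \<longrightarrow> E y (e 0))" by (intro fdef_intros)
    from P_emb_fdef3[where R = "\<lambda>M a _ _. \<forall>z\<in>M. \<forall>y\<in>M. E z a \<and> E y z \<longrightarrow> E y a", OF this w(1) w(1) w(1)]
    have "(\<forall>z\<in>P.N. \<forall>y\<in>P.N. E z (U.emb w) \<and> E y z \<longrightarrow> E y (U.emb w)) \<longleftrightarrow>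
        (\<forall>z\<in>W.N. \<forall>y\<in>W.N. E z w \<and> E y z \<longrightarrow> E y w)" .
    moreover have "\<forall>z\<in>W.N. \<forall>y\<in>W.N. E z w \<and> E y z \<longrightarrow> E y w"
      using tr unfolding MW.tran_def MW.els_def by blast
    ultimately have "\<forall>z\<in>P.N. \<forall>y\<in>P.N. E z (U.emb w) \<and> E y z \<longrightarrow> E y (U.emb w)"
      by (rule iffD2)
    moreover have "y \<in> P.N" using P.N_trans[OF UwN[OF that(1)] els_in_M[OF that(2)] els_memI[OF that(2)]] .
    ultimately have "E y (U.emb w)" using UwN[OF that(1)] els_memI[OF that(1)] els_memI[OF that(2)] by blast
    then show ?thesis using els_in_M[OF that(2)] by (simp add: els_iff)
  qed
  obtain F where F: "tdef1 W.N E F" "\<And>z. z \<in> els (U.emb w) \<Longrightarrow> F (Q.emb z) = z"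
    by (rule collapse_image[OF Uw _ T(1) elsT]) (erule (1) trw, rule that)
  \<comment> \<open>An index \<eta> for which \<sigma>(\<eta>) is constant with value y leads by
    \<open>TT\<close> to t = Q.emb (U.emb y), and the collapse F returns
    \<open>U.emb y\<close>.\<close>
  define R where "R y v \<longleftrightarrow> (\<exists>\<eta>\<in>W.N. \<exists>s\<in>W.N. \<exists>t\<in>W.N. E \<eta> C \<and> E (MW.opr \<eta> s) \<sigma> \<and>
      (\<forall>i\<in>W.N. E i \<delta> \<longrightarrow> E (MW.opr i y) s) \<and> TT \<eta> t \<and> v = F t)" for y v
  have R_pd: "pdef2 W.N E R"
    unfolding R_def by (intro MW.pdi \<xi>(2,3) \<delta> pdef_pred2[OF TT_pd] tdef_comp1[OF F(1)])
  have R: "R y v \<longleftrightarrow> v = U.emb y" if y: "y \<in> els w" for y v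
  proof
    note yN = in_W[OF w(1) y]
    have Uy: "U.emb y \<in> els (U.emb w)"
      using U.emb_mem_iff[OF W_in_M[OF yN] W_in_M[OF w(1)]] els_memI[OF y] U.emb_in_M[OF W_in_M[OF yN]]
      by (simp add: els_iff)
    {
      assume "R y v"
      then obtain \<eta> s t where m: "\<eta> \<in> W.N" "s \<in> W.N" "t \<in> W.N" "E \<eta> C" "E (MW.opr \<eta> s) \<sigma>"
        and s: "\<And>i. i \<in> W.N \<Longrightarrow> E i \<delta> \<Longrightarrow> E (MW.opr i y) s" and t: "TT \<eta> t" "v = F t"
        unfolding R_def by blast
      have \<eta>: "\<eta> \<in> els C" using m(1,4) W_in_M by (simp add: els_iff)
      have s_eq: "s = MW.app \<sigma> \<eta>" using m(5) unfolding MW.E_fun_iff[OF \<xi>(3,2,7) m(1,2)] by blast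
      have "maps_to P.N E (U.emb s) seed (U.emb y)"
        by (rule seed_of_constant[OF m(2) yN]) (rule s[OF in_W[OF \<delta>] els_memI])
      moreover obtain z where z: "z \<in> P.N" "maps_to P.N E (U.emb s) seed z" "t = Q.emb z"
        using TT[OF \<eta> m(3)] t(1) s_eq by blast
      moreover have "is_partial_fun P.N E (U.emb s) (U.emb \<delta>) (U.emb w)"
        using P_emb_fdef3[where R = "\<lambda>M. is_partial_fun M E", OF fdef_is_partial_fun m(2) \<delta> w(1)]
          \<sigma>_pf[OF \<eta>] s_eq by blast
      then have "\<forall>a\<in>P.N. \<forall>b\<in>P.N. \<forall>b'\<in>P.N. maps_to P.N E (U.emb s) a b \<and>
          maps_to P.N E (U.emb s) a b' \<longrightarrow> b = b'"
        unfolding is_partial_fun_def by (rule conjunct2)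
      ultimately have "z = U.emb y" using seed_in_N emb_in_P_N[OF yN] by blast
      then show "v = U.emb y" using t(2) z(3) F(2)[OF Uy] by simp
    }
    assume v: "v = U.emb y"
    have tc: "tdef1 W.N E (\<lambda>_. y)" by (rule MW.td_const[OF yN])
    define s where "s = MW.lam \<delta> (\<lambda>_. y)"
    have s: "s \<in> W.N" unfolding s_def by (rule MW.lam_in_M[OF \<delta> tc])
    have sE: "E (MW.opr i y) s" if "i \<in> W.N" "E i \<delta>" for i
      unfolding s_def MW.E_lam_iff[OF \<delta> tc that(1) yN] using that(2) by simp
    have "is_partial_fun W.N E s \<delta> w"
      unfolding MW.is_partial_fun_iff[OF \<delta> w(1)]
    proof
      show "MW.els s \<subseteq> MW.els (MW.times \<delta> w)"
        unfolding s_def MW.els_lam[OF \<delta> tc] MW.els_times[OF \<delta> w(1)] els_W[OF w(1)] using y by blast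
      show "MW.func s" unfolding s_def by (rule MW.func_lam[OF \<delta> tc])
    qed
    from \<sigma>_onto[OF s this] obtain \<eta> where \<eta>: "\<eta> \<in> els C" "MW.app \<sigma> \<eta> = s" by blast
    note \<eta>N = in_W[OF \<xi>(2) \<eta>(1)] and UyN = UwN[OF Uy]
    have "maps_to P.N E (U.emb s) seed (U.emb y)"
      by (rule seed_of_constant[OF s yN]) (rule sE[OF in_W[OF \<delta>] els_memI])
    then have "TT \<eta> (Q.emb (U.emb y))" using TT[OF \<eta>(1) Q_W[OF UyN]] \<eta>(2) UyN by blast
    moreover have "E (MW.opr \<eta> s) \<sigma>"
      unfolding MW.E_fun_iff[OF \<xi>(3,2,7) \<eta>N s] els_W[OF \<xi>(2)] using \<eta> by simp
    ultimately show "R y v"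
      unfolding R_def v using \<eta>N s sE Q_W[OF UyN] els_memI[OF \<eta>(1)] F(2)[OF Uy]
      by (intro bexI[OF _ \<eta>N] bexI[OF _ s] bexI[OF _ Q_W[OF UyN]]) simp
  qed
  have UW: "U.emb y \<in> W.N" if y: "y \<in> els w" for y
  proof -
    note yM = els_in_M[OF y]
    have Uy: "U.emb y \<in> els (U.emb w)"
      using U.emb_mem_iff[OF yM W_in_M[OF w(1)]] els_memI[OF y] U.emb_in_M[OF yM] by (simp add: els_iff)
    show ?thesis using MW.tdef1_in_M[OF F(1) Q_W[OF UwN[OF Uy]]] F(2)[OF Uy] by simp
  qed
  have xW: "MW.els x = els x" by (rule els_W[OF x])
  have "pdef2 W.N E (\<lambda>y p. \<exists>v\<in>W.N. R y v \<and> p = MW.opr y v)" by (intro MW.pdi pdef_pred2[OF R_pd])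
  note p_pd = this
  have p_iff: "(\<exists>v\<in>W.N. R y v \<and> p = MW.opr y v) \<longleftrightarrow> p = MW.opr y (U.emb y)" if "y \<in> els x" for y p
  proof -
    have "y \<in> els w" using that w(2) by blast
    then show ?thesis using R UW by simp
  qed
  have sr: "MW.small {p \<in> W.N. \<exists>y\<in>MW.els x. \<exists>v\<in>W.N. R y v \<and> p = MW.opr y v}"
    by (rule MW.replacement[OF MW.small_els[OF x] p_pd]) (simp add: xW p_iff)
  define r where "r = MW.mk {p \<in> W.N. \<exists>y\<in>MW.els x. \<exists>v\<in>W.N. R y v \<and> p = MW.opr y v}"
  have r: "r \<in> W.N" "MW.els r = {p \<in> W.N. \<exists>y\<in>MW.els x. \<exists>v\<in>W.N. R y v \<and> p = MW.opr y v}"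
    unfolding r_def by (rule MW.mk_props[OF sr])+
  have "els r = {opr a (U.emb a) |a. a \<in> els x}"
  proof -
    have "els r = {p \<in> W.N. \<exists>y\<in>els x. p = MW.opr y (U.emb y)}"
      using els_W[OF r(1)] by (simp add: r(2) xW p_iff cong: bex_cong)
    also have "\<dots> = {opr a (U.emb a) |a. a \<in> els x}"
    proof -
      have "MW.opr a (U.emb a) = opr a (U.emb a)" "opr a (U.emb a) \<in> W.N" if a: "a \<in> els x" for a
      proof -
        have "U.emb a \<in> W.N" using UW a w(2) by blast
        then show "MW.opr a (U.emb a) = opr a (U.emb a)" "opr a (U.emb a) \<in> W.N"
          using opr_W[OF in_W[OF x a]] MW.opr_in_M[OF in_W[OF x a]] by fastforce+
      qed
      then show ?thesis by fastforce
    qed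
    finally show ?thesis .
  qed
  then have "E p r \<longleftrightarrow> (\<exists>a\<in>M. E a x \<and> p = opr a (U.emb a))" if "p \<in> M" for p
    using that by (auto simp: els_def)
  with r(1) show ?thesis by blast
qed

end

theorem mainTheorem11:
  fixes E :: "'v \<Rightarrow> 'v \<Rightarrow> bool" and U W :: 'v
  assumes "ZFC UNIV E"
    and "ultrapower_axiom E"
    and "cc_ultrafilter UNIV E U"
    and "cc_ultrafilter UNIV E W"
    and "\<And>\<alpha>. is_ordinal UNIV E \<alpha> \<Longrightarrow>
           restriction_in E (ultrapower UNIV E W) (ult_embedding UNIV E U) \<alpha>"
  shows "internal_rel E U W"
proof -
  interpret two_ultra UNIV E U W
    by unfold_locales (fact assms)+
  \<comment> \<open>The axiom is applied to the product ultrafilter \<open>P\<close> and W.\<close>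
  obtain N i0 i1 where
    i: "internal_ultrapower_embedding E (ultrapower UNIV E P) N i0"
      "internal_ultrapower_embedding E (ultrapower UNIV E W) N i1"
    using assms(2) cc_P assms(4) unfolding ultrapower_axiom_def by blast
  obtain Z where Z: "cc_ultrafilter P.N E Z" "N = ultrapower P.N E Z"
    using i(1) unfolding internal_ultrapower_embedding_def P.N_def by blast
  \<comment> \<open>The ultrafilter on the side of W serves to place the common target N inside
    \<open>W.N\<close>, as an ultrapower of \<open>W.N\<close> is a subclass of it.\<close>
  obtain Z' where Z': "cc_ultrafilter W.N E Z'" "N = ultrapower W.N E Z'"
    using i(2) unfolding internal_ultrapower_embedding_def W.N_def by blast
  interpret Z': ultra W.N E Z' by unfold_locales (rule Z'(1))
  interpret comparison UNIV E U W Z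
    by unfold_locales (use Z Z'(2) Z'.N_sub in \<open>simp_all add: Z'.N_def\<close>)
  have iff: "restriction_in E (ultrapower UNIV E W) (ult_embedding UNIV E U) x \<longleftrightarrow>
      (\<exists>r\<in>W.N. \<forall>p\<in>UNIV. E p r \<longleftrightarrow> (\<exists>a\<in>UNIV. E a x \<and> p = opr a (U.emb a)))" for x
    unfolding restriction_in_def W.N_def U.emb_def by (simp add: is_opair_iff)
  show ?thesis
    unfolding internal_rel_def iff using restriction_to_set assms(5)[unfolded iff]
    by (simp add: W.N_def)
qed

end
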